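(* Every symplectic orbifold possesses a star product.
   Context: Orbifolds. $\mathfrak{Man}^{\mathrm{sym}}$ has as objects pairs $(M,G)$ of a finite dimensional smooth manifold $M$ and a compact Lie group $G$ acting smoothly on $M$; a morphism $(\varphi,\iota):(N,H)\to(M,G)$ is a smooth map $\varphi$ together with a continuous homomorphism $\iota:H\to G$ with $\varphi(hy)=\iota(h)\varphi(y)$; it induces $\overline\varphi:N/H\to M/G$. It is an embedding if $\varphi$ is a smooth embedding and $\overline\varphi$ is a homeomorphism onto an open subset, and an open embedding if moreover $\varphi$ is open. An orbifold chart of a Hausdorff space $X$ is a triple $(\tilde U,G,\varrho)$ with $(\tilde U,G)\in\mathfrak{Man}^{\mathrm{sym}}$, $G$ finite, and $\varrho:\tilde U\to X$ continuous, $G$-invariant, inducing a homeomorphism $\tilde U/G\to U$ onto an open set $U\subset X$ (the image). Morphisms of charts $(\tilde V,H,\upsilon)\to(\tilde U,G,\varrho)$ are morphisms $(\varphi,\iota)$ with $\varrho\circ\varphi=\upsilon$. Two charts are germ equivalent at a point $x$ of the intersection of their images if there is a chart $(\tilde V,H,\upsilon)$ with $x$ in its image and embeddings of it into both charts (as morphisms of charts). An orbifold is a second countable, paracompact Hausdorff space $X$ with a maximal orbifold atlas $\mathcal A_X$, i.e. a maximal covering by orbifold charts any two of which are germ equivalent at every point of the intersection of their images. No restriction is made on the codimension of fixed point sets. For an open covering $\mathcal U$ of $X$, $\overline{\mathcal U}$ is the category whose objects are the connected components of finite intersections of elements of $\mathcal U$ and whose morphisms are the inclusions. An orbifold is regarded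 as an orbispace by means of an orbispace functor $\mathsf X:\overline{\mathcal U}\to\mathcal A_X$, i.e. a functor such that $\mathsf X(U)$ has image $U$ and connected domain $\tilde U$, and each $\mathsf X_{VU}=\mathsf X(V\to U)$ is an open embedding. A symplectic form on $X$ is a family $(\omega_{\tilde U})$ of $G$-invariant symplectic forms on the domains $\tilde U$ of the charts $(\tilde U,G,\varrho)$ of $\mathsf X$ with $\varphi^*\omega_{\tilde U}=\omega_{\tilde V}$ for every morphism $(\varphi,\iota)=\mathsf X_{VU}$. A symplectic orbifold is an orbifold with a symplectic form. Star products. $C^\infty(X)$ is the algebra of complex valued continuous functions $f$ on $X$ such that $f\circ\varrho$ is smooth for all charts $(\tilde U,G,\varrho)$. It carries the Poisson bracket $\{f,g\}(\varrho(\tilde x))=\{f\circ\varrho,g\circ\varrho\}_{\tilde U}(\tilde x)$, where $\{\cdot,\cdot\}_{\tilde U}$ is the Poisson bracket of $(\tilde U,\omega_{\tilde U})$. A star product (formal deformation quantization) for $X$ is a $\mathbb C[[\lambda]]$-bilinear associative product $\star$ on $C^\infty(X)[[\lambda]]$ such that for all $f,g\in C^\infty(X)$: (DQ1) $f\star g=\sum_{k\ge0}\mu_k(f,g)\lambda^k$ with bilinear maps $\mu_k:C^\infty(X)\times C^\infty(X)\to C^\infty(X)$ and $\mu_0$ the pointwise product; (DQ2) $f\star g-g\star f-i\lambda\{f,g\}\in\lambda^2C^\infty(X)[[\lambda]]$; (DQ3) $f\star1=1\star f=f$. *)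

theory Defs
  imports
    "HOL-Analysis.Analysis"
    "HOL-Algebra.Group_Action"
    "HOL-Computational_Algebra.Formal_Power_Series"
    "HOL-Library.Function_Algebras"
begin

section \<open>Smooth functions on open subsets of Euclidean space\<close>

text \<open>
  \<open>Euclidean_space n\<close> is the subspace of \<open>nat \<Rightarrow> real\<close> of the sequences vanishing from index
  \<open>n\<close> on. It is used as the model of \<open>\<real>\<^sup>n\<close>, so that the dimension is a value, may be zero, and may
  differ from one orbifold chart to another.
\<close>

definition partial_deriv ::
  "nat \<Rightarrow> ((nat \<Rightarrow> real) \<Rightarrow> 'b::real_normed_vector) \<Rightarrow> (nat \<Rightarrow> real) \<Rightarrow> 'b" where
  "partial_deriv i f x = vector_derivative (\<lambda>t. f (x(i := t))) (at (x i))"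

text \<open>All partial derivatives up to order \<open>k\<close> exist and are continuous on \<open>V\<close>, which is meant to be
  open in \<open>Euclidean_space n\<close>.\<close>

primrec Ck_on ::
  "nat \<Rightarrow> nat \<Rightarrow> (nat \<Rightarrow> real) set \<Rightarrow> ((nat \<Rightarrow> real) \<Rightarrow> 'b::real_normed_vector) \<Rightarrow> bool" where
  "Ck_on 0 n V f \<longleftrightarrow> continuous_map (subtopology (Euclidean_space n) V) euclidean f"
| "Ck_on (Suc k) n V f \<longleftrightarrow>
     continuous_map (subtopology (Euclidean_space n) V) euclidean f \<and>
     (\<forall>i<n. (\<forall>x\<in>V. (\<lambda>t. f (x(i := t))) differentiable (at (x i))) \<and>
            Ck_on k n V (partial_deriv i f))"

definition smooth_on ::
  "nat \<Rightarrow> (nat \<Rightarrow> real) set \<Rightarrow> ((nat \<Rightarrow> real) \<Rightarrow> 'b::real_normed_vector) \<Rightarrow> bool" where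
  "smooth_on n V f \<longleftrightarrow> (\<forall>k. Ck_on k n V f)"


section \<open>Smooth manifolds\<close>

text \<open>A coordinate system is a pair of its domain and its coordinate map. The map is a total
  function whose values outside the domain are irrelevant.\<close>

type_synonym 'm coord = "'m set \<times> ('m \<Rightarrow> nat \<Rightarrow> real)"

record 'm manifold =
  mtop :: "'m topology"
  mdim :: nat
  mcoords :: "'m coord set"

text \<open>The local representative \<open>b \<circ> \<phi> \<circ> a\<^sup>-\<^sup>1\<close> of a map \<open>\<phi>\<close>, and the domain on which it is
  considered.\<close>

definition coord_rep :: "'m coord \<Rightarrow> ('m \<Rightarrow> 'k) \<Rightarrow> 'k coord \<Rightarrow> (nat \<Rightarrow> real) \<Rightarrow> nat \<Rightarrow> real" where
  "coord_rep a \<phi> b = snd b \<circ> \<phi> \<circ> inv_into (fst a) (snd a)"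

definition coord_rep_dom :: "'m coord \<Rightarrow> ('m \<Rightarrow> 'k) \<Rightarrow> 'k coord \<Rightarrow> (nat \<Rightarrow> real) set" where
  "coord_rep_dom a \<phi> b = snd a ` (fst a \<inter> \<phi> -` fst b)"

definition coord_system :: "'m topology \<Rightarrow> nat \<Rightarrow> 'm coord \<Rightarrow> bool" where
  "coord_system T n a \<longleftrightarrow>
     openin T (fst a) \<and>
     openin (Euclidean_space n) (snd a ` fst a) \<and>
     homeomorphic_map (subtopology T (fst a)) (subtopology (Euclidean_space n) (snd a ` fst a)) (snd a)"

definition smooth_atlas :: "'m topology \<Rightarrow> nat \<Rightarrow> 'm coord set \<Rightarrow> bool" where
  "smooth_atlas T n C \<longleftrightarrow>
     (\<forall>a\<in>C. coord_system T n a) \<and>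
     \<Union>(fst ` C) = topspace T \<and>
     (\<forall>a\<in>C. \<forall>b\<in>C. \<forall>j<n. smooth_on n (coord_rep_dom a id b) (\<lambda>x. coord_rep a id b x j))"

definition smooth_manifold :: "'m manifold \<Rightarrow> bool" where
  "smooth_manifold M \<longleftrightarrow>
     Hausdorff_space (mtop M) \<and> second_countable (mtop M) \<and>
     smooth_atlas (mtop M) (mdim M) (mcoords M) \<and>
     (\<forall>C. smooth_atlas (mtop M) (mdim M) C \<and> mcoords M \<subseteq> C \<longrightarrow> C = mcoords M)"

definition smooth_map :: "'n manifold \<Rightarrow> 'm manifold \<Rightarrow> ('n \<Rightarrow> 'm) \<Rightarrow> bool" where
  "smooth_map N M \<phi> \<longleftrightarrow>
     continuous_map (mtop N) (mtop M) \<phi> \<and>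
     (\<forall>a\<in>mcoords N. \<forall>b\<in>mcoords M. \<forall>j<mdim M.
        smooth_on (mdim N) (coord_rep_dom a \<phi> b) (\<lambda>x. coord_rep a \<phi> b x j))"

definition smooth_function :: "'m manifold \<Rightarrow> ('m \<Rightarrow> 'b::real_normed_vector) \<Rightarrow> bool" where
  "smooth_function M f \<longleftrightarrow>
     (\<forall>a\<in>mcoords M. smooth_on (mdim M) (snd a ` fst a) (f \<circ> inv_into (fst a) (snd a)))"

text \<open>The entry in row \<open>j\<close> and column \<open>i\<close> of the Jacobian matrix of \<open>\<phi>\<close> at \<open>p\<close>.\<close>

definition jacobian ::
  "'m coord \<Rightarrow> ('m \<Rightarrow> 'k) \<Rightarrow> 'k coord \<Rightarrow> 'm \<Rightarrow> nat \<Rightarrow> nat \<Rightarrow> real" where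
  "jacobian a \<phi> b p j i = partial_deriv i (\<lambda>x. coord_rep a \<phi> b x j) (snd a p)"

definition immersion :: "'n manifold \<Rightarrow> 'm manifold \<Rightarrow> ('n \<Rightarrow> 'm) \<Rightarrow> bool" where
  "immersion N M \<phi> \<longleftrightarrow>
     smooth_map N M \<phi> \<and>
     (\<forall>a\<in>mcoords N. \<forall>b\<in>mcoords M. \<forall>p \<in> fst a \<inter> \<phi> -` fst b. \<forall>v :: nat \<Rightarrow> real.
        (\<forall>j<mdim M. (\<Sum>i<mdim N. jacobian a \<phi> b p j i * v i) = 0) \<longrightarrow> (\<forall>i<mdim N. v i = 0))"

definition smooth_embedding :: "'n manifold \<Rightarrow> 'm manifold \<Rightarrow> ('n \<Rightarrow> 'm) \<Rightarrow> bool" where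
  "smooth_embedding N M \<phi> \<longleftrightarrow> immersion N M \<phi> \<and> embedding_map (mtop N) (mtop M) \<phi>"


section \<open>Two-forms, symplectic forms and the Poisson bracket\<close>

text \<open>A two-form is given by its components \<open>\<omega> a p i j\<close>, the value at \<open>p\<close> on the \<open>i\<close>-th and \<open>j\<close>-th
  coordinate vector fields of the coordinate system \<open>a\<close>.\<close>

type_synonym 'm two_form = "'m coord \<Rightarrow> 'm \<Rightarrow> nat \<Rightarrow> nat \<Rightarrow> real"

text \<open>\<open>pullback_eq N M \<phi> \<omega> \<eta>\<close> says that \<open>\<phi>\<^sup>*\<omega> = \<eta>\<close>.\<close>

definition pullback_eq ::
  "'n manifold \<Rightarrow> 'm manifold \<Rightarrow> ('n \<Rightarrow> 'm) \<Rightarrow> 'm two_form \<Rightarrow> 'n two_form \<Rightarrow> bool" where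
  "pullback_eq N M \<phi> \<omega> \<eta> \<longleftrightarrow>
     (\<forall>a\<in>mcoords N. \<forall>b\<in>mcoords M. \<forall>p \<in> fst a \<inter> \<phi> -` fst b. \<forall>i<mdim N. \<forall>j<mdim N.
        \<eta> a p i j =
          (\<Sum>k<mdim M. \<Sum>l<mdim M. \<omega> b (\<phi> p) k l * jacobian a \<phi> b p k i * jacobian a \<phi> b p l j))"

text \<open>The components of \<open>\<omega>\<close> in \<open>a\<close> as functions of the coordinates.\<close>

definition form_rep :: "'m two_form \<Rightarrow> 'm coord \<Rightarrow> nat \<Rightarrow> nat \<Rightarrow> (nat \<Rightarrow> real) \<Rightarrow> real" where
  "form_rep \<omega> a i j x = \<omega> a (inv_into (fst a) (snd a) x) i j"

text \<open>The last conjunct, \<open>id\<^sup>*\<omega> = \<omega>\<close>, is the transformation law of the components under a change of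
  coordinates.\<close>

definition smooth_two_form :: "'m manifold \<Rightarrow> 'm two_form \<Rightarrow> bool" where
  "smooth_two_form M \<omega> \<longleftrightarrow>
     (\<forall>a\<in>mcoords M. \<forall>i<mdim M. \<forall>j<mdim M. smooth_on (mdim M) (snd a ` fst a) (form_rep \<omega> a i j)) \<and>
     (\<forall>a\<in>mcoords M. \<forall>p\<in>fst a. \<forall>i<mdim M. \<forall>j<mdim M. \<omega> a p i j = - \<omega> a p j i) \<and>
     pullback_eq M M id \<omega> \<omega>"

definition closed_two_form :: "'m manifold \<Rightarrow> 'm two_form \<Rightarrow> bool" where
  "closed_two_form M \<omega> \<longleftrightarrow>
     (\<forall>a\<in>mcoords M. \<forall>x \<in> snd a ` fst a. \<forall>i<mdim M. \<forall>j<mdim M. \<forall>k<mdim M.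
        partial_deriv i (form_rep \<omega> a j k) x + partial_deriv j (form_rep \<omega> a k i) x
          + partial_deriv k (form_rep \<omega> a i j) x = 0)"

definition nondegenerate_two_form :: "'m manifold \<Rightarrow> 'm two_form \<Rightarrow> bool" where
  "nondegenerate_two_form M \<omega> \<longleftrightarrow>
     (\<forall>a\<in>mcoords M. \<forall>p\<in>fst a. \<forall>v :: nat \<Rightarrow> real.
        (\<forall>j<mdim M. (\<Sum>i<mdim M. v i * \<omega> a p i j) = 0) \<longrightarrow> (\<forall>i<mdim M. v i = 0))"

definition symplectic_form :: "'m manifold \<Rightarrow> 'm two_form \<Rightarrow> bool" where
  "symplectic_form M \<omega> \<longleftrightarrow>
     smooth_two_form M \<omega> \<and> closed_two_form M \<omega> \<and> nondegenerate_two_form M \<omega>"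

text \<open>\<open>v\<close> is the (complex) coordinate vector at \<open>p\<close> of the Hamiltonian vector field \<open>X\<^sub>f\<close>, defined by
  \<open>\<omega>(X\<^sub>f, \<cdot>) = df\<close>.\<close>

definition hamiltonian_vector ::
  "'m manifold \<Rightarrow> 'm two_form \<Rightarrow> ('m \<Rightarrow> complex) \<Rightarrow> 'm coord \<Rightarrow> 'm \<Rightarrow> (nat \<Rightarrow> complex) \<Rightarrow> bool" where
  "hamiltonian_vector M \<omega> f a p v \<longleftrightarrow>
     (\<forall>j<mdim M. (\<Sum>i<mdim M. v i * of_real (\<omega> a p i j)) =
                 partial_deriv j (f \<circ> inv_into (fst a) (snd a)) (snd a p))"

text \<open>\<open>{f, g} = \<omega>(X\<^sub>f, X\<^sub>g)\<close>; thus \<open>{q, p} = 1\<close> for \<open>\<omega> = dq \<and> dp\<close> on the plane. The value does not depend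
  on the coordinate system \<open>a\<close> around \<open>p\<close>.\<close>

definition poisson_bracket ::
  "'m manifold \<Rightarrow> 'm two_form \<Rightarrow> ('m \<Rightarrow> complex) \<Rightarrow> ('m \<Rightarrow> complex) \<Rightarrow> 'm \<Rightarrow> complex" where
  "poisson_bracket M \<omega> f g p =
     (THE z. \<forall>a\<in>mcoords M. p \<in> fst a \<longrightarrow>
        (\<exists>v w. hamiltonian_vector M \<omega> f a p v \<and> hamiltonian_vector M \<omega> g a p w \<and>
               z = (\<Sum>i<mdim M. \<Sum>j<mdim M. of_real (\<omega> a p i j) * v i * w j)))"


section \<open>Manifolds with a finite group action\<close>

definition quotient_topology :: "'a topology \<Rightarrow> ('a \<Rightarrow> 'b) \<Rightarrow> 'b topology" where
  "quotient_topology T q =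
     topology (\<lambda>S. S \<subseteq> q ` topspace T \<and> openin T {x \<in> topspace T. q x \<in> S})"

lemma openin_quotient_topology:
  "openin (quotient_topology T q) S \<longleftrightarrow>
     S \<subseteq> q ` topspace T \<and> openin T {x \<in> topspace T. q x \<in> S}"
proof -
  have "istopology (\<lambda>S. S \<subseteq> q ` topspace T \<and> openin T {x \<in> topspace T. q x \<in> S})"
    unfolding istopology_def
  proof (intro conjI allI impI)
    fix S U
    assume "S \<subseteq> q ` topspace T \<and> openin T {x \<in> topspace T. q x \<in> S}"
      and "U \<subseteq> q ` topspace T \<and> openin T {x \<in> topspace T. q x \<in> U}"
    moreover have "{x \<in> topspace T. q x \<in> S \<inter> U} =
        {x \<in> topspace T. q x \<in> S} \<inter> {x \<in> topspace T. q x \<in> U}" by auto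
    ultimately show "S \<inter> U \<subseteq> q ` topspace T" "openin T {x \<in> topspace T. q x \<in> S \<inter> U}"
      by (auto simp: openin_Int)
  next
    fix K
    assume K: "\<forall>S\<in>K. S \<subseteq> q ` topspace T \<and> openin T {x \<in> topspace T. q x \<in> S}"
    have "{x \<in> topspace T. q x \<in> \<Union>K} = (\<Union>S\<in>K. {x \<in> topspace T. q x \<in> S})" by auto
    with K show "\<Union>K \<subseteq> q ` topspace T" "openin T {x \<in> topspace T. q x \<in> \<Union>K}"
      by (auto intro!: openin_Union)
  qed
  then show ?thesis by (simp add: quotient_topology_def)
qed

lemma topspace_quotient_topology: "topspace (quotient_topology T q) = q ` topspace T"
proof -
  have "{x \<in> topspace T. q x \<in> q ` topspace T} = topspace T" by auto
  then have "openin (quotient_topology T q) (q ` topspace T)"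
    by (simp add: openin_quotient_topology)
  then show ?thesis
    by (metis openin_quotient_topology openin_subset openin_topspace subset_antisym)
qed

lemma quotient_map_quotient_topology: "quotient_map T (quotient_topology T q) q"
  by (simp add: quotient_map_def openin_quotient_topology topspace_quotient_topology)

record ('m, 'g) gmanifold =
  gspace :: "'m manifold"
  ggroup :: "'g monoid"
  gact :: "'g \<Rightarrow> 'm \<Rightarrow> 'm"

abbreviation gtop :: "('m, 'g, 'z) gmanifold_scheme \<Rightarrow> 'm topology" where
  "gtop M \<equiv> mtop (gspace M)"

abbreviation gpoints :: "('m, 'g, 'z) gmanifold_scheme \<Rightarrow> 'm set" where
  "gpoints M \<equiv> topspace (gtop M)"

abbreviation gorbit :: "('m, 'g, 'z) gmanifold_scheme \<Rightarrow> 'm \<Rightarrow> 'm set" where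
  "gorbit M \<equiv> orbit (ggroup M) (gact M)"

text \<open>The objects with finite group. A finite Lie group is discrete, so an action is smooth as soon
  as every group element acts by a smooth map, and every homomorphism is continuous.\<close>

definition finite_gmanifold :: "('m, 'g, 'z) gmanifold_scheme \<Rightarrow> bool" where
  "finite_gmanifold M \<longleftrightarrow>
     smooth_manifold (gspace M) \<and>
     group (ggroup M) \<and> finite (carrier (ggroup M)) \<and>
     group_action (ggroup M) (gpoints M) (gact M) \<and>
     (\<forall>g \<in> carrier (ggroup M). smooth_map (gspace M) (gspace M) (gact M g))"

definition orbit_space :: "('m, 'g, 'z) gmanifold_scheme \<Rightarrow> 'm set topology" where
  "orbit_space M = quotient_topology (gtop M) (gorbit M)"

definition gmorphism ::
  "('n, 'h, 'y) gmanifold_scheme \<Rightarrow> ('m, 'g, 'z) gmanifold_scheme \<Rightarrow> ('n \<Rightarrow> 'm) \<times> ('h \<Rightarrow> 'g) \<Rightarrow> bool"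
  where
  "gmorphism N M F \<longleftrightarrow>
     smooth_map (gspace N) (gspace M) (fst F) \<and>
     snd F \<in> hom (ggroup N) (ggroup M) \<and>
     (\<forall>h \<in> carrier (ggroup N). \<forall>y \<in> gpoints N. fst F (gact N h y) = gact M (snd F h) (fst F y))"

text \<open>The induced map sends an orbit to the union of the orbits of the images of its points, which
  for equivariant maps is a single orbit.\<close>

definition induced_map :: "('m, 'g, 'z) gmanifold_scheme \<Rightarrow> ('n \<Rightarrow> 'm) \<Rightarrow> 'n set \<Rightarrow> 'm set" where
  "induced_map M \<phi> O' = (\<Union>y\<in>O'. gorbit M (\<phi> y))"

definition gembedding ::
  "('n, 'h, 'y) gmanifold_scheme \<Rightarrow> ('m, 'g, 'z) gmanifold_scheme \<Rightarrow> ('n \<Rightarrow> 'm) \<times> ('h \<Rightarrow> 'g) \<Rightarrow> bool"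
  where
  "gembedding N M F \<longleftrightarrow>
     gmorphism N M F \<and>
     smooth_embedding (gspace N) (gspace M) (fst F) \<and>
     embedding_map (orbit_space N) (orbit_space M) (induced_map M (fst F)) \<and>
     openin (orbit_space M) (induced_map M (fst F) ` topspace (orbit_space N))"

definition open_gembedding ::
  "('n, 'h, 'y) gmanifold_scheme \<Rightarrow> ('m, 'g, 'z) gmanifold_scheme \<Rightarrow> ('n \<Rightarrow> 'm) \<times> ('h \<Rightarrow> 'g) \<Rightarrow> bool"
  where
  "open_gembedding N M F \<longleftrightarrow> gembedding N M F \<and> open_map (gtop N) (gtop M) (fst F)"


section \<open>Orbifolds\<close>

record ('m, 'g, 'x) ochart = "('m, 'g) gmanifold" +
  oproj :: "'m \<Rightarrow> 'x"

definition oimage :: "('m, 'g, 'x) ochart \<Rightarrow> 'x set" where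
  "oimage c = oproj c ` gpoints c"

text \<open>On an orbit the invariant map \<open>oproj c\<close> is constant, so \<open>the_elem (oproj c ` O)\<close> is its value
  there. No effectivity of the action is assumed.\<close>

definition orbifold_chart :: "'x topology \<Rightarrow> ('m, 'g, 'x) ochart \<Rightarrow> bool" where
  "orbifold_chart X c \<longleftrightarrow>
     finite_gmanifold c \<and>
     continuous_map (gtop c) X (oproj c) \<and>
     (\<forall>g \<in> carrier (ggroup c). \<forall>y \<in> gpoints c. oproj c (gact c g y) = oproj c y) \<and>
     openin X (oimage c) \<and>
     homeomorphic_map (orbit_space c) (subtopology X (oimage c)) (\<lambda>O'. the_elem (oproj c ` O'))"

definition over_space :: "('m, 'g, 'x) ochart \<Rightarrow> ('m, 'g, 'x) ochart \<Rightarrow> ('m \<Rightarrow> 'm) \<times> ('g \<Rightarrow> 'g) \<Rightarrow> bool" where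
  "over_space d c F \<longleftrightarrow> (\<forall>y \<in> gpoints d. oproj c (fst F y) = oproj d y)"

definition germ_equivalent ::
  "'x topology \<Rightarrow> 'x \<Rightarrow> ('m, 'g, 'x) ochart \<Rightarrow> ('m, 'g, 'x) ochart \<Rightarrow> bool" where
  "germ_equivalent X x c c' \<longleftrightarrow>
     (\<exists>d. orbifold_chart X d \<and> x \<in> oimage d \<and>
        (\<exists>F. gembedding d c F \<and> over_space d c F) \<and>
        (\<exists>F. gembedding d c' F \<and> over_space d c' F))"

definition orbifold_atlas :: "'x topology \<Rightarrow> ('m, 'g, 'x) ochart set \<Rightarrow> bool" where
  "orbifold_atlas X A \<longleftrightarrow>
     (\<forall>c\<in>A. orbifold_chart X c) \<and>
     \<Union>(oimage ` A) = topspace X \<and>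
     (\<forall>c\<in>A. \<forall>c'\<in>A. \<forall>x \<in> oimage c \<inter> oimage c'. germ_equivalent X x c c')"

definition paracompact_space :: "'x topology \<Rightarrow> bool" where
  "paracompact_space X \<longleftrightarrow>
     (\<forall>\<U>. (\<forall>U\<in>\<U>. openin X U) \<and> \<Union>\<U> = topspace X \<longrightarrow>
        (\<exists>\<V>. (\<forall>V\<in>\<V>. openin X V \<and> (\<exists>U\<in>\<U>. V \<subseteq> U)) \<and> \<Union>\<V> = topspace X \<and> locally_finite_in X \<V>))"

text \<open>The types of the points of the chart domains and of the group elements bound the size of the
  charts. Second countable manifolds have at most the cardinality of the continuum, so for
  \<open>real\<close> and \<open>nat\<close>, say, all charts occur up to isomorphism.\<close>

definition orbifold :: "'x topology \<Rightarrow> ('m, 'g, 'x) ochart set \<Rightarrow> bool" where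
  "orbifold X A \<longleftrightarrow>
     Hausdorff_space X \<and> second_countable X \<and> paracompact_space X \<and>
     orbifold_atlas X A \<and>
     (\<forall>B. orbifold_atlas X B \<and> A \<subseteq> B \<longrightarrow> B = A)"


section \<open>Orbispace functors and symplectic orbifolds\<close>

definition open_covering :: "'x topology \<Rightarrow> 'x set set \<Rightarrow> bool" where
  "open_covering X \<U> \<longleftrightarrow> (\<forall>U\<in>\<U>. openin X U) \<and> \<Union>\<U> = topspace X"

definition cover_objects :: "'x topology \<Rightarrow> 'x set set \<Rightarrow> 'x set set" where
  "cover_objects X \<U> =
     {U. \<exists>\<F>. finite \<F> \<and> \<F> \<noteq> {} \<and> \<F> \<subseteq> \<U> \<and> U \<in> connected_components_of (subtopology X (\<Inter>\<F>))}"

text \<open>\<open>Ob U\<close> is the chart assigned to \<open>U\<close>, and \<open>Mor V U\<close> the morphism of charts assigned to the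
  inclusion of \<open>V\<close> into \<open>U\<close>. Morphisms are compared on the domain and on the group.\<close>

definition orbispace_functor ::
  "'x topology \<Rightarrow> ('m, 'g, 'x) ochart set \<Rightarrow> 'x set set \<Rightarrow> ('x set \<Rightarrow> ('m, 'g, 'x) ochart) \<Rightarrow>
   ('x set \<Rightarrow> 'x set \<Rightarrow> ('m \<Rightarrow> 'm) \<times> ('g \<Rightarrow> 'g)) \<Rightarrow> bool" where
  "orbispace_functor X A \<U> Ob Mor \<longleftrightarrow>
     (\<forall>U \<in> cover_objects X \<U>.
        Ob U \<in> A \<and> oimage (Ob U) = U \<and> connected_space (gtop (Ob U))) \<and>
     (\<forall>V \<in> cover_objects X \<U>. \<forall>U \<in> cover_objects X \<U>. V \<subseteq> U \<longrightarrow>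
        open_gembedding (Ob V) (Ob U) (Mor V U) \<and> over_space (Ob V) (Ob U) (Mor V U)) \<and>
     (\<forall>U \<in> cover_objects X \<U>.
        (\<forall>y \<in> gpoints (Ob U). fst (Mor U U) y = y) \<and>
        (\<forall>g \<in> carrier (ggroup (Ob U)). snd (Mor U U) g = g)) \<and>
     (\<forall>W \<in> cover_objects X \<U>. \<forall>V \<in> cover_objects X \<U>. \<forall>U \<in> cover_objects X \<U>.
        W \<subseteq> V \<and> V \<subseteq> U \<longrightarrow>
        (\<forall>y \<in> gpoints (Ob W). fst (Mor W U) y = fst (Mor V U) (fst (Mor W V) y)) \<and>
        (\<forall>g \<in> carrier (ggroup (Ob W)). snd (Mor W U) g = snd (Mor V U) (snd (Mor W V) g)))"

definition orbifold_symplectic_form ::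
  "'x topology \<Rightarrow> 'x set set \<Rightarrow> ('x set \<Rightarrow> ('m, 'g, 'x) ochart) \<Rightarrow>
   ('x set \<Rightarrow> 'x set \<Rightarrow> ('m \<Rightarrow> 'm) \<times> ('g \<Rightarrow> 'g)) \<Rightarrow> ('x set \<Rightarrow> 'm two_form) \<Rightarrow> bool" where
  "orbifold_symplectic_form X \<U> Ob Mor \<omega> \<longleftrightarrow>
     (\<forall>U \<in> cover_objects X \<U>.
        symplectic_form (gspace (Ob U)) (\<omega> U) \<and>
        (\<forall>g \<in> carrier (ggroup (Ob U)).
           pullback_eq (gspace (Ob U)) (gspace (Ob U)) (gact (Ob U) g) (\<omega> U) (\<omega> U))) \<and>
     (\<forall>V \<in> cover_objects X \<U>. \<forall>U \<in> cover_objects X \<U>. V \<subseteq> U \<longrightarrow>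
        pullback_eq (gspace (Ob V)) (gspace (Ob U)) (fst (Mor V U)) (\<omega> U) (\<omega> V))"


section \<open>Star products\<close>

text \<open>Functions on the set \<open>topspace X\<close> are represented by their extensions by zero, so that they
  form a subspace of \<open>'x \<Rightarrow> complex\<close>.\<close>

definition orbifold_functions :: "'x topology \<Rightarrow> ('m, 'g, 'x) ochart set \<Rightarrow> ('x \<Rightarrow> complex) set" where
  "orbifold_functions X A =
     {f. (\<forall>x. x \<notin> topspace X \<longrightarrow> f x = 0) \<and> continuous_map X euclidean f \<and>
         (\<forall>c\<in>A. smooth_function (gspace c) (f \<circ> oproj c))}"

definition orbifold_bracket ::
  "'x topology \<Rightarrow> 'x set set \<Rightarrow> ('x set \<Rightarrow> ('m, 'g, 'x) ochart) \<Rightarrow> ('x set \<Rightarrow> 'm two_form) \<Rightarrow>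
   ('x \<Rightarrow> complex) \<Rightarrow> ('x \<Rightarrow> complex) \<Rightarrow> 'x \<Rightarrow> complex" where
  "orbifold_bracket X \<U> Ob \<omega> f g x =
     (if x \<in> topspace X
      then THE z. \<forall>U \<in> cover_objects X \<U>. \<forall>y \<in> gpoints (Ob U). oproj (Ob U) y = x \<longrightarrow>
             z = poisson_bracket (gspace (Ob U)) (\<omega> U) (f \<circ> oproj (Ob U)) (g \<circ> oproj (Ob U)) y
      else 0)"

definition orbifold_one :: "'x topology \<Rightarrow> 'x \<Rightarrow> complex" where
  "orbifold_one X x = (if x \<in> topspace X then 1 else 0)"

definition fps_over :: "'a::zero set \<Rightarrow> 'a fps set" where
  "fps_over C = {F. \<forall>n. fps_nth F n \<in> C}"

text \<open>The action of complex formal power series on formal power series with coefficients in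
  the complex vector space of functions.\<close>

definition fps_scale :: "complex fps \<Rightarrow> ('x \<Rightarrow> complex) fps \<Rightarrow> ('x \<Rightarrow> complex) fps" where
  "fps_scale a F = Abs_fps (\<lambda>n x. \<Sum>k\<le>n. fps_nth a k * fps_nth F (n - k) x)"

definition bilinear_on ::
  "('x \<Rightarrow> complex) set \<Rightarrow> (('x \<Rightarrow> complex) \<Rightarrow> ('x \<Rightarrow> complex) \<Rightarrow> ('x \<Rightarrow> complex)) \<Rightarrow> bool" where
  "bilinear_on C \<mu> \<longleftrightarrow>
     (\<forall>f\<in>C. \<forall>g\<in>C. \<mu> f g \<in> C) \<and>
     (\<forall>f\<in>C. \<forall>f'\<in>C. \<forall>g\<in>C. \<mu> (f + f') g = \<mu> f g + \<mu> f' g \<and> \<mu> g (f + f') = \<mu> g f + \<mu> g f') \<and>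
     (\<forall>z. \<forall>f\<in>C. \<forall>g\<in>C. \<mu> (\<lambda>x. z * f x) g = (\<lambda>x. z * \<mu> f g x) \<and>
                       \<mu> f (\<lambda>x. z * g x) = (\<lambda>x. z * \<mu> f g x))"

definition fps_bilinear_on ::
  "('x \<Rightarrow> complex) fps set \<Rightarrow>
   (('x \<Rightarrow> complex) fps \<Rightarrow> ('x \<Rightarrow> complex) fps \<Rightarrow> ('x \<Rightarrow> complex) fps) \<Rightarrow> bool" where
  "fps_bilinear_on D star \<longleftrightarrow>
     (\<forall>F\<in>D. \<forall>G\<in>D. star F G \<in> D) \<and>
     (\<forall>F\<in>D. \<forall>F'\<in>D. \<forall>G\<in>D. star (F + F') G = star F G + star F' G \<and>
                            star G (F + F') = star G F + star G F') \<and>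
     (\<forall>a. \<forall>F\<in>D. \<forall>G\<in>D. star (fps_scale a F) G = fps_scale a (star F G) \<and>
                       star F (fps_scale a G) = fps_scale a (star F G))"

definition star_product ::
  "'x topology \<Rightarrow> ('m, 'g, 'x) ochart set \<Rightarrow> 'x set set \<Rightarrow> ('x set \<Rightarrow> ('m, 'g, 'x) ochart) \<Rightarrow>
   ('x set \<Rightarrow> 'm two_form) \<Rightarrow>
   (('x \<Rightarrow> complex) fps \<Rightarrow> ('x \<Rightarrow> complex) fps \<Rightarrow> ('x \<Rightarrow> complex) fps) \<Rightarrow> bool" where
  "star_product X A \<U> Ob \<omega> star \<longleftrightarrow>
     (let C = orbifold_functions X A; D = fps_over C in
      fps_bilinear_on D star \<and>
      (\<forall>F\<in>D. \<forall>G\<in>D. \<forall>H\<in>D. star (star F G) H = star F (star G H)) \<and>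
      (\<exists>\<mu>. (\<forall>k. bilinear_on C (\<mu> k)) \<and>
           (\<forall>f\<in>C. \<forall>g\<in>C. \<mu> 0 f g = (\<lambda>x. f x * g x) \<and>
              star (fps_const f) (fps_const g) = Abs_fps (\<lambda>k. \<mu> k f g))) \<and>
      (\<forall>f\<in>C. \<forall>g\<in>C. \<exists>R\<in>D.
         star (fps_const f) (fps_const g) - star (fps_const g) (fps_const f)
           - fps_scale (fps_const \<i> * fps_X) (fps_const (orbifold_bracket X \<U> Ob \<omega> f g))
         = fps_scale (fps_X ^ 2) R) \<and>
      (\<forall>f\<in>C. star (fps_const f) (fps_const (orbifold_one X)) = fps_const f \<and>
             star (fps_const (orbifold_one X)) (fps_const f) = fps_const f))"

end

theory Submission
  imports Defs "Jordan_Normal_Form.Determinant" "HOL-Homology.Homology"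
begin

text \<open>The proof is Fedosov's construction, arranged so that gluing is automatic. On a coordinate
  domain with a symplectic connection, Fedosov's recursion produces a flat derivation of the sections
  of the formal Weyl bundle; restriction to the zero section identifies its flat sections with the
  formal power series of functions, and the fibrewise Moyal product becomes a star product. Every step
  is uniquely determined by the form and the connection, hence natural for symplectic maps which match
  the connections. What remains is a family of symplectic connections on the coordinate domains of all
  charts that is compatible with every local map over the identity of the orbifold. Such maps are
  obtained from germ equivalence (charts joined by embeddings have equal dimension by Baire's theorem
  and invariance of domain), and a compatible family by averaging local connections over the finite
  groups and summing with a locally finite family of invariant cut-off functions. Two lifts of the
  same map differ, near the points of a dense open set, by a group element; so averages do not depend
  on lifts, although the group actions need not be effective.\<close>

text \<open>The obstacle is that star products can be neither averaged nor glued with cut-off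
  functions, since associativity is quadratic. Symplectic connections form an affine space;
  therefore all averaging takes place among them, and the passage from connections to products has
  to be functorial. Functoriality rests on uniqueness at two places: the gauge
  \<open>\<Sum> y\<^sub>i r\<^sub>i = 0\<close> together with degree at least 3 fixes the form
  \<open>r\<close>, and the term free of \<open>y\<close> fixes a flat section. The degree counts
  the formal parameter twice and each \<open>y\<close> once; a bracket sends degrees p and q to p +
  q - 2, so that bracketing with degree 3 still gains one degree, and every recursion is a
  contraction. Weighted sums need care: the transformation law of a connection has an inhomogeneous
  term linear in the form. Each local connection therefore travels with its weight, and the total is
  divided by the total weight at the end. Cut-off functions and smoothness live on the chart
  domains, and functions on \<open>X\<close> arise as group sums, so fixed point sets of any
  codimension are harmless.\<close>

notation (input) iff (infixr "<->" 25)

type_synonym pt = "nat => real"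

abbreviation (input) "ES == Euclidean_space"
abbreviation (input) "oES n == openin (ES n)"
abbreviation (input) "sES n == subtopology (ES n)"
abbreviation (input) "pd == partial_deriv"
abbreviation (input) "jc F i p z == pd i (%x. F x p) z"
abbreviation (input) "hs F i j p z == pd i (pd j (%x. F x p)) z"
abbreviation (input) "dl i j == if i = j then 1 else 0"

text \<open>Along a map \<open>F\<close>, \<open>fpb\<close> pulls back two-forms and \<open>claw\<close> symplectic connections whose upper
  index has been lowered by the form.\<close>

abbreviation (input) "fpb n w F i j z == SUM k<n. SUM l<n. w k l * jc F i k z * jc F j l z"

abbreviation (input) "claw n F i j k z T w == SUM r<n. jc F k r z *
 ((SUM p<n. SUM q<n. T r p q * jc F i p z * jc F j q z) + (SUM m<n. w r m * hs F i j m z))"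

abbreviation (input) "gcar c == carrier (ggroup c)"
abbreviation (input) "cdim c == mdim (gspace c)"
abbreviation (input) "pj == Defs.oproj"

section \<open>Calculus on open subsets of Euclidean space\<close>

lemma Euclidean_space_eq_top_of_set: "ES n = top_of_set {x. ALL i>=n. x i = 0}"
 by (simp add: Euclidean_space_def euclidean_product_topology)

lemma openin_ES_subset: "oES n V ==> V <= {x. ALL i>=n. x i = 0}"
 by (metis openin_subset topspace_Euclidean_space)

lemma subtopology_ES: "V <= {x. ALL i>=n. x i = 0} ==> sES n V = top_of_set V"
 by (simp add: Euclidean_space_eq_top_of_set subtopology_subtopology inf.absorb2)

lemma continuous_map_ES_iff:
 "V <= {x. ALL i>=n. x i = 0} ==>
  continuous_map (sES n V) euclidean f <-> continuous_on V f"
 by (simp add: subtopology_ES)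

text \<open>Coordinates from \<open>n\<close> on are frozen at zero, so membership in a basic
  product neighbourhood is decided by finitely many radii. Closed boxes will also serve as compact
  sets.\<close>

lemma openin_ES_box:
 assumes V: "oES n V" and x: "x : V"
 obtains e where "e > 0" "!!y. (!!i. i >= n ==> y i = 0) ==> (!!i. i<n ==> \<bar>y i - x i\<bar> <= e) ==> y : V"
proof -
 obtain S where S: "openin (powertop_real UNIV) S" "V = S Int {x. ALL i>=n. x i = 0}"
  using V unfolding Euclidean_space_def openin_subtopology by auto
 obtain B where B: "x : Pi\<^sub>E UNIV B" "!!i. openin euclideanreal (B i)"
  "finite {i. B i ~= topspace euclideanreal}" "Pi\<^sub>E UNIV B <= S"
  using product_topology_open_contains_basis[OF S(1)] x S(2) by blast
 have "ALL i. EX d>0. ALL t. \<bar>t - x i\<bar><d --> t : B i"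
  using B(1,2) by (simp add: open_real PiE_iff)
 then obtain d where d: "!!i. d i > 0" "!!i t. \<bar>t - x i\<bar><d i ==> t : B i" by metis
 \<comment> \<open>The inserted 1 keeps the minimum meaningful for \<open>n = 0\<close>.\<close>
 define m where "m = Min (insert 1 (d ` {..<n}))"
 have m: "m > 0" unfolding m_def by (subst Min_gr_iff) (auto simp: d)
 have m_le: "m <= d i" if "i<n" for i unfolding m_def using that by (intro Min_le) auto
 define e where "e = m / 2"
 have e: "e > 0" "!!i. i<n ==> e<d i"
  using m m_le by (simp_all add: e_def) (smt (verit, best) m_le)
 have "y : V" if y: "!!i. i >= n ==> y i = 0" "!!i. i<n ==> \<bar>y i - x i\<bar> <= e" for y
 proof -
  have "y i : B i" for i
  proof (cases "i<n")
   case True thus ?thesis using y(2)[OF True] e(2)[OF True] d(2) by force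
  next
   case False
   hence "y i = x i" using y(1) x S(2) by simp
   thus ?thesis using B(1) by auto
  qed
  hence "y : S" using B(4) by (auto simp: PiE_iff)
  thus ?thesis using S(2) y(1) by auto
 qed
 thus ?thesis using that e(1) by blast
qed

lemma openin_ES_update:
 assumes "oES n V" "x : V" "i<n"
 shows "eventually (%t. x(i := t) : V) (nhds (x i))"
proof -
 obtain e where e: "e > 0" "!!y. (!!i. i >= n ==> y i = 0) ==> (!!i. i<n ==> \<bar>y i - x i\<bar> <= e) ==> y : V"
  using openin_ES_box[OF assms(1,2)] by metis
 have "x j = 0" if "j >= n" for j using openin_ES_subset[OF assms(1)] assms(2) that by auto
 hence "x(i := t) : V" if "dist t (x i)<e" for t
  using that assms(3) e(1) by (intro e(2)) (auto simp: dist_real_def)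
 thus ?thesis using e(1) eventually_nhds_metric by blast
qed

text \<open>\<open>partial_deriv\<close> returns some value even where no derivative exists; this
  predicate records existence and value together.\<close>

definition has_pd :: "nat => (pt => 'b::real_normed_vector) => 'b => pt => bool" where
 "has_pd i f D x <-> ((%t. f (x(i := t))) has_vector_derivative D) (at (x i))"

lemma has_pd_imp_eq: "has_pd i f D x ==> pd i f x = D"
 by (simp add: has_pd_def partial_deriv_def vector_derivative_at)

lemma has_pd_cong:
 assumes "oES n V" "x : V" "i<n" "!!y. y : V ==> f y = g y"
 shows "has_pd i f D x <-> has_pd i g D x"
proof -
 have "eventually (%t. f (x(i := t)) = g (x(i := t))) (nhds (x i))"
  using openin_ES_update[OF assms(1-3)] by eventually_elim (simp add: assms(4))
 thus ?thesis unfolding has_pd_def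
  by (intro has_vector_derivative_cong_ev) (auto elim: eventually_mono dest: eventually_nhds_x_imp_x)
qed

text \<open>Both values are chosen by the same predicate, so they agree even where the derivative
  fails to exist.\<close>

lemma partial_deriv_cong:
 assumes "oES n V" "x : V" "i<n" "!!y. y : V ==> f y = g y"
 shows "pd i f x = pd i g x"
proof -
 have "!!D. has_pd i f D x <-> has_pd i g D x" using has_pd_cong[OF assms] .
 thus ?thesis by (simp add: partial_deriv_def vector_derivative_def has_pd_def)
qed

lemma Ck_on_Suc_iff:
 "Ck_on (Suc k) n V f <-> Ck_on 0 n V f &
   (ALL i<n. (ALL x:V. has_pd i f (pd i f x) x) & Ck_on k n V (pd i f))"
 by (simp add: has_pd_def partial_deriv_def vector_derivative_works)

declare Ck_on.simps(2) [simp del]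

lemma Ck_on_0_iff: "oES n V ==> Ck_on 0 n V f <-> continuous_on V f"
 by (simp add: continuous_map_ES_iff openin_ES_subset)

lemma Ck_on_imp_cont: "Ck_on k n V f ==> Ck_on 0 n V f" by (cases k) (auto simp: Ck_on_Suc_iff)

lemma Ck_on_cong:
 assumes V: "oES n V" and "!!y. y : V ==> f y = g y"
 shows "Ck_on k n V f <-> Ck_on k n V g" using assms(2)
proof (induction k arbitrary: f g)
 case 0
 thus ?case by (simp only: Ck_on_0_iff[OF V]) (rule continuous_on_cong; simp)
next
 case (Suc k)
 have 1: "Ck_on 0 n V f = Ck_on 0 n V g"
  using Suc.prems by (simp only: Ck_on_0_iff[OF V]) (rule continuous_on_cong; simp)
 have 2: "pd i f x = pd i g x" if "i<n" "x : V" for i x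
  using partial_deriv_cong[OF V that(2,1) Suc.prems] .
 have 3: "has_pd i f (pd i f x) x = has_pd i g (pd i g x) x" if "i<n" "x : V" for i x
  using has_pd_cong[OF V that(2,1) Suc.prems] 2[OF that] by simp
 have 4: "Ck_on k n V (pd i f) = Ck_on k n V (pd i g)" if "i<n" for i using Suc.IH 2[OF that] by blast
 show ?case unfolding Ck_on_Suc_iff using 1 3 4 by auto
qed

lemma Ck_on_SucI:
 assumes V: "oES n V" and "continuous_on V f"
  and pd: "!!i x. i<n ==> x : V ==> has_pd i f (f' i x) x"
  and "!!i. i<n ==> Ck_on k n V (f' i)"
 shows "Ck_on (Suc k) n V f"
proof -
 have "Ck_on k n V (pd i f)" if "i<n" for i
  using Ck_on_cong[OF V, of "pd i f" "f' i" k] has_pd_imp_eq[OF pd[OF that]] assms(4)[OF that] by simp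
 thus ?thesis unfolding Ck_on_Suc_iff Ck_on_0_iff[OF V] using assms(2) pd has_pd_imp_eq[OF pd] by auto
qed

lemma Ck_on_SucD: "Ck_on (Suc k) n V f ==> Ck_on k n V f"
proof (induction k arbitrary: f)
 case 0 thus ?case by (simp only: Ck_on_Suc_iff)
next
 case (Suc k) thus ?case by (subst Ck_on_Suc_iff) (auto simp: Ck_on_Suc_iff[of "Suc k"])
qed

lemma Ck_on_subset:
 assumes "oES n V" "oES n W" "W <= V" "Ck_on k n V f"
 shows "Ck_on k n W f" using assms(4)
proof (induction k arbitrary: f)
 case 0 thus ?case
  unfolding Ck_on_0_iff[OF assms(1)] Ck_on_0_iff[OF assms(2)] using assms(3) continuous_on_subset by metis
next
 case (Suc k)
 have "continuous_on W f"
  using Suc.prems Ck_on_imp_cont Ck_on_0_iff[OF assms(1)] assms(3) continuous_on_subset by metis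
 moreover have "has_pd i f (pd i f x) x" if "i<n" "x : W" for i x
  using Suc.prems that assms(3) unfolding Ck_on_Suc_iff by (metis subsetD)
 moreover have "Ck_on k n W (pd i f)" if "i<n" for i
  using Suc.prems that unfolding Ck_on_Suc_iff by (intro Suc.IH) metis
 ultimately show ?case unfolding Ck_on_Suc_iff Ck_on_0_iff[OF assms(2)] by simp
qed

text \<open>The sheaf property, which lets smoothness be checked on one small neighbourhood at a
  time.\<close>

lemma Ck_on_local:
 assumes V: "oES n V"
  and loc: "!!x. x : V ==> EX W. oES n W & x : W & Ck_on k n W f"
 shows "Ck_on k n V f" using loc
proof (induction k arbitrary: f)
 case 0
 have *: "EX U. open U & x : U & continuous_on (V Int U) f" if x: "x : V" for x
 proof -
  obtain W where W: "oES n W" "x : W" "Ck_on 0 n W f" using 0[OF x] by blast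
  obtain U where U: "open U" "W = {x. ALL i>=n. x i = 0} Int U"
   using W(1) unfolding Euclidean_space_eq_top_of_set openin_open by blast
  have "V Int U <= W" using U openin_ES_subset[OF V] by auto
  moreover have "continuous_on W f" using W(1,3) Ck_on_0_iff by blast
  ultimately show ?thesis using U W(2) continuous_on_subset by blast
 qed
 have "continuous (at x within V) f" if x: "x : V" for x
 proof -
  obtain U where U: "open U" "x : U" "continuous_on (V Int U) f" using *[OF x] by blast
  hence "continuous (at x within V Int U) f" using x by (simp add: continuous_on_eq_continuous_within)
  moreover have "at x within V = at x within V Int U" using U by (intro at_within_nhd[of x U]) auto
  ultimately show ?thesis by simp
 qed
 hence "continuous_on V f" by (simp add: continuous_on_eq_continuous_within)
 thus ?case using Ck_on_0_iff[OF V] by blast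
next
 case (Suc k)
 have 1: "Ck_on k n V f" using Suc.IH Suc.prems Ck_on_SucD by metis
 have 0: "EX W. oES n W & x : W & has_pd i f (pd i f x) x
   & Ck_on k n W (pd i f)" if i: "i<n" and x: "x : V" for i x
 proof -
  obtain W where W: "oES n W" "x : W" "Ck_on (Suc k) n W f" using Suc.prems[OF x] by metis
  thus ?thesis using i unfolding Ck_on_Suc_iff by (intro exI[of _ W]) simp
 qed
 have 2: "has_pd i f (pd i f x) x" if "i<n" "x : V" for i x using 0[OF that] by metis
 have 3: "Ck_on k n V (pd i f)" if "i<n" for i by (rule Suc.IH) (use 0[OF that] in metis)
 show ?case unfolding Ck_on_Suc_iff using Ck_on_imp_cont[OF 1] 2 3 by simp
qed

lemma Ck_on_const: "oES n V ==> Ck_on k n V (%x. c)"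
proof (induction k arbitrary: c)
 case 0 thus ?case by (simp only: Ck_on_0_iff) simp
next
 case (Suc k)
 show ?case by (rule Ck_on_SucI[where f'="%i x. 0"]) (auto simp: Suc has_pd_def)
qed

lemma Ck_on_coord: "oES n V ==> Ck_on k n V (%x. x j)"
proof (cases k)
 case 0
 moreover assume "oES n V"
 ultimately show ?thesis by (simp only: Ck_on_0_iff) (metis continuous_on_product_coordinates continuous_on_subset subset_UNIV)
next
 case (Suc k')
 assume V: "oES n V"
 have "has_pd i (%x. x j) (dl i j) x" for i x by (auto simp: has_pd_def)
 thus ?thesis unfolding Suc by (intro Ck_on_SucI[where f'="%i x. if i = j then 1 else 0"])
    (auto intro: Ck_on_const V continuous_on_subset[OF continuous_on_product_coordinates])
qed

lemma has_pd_add: "has_pd i f D x ==> has_pd i g E x ==> has_pd i (%x. f x + g x) (D + E) x"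
 unfolding has_pd_def by (rule has_vector_derivative_add)

lemma has_pd_linear: "bounded_linear L ==> has_pd i f D x ==> has_pd i (%x. L (f x)) (L D) x"
 unfolding has_pd_def by (rule bounded_linear.has_vector_derivative)

lemma has_pd_bilinear:
 "bounded_bilinear B ==> has_pd i f D x ==> has_pd i g E x ==>
  has_pd i (%x. B (f x) (g x)) (B (f x) E + B D (g x)) x"
 unfolding has_pd_def by (drule (2) bounded_bilinear.has_vector_derivative) simp

lemma Ck_on_add:
 "oES n V ==> Ck_on k n V f ==> Ck_on k n V g ==> Ck_on k n V (%x. f x + g x)"
proof (induction k arbitrary: f g)
 case 0 thus ?case by (simp only: Ck_on_0_iff) (rule continuous_on_add)
next
 case (Suc k)
 have "continuous_on V f" "continuous_on V g"  using Suc.prems Ck_on_imp_cont Ck_on_0_iff by metis+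
 with Suc show ?case by (intro Ck_on_SucI[where f'="%i x. pd i f x + pd i g x"])
    (auto simp: Ck_on_Suc_iff intro: continuous_on_add has_pd_add)
qed

lemma Ck_on_linear:
 assumes "bounded_linear L"
 shows "oES n V ==> Ck_on k n V f ==> Ck_on k n V (%x. L (f x))"
proof (induction k arbitrary: f)
 case 0 thus ?case by (simp only: Ck_on_0_iff) (rule bounded_linear.continuous_on[OF assms])
next
 case (Suc k)
 have "continuous_on V f" using Suc.prems Ck_on_imp_cont Ck_on_0_iff by metis+
 with Suc show ?case by (intro Ck_on_SucI[where f'="%i x. L (pd i f x)"])
    (auto simp: Ck_on_Suc_iff intro: bounded_linear.continuous_on[OF assms] has_pd_linear[OF assms])
qed

lemma Ck_on_bilinear:
 assumes B: "bounded_bilinear B"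
 shows "oES n V ==> Ck_on k n V f ==> Ck_on k n V g ==> Ck_on k n V (%x. B (f x) (g x))"
proof (induction k arbitrary: f g)
 case 0 thus ?case by (simp only: Ck_on_0_iff) (rule bounded_bilinear.continuous_on[OF B])
next
 case (Suc k)
 have c: "continuous_on V f" "continuous_on V g"  using Suc.prems Ck_on_imp_cont Ck_on_0_iff by metis+
 have "Ck_on k n V f" "Ck_on k n V g" using Suc.prems Ck_on_SucD by blast+
 with Suc c show ?case
  by (intro Ck_on_SucI[where f'="%i x. B (f x) (pd i g x) + B (pd i f x) (g x)"] Ck_on_add)
    (auto simp: Ck_on_Suc_iff intro!: bounded_bilinear.continuous_on[OF B] has_pd_bilinear[OF B])
qed

lemma smooth_on_iff_step:
 "smooth_on n V f <-> Ck_on 0 n V f &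
   (ALL i<n. (ALL x:V. has_pd i f (pd i f x) x) & smooth_on n V (pd i f))"
proof -
 have "smooth_on n V f <-> (ALL k. Ck_on (Suc k) n V f)"
  unfolding smooth_on_def using Ck_on_SucD by blast
 thus ?thesis unfolding smooth_on_def Ck_on_Suc_iff by blast
qed

lemma smooth_on_has_pd: "smooth_on n V f ==> i<n ==> x : V ==> has_pd i f (pd i f x) x"
 and smooth_on_partial_deriv: "smooth_on n V f ==> i<n ==> smooth_on n V (pd i f)"
 using smooth_on_iff_step by blast+

lemma smooth_on_continuous: "oES n V ==> smooth_on n V f ==> continuous_on V f"
 using smooth_on_iff_step Ck_on_0_iff by blast

lemma smooth_on_cong:
 "oES n V ==> (!!y. y : V ==> f y = g y) ==> smooth_on n V f <-> smooth_on n V g"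
 unfolding smooth_on_def using Ck_on_cong by blast

lemma smooth_on_subset:
 "oES n V ==> oES n W ==> W <= V ==> smooth_on n V f ==> smooth_on n W f"
 unfolding smooth_on_def using Ck_on_subset by blast

lemma smooth_on_local:
 assumes "oES n V"
  and "!!x. x : V ==> EX W. oES n W & x : W & smooth_on n W f"
 shows "smooth_on n V f"
proof -
 have "Ck_on k n V f" for k by (rule Ck_on_local[OF assms(1)]) (use assms(2) smooth_on_def in metis)
 thus ?thesis by (simp add: smooth_on_def)
qed

lemma smooth_on_const: "oES n V ==> smooth_on n V (%x. c)"
 by (simp add: smooth_on_def Ck_on_const)

lemma smooth_on_coord: "oES n V ==> smooth_on n V (%x. x j)"
 by (simp add: smooth_on_def Ck_on_coord)

lemma smooth_on_add:
 "oES n V ==> smooth_on n V f ==> smooth_on n V g ==> smooth_on n V (%x. f x + g x)"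
 by (simp add: smooth_on_def Ck_on_add)

lemma smooth_on_mult:
 fixes f g :: "_ => 'a::real_normed_algebra"
 shows "oES n V ==> smooth_on n V f ==> smooth_on n V g ==> smooth_on n V (%x. f x * g x)"
 by (simp add: smooth_on_def Ck_on_bilinear bounded_bilinear_mult)

lemma smooth_on_linear:
 "oES n V ==> bounded_linear L ==> smooth_on n V f ==> smooth_on n V (%x. L (f x))"
 by (simp add: smooth_on_def Ck_on_linear)

lemma smooth_on_of_real:
 "oES n V ==> smooth_on n V f ==>
  smooth_on n V (%x. of_real (f x) :: 'a::{real_normed_algebra_1,real_inner})"
 by (intro smooth_on_linear[where L=of_real] bounded_linear_of_real)

lemma smooth_on_uminus: "oES n V ==> smooth_on n V f ==> smooth_on n V (%x. - f x)"
 by (intro smooth_on_linear[where L=uminus] bounded_linear_minus bounded_linear_ident)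

lemma smooth_on_diff:
 "oES n V ==> smooth_on n V f ==> smooth_on n V g ==> smooth_on n V (%x. f x - g x)"
 using smooth_on_add[of n V f "%x. - g x"] smooth_on_uminus by fastforce

lemma smooth_on_sum:
 "oES n V ==> (!!i. i : I ==> smooth_on n V (f i)) ==> smooth_on n V (%x. SUM i:I. f i x)"
 by (induction I rule: infinite_finite_induct) (auto intro: smooth_on_const smooth_on_add)

lemma smooth_on_prod:
 fixes f :: "_ => _ => 'a::{real_normed_algebra_1,comm_ring_1}"
 shows "oES n V ==> (!!i. i : I ==> smooth_on n V (f i)) ==> smooth_on n V (%x. PROD i:I. f i x)"
 by (induction I rule: infinite_finite_induct) (auto intro: smooth_on_const smooth_on_mult)

lemma partial_deriv_const [simp]: "pd i (%x. c) x = 0" by (simp add: partial_deriv_def)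

lemma partial_deriv_coord: "pd i (%x. x j) x = dl i j"
 by (intro has_pd_imp_eq) (auto simp: has_pd_def)

context
 fixes n :: nat and V x i
 assumes V: "oES n V" and x: "x : V" and i: "i<n"
begin

lemma partial_deriv_add:
 "smooth_on n V f ==> smooth_on n V g ==> pd i (%x. f x + g x) x = pd i f x + pd i g x"
 by (rule has_pd_imp_eq, rule has_pd_add) (auto intro: smooth_on_has_pd x i)

lemma partial_deriv_linear:
 "bounded_linear L ==> smooth_on n V f ==> pd i (%x. L (f x)) x = L (pd i f x)"
 by (rule has_pd_imp_eq, erule has_pd_linear) (auto intro: smooth_on_has_pd x i)

lemma partial_deriv_mult:
 fixes f g :: "_ => 'a::real_normed_algebra"
 shows "smooth_on n V f ==> smooth_on n V g ==>
  pd i (%x. f x * g x) x = f x * pd i g x + pd i f x * g x"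
 by (rule has_pd_imp_eq, rule has_pd_bilinear[OF bounded_bilinear_mult]) (auto intro: smooth_on_has_pd x i)

lemma partial_deriv_uminus: "smooth_on n V f ==> pd i (%x. - f x) x = - pd i f x"
 by (intro partial_deriv_linear bounded_linear_minus bounded_linear_ident)

lemma partial_deriv_diff:
 "smooth_on n V f ==> smooth_on n V g ==> pd i (%x. f x - g x) x = pd i f x - pd i g x"
 using partial_deriv_add[of f "%x. - g x"] partial_deriv_uminus[of g] smooth_on_uminus[OF V, of g] by simp

lemma partial_deriv_of_real:
 "smooth_on n V f ==> pd i (%x. of_real (f x) :: 'a::{real_normed_algebra_1,real_inner}) x
   = of_real (pd i f x)" by (intro partial_deriv_linear[where L=of_real] bounded_linear_of_real)

lemma partial_deriv_sum:
 "(!!j. j : J ==> smooth_on n V (f j)) ==> pd i (%x. SUM j:J. f j x) x = (SUM j:J. pd i (f j) x)"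
proof (induction J rule: infinite_finite_induct)
 case (insert j J)
 have "pd i (%x. f j x + (SUM j:J. f j x)) x = pd i (f j) x + pd i (%x. SUM j:J. f j x) x"
  by (intro partial_deriv_add smooth_on_sum V insert.prems) simp_all
 moreover have "pd i (%x. SUM j:J. f j x) x = (SUM j:J. pd i (f j) x)"
  by (intro insert.IH insert.prems) simp
 ultimately show ?case using insert.hyps by simp
next
 case (infinite J) show ?case using infinite(1) by simp
next
 case empty show ?case by simp
qed

end

subsection \<open>The chain rule and the symmetry of second derivatives\<close>

text \<open>Mean value inequality for \<open>f t - t *\<^sub>R L\<close>, whose derivative is
  bounded by \<open>B\<close>.\<close>

lemma vector_derivative_mvt_bound:
 fixes f :: "real => 'b::real_normed_vector"
 assumes d: "!!t. t : closed_segment a b ==> (f has_vector_derivative f' t) (at t)"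
  and B: "!!t. t : closed_segment a b ==> norm (f' t - L) <= B"
 shows "norm (f b - f a - (b - a) *\<^sub>R L) <= B * \<bar>b - a\<bar>"
proof -
 let ?g = "%t. f t - t *\<^sub>R L"
 have "norm (?g b - ?g a) <= B * norm (b - a)"
 proof (rule differentiable_bound[OF convex_closed_segment])
  fix t assume t: "t : closed_segment a b"
  have "(?g has_vector_derivative (f' t - L)) (at t)" by (auto intro!: derivative_eq_intros d[OF t])
  thus "(?g has_derivative (%h. h *\<^sub>R (f' t - L))) (at t within closed_segment a b)"
   using has_vector_derivative_at_within has_vector_derivative_def by blast
  show "onorm (%h. h *\<^sub>R (f' t - L)) <= B"
   using B[OF t] by (intro onorm_le) (simp add: mult.commute[of B] mult_left_mono)
 qed auto
 thus ?thesis by (simp add: algebra_simps)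
qed

lemma continuous_on_ES_box:
 assumes V: "oES n V" and x: "x : V" and g: "continuous_on V g" and e: "e > 0"
 obtains d where "d > 0"
  "!!y. (!!i. i >= n ==> y i = 0) ==> (!!i. i<n ==> \<bar>y i - x i\<bar> <= d) ==> y : V & norm (g y - g x) <= e"
proof -
 have "openin (top_of_set V) (V Int g -` ball (g x) e)"
  by (rule continuous_openin_preimage_gen[OF g]) simp
 hence "oES n (V Int g -` ball (g x) e)"
  using V subtopology_ES[OF openin_ES_subset[OF V]] openin_trans_full by metis
 moreover have "x : V Int g -` ball (g x) e" using x e by simp
 ultimately obtain d where d: "d > 0" "!!y. (!!i. i >= n ==> y i = 0) ==> (!!i. i<n ==> \<bar>y i - x i\<bar> <= d)
   ==> y : V Int g -` ball (g x) e" using openin_ES_box by metis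
 have "y : V & norm (g y - g x) <= e" if "!!i. i >= n ==> y i = 0" "!!i. i<n ==> \<bar>y i - x i\<bar> <= d" for y
  using d(2)[OF that] by (simp add: dist_norm norm_minus_commute)
 thus ?thesis using that d(1) by blast
qed

lemma continuous_on_ES_box_finite:
 assumes V: "oES n V" and x: "x : V" and e: "e > 0"
  and g: "!!l::nat. l<m ==> continuous_on V (g l)" 
 obtains d where "d > 0"
  "!!y. (!!i. i >= n ==> y i = 0) ==> (!!i. i<n ==> \<bar>y i - x i\<bar> <= d) ==> y : V"
  "!!y l. l<m ==> (!!i. i >= n ==> y i = 0) ==> (!!i. i<n ==> \<bar>y i - x i\<bar> <= d) ==> norm (g l y - g l x) <= e"
proof -
 have "EX d>0. ALL y. (ALL i>=n. y i = 0) --> (ALL i<n. \<bar>y i - x i\<bar> <= d) --> y : V & (ALL l<m. norm (g l y - g l x) <= e)"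
  using g
 proof (induction m)
  case 0
  obtain d where "d > 0" "!!y. (!!i. i >= n ==> y i = 0) ==> (!!i. i<n ==> \<bar>y i - x i\<bar> <= d) ==> y : V"
   using openin_ES_box[OF V x] by metis
  thus ?case by auto
 next
  case (Suc m)
  then obtain d where d: "d > 0" "!!y. (ALL i>=n. y i = 0) ==> (ALL i<n. \<bar>y i - x i\<bar> <= d) ==>
    y : V & (ALL l<m. norm (g l y - g l x) <= e)" by auto
  obtain d' where d': "d' > 0" "!!y. (!!i. i >= n ==> y i = 0) ==> (!!i. i<n ==> \<bar>y i - x i\<bar> <= d') ==>
    y : V & norm (g m y - g m x) <= e"
   using continuous_on_ES_box[OF V x Suc.prems[of m] e] by auto
  show ?case using d d' by (intro exI[of _ "min d d'"]) (auto simp: less_Suc_eq)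
 qed
 thus ?thesis using that by auto
qed

text \<open>Hadamard's form of differentiability: no Frechet derivative on \<open>nat \<Rightarrow> real\<close> is needed, since
  the chain rule and the derivative of an inverse map both follow from such a factorization.\<close>

lemma hadamard:
 fixes f :: "pt => 'b::real_normed_vector"
 assumes V: "oES n V" and x0: "x0 : V"
  and pd: "!!x l. x : V ==> l<n ==> has_pd l f (f' l x) x"
  and cont: "!!l. l<n ==> continuous_on V (f' l)"
  and c: "eventually (%t. ALL i>=n. c t i = 0) F" "!!i. i<n ==> ((%t. c t i) \<longlongrightarrow> x0 i) F"
 obtains B where "eventually (%t. f (c t) - f x0 = (SUM l<n. (c t l - x0 l) *\<^sub>R B l t)) F"
  "!!l. l<n ==> ((%t. B l t) \<longlongrightarrow> f' l x0) F"
proof -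
 \<comment> \<open>The first \<open>l\<close> coordinates come from \<open>x\<close>, the others
   from \<open>x0\<close>. Increasing \<open>l\<close> by one moves along a single coordinate, so
   partial derivatives suffice and the differences telescope.\<close>
 define mix where "mix l x = (%i. if i<l then x i else x0 i)" for l :: nat and x
 \<comment> \<open>Difference quotient in direction \<open>l\<close>; where it is undefined, the
   expected limit is inserted.\<close>
 define A where "A l x = (if x l = x0 l then f' l x0 else (f (mix (Suc l) x) - f (mix l x)) /\<^sub>R (x l - x0 l))" for l x
 have x00: "x0 i = 0" if "i >= n" for i using openin_ES_subset[OF V] x0 that by auto
 have mixS: "mix (Suc l) x = (mix l x)(l := x l)" and mix0: "mix l x = (mix l x)(l := x0 l)" for l x
  by (auto simp: mix_def fun_eq_iff)
 have A: "(x l - x0 l) *\<^sub>R A l x = f (mix (Suc l) x) - f (mix l x)" for l x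
 proof (cases "x l = x0 l")
  case True
  hence "mix (Suc l) x = mix l x" using mixS[of l x] mix0[of l x] by simp
  thus ?thesis using True by simp
 qed (simp add: A_def)
 have tele: "(SUM l<m. f (mix (Suc l) x) - f (mix l x)) = f (mix m x) - f (mix 0 x)" for x m
  by (rule sum_lessThan_telescope)
 have mixn: "mix n x = x" if "ALL i>=n. x i = 0" for x
  using that x00 by (auto simp: mix_def fun_eq_iff not_less)
 have eq: "f x - f x0 = (SUM l<n. (x l - x0 l) *\<^sub>R A l x)" if "ALL i>=n. x i = 0" for x
  using tele[of x n] mixn[OF that] by (simp add: A) (simp add: mix_def)
 have bound: "norm (A l x - f' l x0) <= e"
  if l: "l<n" and e: "e > 0" and d: "d > 0" 
   and V': "!!y. (!!i. i >= n ==> y i = 0) ==> (!!i. i<n ==> \<bar>y i - x0 i\<bar> <= d) ==> y : V"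
   and b: "!!y. (!!i. i >= n ==> y i = 0) ==> (!!i. i<n ==> \<bar>y i - x0 i\<bar> <= d) ==> norm (f' l y - f' l x0) <= e"
   and x: "ALL i>=n. x i = 0" "ALL i<n. \<bar>x i - x0 i\<bar> <= d" for l x e d
 proof (cases "x l = x0 l")
  case True thus ?thesis using e by (simp add: A_def)
 next
  case False
  have seg: "\<bar>s - x0 l\<bar> <= d" if "s : closed_segment (x0 l) (x l)" for s
   using that x(2) l by (auto simp: closed_segment_eq_real_ivl split: if_splits)
  have box: "((mix l x)(l := s)) i = 0" if "i >= n" for i s using that l x00 by (auto simp: mix_def)
  have box2: "\<bar>((mix l x)(l := s)) i - x0 i\<bar> <= d" if "s : closed_segment (x0 l) (x l)" "i<n" for i s
   using seg[OF that(1)] x(2) that(2) d by (auto simp: mix_def)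
  have "norm (f ((mix l x)(l := x l)) - f ((mix l x)(l := x0 l)) - (x l - x0 l) *\<^sub>R f' l x0) <= e * \<bar>x l - x0 l\<bar>"
  proof (rule vector_derivative_mvt_bound)
   fix s assume s: "s : closed_segment (x0 l) (x l)"
   have "(mix l x)(l := s) : V" using box box2[OF s] V' by blast
   from pd[OF this l] show "((%s. f ((mix l x)(l := s))) has_vector_derivative f' l ((mix l x)(l := s))) (at s)"
    by (simp add: has_pd_def)
   show "norm (f' l ((mix l x)(l := s)) - f' l x0) <= e" using box box2[OF s] b by blast
  qed
  hence "norm ((x l - x0 l) *\<^sub>R A l x - (x l - x0 l) *\<^sub>R f' l x0) <= e * \<bar>x l - x0 l\<bar>"
   unfolding A mixS[symmetric] mix0[symmetric] .
  hence "\<bar>x l - x0 l\<bar> * norm (A l x - f' l x0) <= \<bar>x l - x0 l\<bar> * e"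
   by (simp add: scaleR_right_diff_distrib[symmetric] mult.commute)
  thus ?thesis using False by simp
 qed
 have small: "EX d>0. ALL x. (ALL i>=n. x i = 0) --> (ALL i<n. \<bar>x i - x0 i\<bar> <= d) --> norm (A l x - f' l x0) <= e"
  if l: "l<n" and e: "e > 0" for l e
 proof -
  obtain d where d: "d > 0"
   "!!y. (!!i. i >= n ==> y i = 0) ==> (!!i. i<n ==> \<bar>y i - x0 i\<bar> <= d) ==> y : V & norm (f' l y - f' l x0) <= e"
   using continuous_on_ES_box[OF V x0 cont[OF l] e] by blast
  show ?thesis using bound[OF l e d(1)] d by (intro exI[of _ d]) auto
 qed
 have "eventually (%t. f (c t) - f x0 = (SUM l<n. (c t l - x0 l) *\<^sub>R A l (c t))) F"
  using c(1) by eventually_elim (rule eq)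
 moreover have "((%t. A l (c t)) \<longlongrightarrow> f' l x0) F" if l: "l<n" for l
  proof (rule tendstoI)
   fix e :: real assume "e > 0"
   then obtain d where d: "d > 0" "!!x. (ALL i>=n. x i = 0) ==> (ALL i<n. \<bar>x i - x0 i\<bar> <= d) ==> norm (A l x - f' l x0) <= e/2"
    using small[OF l, of "e/2"] by auto
   have "eventually (%t. ALL i:{..<n}. dist (c t i) (x0 i)<d) F"
    by (intro eventually_ball_finite finite_lessThan ballI tendstoD[OF c(2)] d(1)) simp
   with c(1) show "eventually (%t. dist (A l (c t)) (f' l x0)<e) F"
   proof eventually_elim
    case (elim t)
    hence "norm (A l (c t) - f' l x0) <= e/2"
     by (intro d(2)) (auto simp: dist_real_def intro: less_imp_le)
    thus ?case using \<open>e > 0\<close> by (simp add: dist_norm)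
   qed
  qed
 ultimately show ?thesis by (rule that[of "%l t. A l (c t)"])
qed

lemma has_vector_derivative_iff_quotient:
 "(f has_vector_derivative D) (at t0) <-> ((%t. (f t - f t0) /\<^sub>R (t - t0)) \<longlongrightarrow> D) (at t0)"
proof -
 have "(f has_vector_derivative D) (at t0) <->
  ((%y. norm ((f y - f t0) - (y - t0) *\<^sub>R D) / norm (y - t0)) \<longlongrightarrow> 0) (at t0)"
  unfolding has_vector_derivative_def has_derivative_iff_norm by (simp add: bounded_linear_scaleR_left)
 also have "... <-> ((%t. norm ((f t - f t0) /\<^sub>R (t - t0) - D)) \<longlongrightarrow> 0) (at t0)"
 proof (rule filterlim_cong[OF refl refl])
  have "norm ((f y - f t0) - (y - t0) *\<^sub>R D) / norm (y - t0) = norm ((f y - f t0) /\<^sub>R (y - t0) - D)" if "y ~= t0" for y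
  proof -
   have "(f y - f t0) /\<^sub>R (y - t0) - D = ((f y - f t0) - (y - t0) *\<^sub>R D) /\<^sub>R (y - t0)"
    using that by (simp add: scaleR_right_diff_distrib)
   thus ?thesis by (simp add: divide_inverse mult.commute)
  qed
  thus "eventually (%y. norm ((f y - f t0) - (y - t0) *\<^sub>R D) / norm (y - t0) = norm ((f y - f t0) /\<^sub>R (y - t0) - D)) (at t0)"
   by (auto simp: eventually_at_filter)
 qed
 also have "... <-> ((%t. (f t - f t0) /\<^sub>R (t - t0)) \<longlongrightarrow> D) (at t0)"
  by (simp add: tendsto_norm_zero_iff LIM_zero_iff)
 finally show ?thesis .
qed

lemma chain_rule_curve:
 fixes f :: "pt => 'b::real_normed_vector"
 assumes V: "oES n V" and x0: "c t0 : V"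
  and pd: "!!x l. x : V ==> l<n ==> has_pd l f (f' l x) x"
  and cont: "!!l. l<n ==> continuous_on V (f' l)"
  and c: "eventually (%t. ALL i>=n. c t i = 0) (at t0)" "!!i. i<n ==> ((%t. c t i) has_real_derivative c' i) (at t0)"
 shows "((%t. f (c t)) has_vector_derivative (SUM l<n. c' l *\<^sub>R f' l (c t0))) (at t0)"
proof -
 have lim: "((%t. c t i) \<longlongrightarrow> c t0 i) (at t0)" if "i<n" for i
  using DERIV_isCont[OF c(2)[OF that]] by (simp add: isCont_def)
 have q: "((%t. (c t i - c t0 i) / (t - t0)) \<longlongrightarrow> c' i) (at t0)" if "i<n" for i
  using c(2)[OF that] by (simp add: has_field_derivative_iff)
 obtain A where A: "eventually (%t. f (c t) - f (c t0) = (SUM l<n. (c t l - c t0 l) *\<^sub>R A l t)) (at t0)"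
   "!!l. l<n ==> ((%t. A l t) \<longlongrightarrow> f' l (c t0)) (at t0)"
  using hadamard[where f=f and f'=f' and c=c and F="at t0", OF V x0 pd cont c(1) lim] by blast
 have "((%t. SUM l<n. ((c t l - c t0 l) / (t - t0)) *\<^sub>R A l t) \<longlongrightarrow> (SUM l<n. c' l *\<^sub>R f' l (c t0))) (at t0)"
  by (intro tendsto_sum tendsto_scaleR A(2) q) simp_all
 moreover have "eventually (%t. (SUM l<n. ((c t l - c t0 l) / (t - t0)) *\<^sub>R A l t) = (f (c t) - f (c t0)) /\<^sub>R (t - t0)) (at t0)"
  using A(1) by eventually_elim (simp add: scaleR_sum_right divide_inverse mult.commute)
 ultimately show ?thesis unfolding has_vector_derivative_iff_quotient by (rule Lim_transform_eventually)
qed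

lemma has_pd_compose:
 fixes f :: "pt => 'b::real_normed_vector"
 assumes V: "oES n V" and W: "oES m W"
  and x0: "x0 : W" and i: "i<m" and p: "!!x. x : W ==> ff x : V"
  and pd: "!!x l. x : V ==> l<n ==> has_pd l f (f' l x) x"
  and cont: "!!l. l<n ==> continuous_on V (f' l)"
  and c: "!!l. l<n ==> has_pd i (%x. ff x l) (J l) x0"
 shows "has_pd i (%x. f (ff x)) (SUM l<n. J l *\<^sub>R f' l (ff x0)) x0"
proof -
 have "((%t. f (ff (x0(i := t)))) has_vector_derivative (SUM l<n. J l *\<^sub>R f' l (ff (x0(i := x0 i))))) (at (x0 i))"
 proof (rule chain_rule_curve[OF V _ pd cont])
  show "ff (x0(i := x0 i)) : V" using p x0 by simp
  have "eventually (%t. x0(i := t) : W) (at (x0 i))"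
   using openin_ES_update[OF W x0 i] eventually_nhds_conv_at by blast
  thus "eventually (%t. ALL l>=n. ff (x0(i := t)) l = 0) (at (x0 i))"
   by eventually_elim (use p openin_ES_subset[OF V] in auto)
  show "((%t. ff (x0(i := t)) l) has_real_derivative J l) (at (x0 i))" if "l<n" for l
   using c[OF that] by (simp add: has_pd_def has_real_derivative_iff_has_vector_derivative)
 qed
 thus ?thesis by (simp add: has_pd_def)
qed

lemma continuous_on_ES_map:
 fixes ff :: "'a::topological_space => pt"
 assumes "!!x. x : W ==> ff x : V" "V <= {x. ALL i>=n. x i = 0}" "!!l. l<n ==> continuous_on W (%x. ff x l)"
 shows "continuous_on W ff"
proof (rule continuous_on_coordinatewise_then_product)
 fix l
 show "continuous_on W (%x. ff x l)"
 proof (cases "l<n")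
  case True thus ?thesis by (rule assms(3))
 next
  case False
  hence "ff x l = 0" if "x : W" for x using subsetD[OF assms(2) assms(1)[OF that]] by simp
  hence "continuous_on W (%x. ff x l) <-> continuous_on W (%x. 0::real)"
   by (intro continuous_on_cong) auto
  thus ?thesis by simp
 qed
qed

lemma Ck_on_compose:
 fixes f :: "pt => 'b::real_normed_vector"
 assumes V: "oES n V" and W: "oES m W"
  and p: "!!x. x : W ==> ff x : V"
 shows "Ck_on k n V f ==> (!!l. l<n ==> Ck_on k m W (%x. ff x l)) ==> Ck_on k m W (%x. f (ff x))"
proof (induction k arbitrary: f)
 have c0: "continuous_on W (%x. f (ff x))" if "continuous_on V f" "!!l. l<n ==> continuous_on W (%x. ff x l)"
  for f :: "pt => 'b"
  by (rule continuous_on_compose2[OF that(1) continuous_on_ES_map[OF p openin_ES_subset[OF V] that(2)]])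
    (use p in auto)
 {
  case 0
  thus ?case using c0 unfolding Ck_on_0_iff[OF V] Ck_on_0_iff[OF W] by simp
 next
  case (Suc k)
  have pf: "!!x l. x : V ==> l<n ==> has_pd l f (pd l f x) x" "!!l. l<n ==> Ck_on k n V (pd l f)"
   using Suc.prems(1) unfolding Ck_on_Suc_iff by simp_all
  have pp: "!!x l i. x : W ==> l<n ==> i<m ==> has_pd i (%x. ff x l) (jc ff i l x) x"
    "!!l i. l<n ==> i<m ==> Ck_on k m W (pd i (%x. ff x l))"
   using Suc.prems(2) unfolding Ck_on_Suc_iff by simp_all
  have cf: "!!l. l<n ==> continuous_on V (pd l f)"
   using pf(2) Ck_on_imp_cont Ck_on_0_iff[OF V] by metis
  have IH: "Ck_on k m W (%x. pd l f (ff x))" if "l<n" for l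
   by (rule Suc.IH[OF pf(2)[OF that]]) (rule Ck_on_SucD[OF Suc.prems(2)])
  have sum: "Ck_on k m W (%x. SUM l:I. jc ff i l x *\<^sub>R pd l f (ff x))" 
   if "i<m" "finite I" "I <= {..<n}" for i I using that(2,3)
  proof (induction I rule: finite_induct)
   case empty thus ?case by (simp add: Ck_on_const[OF W])
  next
   case (insert l I)
   hence "Ck_on k m W (%x. jc ff i l x *\<^sub>R pd l f (ff x))"
    by (intro Ck_on_bilinear[OF bounded_bilinear_scaleR W] pp(2) that(1) IH) auto
   with insert show ?case by (simp add: Ck_on_add[OF W])
  qed
  show ?case
  proof (rule Ck_on_SucI[OF W])
   show "continuous_on W (%x. f (ff x))"
    by (rule c0) (use Suc.prems Ck_on_imp_cont Ck_on_0_iff[OF V] Ck_on_0_iff[OF W] in metis)+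
   show "has_pd i (%x. f (ff x)) (SUM l<n. jc ff i l x *\<^sub>R pd l f (ff x)) x"
    if "i<m" "x : W" for i x
    by (rule has_pd_compose[OF V W that(2,1) p pf(1) cf pp(1)[OF that(2) _ that(1)]])
   show "Ck_on k m W (%x. SUM l<n. jc ff i l x *\<^sub>R pd l f (ff x))" if "i<m" for i
    using sum[OF that] by simp
  qed
 }
qed

lemma smooth_on_compose:
 fixes f :: "pt => 'b::real_normed_vector"
 assumes V: "oES n V" and W: "oES m W"
  and p: "!!x. x : W ==> ff x : V"
 shows "smooth_on n V f ==> (!!l. l<n ==> smooth_on m W (%x. ff x l)) ==> smooth_on m W (%x. f (ff x))"
 unfolding smooth_on_def by (intro allI, rule Ck_on_compose[OF V W p]) simp_all

lemma partial_deriv_compose: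
 fixes f :: "pt => 'b::real_normed_vector"
 assumes V: "oES n V" and W: "oES m W"
  and p: "!!x. x : W ==> ff x : V" and x: "x : W" "i<m"
  and f: "smooth_on n V f" and ph: "!!l. l<n ==> smooth_on m W (%x. ff x l)"
 shows "pd i (%x. f (ff x)) x = (SUM l<n. jc ff i l x *\<^sub>R pd l f (ff x))"
 by (rule has_pd_imp_eq, rule has_pd_compose[OF V W x p])
   (auto intro: smooth_on_has_pd[OF f] smooth_on_has_pd[OF ph] x smooth_on_continuous[OF V] smooth_on_partial_deriv f)

text \<open>Mean value inequality in each variable in turn: the second difference over a square of
  side \<open>h\<close> is \<open>h * h\<close> times the mixed derivative, up to the oscillation of
  the latter.\<close>

lemma second_difference_bound:
 fixes f :: "pt => 'b::real_normed_vector" and x h and i j :: nat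
 defines "P \<equiv> %a b. x(i := x i + a, j := x j + b)"
 assumes ij: "i ~= j" and h: "h > 0"
  and pd1: "!!a b. 0 <= a ==> a <= h ==> 0 <= b ==> b <= h ==> has_pd i f (f' (P a b)) (P a b)"
  and pd2: "!!a b. 0 <= a ==> a <= h ==> 0 <= b ==> b <= h ==> has_pd j f' (f'' (P a b)) (P a b)"
  and e: "!!a b. 0 <= a ==> a <= h ==> 0 <= b ==> b <= h ==> norm (f'' (P a b) - L) <= e"
 shows "norm (f (P h h) - f (P h 0) - f (P 0 h) + f (P 0 0) - (h * h) *\<^sub>R L) <= e * h * h"
proof -
 have seg: "t : closed_segment 0 h <-> 0 <= t & t <= h" for t
  using h by (auto simp: closed_segment_eq_real_ivl)
 have d1: "((%a. f (P a b)) has_vector_derivative f' (P a b)) (at a)" if "0 <= a" "a <= h" "0 <= b" "b <= h" for a b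
 proof -
  have "((%t. f ((P a b)(i := t))) has_vector_derivative f' (P a b)) (at (x i + a))"
   using pd1[OF that] ij by (simp add: has_pd_def P_def)
  moreover have "(%a. f (P a b)) = (%t. f ((P a b)(i := t))) o (%a. x i + a)"
   using ij by (auto simp: P_def fun_eq_iff intro!: arg_cong[of _ _ f])
  moreover have "((%a. x i + a) has_vector_derivative 1) (at a)"
   by (auto intro!: derivative_eq_intros)
  ultimately show ?thesis using vector_diff_chain_at[of "%a. x i + a" 1 a] by fastforce
 qed
 have d2: "((%b. f' (P a b)) has_vector_derivative f'' (P a b)) (at b)" if "0 <= a" "a <= h" "0 <= b" "b <= h" for a b
 proof -
  have "((%t. f' ((P a b)(j := t))) has_vector_derivative f'' (P a b)) (at (x j + b))"
   using pd2[OF that] ij by (simp add: has_pd_def P_def)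
  moreover have "(%b. f' (P a b)) = (%t. f' ((P a b)(j := t))) o (%b. x j + b)"
   using ij by (auto simp: P_def fun_eq_iff intro!: arg_cong[of _ _ f'])
  moreover have "((%b. x j + b) has_vector_derivative 1) (at b)"
   by (auto intro!: derivative_eq_intros)
  ultimately show ?thesis using vector_diff_chain_at[of "%a. x j + a" 1 b] by fastforce
 qed
 have inner: "norm ((f' (P a h) - f' (P a 0)) - h *\<^sub>R L) <= e * h" if "0 <= a" "a <= h" for a
  using vector_derivative_mvt_bound[of 0 h "%b. f' (P a b)" "%b. f'' (P a b)" L e] d2 e that h seg by simp
 have "norm ((f (P h h) - f (P h 0)) - (f (P 0 h) - f (P 0 0)) - (h - 0) *\<^sub>R (h *\<^sub>R L)) <= (e * h) * \<bar>h - 0\<bar>"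
 proof (rule vector_derivative_mvt_bound)
  fix a assume "a : closed_segment 0 h"
  hence a: "0 <= a" "a <= h" using seg by auto
  show "((%a. f (P a h) - f (P a 0)) has_vector_derivative (f' (P a h) - f' (P a 0))) (at a)"
   using h by (intro has_vector_derivative_diff d1 a) auto
  show "norm (f' (P a h) - f' (P a 0) - h *\<^sub>R L) <= e * h" by (rule inner[OF a])
 qed
 thus ?thesis using h by (simp add: algebra_simps)
qed

text \<open>Both mixed derivatives approximate the same second difference up to
  \<open>e/2 * d * d\<close>, so they differ by at most \<open>e\<close>.\<close>

lemma partial_deriv_commute:
 fixes f :: "pt => 'b::real_normed_vector"
 assumes V: "oES n V" and x: "x : V" and i: "i<n" and j: "j<n" and f: "smooth_on n V f"
 shows "pd i (pd j f) x = pd j (pd i f) x"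
proof (cases "i = j")
 case False
 let ?D = "%l m. pd l (pd m f)"
 have "norm (?D i j x - ?D j i x) <= e" if e: "e > 0" for e
 proof -
  define g where "g l = (if l = 0 then ?D i j else ?D j i)" for l :: nat
  have g: "continuous_on V (g l)" if "l<2" for l
   unfolding g_def by (auto intro!: smooth_on_continuous[OF V] smooth_on_partial_deriv f i j)
  obtain d where d: "d > 0"
   "!!y. (!!i. i >= n ==> y i = 0) ==> (!!i. i<n ==> \<bar>y i - x i\<bar> <= d) ==> y : V"
   "!!y l. l<2 ==> (!!i. i >= n ==> y i = 0) ==> (!!i. i<n ==> \<bar>y i - x i\<bar> <= d) ==> norm (g l y - g l x) <= e/2"
   using continuous_on_ES_box_finite[of n V x "e/2" 2 g, OF V x half_gt_zero[OF e] g] by blast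
  have x0: "x l = 0" if "l >= n" for l using openin_ES_subset[OF V] x that by auto
  define P where "P a b = x(i := x i + a, j := x j + b)" for a b
  have box: "P a b l = 0" if "l >= n" for a b l using that x0 i j by (auto simp: P_def)
  have box2: "\<bar>P a b l - x l\<bar> <= d" if "0 <= a" "a <= d" "0 <= b" "b <= d" for a b l
   using that d(1) by (auto simp: P_def)
  have PV: "P a b : V" if "0 <= a" "a <= d" "0 <= b" "b <= d" for a b
   using d(2) box box2[OF that] by blast
  have Pe: "norm (?D i j (P a b) - ?D i j x) <= e/2" "norm (?D j i (P a b) - ?D j i x) <= e/2"
   if "0 <= a" "a <= d" "0 <= b" "b <= d" for a b
   using d(3)[of 0 "P a b"] d(3)[of 1 "P a b"] box box2[OF that] by (simp_all add: g_def)
  let ?\<Delta> = "f (P d d) - f (P d 0) - f (P 0 d) + f (P 0 0)"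
  have 1: "norm (?\<Delta> - (d * d) *\<^sub>R ?D j i x) <= e/2 * d * d" unfolding P_def
   by (rule second_difference_bound[OF False d(1), where f'="pd i f" and f''="?D j i"])
     (use PV Pe in \<open>auto simp: P_def intro!: smooth_on_has_pd[OF f i] smooth_on_has_pd[OF smooth_on_partial_deriv[OF f i] j]\<close>)
  have P': "P a b = x(j := x j + b, i := x i + a)" for a b using False by (auto simp: P_def)
  have "norm (f (P d d) - f (P 0 d) - f (P d 0) + f (P 0 0) - (d * d) *\<^sub>R ?D i j x) <= e/2 * d * d"
   unfolding P'
   by (rule second_difference_bound[OF not_sym[OF False] d(1), where f'="pd j f" and f''="?D i j"])
     (use PV Pe in \<open>auto simp: P' intro!: smooth_on_has_pd[OF f j] smooth_on_has_pd[OF smooth_on_partial_deriv[OF f j] i]\<close>)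
  hence 2: "norm (?\<Delta> - (d * d) *\<^sub>R ?D i j x) <= e/2 * d * d" by (simp add: algebra_simps)
  have "norm ((d * d) *\<^sub>R ?D i j x - (d * d) *\<^sub>R ?D j i x) <= e * d * d"
   using norm_triangle_ineq4[of "?\<Delta> - (d * d) *\<^sub>R ?D j i x" "?\<Delta> - (d * d) *\<^sub>R ?D i j x"] 1 2
   by (simp add: algebra_simps)
  hence "(d * d) * norm (?D i j x - ?D j i x) <= (d * d) * e"
   by (simp add: scaleR_right_diff_distrib[symmetric] mult_ac)
  thus ?thesis using d(1) by (simp add: mult_le_cancel_left_pos)
 qed
 hence "norm (?D i j x - ?D j i x) <= 0" by (rule field_le_epsilon) simp
 thus ?thesis by simp
qed simp

subsection \<open>Inverse maps, inverse matrices and cut-off functions\<close>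

text \<open>No bound on \<open>d\<close> is assumed. As soon as \<open>M\<close> is within 1/2 of
  the identity in the sum norm, \<open>S <= K + \<eta> * S\<close> bounds \<open>d\<close> by
  \<open>2 * K\<close>, and its error is then at most \<open>\<eta> * (2 * K)\<close>.\<close>

lemma tendsto_perturbed_identity:
 fixes M :: "nat => nat => 't => real"
 assumes M: "!!i l. i<n ==> l<n ==> (M i l \<longlongrightarrow> dl i l) F"
  and d: "!!i. i<n ==> eventually (%t. (SUM l<n. M i l t * d l t) = \<kappa> i) F" and i: "i<n"
 shows "(d i \<longlongrightarrow> \<kappa> i) F"
proof -
 define \<eta> where "\<eta> t = (SUM i<n. SUM l<n. \<bar>M i l t - dl i l\<bar>)" for t
 have "(\<eta> \<longlongrightarrow> (SUM i<n. SUM l<n. \<bar>dl i l - (if i = l then 1 else 0 :: real)\<bar>)) F"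
  unfolding \<eta>_def by (rule tendsto_sum)+ (rule tendsto_rabs[OF tendsto_diff[OF M tendsto_const]]; simp)
 hence \<eta>: "(\<eta> \<longlongrightarrow> 0) F" by simp
 define S where "S t = (SUM i<n. \<bar>d i t\<bar>)" for t
 define K where "K = (SUM i<n. \<bar>\<kappa> i\<bar>)"
 have "eventually (%t. ALL i:{..<n}. (SUM l<n. M i l t * d l t) = \<kappa> i) F"
  by (rule eventually_ball_finite) (simp_all add: d)
 moreover have "eventually (%t. dist (\<eta> t) 0<1/2) F" by (rule tendstoD[OF \<eta>]) simp
 ultimately have "eventually (%t. norm (d i t - \<kappa> i) <= norm (\<eta> t * (2 * K))) F"
 proof eventually_elim
  case (elim t)
  have diff: "\<bar>d i t - \<kappa> i\<bar> <= (SUM l<n. \<bar>M i l t - dl i l\<bar> * \<bar>d l t\<bar>)" if "i<n" for i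
  proof -
   have "d i t = (SUM l<n. dl i l * d l t)"
    using that by (simp add: if_distrib[of "%x. x * _"] cong: if_cong)
   hence "d i t - \<kappa> i = (SUM l<n. (dl i l - M i l t) * d l t)"
    using elim(1) that by (simp add: left_diff_distrib sum_subtractf)
   also have "\<bar>...\<bar> <= (SUM l<n. \<bar>(dl i l - M i l t) * d l t\<bar>)" by (rule sum_abs)
   finally show ?thesis by (simp add: abs_mult abs_minus_commute)
  qed
  have row: "(SUM l<n. \<bar>M i l t - dl i l\<bar> * \<bar>d l t\<bar>)
    <= (SUM l<n. \<bar>M i l t - dl i l\<bar>) * S t" if "i<n" for i
  proof -
   have "\<bar>d l t\<bar> <= S t" if "l<n" for l unfolding S_def
    using member_le_sum[of l "{..<n}" "%i. \<bar>d i t\<bar>"] that by simp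
   thus ?thesis unfolding sum_distrib_right by (intro sum_mono mult_left_mono) simp_all
  qed
  have S0: "0 <= S t" by (simp add: S_def sum_nonneg)
  have "S t <= (SUM i<n. \<bar>\<kappa> i\<bar> + (SUM l<n. \<bar>M i l t - dl i l\<bar>) * S t)"
   unfolding S_def[of t] 
  proof (rule sum_mono)
   fix i assume "i : {..<n}"
   hence "\<bar>d i t - \<kappa> i\<bar> <= (SUM l<n. \<bar>M i l t - dl i l\<bar>) * S t" 
    using order_trans[OF diff row] by simp
   thus "\<bar>d i t\<bar> <= \<bar>\<kappa> i\<bar> + (SUM l<n. \<bar>M i l t - dl i l\<bar>) * (SUM i<n. \<bar>d i t\<bar>)"
    unfolding S_def by linarith
  qed
  also have "... = K + \<eta> t * S t" by (simp add: K_def \<eta>_def sum.distrib sum_distrib_right)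
  finally have "S t <= K + \<eta> t * S t" .
  moreover have "\<eta> t >= 0" by (auto simp: \<eta>_def intro!: sum_nonneg)
  moreover have "\<eta> t * S t <= 1/2 * S t" using elim(2) S0 by (intro mult_right_mono) simp_all
  ultimately have S2: "S t <= 2 * K" by linarith
  have "\<bar>d i t - \<kappa> i\<bar> <= (SUM l<n. \<bar>M i l t - dl i l\<bar>) * S t"
   using order_trans[OF diff[OF i] row[OF i]] .
  also have "... <= \<eta> t * S t" unfolding \<eta>_def using i S0
   by (intro mult_right_mono member_le_sum[of i "{..<n}" "%i. SUM l<n. \<bar>M i l t - dl i l\<bar>"])
     (simp_all add: sum_nonneg)
  also have "... <= \<eta> t * (2 * K)" using S2 \<open>\<eta> t >= 0\<close> by (rule mult_left_mono)
  finally show ?case by simp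
 qed
 moreover have "((%t. \<eta> t * (2 * K)) \<longlongrightarrow> 0) F" using tendsto_mult_left_zero[OF \<eta>] .
 ultimately have "((%t. d i t - \<kappa> i) \<longlongrightarrow> 0) F" by (rule Lim_null_comparison[OF _ tendsto_norm_zero])
 thus ?thesis by (simp add: LIM_zero_iff)
qed

text \<open>The inverse is only known to be continuous. \<open>hadamard\<close> along the image of a
  coordinate line gives a linear system for the difference quotients of \<open>pz\<close>, whose
  matrix tends to the identity after multiplication with \<open>K\<close>. So the derivative is
  \<open>K\<close> composed with \<open>pz\<close>, and the order of differentiability can be raised
  step by step.\<close>

lemma smooth_on_inverse_map:
 fixes ff pz :: "pt => pt"
 assumes U: "oES n U" and V: "oES n V"
  and ph: "!!j. j<n ==> smooth_on n U (%x. ff x j)" 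
  and K: "!!i j. i<n ==> j<n ==> smooth_on n U (K i j)"
  and inv: "!!x i k. x : U ==> i<n ==> k<n ==>
    (SUM j<n. K i j x * jc ff k j x) = dl i k"
  and ps: "!!y. y : V ==> pz y : U" "!!y. y : V ==> ff (pz y) = y" "continuous_on V pz"
  and i: "i<n"
 shows "smooth_on n V (%y. pz y i)"
proof -
 have cps: "continuous_on V (%y. pz y i)" for i
  using continuous_on_product_then_coordinatewise[OF ps(3)] .
 have pd: "has_pd m (%y. pz y i) (K i m (pz y)) y" if y: "y : V" and m: "m<n" and i: "i<n" for i m y
 proof -
  let ?t0 = "y m" and ?c = "%t. pz (y(m := t))"
  have evV: "eventually (%t. y(m := t) : V) (at ?t0)"
   using openin_ES_update[OF V y m] eventually_nhds_conv_at by blast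
  have c0: "eventually (%t. ALL i>=n. ?c t i = 0) (at ?t0)"
   using evV by eventually_elim (use ps(1) openin_ES_subset[OF U] in auto)
  have clim: "((%t. ?c t l) \<longlongrightarrow> pz y l) (at ?t0)" for l
  proof -
   have "continuous_on UNIV (%t. y(m := t))"
   proof (rule continuous_on_coordinatewise_then_product)
    show "continuous_on UNIV (%t. (y(m := t)) i)" for i by (cases "i = m") simp_all
   qed
   hence "isCont (%t. y(m := t)) (y m)" by (simp add: continuous_on_eq_continuous_at)
   hence "((%t. y(m := t)) \<longlongrightarrow> y) (at ?t0)" by (simp add: isCont_def)
   from continuous_on_tendsto_compose[OF cps[of l] this y evV] show ?thesis .
  qed
  have "ALL j. EX A. j<n --> eventually (%t. ff (?c t) j - ff (pz y) j = (SUM l<n. (?c t l - pz y l) * A l t)) (at ?t0) &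
    (ALL l<n. (A l \<longlongrightarrow> jc ff l j (pz y)) (at ?t0))"
  proof (intro allI)
   fix j
   show "EX A. j<n --> eventually (%t. ff (?c t) j - ff (pz y) j = (SUM l<n. (?c t l - pz y l) * A l t)) (at ?t0) &
    (ALL l<n. (A l \<longlongrightarrow> jc ff l j (pz y)) (at ?t0))"
   proof (cases "j<n")
    case True
    obtain B where "eventually (%t. ff (?c t) j - ff (pz y) j = (SUM l<n. (?c t l - pz y l) *\<^sub>R B l t)) (at ?t0)"
     "!!l. l<n ==> ((%t. B l t) \<longlongrightarrow> jc ff l j (pz y)) (at ?t0)"
     using hadamard[where f="%x. ff x j" and c="?c" and F="at ?t0" and f'="%l. pd l (%x. ff x j)",
      OF U ps(1)[OF y] smooth_on_has_pd[OF ph[OF True]] smooth_on_continuous[OF U smooth_on_partial_deriv[OF ph[OF True]]] c0 clim]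
     by blast
    thus ?thesis unfolding real_scaleR_def by (intro exI[of _ B]) simp
   qed simp
  qed
  from choice[OF this] obtain A where A': "ALL j. j<n --> eventually (%t. ff (?c t) j - ff (pz y) j = (SUM l<n. (?c t l - pz y l) * A j l t)) (at ?t0) &
    (ALL l<n. (A j l \<longlongrightarrow> jc ff l j (pz y)) (at ?t0))" ..
  have A: "!!j. j<n ==> eventually (%t. ff (?c t) j - ff (pz y) j = (SUM l<n. (?c t l - pz y l) * A j l t)) (at ?t0)"
   "!!j l. j<n ==> l<n ==> (A j l \<longlongrightarrow> jc ff l j (pz y)) (at ?t0)"
   using A' by simp_all
  define d where "d l t = (?c t l - pz y l) / (t - ?t0)" for l t
  define M where "M i l t = (SUM j<n. K i j (pz y) * A j l t)" for i l t
  have Mlim: "(M i l \<longlongrightarrow> dl i l) (at ?t0)" if "i<n" "l<n" for i l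
   unfolding M_def inv[OF ps(1)[OF y] that, symmetric]
   by (rule tendsto_sum, rule tendsto_mult[OF tendsto_const A(2)]) (use that in auto)
  have Md: "eventually (%t. (SUM l<n. M i l t * d l t) = K i m (pz y)) (at ?t0)" if "i<n" for i
  proof -
   have "eventually (%t. ALL j:{..<n}. ff (?c t) j - ff (pz y) j = (SUM l<n. (?c t l - pz y l) * A j l t)) (at ?t0)"
    by (rule eventually_ball_finite) (simp_all add: A(1))
   moreover have "eventually (%t. t ~= ?t0) (at ?t0)" by (simp add: eventually_at_filter)
   ultimately show ?thesis using evV
   proof eventually_elim
    case (elim t)
    have e: "(SUM l<n. A j l t * d l t) = dl j m" if "j<n" for j
    proof -
     have "(SUM l<n. A j l t * d l t) * (t - ?t0) = (SUM l<n. (?c t l - pz y l) * A j l t)"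
      unfolding sum_distrib_right d_def using elim(2) by (intro sum.cong) auto
     also have "... = ff (?c t) j - ff (pz y) j" using elim(1) that by simp
     also have "... = dl j m * (t - ?t0)"  using ps(2)[OF elim(3)] ps(2)[OF y] by auto
     finally show ?thesis by (rule mult_right_cancel[THEN iffD1, rotated]) (use elim(2) in simp)
    qed
    have "(SUM l<n. M i l t * d l t) = (SUM j<n. K i j (pz y) * (SUM l<n. A j l t * d l t))"
     unfolding M_def sum_distrib_right sum_distrib_left by (subst sum.swap) (simp add: mult.assoc)
    also have "... = (SUM j<n. K i j (pz y) * dl j m)" using e by (intro sum.cong) auto
    also have "... = K i m (pz y)" using m by (simp add: if_distrib cong: if_cong)
    finally show ?case .
   qed
  qed
  have "(d i \<longlongrightarrow> K i m (pz y)) (at ?t0)"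
   by (rule tendsto_perturbed_identity[OF Mlim Md i])
  thus ?thesis unfolding has_pd_def has_vector_derivative_iff_quotient d_def
   by (simp add: divide_inverse mult.commute)
 qed
 have "Ck_on k n V (%y. pz y i)" if "i<n" for i k using that
 proof (induction k arbitrary: i)
  case 0 show ?case unfolding Ck_on_0_iff[OF V] by (rule cps)
 next
  case (Suc k)
  show ?case
  proof (rule Ck_on_SucI[OF V cps])
   show "has_pd m (%y. pz y i) (K i m (pz y)) y" if "m<n" "y : V" for m y
    by (rule pd[OF that(2,1) Suc.prems])
   show "Ck_on k n V (%y. K i m (pz y))" if "m<n" for m
    by (rule Ck_on_compose[OF U V ps(1) _ Suc.IH]) (use K[OF Suc.prems that] in \<open>simp_all add: smooth_on_def\<close>)
  qed
 qed
 thus ?thesis using i by (simp add: smooth_on_def)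
qed

lemma Ck_on_inverse:
 fixes f :: "pt => real"
 assumes V: "oES n V" and nz: "!!x. x : V ==> f x ~= 0"
 shows "Ck_on k n V f ==> Ck_on k n V (%x. inverse (f x))"
proof (induction k)
 case 0 thus ?case unfolding Ck_on_0_iff[OF V] using nz by (intro continuous_intros) auto
next
 case (Suc k)
 have f: "continuous_on V f" "!!i x. i<n ==> x : V ==> has_pd i f (pd i f x) x"
  "!!i. i<n ==> Ck_on k n V (pd i f)"
  using Suc.prems unfolding Ck_on_Suc_iff Ck_on_0_iff[OF V] by simp_all
 have IH: "Ck_on k n V (%x. inverse (f x))" using Suc Ck_on_SucD by blast
 show ?case
 proof (rule Ck_on_SucI[OF V])
  show "continuous_on V (%x. inverse (f x))" using nz f(1) by (intro continuous_intros) auto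
  show "has_pd i (%x. inverse (f x)) (- (inverse (f x) * pd i f x * inverse (f x))) x" if "i<n" "x : V" for i x
   using f(2)[OF that] nz[OF that(2)] unfolding has_pd_def
   by (auto simp: has_real_derivative_iff_has_vector_derivative[symmetric] intro!: derivative_eq_intros)
  show "Ck_on k n V (%x. - (inverse (f x) * pd i f x * inverse (f x)))" if "i<n" for i
   by (rule Ck_on_linear[OF bounded_linear_minus[OF bounded_linear_ident] V])
     (rule Ck_on_bilinear[OF bounded_bilinear_mult V] IH f(3) that)+
 qed
qed

lemma smooth_on_inverse:
 fixes f :: "pt => real"
 assumes "oES n V" "smooth_on n V f" "!!x. x : V ==> f x ~= 0"
 shows "smooth_on n V (%x. inverse (f x))" using assms Ck_on_inverse by (auto simp: smooth_on_def)

lemma smooth_on_det: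
 fixes A :: "pt => real mat"
 assumes V: "oES n V" and A: "!!x. A x : carrier_mat m m"
  and s: "!!i j. i<m ==> j<m ==> smooth_on n V (%x. A x $$ (i, j))"
 shows "smooth_on n V (%x. det (A x))"
proof -
 have "smooth_on n V (%x. SUM p:{p. p permutes {0..<m}}. signof p * (PROD i = 0..<m. A x $$ (i, p i)))"
 proof (rule smooth_on_sum[OF V], rule smooth_on_mult[OF V smooth_on_const[OF V]], rule smooth_on_prod[OF V])
  fix p i assume "p : {p. p permutes {0..<m}}" and i: "i : {0..<m}"
  hence "p i : {0..<m}" using permutes_in_image by fastforce
  thus "smooth_on n V (%x. A x $$ (i, p i))" using i by (intro s) auto
 qed
 moreover have "(%x. det (A x)) = (%x. SUM p:{p. p permutes {0..<m}}. signof p * (PROD i = 0..<m. A x $$ (i, p i)))"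
  by (rule ext) (rule det_def'[OF A])
 ultimately show ?thesis by simp
qed

text \<open>Cramer's rule: the entries of the inverse are polynomials in those of \<open>a\<close>,
  divided by the determinant, which is nonzero by injectivity.\<close>

lemma smooth_inverse_matrix:
 fixes a :: "nat => nat => pt => real"
 assumes V: "oES n V" and s: "!!i j. i<m ==> j<m ==> smooth_on n V (a i j)"
  and inj: "!!x v. x : V ==> (!!i. i<m ==> (SUM j<m. a i j x * v j) = 0) ==> ALL j<m. v j = 0"
 obtains K where "!!i j. i<m ==> j<m ==> smooth_on n V (K i j)"
  "!!x i k. x : V ==> i<m ==> k<m ==> (SUM j<m. K i j x * a j k x) = dl i k"
  "!!x i k. x : V ==> i<m ==> k<m ==> (SUM j<m. a i j x * K j k x) = dl i k"
proof -
 define A where "A x = mat m m (%(i, j). a i j x)" for x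
 have Ac: "A x : carrier_mat m m" for x by (simp add: A_def)
 define K where "K i j x = adj_mat (A x) $$ (i, j) * inverse (det (A x))" for i j x
 have nz: "det (A x) ~= 0" if x: "x : V" for x
 proof
  assume "det (A x) = 0"
  then obtain v where v: "v : carrier_vec m" "v ~= 0\<^sub>v m" "A x *\<^sub>v v = 0\<^sub>v m"
   using det_0_iff_vec_prod_zero[OF Ac] by blast
  have "(SUM j<m. a i j x * (v $ j)) = 0" if i: "i<m" for i
  proof -
   have "(A x *\<^sub>v v) $ i = (SUM j<m. a i j x * (v $ j))"
    using i v(1) by (simp add: A_def scalar_prod_def lessThan_atLeast0)
   thus ?thesis using v(3) i by simp
  qed
  hence "ALL j<m. v $ j = 0" by (rule inj[OF x])
  hence "v = 0\<^sub>v m" using v(1) by (intro eq_vecI) auto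
  thus False using v(2) by simp
 qed
 have "smooth_on n V (%x. adj_mat (A x) $$ (i, j))" if ij: "i<m" "j<m" for i j
 proof -
  have "adj_mat (A x) $$ (i, j) = (-1)^(j + i) * det (mat_delete (A x) j i)" for x
   using ij Ac[of x] by (simp add: adj_mat_def cofactor_def)
  moreover have "smooth_on n V (%x. det (mat_delete (A x) j i))"
  proof (rule smooth_on_det[OF V])
   show "mat_delete (A x) j i : carrier_mat (m - 1) (m - 1)" for x
    using Ac[of x] by (simp add: mat_delete_def)
   fix k l assume kl: "k<m - 1" "l<m - 1"
   have "mat_delete (A x) j i $$ (k, l) = a (if k<j then k else Suc k) (if l<i then l else Suc l) x" for x
    using kl by (simp add: mat_delete_def A_def)
   moreover have "smooth_on n V (a (if k<j then k else Suc k) (if l<i then l else Suc l))"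
    using kl by (intro s) auto
   ultimately show "smooth_on n V (%x. mat_delete (A x) j i $$ (k, l))" by simp
  qed
  ultimately show ?thesis by (simp add: smooth_on_mult[OF V smooth_on_const[OF V]])
 qed
 moreover have "smooth_on n V (%x. det (A x))" by (rule smooth_on_det[OF V Ac]) (simp add: A_def s)
 ultimately have "smooth_on n V (K i j)" if "i<m" "j<m" for i j
  unfolding K_def using that nz by (simp add: smooth_on_mult[OF V] smooth_on_inverse[OF V])
 moreover have "(SUM j<m. K i j x * a j k x) = dl i k" if "x : V" "i<m" "k<m" for x i k
 proof -
  have "(SUM j<m. adj_mat (A x) $$ (i, j) * a j k x) = (adj_mat (A x) * A x) $$ (i, k)"
   using that adj_mat(1)[OF Ac[of x]] by (simp add: A_def scalar_prod_def lessThan_atLeast0)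
  also have "... = (if i = k then det (A x) else 0)" using that by (simp add: adj_mat(3)[OF Ac])
  finally show ?thesis using nz[OF that(1)] unfolding K_def
   by (simp add: mult.commute[of _ "inverse _"] mult.assoc sum_distrib_left[symmetric])
 qed
 moreover have "(SUM j<m. a i j x * K j k x) = dl i k" if "x : V" "i<m" "k<m" for x i k
 proof -
  have "(SUM j<m. a i j x * adj_mat (A x) $$ (j, k)) = (A x * adj_mat (A x)) $$ (i, k)"
   using that adj_mat(1)[OF Ac[of x]] by (simp add: A_def scalar_prod_def lessThan_atLeast0)
  also have "... = (if i = k then det (A x) else 0)" using that by (simp add: adj_mat(2)[OF Ac])
  finally show ?thesis using nz[OF that(1)] unfolding K_def
   by (simp add: mult.assoc[symmetric] sum_distrib_right[symmetric])
 qed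
 ultimately show ?thesis using that by blast
qed

text \<open>The derivatives of \<open>exp (- (1 / t))\<close> have the form
  \<open>p (1 / t) * exp (- (1 / t))\<close>; differentiating once more replaces \<open>p\<close> by
  the square of the variable times \<open>p - p'\<close>.\<close>

definition flat_exp_deriv :: "nat => real poly" where
 "flat_exp_deriv k = ((%p. [:0, 0, 1:] * (p - pderiv p)) ^^ k) 1"

definition flat_exp :: "nat => real => real" where
 "flat_exp k t = (if t > 0 then poly (flat_exp_deriv k) (1 / t) * exp (- (1 / t)) else 0)"

lemma poly_exp_tendsto_0: "((%x. poly (p :: real poly) x * exp (- x)) \<longlongrightarrow> 0) at_top"
proof -
 have "((%x. SUM i<=degree p. poly.coeff p i * (x ^ i / exp x)) \<longlongrightarrow> (SUM i<=degree p. poly.coeff p i * 0)) at_top"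
  by (intro tendsto_sum tendsto_mult tendsto_const tendsto_power_div_exp_0)
 thus ?thesis by (simp add: poly_altdef exp_minus field_simps sum_divide_distrib sum_distrib_right)
qed

text \<open>With \<open>x = 1 / t\<close> the quotient becomes a polynomial in \<open>x\<close>
  times \<open>exp (- x)\<close>; an extra factor \<open>x\<close> absorbs the division by
  \<open>t\<close>.\<close>

lemma flat_exp_deriv_at_0: "((%t. flat_exp k t / t) \<longlongrightarrow> 0) (at 0)"
proof -
 have "((%t. poly ([:0, 1:] * flat_exp_deriv k) (inverse t) * exp (- inverse t)) \<longlongrightarrow> 0) (at_right 0)"
  by (rule filterlim_compose[OF poly_exp_tendsto_0 filterlim_inverse_at_top_right])
 moreover have "eventually (%t. poly ([:0, 1:] * flat_exp_deriv k) (inverse t) * exp (- inverse t) = flat_exp k t / t) (at_right 0)"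
  by (rule eventually_at_right_less[THEN eventually_mono]) (simp add: flat_exp_def field_simps)
 ultimately have "((%t. flat_exp k t / t) \<longlongrightarrow> 0) (at_right 0)" by (rule Lim_transform_eventually)
 moreover have "((%t. flat_exp k t / t) \<longlongrightarrow> 0) (at_left 0)"
 proof (rule Lim_transform_eventually[OF tendsto_const])
  show "eventually (%t. 0 = flat_exp k t / t) (at_left 0)"
   unfolding eventually_at_filter by (simp add: flat_exp_def)
 qed
 ultimately show ?thesis by (simp add: filterlim_split_at)
qed

lemma flat_exp_has_derivative: "(flat_exp k has_real_derivative flat_exp (Suc k) t) (at t)"
proof -
 consider "t > 0" | "t<0" | "t = 0" by linarith
 thus ?thesis
 proof cases
  case 1
  have d: "((%t. poly (flat_exp_deriv k) (1 / t) * exp (- (1 / t))) has_real_derivative flat_exp (Suc k) t) (at t)"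
   using 1 by (auto intro!: derivative_eq_intros poly_DERIV[THEN DERIV_chain2] 
      simp: flat_exp_def flat_exp_deriv_def field_simps power2_eq_square)
  have ev: "eventually (%t. poly (flat_exp_deriv k) (1 / t) * exp (- (1 / t)) = flat_exp k t) (nhds t)"
   using eventually_nhds_in_open[of "{0<..}" t] 1 by (auto elim!: eventually_mono simp: flat_exp_def)
  show ?thesis by (rule DERIV_cong_ev[OF refl ev refl, THEN iffD1, OF d])
 next
  case 2
  have ev: "eventually (%t. 0 = flat_exp k t) (nhds t)"
   using eventually_nhds_in_open[of "{..<0}" t] 2 by (auto elim!: eventually_mono simp: flat_exp_def)
  have d: "((%t. 0) has_real_derivative flat_exp (Suc k) t) (at t)" using 2 by (simp add: flat_exp_def)
  show ?thesis by (rule DERIV_cong_ev[OF refl ev refl, THEN iffD1, OF d])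
 next
  case 3
  thus ?thesis using flat_exp_deriv_at_0[of k] by (simp add: has_field_derivative_iff flat_exp_def)
 qed
qed

lemma smooth_on_flat_exp:
 assumes V: "oES n V" and u: "smooth_on n V u"
 shows "smooth_on n V (%x. flat_exp 0 (u x))"
proof -
 have c: "continuous_on UNIV (flat_exp m)" for m
  using DERIV_continuous_on[OF has_field_derivative_at_within[OF flat_exp_has_derivative]] .
 have cu: "continuous_on V u" using smooth_on_continuous[OF V u] .
 have cc: "continuous_on V (%x. flat_exp m (u x))" for m
  by (rule continuous_on_compose2[OF c cu]) simp
 have "Ck_on k n V (%x. flat_exp m (u x))" for k m
 proof (induction k arbitrary: m)
  case 0 show ?case unfolding Ck_on_0_iff[OF V] by (rule cc)
 next
  case (Suc k)
  show ?case
  proof (rule Ck_on_SucI[OF V cc])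
   fix i assume i: "i<n"
   show "Ck_on k n V (%x. pd i u x * flat_exp (Suc m) (u x))"
    by (rule Ck_on_bilinear[OF bounded_bilinear_mult V _ Suc.IH])
      (use smooth_on_partial_deriv[OF u i] in \<open>simp add: smooth_on_def\<close>)
   fix x assume x: "x : V"
   have "((%t. flat_exp m (u (x(i := t)))) has_real_derivative flat_exp (Suc m) (u (x(i := x i))) * pd i u x) (at (x i))"
    using smooth_on_has_pd[OF u i x] by (intro DERIV_chain2[OF flat_exp_has_derivative])
      (simp add: has_pd_def has_real_derivative_iff_has_vector_derivative)
   thus "has_pd i (%x. flat_exp m (u x)) (pd i u x * flat_exp (Suc m) (u x)) x"
    by (simp add: has_pd_def has_real_derivative_iff_has_vector_derivative mult.commute)
  qed
 qed
 thus ?thesis by (simp add: smooth_on_def)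
qed

lemma flat_exp_pos_iff: "flat_exp 0 t > 0 <-> t > 0" and flat_exp_nonneg: "flat_exp 0 t >= 0"
 by (simp_all add: flat_exp_def flat_exp_deriv_def)

section \<open>The formal Weyl algebra\<close>

text \<open>A power series in fibre coordinates \<open>y\<close> is represented by its Taylor coefficients, indexed by
  multisets of coordinate indices; then \<open>\<partial>/\<partial>y\<^sub>i\<close> is a shift of the index, and products are
  determined by their constant term and the Leibniz rule.\<close>

type_synonym pol = "nat multiset => complex"

definition dy :: "nat => pol => pol" where "dy i a M = a (add_mset i M)"

text \<open>\<open>a M\<close> stands for the derivative of \<open>a\<close> along \<open>M\<close>
  at the origin, without division by factorials. The multiplicity of \<open>i\<close> counts the
  ways in which Leibniz' rule differentiates the factor \<open>y\<^sub>i\<close>.\<close>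

definition ymul :: "nat => pol => pol" where "ymul i a M = of_nat (count M i) * a (M - {#i#})"

definition sc :: "complex => ('i => complex) => 'i => complex" where "sc z a = (%M. z * a M)"

lemma sc_apply: "sc z a M = z * a M" by (simp add: sc_def)

definition pone :: pol where "pone M = (if M = {#} then 1 else 0)"

lemma sum_fun_apply: "(SUM i:I. f i) x = (SUM i:I. f i x)"
 by (induction I rule: infinite_finite_induct) auto

lemma dy_commute: "dy i (dy j a) = dy j (dy i a)" by (simp add: dy_def fun_eq_iff add_mset_commute)

lemma dy_add: "dy i (a + b) = dy i a + dy i b" and dy_sc: "dy i (sc z a) = sc z (dy i a)"
 and dy_zero: "dy i 0 = 0" and dy_diff: "dy i (a - b) = dy i a - dy i b"
 by (simp_all add: dy_def sc_def fun_eq_iff)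

lemma dy_sum: "dy i (SUM j:J. f j) = (SUM j:J. dy i (f j))"
 by (simp add: dy_def fun_eq_iff sum_fun_apply)

lemma ymul_add: "ymul i (a + b) = ymul i a + ymul i b" and ymul_sc: "ymul i (sc z a) = sc z (ymul i a)"
 and ymul_zero: "ymul i 0 = 0" by (simp_all add: ymul_def sc_def fun_eq_iff algebra_simps)

lemma ymul_sum: "ymul i (SUM j:J. f j) = (SUM j:J. ymul i (f j))"
 by (simp add: ymul_def fun_eq_iff sum_fun_apply sum_distrib_left)

lemma sc_add: "sc z (a + b) = sc z a + sc z b" and sc_add_left: "sc (z + w) a = sc z a + sc w a"
 and sc_sc: "sc z (sc w a) = sc (z * w) a" and sc_one: "sc 1 a = a" and sc_zero: "sc z 0 = 0"
 and sc_zero_left: "sc 0 a = 0" and sc_diff: "sc z (a - b) = sc z a - sc z b"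
 and sc_minus_one: "sc (- 1) a = - a" and sc_minus_left: "sc (- z) a = - sc z a"
 by (simp_all add: sc_def fun_eq_iff algebra_simps)

lemma sc_sum: "sc z (SUM j:J. f j) = (SUM j:J. sc z (f j))"
 by (simp add: sc_def fun_eq_iff sum_fun_apply sum_distrib_left)

lemma sc_sum_left: "sc (SUM j:J. f j) a = (SUM j:J. sc (f j) a)"
 by (simp add: sc_def fun_eq_iff sum_fun_apply sum_distrib_right)

lemma dy_ymul: "dy i (ymul j a) = (if i = j then a else 0) + ymul j (dy i a)"
proof (rule ext)
 fix M
 show "dy i (ymul j a) M = ((if i = j then a else 0) + ymul j (dy i a)) M"
 proof (cases "j \<in># M")
  case True
  hence "add_mset i M - {#j#} = add_mset i (M - {#j#})" by auto
  thus ?thesis by (auto simp: dy_def ymul_def algebra_simps)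
 next
  case False
  thus ?thesis by (auto simp: dy_def ymul_def not_in_iff)
 qed
qed

lemma dy_pone: "dy i pone = 0" by (simp add: dy_def pone_def fun_eq_iff)

lemma ymul_commute: "ymul i (ymul j a) = ymul j (ymul i a)"
proof (cases "i = j")
 case False
 thus ?thesis by (simp add: ymul_def fun_eq_iff ac_simps diff_right_commute)
qed simp

lemma ymul_empty: "ymul i a {#} = 0" by (simp add: ymul_def)

subsection \<open>The commutative product\<close>

text \<open>Leibniz' rule, read off along an enumeration of the index. Derivatives commute, so by
  \<open>prod_list_aux_mset\<close> the order of the list is immaterial and the result depends on
  the multiset alone.\<close>

fun prod_list_aux :: "nat list => pol => pol => complex" where
 "prod_list_aux [] a b = a {#} * b {#}"
| "prod_list_aux (i # xs) a b = prod_list_aux xs (dy i a) b + prod_list_aux xs a (dy i b)"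

lemma prod_list_aux_move: "prod_list_aux (us @ i # vs) a b = prod_list_aux (i # us @ vs) a b"
 by (induction us arbitrary: a b) (simp_all add: dy_commute)

lemma prod_list_aux_mset: "mset xs = mset ys ==> prod_list_aux xs a b = prod_list_aux ys a b"
proof (induction xs arbitrary: ys a b)
 case (Cons x xs)
 hence "x : set ys" by (metis list.set_intros(1) mset_eq_setD)
 then obtain us vs where ys: "ys = us @ x # vs" by (meson split_list)
 hence "mset xs = mset (us @ vs)" using Cons.prems by simp
 thus ?case unfolding ys prod_list_aux_move using Cons.IH[of "us @ vs"] by simp
qed simp

definition pprod :: "pol => pol => pol" where
 "pprod a b M = prod_list_aux (sorted_list_of_multiset M) a b"

lemma pprod_empty: "pprod a b {#} = a {#} * b {#}" by (simp add: pprod_def)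

lemma pprod_add_mset: "pprod a b (add_mset i M) = pprod (dy i a) b M + pprod a (dy i b) M"
proof -
 have "prod_list_aux (sorted_list_of_multiset (add_mset i M)) a b = prod_list_aux (i # sorted_list_of_multiset M) a b"
  by (rule prod_list_aux_mset) (simp del: sorted_list_of_multiset_insert)
 thus ?thesis by (simp add: pprod_def)
qed

lemma dy_pprod: "dy i (pprod a b) = pprod (dy i a) b + pprod a (dy i b)"
 by (simp add: fun_eq_iff dy_def[of i "pprod a b"] pprod_add_mset)

lemma pprod_commute: "pprod a b = pprod b a"
proof
 fix M show "pprod a b M = pprod b a M"
  by (induction M arbitrary: a b) (simp_all add: pprod_empty pprod_add_mset)
qed

lemma pprod_add_left: "pprod (a + a') b = pprod a b + pprod a' b"
proof
 fix M show "pprod (a + a') b M = (pprod a b + pprod a' b) M"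
  by (induction M arbitrary: a a' b) (simp_all add: pprod_empty pprod_add_mset dy_add algebra_simps)
qed

lemma pprod_sc_left: "pprod (sc z a) b = sc z (pprod a b)"
proof
 fix M show "pprod (sc z a) b M = (sc z (pprod a b)) M"
  by (induction M arbitrary: a b) (simp_all add: pprod_empty pprod_add_mset dy_sc algebra_simps sc_apply)
qed

lemma pprod_add_right: "pprod a (b + b') = pprod a b + pprod a b'"
 by (simp add: pprod_commute[of a] pprod_add_left)

lemma pprod_sc_right: "pprod a (sc z b) = sc z (pprod a b)" by (simp add: pprod_commute[of a] pprod_sc_left)

lemma pprod_assoc: "pprod (pprod a b) c = pprod a (pprod b c)"
proof
 fix M show "pprod (pprod a b) c M = pprod a (pprod b c) M" by (induction M arbitrary: a b c)
    (simp_all add: pprod_empty pprod_add_mset dy_pprod pprod_add_left pprod_add_right algebra_simps)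
qed

lemma pprod_zero: "pprod 0 b = 0" "pprod a 0 = 0"
proof -
 show 1: "pprod 0 b = 0" for b using pprod_sc_left[of 0 0 b] by (simp add: sc_zero_left)
 show "pprod a 0 = 0" by (simp add: pprod_commute[of a] 1)
qed

lemma pprod_pone: "pprod pone b = b"
proof
 fix M show "pprod pone b M = b M"
  by (induction M arbitrary: b) (simp_all add: pprod_empty pprod_add_mset dy_pone pprod_zero, simp_all add: pone_def dy_def)
qed

lemma pprod_ymul_left: "pprod (ymul j a) b = ymul j (pprod a b)"
proof
 fix M show "pprod (ymul j a) b M = ymul j (pprod a b) M"
 proof (induction M arbitrary: a b)
  case empty thus ?case by (simp add: pprod_empty ymul_empty)
 next
  case (add i M)
  have "ymul j (pprod a b) (add_mset i M) = dy i (ymul j (pprod a b)) M" by (simp add: dy_def)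
  also have "... = (if i = j then pprod a b M else 0) + ymul j (dy i (pprod a b)) M"
   by (simp add: dy_ymul)
  finally show ?case using add
   by (simp add: pprod_add_mset dy_ymul dy_pprod pprod_add_left ymul_add pprod_zero)
 qed
qed

lemma pprod_eq_0:
 "(!!M1 M2. size M1 + size M2 = size M ==> a M1 = 0 | b M2 = 0) ==> pprod a b M = 0"
proof (induction M arbitrary: a b)
 case empty
 thus ?case using empty[of "{#}" "{#}"] by (auto simp: pprod_empty)
next
 case (add i M)
 have "pprod (dy i a) b M = 0" "pprod a (dy i b) M = 0"
  by (rule add.IH; simp only: dy_def; rule add.prems; simp)+
 thus ?case by (simp add: pprod_add_mset)
qed

subsection \<open>The Moyal product\<close>

text \<open>The \<open>k\<close>-th power of the bidifferential operator \<open>\<Sum> po p q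
  \<partial>\<^sub>p \<otimes> \<partial>\<^sub>q\<close>, followed by the commutative product; the
  Moyal product is the corresponding exponential.\<close>

primrec bidiff :: "nat => (nat => nat => complex) => nat => pol => pol => pol" where
 "bidiff n po 0 a b = pprod a b"
| "bidiff n po (Suc k) a b = (SUM p<n. SUM q<n. sc (po p q) (bidiff n po k (dy p a) (dy q b)))"

lemma bidiff_add_left: "bidiff n po k (a + a') b = bidiff n po k a b + bidiff n po k a' b"
 by (induction k arbitrary: a a' b) (simp_all add: pprod_add_left dy_add sc_add sum.distrib)

lemma bidiff_add_right: "bidiff n po k a (b + b') = bidiff n po k a b + bidiff n po k a b'"
 by (induction k arbitrary: a b b') (simp_all add: pprod_add_right dy_add sc_add sum.distrib)

lemma bidiff_sc_left: "bidiff n po k (sc z a) b = sc z (bidiff n po k a b)"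
 by (induction k arbitrary: a b) (simp_all add: pprod_sc_left dy_sc sc_sc sc_sum mult.commute)

lemma bidiff_sc_right: "bidiff n po k a (sc z b) = sc z (bidiff n po k a b)"
 by (induction k arbitrary: a b) (simp_all add: pprod_sc_right dy_sc sc_sc sc_sum mult.commute)

lemma bidiff_zero: "bidiff n po k 0 b = 0" "bidiff n po k a 0 = 0"
 using bidiff_sc_left[of n po k 0 0 b] bidiff_sc_right[of n po k a 0 0] by (simp_all add: sc_zero_left)

lemma bidiff_sum_left: "bidiff n po k (SUM i:I. f i) b = (SUM i:I. bidiff n po k (f i) b)"
 using sum_comp_morphism[of "%a. bidiff n po k a b" f I] by (simp add: bidiff_zero bidiff_add_left comp_def)

lemma bidiff_sum_right: "bidiff n po k a (SUM i:I. f i) = (SUM i:I. bidiff n po k a (f i))"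
 using sum_comp_morphism[of "%b. bidiff n po k a b" f I] by (simp add: bidiff_zero bidiff_add_right comp_def)

lemma dy_bidiff: "dy i (bidiff n po k a b) = bidiff n po k (dy i a) b + bidiff n po k a (dy i b)"
proof (induction k arbitrary: a b)
 case 0 thus ?case by (simp add: dy_pprod)
next
 case (Suc k)
 thus ?case by (simp add: dy_sum dy_sc sc_add sum.distrib dy_commute[of i] del: plus_fun_apply)
qed

lemma bidiff_swap:
 assumes "!!p q. p<n ==> q<n ==> po q p = - po p q"
 shows "bidiff n po k b a = sc ((-1) ^ k) (bidiff n po k a b)"
proof (induction k arbitrary: a b)
 case 0 show ?case by (simp add: pprod_commute[of b] sc_one)
next
 case (Suc k)
 have "bidiff n po (Suc k) b a = (SUM q<n. SUM p<n. sc (po p q) (bidiff n po k (dy p b) (dy q a)))"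
  by (subst sum.swap) simp
 also have "... = (SUM q<n. SUM p<n. sc ((-1) ^ Suc k) (sc (po q p) (bidiff n po k (dy q a) (dy p b))))"
 proof (intro sum.cong refl)
  fix q p assume "q : {..<n}" "p : {..<n}"
  hence "po p q = - po q p" using assms[of q p] by simp
  thus "sc (po p q) (bidiff n po k (dy p b) (dy q a)) =
    sc ((-1) ^ Suc k) (sc (po q p) (bidiff n po k (dy q a) (dy p b)))"
   unfolding Suc[of "dy p b" "dy q a"] sc_sc by (simp add: mult.commute)
 qed
 finally show ?case by (simp add: sc_sum)
qed

text \<open>Every factor of the operator differentiates each argument once, so order
  \<open>k\<close> consumes \<open>2 * k\<close> fibre variables. The degree of \<open>Fil\<close>
  is built on this count.\<close>

lemma bidiff_eq_0:
 "(!!M1 M2. size M1 + size M2 = size M + 2 * k ==> a M1 = 0 | b M2 = 0) ==> bidiff n po k a b M = 0"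
proof (induction k arbitrary: a b)
 case 0 thus ?case by (simp add: pprod_eq_0)
next
 case (Suc k)
 have "bidiff n po k (dy p a) (dy q b) M = 0" for p q
  by (rule Suc.IH; simp only: dy_def; rule Suc.prems; simp)
 thus ?case by (simp add: sum_fun_apply sc_def)
qed

text \<open>Pascal's rule, in the form of the inductive step of the binomial theorem for two
  commuting operators.\<close>

lemma choose_sum_Suc:
 fixes f :: "nat => nat => 'a::comm_semiring_1"
 shows "(SUM k<=Suc m. of_nat (Suc m choose k) * f k (Suc m - k)) =
  (SUM k<=m. of_nat (m choose k) * (f (Suc k) (m - k) + f k (Suc (m - k))))"
proof -
 have "(SUM k<=Suc m. of_nat (Suc m choose k) * f k (Suc m - k)) =
  f 0 (Suc m) + (SUM k<=m. of_nat (Suc m choose Suc k) * f (Suc k) (m - k))"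
  by (subst sum.atMost_Suc_shift) simp
 also have "... = f 0 (Suc m) + (SUM k<=m. of_nat (m choose Suc k) * f (Suc k) (m - k))
   + (SUM k<=m. of_nat (m choose k) * f (Suc k) (m - k))" by (simp add: algebra_simps sum.distrib)
 also have "f 0 (Suc m) + (SUM k<=m. of_nat (m choose Suc k) * f (Suc k) (m - k)) =
   (SUM k<=Suc m. of_nat (m choose k) * f k (Suc m - k))"
  using sum.atMost_Suc_shift[of "%k. of_nat (m choose k) * f k (Suc m - k)" m]
  by (simp add: binomial_eq_0)
 also have "... = (SUM k<=m. of_nat (m choose k) * f k (Suc m - k))" by (simp add: binomial_eq_0)
 also have "... = (SUM k<=m. of_nat (m choose k) * f k (Suc (m - k)))"
  by (intro sum.cong) (auto simp: Suc_diff_le)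
 finally show ?thesis by (simp add: algebra_simps sum.distrib)
qed

text \<open>Both bracketings of a triple product are powers of the same operator
  \<open>\<pi>\<^sub>1\<^sub>2 + \<pi>\<^sub>1\<^sub>3 + \<pi>\<^sub>2\<^sub>3\<close> applied to a tensor product; this is the reason for the associativity.\<close>

primrec tridiff :: "nat => (nat => nat => complex) => nat => pol => pol => pol => pol" where
 "tridiff n po 0 a b c = pprod (pprod a b) c"
| "tridiff n po (Suc k) a b c = (SUM p<n. SUM q<n. sc (po p q)
   (tridiff n po k (dy p a) (dy q b) c + tridiff n po k (dy p a) b (dy q c) + tridiff n po k a (dy p b) (dy q c)))"

text \<open>The binomial theorem for \<open>\<pi>\<^sub>1\<^sub>2 + (\<pi>\<^sub>1\<^sub>3 +
  \<pi>\<^sub>2\<^sub>3)\<close>: Leibniz' rule splits the outer operator into the sum in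
  parentheses, and the inner one is \<open>\<pi>\<^sub>1\<^sub>2\<close>.\<close>

lemma bidiff_bidiff_left:
 "(SUM k<=m. of_nat (m choose k) * bidiff n po k (bidiff n po (m - k) a b) c M) = tridiff n po m a b c M"
proof (induction m arbitrary: a b c)
 case 0 thus ?case by simp
next
 case (Suc m)
 define f where "f k l = bidiff n po k (bidiff n po l a b) c M" for k l
 have 1: "f (Suc k) l = (SUM p<n. SUM q<n. po p q * (bidiff n po k (bidiff n po l (dy p a) b) (dy q c) M
   + bidiff n po k (bidiff n po l a (dy p b)) (dy q c) M))" for k l
  by (simp add: f_def dy_bidiff bidiff_add_left sum_fun_apply sc_def)
 have 2: "f k (Suc l) = (SUM p<n. SUM q<n. po p q * bidiff n po k (bidiff n po l (dy p a) (dy q b)) c M)" for k l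
  by (simp add: f_def bidiff_sum_left bidiff_sc_left sum_fun_apply) (simp add: sc_def)
 have "(SUM k<=Suc m. of_nat (Suc m choose k) * f k (Suc m - k)) =
   (SUM k<=m. of_nat (m choose k) * (f (Suc k) (m - k) + f k (Suc (m - k))))" by (rule choose_sum_Suc)
 also have "... = (SUM k<=m. SUM p<n. SUM q<n. po p q * (of_nat (m choose k) * 
    (bidiff n po k (bidiff n po (m - k) (dy p a) (dy q b)) c M
    + bidiff n po k (bidiff n po (m - k) (dy p a) b) (dy q c) M
   + bidiff n po k (bidiff n po (m - k) a (dy p b)) (dy q c) M)))"
  unfolding 1 2 sum.distrib[symmetric] sum_distrib_left by (simp add: algebra_simps)
 also have "... = (SUM p<n. SUM q<n. SUM k<=m. po p q * (of_nat (m choose k) * 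
    (bidiff n po k (bidiff n po (m - k) (dy p a) (dy q b)) c M
    + bidiff n po k (bidiff n po (m - k) (dy p a) b) (dy q c) M
   + bidiff n po k (bidiff n po (m - k) a (dy p b)) (dy q c) M)))"
  by (subst sum.swap, rule sum.cong[OF refl], rule sum.swap)
 also have "... = (SUM p<n. SUM q<n. po p q * (tridiff n po m (dy p a) (dy q b) c M
    + tridiff n po m (dy p a) b (dy q c) M + tridiff n po m a (dy p b) (dy q c) M))"
  unfolding Suc[symmetric] sum_distrib_left[symmetric] by (simp add: distrib_left sum.distrib)
 finally show ?case unfolding f_def by (simp add: sum_fun_apply sc_def)
qed

text \<open>Reversing the factors and transposing \<open>po\<close> is a symmetry. Statements about
  right factors and right bracketings are obtained from the left ones through it.\<close>

lemma bidiff_flip: "bidiff n (%p q. po q p) k b a = bidiff n po k a b"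
proof (induction k arbitrary: a b)
 case 0 show ?case by (simp add: pprod_commute[of b])
next
 case (Suc k) show ?case by (simp add: Suc) (rule sum.swap)
qed

lemma tridiff_flip: "tridiff n (%p q. po q p) k c b a = tridiff n po k a b c"
proof (induction k arbitrary: a b c)
 case 0 show ?case by (simp add: pprod_assoc[symmetric] pprod_commute[of _ a] pprod_commute[of c])
next
 case (Suc k) show ?case by (simp only: tridiff.simps Suc, subst sum.swap) (simp only: add_ac)
qed

type_synonym fib = "nat => nat multiset => complex"

definition moy_coeff :: "nat => complex" where "moy_coeff k = (\<i> / 2) ^ k / fact k"

text \<open>Powers of the formal parameter: \<open>k\<close> from the exponential, \<open>p\<close>
  and \<open>q\<close> from the two factors.\<close>

definition triples :: "nat => (nat \<times> nat \<times> nat) set" where "triples m = {(k, p, q). k + p + q = m}"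

lemma finite_triples: "finite (triples m)"
 by (rule finite_subset[of _ "{..m} \<times> {..m} \<times> {..m}"]) (auto simp: triples_def)

definition moy :: "nat => (nat => nat => complex) => fib => fib => fib" where
 "moy n po a b m = (SUM (k, p, q):triples m. sc (moy_coeff k) (bidiff n po k (a p) (b q)))"

definition fsc :: "complex => fib => fib" where "fsc z a m = sc z (a m)"

definition fconst :: "pol => fib" where "fconst u m = (if m = 0 then u else 0)"

text \<open>Multiplication by the formal parameter. It is injective, so identities for
  \<open>brk\<close> can be checked after one multiplication, where they become identities for
  commutators.\<close>

definition lam :: "fib => fib" where "lam a m = (case m of 0 => 0 | Suc k => a k)"

lemma triples_0: "triples 0 = {(0, 0, 0)}" by (auto simp: triples_def)

lemma moy_0: "moy n po a b 0 = pprod (a 0) (b 0)" by (simp add: moy_def triples_0 moy_coeff_def sc_one)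

lemma moy_add_left: "moy n po (a + a') b = moy n po a b + moy n po a' b"
 by (simp add: fun_eq_iff[of "moy n po (a + a') b"] moy_def split_beta bidiff_add_left sc_add sum.distrib)

lemma moy_add_right: "moy n po a (b + b') = moy n po a b + moy n po a b'"
 by (simp add: fun_eq_iff[of "moy n po a (b + b')"] moy_def split_beta bidiff_add_right sc_add sum.distrib)

lemma moy_fsc_left: "moy n po (fsc z a) b = fsc z (moy n po a b)"
 by (simp add: fun_eq_iff[of "moy n po (fsc z a) b"] moy_def split_beta bidiff_sc_left fsc_def sc_sum sc_sc mult.commute)

lemma moy_fsc_right: "moy n po a (fsc z b) = fsc z (moy n po a b)"
 by (simp add: fun_eq_iff[of "moy n po a (fsc z b)"] moy_def split_beta bidiff_sc_right fsc_def sc_sum sc_sc mult.commute)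

lemma moy_coeff_mult: "k <= t ==> moy_coeff k * moy_coeff (t - k) = moy_coeff t * of_nat (t choose k)"
proof -
 assume k: "k <= t"
 have "(\<i> / 2 :: complex) ^ t = (\<i> / 2) ^ k * (\<i> / 2) ^ (t - k)"
  using k by (simp add: power_add[symmetric])
 thus ?thesis using k by (simp add: moy_coeff_def binomial_fact field_simps)
qed

definition quads :: "nat => (nat \<times> nat \<times> nat \<times> nat) set" where "quads m = {(t, r, s, q). t + r + s + q = m}"

lemma finite_quads: "finite (quads m)"
 by (rule finite_subset[of _ "{..m} \<times> {..m} \<times> {..m} \<times> {..m}"]) (auto simp: quads_def)

text \<open>Collecting the terms by the total order \<open>t\<close> of the two operators turns the
  product of coefficients into \<open>moy_coeff t\<close> times a binomial coefficient, and
  \<open>bidiff_bidiff_left\<close> sums these.\<close>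

lemma moy_assoc_left:
 "moy n po (moy n po a b) c m M = (SUM (t, r, s, q):quads m. moy_coeff t * tridiff n po t (a r) (b s) (c q) M)"
proof -
 define Y where "Y k l r s q = moy_coeff k * moy_coeff l * bidiff n po k (bidiff n po l (a r) (b s)) (c q) M" for k l r s q
 have "moy n po (moy n po a b) c m M = (SUM x:triples m. SUM z:triples (fst (snd x)).
   Y (fst x) (fst z) (fst (snd z)) (snd (snd z)) (snd (snd x)))"
  by (simp add: moy_def[of _ _ _ c] split_beta moy_def bidiff_sum_left sum_fun_apply sc_apply bidiff_sc_left sum_distrib_left Y_def mult.assoc)
 also have "... = (SUM (x, z):Sigma (triples m) (%x. triples (fst (snd x))). 
   Y (fst x) (fst z) (fst (snd z)) (snd (snd z)) (snd (snd x)))"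
  by (rule sum.Sigma) (auto simp: finite_triples)
 also have "... = (SUM (x, k):Sigma (quads m) (%x. {..fst x}). 
   Y k (fst x - k) (fst (snd x)) (fst (snd (snd x))) (snd (snd (snd x))))"
  by (rule sum.reindex_bij_witness[where j="%((k, p, q), (l, r, s)). ((k + l, r, s, q), k)"
     and i="%((t, r, s, q), k). ((k, t - k + r + s, q), (t - k, r, s))"])
    (auto simp: triples_def quads_def)
 also have "... = (SUM x:quads m. SUM k<=fst x. Y k (fst x - k) (fst (snd x)) (fst (snd (snd x))) (snd (snd (snd x))))"
  by (rule sum.Sigma[symmetric]) (auto simp: finite_quads)
 also have "... = (SUM (t, r, s, q):quads m. moy_coeff t * tridiff n po t (a r) (b s) (c q) M)"
 proof (rule sum.cong[OF refl])
  fix x assume "x : quads m"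
  obtain t r s q where x: "x = (t, r, s, q)" by (cases x)
  have "(SUM k<=t. Y k (t - k) r s q) = (SUM k<=t. moy_coeff t * (of_nat (t choose k) * bidiff n po k (bidiff n po (t - k) (a r) (b s)) (c q) M))"
   unfolding Y_def by (rule sum.cong[OF refl]) (simp add: moy_coeff_mult mult.assoc)
  also have "... = moy_coeff t * tridiff n po t (a r) (b s) (c q) M"
   unfolding sum_distrib_left[symmetric] bidiff_bidiff_left ..
  finally show "(SUM k<=fst x. Y k (fst x - k) (fst (snd x)) (fst (snd (snd x))) (snd (snd (snd x)))) =
   (case x of (t, r, s, q) => moy_coeff t * tridiff n po t (a r) (b s) (c q) M)" by (simp add: x)
 qed
 finally show ?thesis .
qed

lemma moy_flip: "moy n (%p q. po q p) b a = moy n po a b"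
proof
 fix m show "moy n (%p q. po q p) b a m = moy n po a b m"
  unfolding moy_def by (rule sum.reindex_bij_witness[where i="%(k, p, q). (k, q, p)" and j="%(k, p, q). (k, q, p)"])
   (auto simp: triples_def bidiff_flip[of n po])
qed

text \<open>The reversal symmetry carries the right bracketing to a left one, and the operator of
  \<open>tridiff\<close> is invariant under it.\<close>

lemma moy_assoc: "moy n po (moy n po a b) c = moy n po a (moy n po b c)"
proof (intro ext)
 fix m M
 have "moy n po a (moy n po b c) m M = moy n (%p q. po q p) (moy n (%p q. po q p) c b) a m M"
  by (simp only: moy_flip[of n po])
 also have "... = (SUM (t, r, s, q):quads m. moy_coeff t * tridiff n po t (a r) (b s) (c q) M)"
  unfolding moy_assoc_left tridiff_flip[of n po]
  by (rule sum.reindex_bij_witness[where i="%(t, r, s, q). (t, q, s, r)" and j="%(t, r, s, q). (t, q, s, r)"])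
   (auto simp: quads_def)
 finally show "moy n po (moy n po a b) c m M = moy n po a (moy n po b c) m M" unfolding moy_assoc_left ..
qed

lemma moy_zero: "moy n po 0 b = 0" "moy n po a 0 = 0"
 using moy_add_left[of n po 0 0 b] moy_add_right[of n po a 0 0] by simp_all

lemma moy_diff_left: "moy n po (a - a') b = moy n po a b - moy n po a' b"
 using moy_add_left[of n po "a - a'" a' b] by simp

lemma moy_diff_right: "moy n po a (b - b') = moy n po a b - moy n po a b'"
 using moy_add_right[of n po a "b - b'" b'] by simp

lemma lam_Suc: "lam a (Suc m) = a m" and lam_0: "lam a 0 = 0" by (simp_all add: lam_def)

lemma lam_inject: "lam a = lam b <-> a = b" by (metis ext lam_Suc)

lemma lam_add: "lam (a + b) = lam a + lam b" and lam_diff: "lam (a - b) = lam a - lam b"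
 by (simp_all add: fun_eq_iff lam_def split: nat.split)

lemma fsc_add: "fsc z (a + b) = fsc z a + fsc z b"
 by (simp_all add: fun_eq_iff fsc_def sc_apply algebra_simps)

lemma moy_lam_left: "moy n po (lam a) b = lam (moy n po a b)"
proof
 fix m
 show "moy n po (lam a) b m = lam (moy n po a b) m"
 proof (cases m)
  case 0
  thus ?thesis by (simp add: moy_0 lam_0 pprod_zero)
 next
  case (Suc m')
  let ?j = "%(k, p, q). (k, Suc p, q)"
  have "moy n po (lam a) b m = (SUM (k, p, q):?j ` triples m'. sc (moy_coeff k) (bidiff n po k (lam a p) (b q)))"
   unfolding moy_def Suc
  proof (rule sum.mono_neutral_right[OF finite_triples])
   show "?j ` triples m' <= triples (Suc m')" by (auto simp: triples_def)
   show "ALL x:triples (Suc m') - ?j ` triples m'. (case x of (k, p, q) => sc (moy_coeff k) (bidiff n po k (lam a p) (b q))) = 0"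
   proof
    fix x assume x: "x : triples (Suc m') - ?j ` triples m'"
    obtain k p q where xx: "x = (k, p, q)" by (cases x)
    have "p = 0"
    proof (rule ccontr)
     assume "p ~= 0"
     hence "x = ?j (k, p - 1, q)" "(k, p - 1, q) : triples m'" using x by (auto simp: xx triples_def)
     thus False using x by blast
    qed
    thus "(case x of (k, p, q) => sc (moy_coeff k) (bidiff n po k (lam a p) (b q))) = 0"
     by (simp add: xx lam_0 bidiff_zero sc_zero)
   qed
  qed
  also have "... = moy n po a b m'"
   unfolding moy_def by (subst sum.reindex) (auto simp: inj_on_def split_beta lam_Suc intro: sum.cong)
  finally show ?thesis by (simp add: Suc lam_Suc)
 qed
qed

lemma moy_lam_right: "moy n po a (lam b) = lam (moy n po a b)"
 using moy_lam_left[of n "%p q. po q p" b a] by (simp only: moy_flip[of n po])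

lemma moy_fconst_left: "moy n po (fconst u) b m = (SUM k<=m. sc (moy_coeff k) (bidiff n po k u (b (m - k))))"
proof -
 let ?j = "%k. (k, 0, m - k)"
 have "moy n po (fconst u) b m = (SUM (k, p, q):?j ` {..m}. sc (moy_coeff k) (bidiff n po k (fconst u p) (b q)))"
  unfolding moy_def
 proof (rule sum.mono_neutral_right[OF finite_triples])
  show "?j ` {..m} <= triples m" by (auto simp: triples_def)
  show "ALL x:triples m - ?j ` {..m}. (case x of (k, p, q) => sc (moy_coeff k) (bidiff n po k (fconst u p) (b q))) = 0"
  proof
   fix x assume x: "x : triples m - ?j ` {..m}"
   obtain k p q where xx: "x = (k, p, q)" by (cases x)
   have "p ~= 0" using x by (auto simp: xx triples_def)
   thus "(case x of (k, p, q) => sc (moy_coeff k) (bidiff n po k (fconst u p) (b q))) = 0"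
    by (simp add: xx fconst_def bidiff_zero sc_zero)
  qed
 qed
 also have "... = (SUM k<=m. sc (moy_coeff k) (bidiff n po k u (b (m - k))))"
  by (subst sum.reindex) (auto simp: inj_on_def fconst_def)
 finally show ?thesis .
qed

lemma moy_fconst_right: "moy n po b (fconst u) m = (SUM k<=m. sc (moy_coeff k) (bidiff n po k (b (m - k)) u))"
 using moy_fconst_left[of n "%p q. po q p" u b m] by (simp only: moy_flip[of n po] bidiff_flip[of n po])

lemma bidiff_pone: "bidiff n po k pone b = (if k = 0 then b else 0)" "bidiff n po k b pone = (if k = 0 then b else 0)"
proof -
 show "bidiff n po k pone b = (if k = 0 then b else 0)"
  by (cases k) (simp_all add: pprod_pone dy_pone bidiff_zero sc_zero)
 show "bidiff n po k b pone = (if k = 0 then b else 0)"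
  by (cases k) (simp_all add: pprod_commute[of b] pprod_pone dy_pone bidiff_zero sc_zero)
qed

subsection \<open>The bracket\<close>

text \<open>The commutator of the Moyal product is divisible by the formal parameter, and
  \<open>brk a b = (i/\<lambda>) (a \<circ> b - b \<circ> a)\<close>.\<close>

definition brk :: "nat => (nat => nat => complex) => fib => fib => fib" where
 "brk n po a b m = sc \<i> (moy n po a b (Suc m) - moy n po b a (Suc m))"

text \<open>The definition of \<open>brk\<close> shifts the commutator down by one order; nothing is
  lost because \<open>pprod\<close> is commutative, so order zero vanishes.\<close>

lemma lam_brk: "lam (brk n po a b) = fsc \<i> (moy n po a b - moy n po b a)"
proof
 fix m show "lam (brk n po a b) m = fsc \<i> (moy n po a b - moy n po b a) m"
  by (cases m) (simp_all add: lam_Suc lam_0 brk_def fsc_def moy_0 pprod_commute[of "b 0"] sc_zero)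
qed

lemma brk_anti: "brk n po b a = - brk n po a b" by (simp add: fun_eq_iff brk_def sc_apply algebra_simps)

lemma brk_add: "brk n po a (b + c) = brk n po a b + brk n po a c"
 by (simp add: fun_eq_iff brk_def sc_apply algebra_simps moy_add_left moy_add_right)

lemma brk_moy: "brk n po r (moy n po a b) = moy n po (brk n po r a) b + moy n po a (brk n po r b)"
proof -
 have "lam (moy n po (brk n po r a) b) + lam (moy n po a (brk n po r b)) =
   moy n po (lam (brk n po r a)) b + moy n po a (lam (brk n po r b))"
  by (simp only: moy_lam_left moy_lam_right)
 also have "... = lam (brk n po r (moy n po a b))"
  unfolding lam_brk moy_fsc_left moy_fsc_right moy_diff_left moy_diff_right moy_assoc fsc_add[symmetric] by simp
 finally show ?thesis by (simp only: lam_inject lam_add[symmetric])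
qed

lemma brk_diff: "brk n po a (b - c) = brk n po a b - brk n po a c"
 using brk_add[of n po a "b - c" c] by simp

lemma lam_fsc: "lam (fsc z a) = fsc z (lam a)"
 by (simp add: fun_eq_iff lam_def fsc_def sc_apply split: nat.split)

lemma brk_fsc: "brk n po a (fsc z b) = fsc z (brk n po a b)"
 by (simp add: fun_eq_iff brk_def moy_fsc_left moy_fsc_right, simp add: brk_def fsc_def sc_apply algebra_simps)

lemma brk_lam: "brk n po a (lam b) = lam (brk n po a b)"
proof -
 have "lam (brk n po a (lam b)) = lam (lam (brk n po a b))"
  unfolding lam_brk moy_lam_left moy_lam_right lam_diff[symmetric] lam_fsc ..
 thus ?thesis by (simp only: lam_inject)
qed

text \<open>Bracketing with \<open>a\<close> is a derivation of the associative product by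
  \<open>brk_moy\<close>; the Jacobi identity is this derivation applied to a commutator.\<close>

lemma brk_jacobi: "brk n po a (brk n po b c) = brk n po (brk n po a b) c + brk n po b (brk n po a c)"
proof -
 have "lam (brk n po a (brk n po b c)) = brk n po a (lam (brk n po b c))" by (simp only: brk_lam)
 also have "... = lam (brk n po (brk n po a b) c) + lam (brk n po b (brk n po a c))"
  unfolding lam_brk brk_fsc brk_diff brk_moy fsc_add[symmetric]
  by (rule arg_cong[where f="fsc _"]) (simp add: algebra_simps)
 finally show ?thesis by (simp only: lam_inject lam_add[symmetric])
qed

text \<open>Total degree with weight 2 for the formal parameter and 1 for each \<open>y\<close>. The
  Moyal product respects it, since its operator trades two \<open>y\<close> for one formal
  parameter; only the division in \<open>brk\<close> costs 2.\<close>

definition Fil :: "nat => fib set" where "Fil d = {a. ALL m M. 2 * m + size M<d --> a m M = 0}"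

lemma moy_Fil: "a : Fil d ==> b : Fil e ==> moy n po a b : Fil (d + e)"
proof -
 assume a: "a : Fil d" and b: "b : Fil e"
 have "bidiff n po k (a p) (b q) M = 0" if "k + p + q = m" "2 * m + size M<d + e" for k p q m M
 proof (rule bidiff_eq_0, rule ccontr)
  fix M1 M2 :: "nat multiset"
  assume "size M1 + size M2 = size M + 2 * k" "~ (a p M1 = 0 | b q M2 = 0)"
  hence "~ 2 * p + size M1<d" "~ 2 * q + size M2<e" using a b by (auto simp: Fil_def)
  thus False using that \<open>size M1 + size M2 = size M + 2 * k\<close> by linarith
 qed
 thus ?thesis by (auto simp: Fil_def moy_def sum_fun_apply sc_apply triples_def intro!: sum.neutral)
qed

lemma brk_Fil: "a : Fil d ==> b : Fil e ==> brk n po a b : Fil (d + e - 2)"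
 using moy_Fil[of a d b e n po] moy_Fil[of b e a d n po] by (auto simp: Fil_def brk_def sc_apply add.commute)

text \<open>Even orders cancel in the commutator by antisymmetry, and orders from 3 on vanish on a
  polynomial of degree at most 2; the first-order term is all that remains.\<close>

lemma brk_fconst:
 assumes anti: "!!p q. p<n ==> q<n ==> po q p = - po p q"
  and u: "!!p q r. p<n ==> q<n ==> r<n ==> dy p (dy q (dy r u)) = 0"
 shows "brk n po (fconst u) b m = - bidiff n po 1 u (b m)"
proof -
 have z: "bidiff n po k u c = 0" if "k >= 3" for k c
 proof -
  obtain l where k: "k = Suc (Suc (Suc l))" using \<open>k >= 3\<close> by (metis Suc_diff_le Suc_n_not_le_n less_eqE add_Suc add_Suc_shift numeral_3_eq_3 plus_nat.add_0)
  show ?thesis unfolding k by (simp add: u bidiff_zero sc_zero dy_commute)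
 qed
 have "moy n po (fconst u) b (Suc m) - moy n po b (fconst u) (Suc m) =
   (SUM k<=Suc m. sc (moy_coeff k) (bidiff n po k u (b (Suc m - k)) - bidiff n po k (b (Suc m - k)) u))"
  by (simp only: moy_fconst_left moy_fconst_right sum_subtractf sc_diff)
 also have "... = (SUM k<=Suc m. if k = 1 then sc \<i> (bidiff n po 1 u (b m)) else 0)"
 proof (rule sum.cong[OF refl])
  fix k assume "k : {..Suc m}"
  have sw: "bidiff n po k c u = sc ((-1) ^ k) (bidiff n po k u c)" for c by (rule bidiff_swap[OF anti])
  consider "k = 0" | "k = 1" | "k = 2" | "k >= 3" by linarith
  thus "sc (moy_coeff k) (bidiff n po k u (b (Suc m - k)) - bidiff n po k (b (Suc m - k)) u) =
    (if k = 1 then sc \<i> (bidiff n po 1 u (b m)) else 0)"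
  proof cases
   case 1 thus ?thesis by (simp add: pprod_commute[of u] sc_zero)
  next
   case 3 thus ?thesis by (simp add: sw[unfolded 3] sc_one sc_zero)
  next
   case 4 thus ?thesis by (simp add: sw z sc_zero)
  next
   case 2
   have "sc (moy_coeff 1) (bidiff n po 1 u (b m) - sc ((-1) ^ 1) (bidiff n po 1 u (b m))) = sc \<i> (bidiff n po 1 u (b m))"
    by (simp add: fun_eq_iff sc_apply moy_coeff_def)
   thus ?thesis using 2 sw[of "b m"] by simp
  qed
 qed
 also have "... = sc \<i> (bidiff n po 1 u (b m))" by simp
 finally show ?thesis unfolding brk_def by (simp add: sc_sc sc_minus_one)
qed

subsection \<open>Linear substitutions and linear vector fields\<close>

text \<open>\<open>jst n J a\<close> is the power series \<open>y \<mapsto> a (J y)\<close>.\<close>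

fun jst_aux :: "nat => (nat => nat => complex) => nat list => pol => complex" where
 "jst_aux n J [] a = a {#}"
| "jst_aux n J (i # xs) a = (SUM k<n. J k i * jst_aux n J xs (dy k a))"

lemma jst_aux_move: "jst_aux n J (us @ i # vs) a = jst_aux n J (i # us @ vs) a"
proof (induction us arbitrary: a)
 case (Cons u us)
 have "jst_aux n J ((u # us) @ i # vs) a = (SUM k<n. SUM l<n. J k u * (J l i * jst_aux n J (us @ vs) (dy l (dy k a))))"
  using Cons by (simp add: sum_distrib_left)
 also have "... = (SUM l<n. SUM k<n. J l i * (J k u * jst_aux n J (us @ vs) (dy k (dy l a))))"
  by (subst sum.swap) (simp add: dy_commute mult.left_commute)
 finally show ?case by (simp add: sum_distrib_left)
qed simp

lemma jst_aux_mset: "mset xs = mset ys ==> jst_aux n J xs a = jst_aux n J ys a"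
proof (induction xs arbitrary: ys a)
 case (Cons x xs)
 hence "x : set ys" by (metis list.set_intros(1) mset_eq_setD)
 then obtain us vs where ys: "ys = us @ x # vs" by (meson split_list)
 hence "mset xs = mset (us @ vs)" using Cons.prems by simp
 thus ?case unfolding ys jst_aux_move using Cons.IH[of "us @ vs"] by simp
qed simp

definition jst :: "nat => (nat => nat => complex) => pol => pol" where
 "jst n J a M = jst_aux n J (sorted_list_of_multiset M) a"

lemma jst_empty: "jst n J a {#} = a {#}" by (simp add: jst_def)

lemma jst_add_mset: "jst n J a (add_mset i M) = (SUM k<n. J k i * jst n J (dy k a) M)"
proof -
 have "jst_aux n J (sorted_list_of_multiset (add_mset i M)) a = jst_aux n J (i # sorted_list_of_multiset M) a"
  by (rule jst_aux_mset) (simp del: sorted_list_of_multiset_insert)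
 thus ?thesis by (simp add: jst_def)
qed

lemma dy_jst: "dy i (jst n J a) = (SUM k<n. sc (J k i) (jst n J (dy k a)))"
 by (simp add: fun_eq_iff dy_def[of i "jst n J a"] jst_add_mset sum_fun_apply sc_apply)

lemma jst_add: "jst n J (a + b) = jst n J a + jst n J b"
proof
 fix M show "jst n J (a + b) M = (jst n J a + jst n J b) M"
  by (induction M arbitrary: a b) (simp_all add: jst_empty jst_add_mset dy_add distrib_left sum.distrib)
qed

lemma jst_sc: "jst n J (sc z a) = sc z (jst n J a)"
proof
 fix M show "jst n J (sc z a) M = sc z (jst n J a) M"
  by (induction M arbitrary: a) (simp_all add: jst_empty jst_add_mset dy_sc sc_apply sum_distrib_left mult.left_commute)
qed

lemma jst_zero: "jst n J 0 = 0" using jst_sc[of n J 0 0] by (simp add: sc_zero_left)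

lemma jst_diff: "jst n J (a - b) = jst n J a - jst n J b" using jst_add[of n J "a - b" b] by simp

lemma jst_sum: "jst n J (SUM i:I. f i) = (SUM i:I. jst n J (f i))"
 using sum_comp_morphism[of "jst n J" f I] by (simp add: jst_zero jst_add comp_def)

lemma pprod_sum_left: "pprod (SUM i:I. f i) b = (SUM i:I. pprod (f i) b)"
 and pprod_sum_right: "pprod a (SUM i:I. f i) = (SUM i:I. pprod a (f i))"
 using bidiff_sum_left[of n po 0 f I b] bidiff_sum_right[of n po 0 a f I] by simp_all

lemma jst_pprod: "jst n J (pprod a b) = pprod (jst n J a) (jst n J b)"
proof
 fix M show "jst n J (pprod a b) M = pprod (jst n J a) (jst n J b) M"
 proof (induction M arbitrary: a b)
  case (add i M)
  have "jst n J (pprod a b) (add_mset i M) =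
    (SUM k<n. J k i * (pprod (jst n J (dy k a)) (jst n J b) M + pprod (jst n J a) (jst n J (dy k b)) M))"
   by (simp add: jst_add_mset dy_pprod jst_add add)
  also have "... = pprod (jst n J a) (jst n J b) (add_mset i M)"
   by (simp add: pprod_add_mset dy_jst pprod_sum_left pprod_sum_right pprod_sc_left pprod_sc_right sum_fun_apply sc_apply
     distrib_left sum.distrib)
  finally show ?case .
 qed (simp add: jst_empty pprod_empty)
qed

lemma sum3_swap: "(SUM q:A. SUM k:B. SUM l:C. f q k l) = (SUM k:B. SUM l:C. SUM q:A. f q k l)"
 by (subst sum.swap, rule sum.cong[OF refl], rule sum.swap)

lemma sum4_swap: "(SUM p:A. SUM q:B. SUM k:C. SUM l:D. f p q k l) = (SUM k:C. SUM l:D. SUM p:A. SUM q:B. f p q k l)"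
proof -
 have "(SUM p:A. SUM q:B. SUM k:C. SUM l:D. f p q k l) = (SUM p:A. SUM k:C. SUM l:D. SUM q:B. f p q k l)"
  by (rule sum.cong[OF refl], rule sum3_swap)
 also have "... = (SUM k:C. SUM l:D. SUM p:A. SUM q:B. f p q k l)" by (rule sum3_swap)
 finally show ?thesis .
qed

text \<open>Substitution is compatible with the operators because \<open>po'\<close> is the image of
  the bivector \<open>po\<close> under \<open>J\<close>; for the Jacobian of a symplectic map this
  will be \<open>pois_J\<close>.\<close>

lemma jst_bidiff:
 assumes J: "!!k l. k<n ==> l<n ==> po' k l = (SUM p<n. SUM q<n. J k p * J l q * po p q)"
 shows "jst n J (bidiff n po' r a b) = bidiff n po r (jst n J a) (jst n J b)"
proof (induction r arbitrary: a b)
 case 0 show ?case by (simp add: jst_pprod)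
next
 case (Suc r)
 have "bidiff n po (Suc r) (jst n J a) (jst n J b) =
   (SUM p<n. SUM q<n. SUM k<n. SUM l<n. sc (J k p * J l q * po p q) (bidiff n po r (jst n J (dy k a)) (jst n J (dy l b))))"
  by (simp only: bidiff.simps dy_jst bidiff_sum_left bidiff_sc_left)
    (simp only: bidiff_sum_right bidiff_sc_right sc_sum sc_sc, simp only: mult_ac)
 also have "... = (SUM k<n. SUM l<n. SUM p<n. SUM q<n. sc (J k p * J l q * po p q) (bidiff n po r (jst n J (dy k a)) (jst n J (dy l b))))"
  by (rule sum4_swap)
 also have "... = (SUM k<n. SUM l<n. sc (po' k l) (bidiff n po r (jst n J (dy k a)) (jst n J (dy l b))))"
  by (simp add: J sc_sum_left)
 also have "... = jst n J (bidiff n po' (Suc r) a b)" by (simp add: jst_sum jst_sc Suc)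
 finally show ?case ..
qed

lemma jst_ymul:
 assumes J: "!!k i. i >= n ==> J k i = 0" and k: "k<n"
 shows "jst n J (ymul k a) = (SUM i<n. sc (J k i) (ymul i (jst n J a)))"
proof
 fix M show "jst n J (ymul k a) M = (SUM i<n. sc (J k i) (ymul i (jst n J a))) M"
 proof (induction M arbitrary: a)
  case empty show ?case by (simp add: jst_empty ymul_empty sum_fun_apply sc_apply)
 next
  case (add i M)
  have "jst n J (ymul k a) (add_mset i M) = (SUM l<n. J l i * (if l = k then jst n J a M else 0))
    + (SUM l<n. J l i * jst n J (ymul k (dy l a)) M)"
   by (simp add: jst_add_mset dy_ymul jst_add distrib_left sum.distrib) 
     (rule sum.cong, auto simp: jst_zero)
  also have "(SUM l<n. J l i * (if l = k then jst n J a M else 0)) = J k i * jst n J a M"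
   using k by (simp add: if_distrib cong: if_cong)
  also have "(SUM l<n. J l i * jst n J (ymul k (dy l a)) M) = (SUM l<n. SUM j<n. J l i * (J k j * ymul j (jst n J (dy l a)) M))"
   by (simp add: add sum_fun_apply sc_apply sum_distrib_left)
  also have "... = (SUM j<n. J k j * ymul j (SUM l<n. sc (J l i) (jst n J (dy l a))) M)"
   by (subst sum.swap) (simp add: ymul_sum ymul_sc sum_fun_apply sc_apply sum_distrib_left mult.left_commute)
  also have "J k i * jst n J a M + ... = (SUM j<n. J k j * dy i (ymul j (jst n J a)) M)"
  proof -
   have "J k i * jst n J a M = (SUM j<n. J k j * (if i = j then jst n J a M else 0))"
    using J[of i k] by (cases "i<n") (auto simp: if_distrib cong: if_cong)
   moreover have "dy i (ymul j (jst n J a)) M = (if i = j then jst n J a M else 0) + ymul j (dy i (jst n J a)) M" for j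
    by (simp add: dy_ymul)
   ultimately show ?thesis by (simp add: dy_jst distrib_left sum.distrib)
  qed
  finally show ?case by (simp add: sum_fun_apply sc_apply dy_def)
 qed
qed

text \<open>A linear substitution preserves homogeneous parts. The weight \<open>g\<close> is
  arbitrary, so that an indicator function gives the truncation in
  \<open>jst_size_zero\<close>.\<close>

lemma jst_size_scale: "jst n J (%M. g (size M) * a M) M = g (size M) * jst n J a M"
proof (induction M arbitrary: a g)
 case (add i M)
 have "dy k (%M. g (size M) * a M) = (%M. (%s. g (Suc s)) (size M) * dy k a M)" for k
  by (simp add: dy_def fun_eq_iff)
 moreover have "jst n J (%M. (%s. g (Suc s)) (size M) * dy k a M) M = g (Suc (size M)) * jst n J (dy k a) M" for k
  by (rule add)
 ultimately show ?case by (simp add: jst_add_mset sum_distrib_left mult.left_commute)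
qed (simp add: jst_empty)

lemma jst_size_zero:
 assumes "!!M. size M<d ==> a M = 0" "size M<d"
 shows "jst n J a M = 0"
proof -
 have "a = (%M. (%s. if s<d then 0 else 1) (size M) * a M)" using assms(1) by (auto simp: fun_eq_iff)
 thus ?thesis using jst_size_scale[of n J "%s. if s<d then 0 else 1" a M] assms(2) by simp
qed

lemma jst_pone: "jst n J pone = pone"
proof
 fix M show "jst n J pone M = pone M"
  by (cases M) (simp_all add: jst_empty jst_add_mset dy_pone jst_zero, simp add: pone_def)
qed

definition fmap :: "(pol => pol) => fib => fib" where "fmap T a m = T (a m)"

lemma jst_moy:
 assumes J: "!!k l. k<n ==> l<n ==> po' k l = (SUM p<n. SUM q<n. J k p * J l q * po p q)"
 shows "fmap (jst n J) (moy n po' a b) = moy n po (fmap (jst n J) a) (fmap (jst n J) b)"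
 by (simp add: fun_eq_iff[of "fmap _ _"] fmap_def moy_def split_beta jst_sum jst_sc jst_bidiff[OF J])

lemma jst_brk:
 assumes J: "!!k l. k<n ==> l<n ==> po' k l = (SUM p<n. SUM q<n. J k p * J l q * po p q)"
 shows "fmap (jst n J) (brk n po' a b) = brk n po (fmap (jst n J) a) (fmap (jst n J) b)"
proof
 fix m
 have "jst n J (moy n po' a b m) = moy n po (fmap (jst n J) a) (fmap (jst n J) b) m" for a b m
 proof -
  have "fmap (jst n J) (moy n po' a b) = moy n po (fmap (jst n J) a) (fmap (jst n J) b)"
   by (rule jst_moy) (rule J)
  from fun_cong[OF this, of m] show ?thesis by (simp add: fmap_def[of _ "moy n po' a b"])
 qed
 thus "fmap (jst n J) (brk n po' a b) m = brk n po (fmap (jst n J) a) (fmap (jst n J) b) m"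
  by (simp add: fmap_def[of _ "brk n po' a b"] brk_def jst_sc jst_diff)
qed

text \<open>The linear vector field of a matrix: the derivation by which connection and curvature
  matrices act on power series in the fibre.\<close>

definition Lop :: "nat => (nat => nat => complex) => pol => pol" where
 "Lop n A a = (SUM j<n. SUM k<n. sc (A k j) (ymul j (dy k a)))"

lemma Lop_add: "Lop n A (a + b) = Lop n A a + Lop n A b"
 by (simp add: Lop_def dy_add ymul_add sc_add sum.distrib)

lemma Lop_sc: "Lop n A (sc z a) = sc z (Lop n A a)"
 by (simp add: Lop_def dy_sc ymul_sc sc_sc sc_sum mult.commute)

lemma dy_Lop: "p<n ==> dy p (Lop n A a) = (SUM k<n. sc (A k p) (dy k a)) + Lop n A (dy p a)"
proof -
 assume p: "p<n"
 have "dy p (Lop n A a) = (SUM j<n. SUM k<n. sc (A k j) (if p = j then dy k a else 0)) + Lop n A (dy p a)"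
  by (simp add: Lop_def dy_sum dy_sc dy_ymul sc_add sum.distrib dy_commute[of p])
 also have "(SUM j<n. SUM k<n. sc (A k j) (if p = j then dy k a else 0)) = (SUM j<n. if p = j then (SUM k<n. sc (A k j) (dy k a)) else 0)"
  by (rule sum.cong) (auto simp: sc_zero)
 also have "... = (SUM k<n. sc (A k p) (dy k a))" using p by simp
 finally show ?thesis .
qed

lemma Lop_pprod: "Lop n A (pprod a b) = pprod (Lop n A a) b + pprod a (Lop n A b)"
proof -
 have r: "pprod a (ymul j b) = ymul j (pprod a b)" for j a b
  by (simp add: pprod_commute[of a] pprod_ymul_left)
 show ?thesis
  by (simp add: Lop_def dy_pprod ymul_add sc_add sum.distrib pprod_sum_left pprod_sum_right pprod_sc_left pprod_sc_right
     pprod_ymul_left r)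
qed

lemma Lop_ymul: "l<n ==> Lop n A (ymul l a) = (SUM j<n. sc (A l j) (ymul j a)) + ymul l (Lop n A a)"
proof -
 assume l: "l<n"
 have "Lop n A (ymul l a) = (SUM j<n. SUM k<n. sc (A k j) (if k = l then ymul j a else 0)) + ymul l (Lop n A a)"
  by (simp add: Lop_def dy_ymul ymul_add sc_add sum.distrib ymul_sum ymul_sc ymul_commute[of l])
    (intro sum.cong refl, auto simp: ymul_zero)
 also have "(SUM j<n. SUM k<n. sc (A k j) (if k = l then ymul j a else 0)) = (SUM j<n. SUM k<n. if k = l then sc (A k j) (ymul j a) else 0)"
  by (intro sum.cong refl) (auto simp: sc_zero)
 also have "... = (SUM j<n. sc (A l j) (ymul j a))" using l by simp
 finally show ?thesis .
qed

lemma Lop_pone: "Lop n A pone = 0" by (simp add: Lop_def dy_pone ymul_zero sc_zero)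

lemma Lop_zero: "Lop n A 0 = 0" by (simp add: Lop_def dy_zero ymul_zero sc_zero)

text \<open>The second-order parts agree since the \<open>ymul\<close> commute and the
  \<open>dy\<close> commute. What is left is the commutator of the matrices, in the reversed order
  proper to vector fields.\<close>

lemma Lop_compose: "Lop n A (Lop n B a) - Lop n B (Lop n A a) =
  Lop n (%m l. SUM k<n. B m k * A k l - A m k * B k l) a"
proof -
 have e: "Lop n A (Lop n B a) = (SUM l<n. SUM m<n. sc (SUM k<n. B m k * A k l) (ymul l (dy m a)))
   + (SUM j<n. SUM k<n. sc (A k j) (ymul j (Lop n B (dy k a))))" for A B
 proof -
  have "Lop n A (Lop n B a) = (SUM j<n. SUM k<n. SUM m<n. sc (B m k * A k j) (ymul j (dy m a)))
   + (SUM j<n. SUM k<n. sc (A k j) (ymul j (Lop n B (dy k a))))"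
   unfolding Lop_def[of n A] by (simp add: dy_Lop ymul_add ymul_sum ymul_sc sc_add sc_sum sc_sc sum.distrib mult.commute)
  also have "(SUM j<n. SUM k<n. SUM m<n. sc (B m k * A k j) (ymul j (dy m a))) = 
    (SUM j<n. SUM m<n. sc (SUM k<n. B m k * A k j) (ymul j (dy m a)))"
   by (rule sum.cong[OF refl], subst sum.swap) (simp add: sc_sum_left)
  finally show ?thesis .
 qed
 have s: "(SUM j<n. SUM k<n. sc (A k j) (ymul j (Lop n B (dy k a)))) = (SUM j<n. SUM k<n. sc (B k j) (ymul j (Lop n A (dy k a))))"
 proof -
  have "(SUM j<n. SUM k<n. sc (A k j) (ymul j (Lop n B (dy k a)))) =
   (SUM j<n. SUM k<n. SUM l<n. SUM m<n. sc (A k j * B m l) (ymul j (ymul l (dy m (dy k a)))))"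
   by (simp add: Lop_def ymul_sum ymul_sc sc_sum sc_sc)
  also have "... = (SUM l<n. SUM m<n. SUM j<n. SUM k<n. sc (A k j * B m l) (ymul j (ymul l (dy m (dy k a)))))"
   by (rule sum4_swap)
  also have "... = (SUM l<n. SUM m<n. SUM j<n. SUM k<n. sc (B m l * A k j) (ymul l (ymul j (dy k (dy m a)))))"
   by (intro sum.cong refl) (simp only: mult.commute[of "A _ _"] ymul_commute dy_commute)
  also have "... = (SUM j<n. SUM k<n. sc (B k j) (ymul j (Lop n A (dy k a))))"
   by (simp add: Lop_def ymul_sum ymul_sc sc_sum sc_sc)
  finally show ?thesis .
 qed
 have "Lop n A (Lop n B a) - Lop n B (Lop n A a) = 
   (SUM l<n. SUM m<n. sc (SUM k<n. B m k * A k l) (ymul l (dy m a))) - (SUM l<n. SUM m<n. sc (SUM k<n. A m k * B k l) (ymul l (dy m a)))"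
  unfolding e[of A B] e[of B A] s by simp
 also have "... = Lop n (%m l. SUM k<n. B m k * A k l - A m k * B k l) a"
  unfolding Lop_def sum_subtractf[symmetric] by (intro sum.cong refl) (simp add: fun_eq_iff sc_apply sum_subtractf left_diff_distrib)
 finally show ?thesis .
qed

text \<open>Quadratic fibre functions act as linear Hamiltonian vector fields; this is how curvature
  becomes a bracket. The factor 1/2 is compensated by the two equal derivatives of the symmetric
  form \<open>q\<close>.\<close>

lemma brk_quadratic:
 assumes anti: "!!p q. p<n ==> q<n ==> po q p = - po p q"
  and sym: "!!j k. j<n ==> k<n ==> q k j = q j k"
  and A: "!!l j. l<n ==> j<n ==> A l j = - (SUM k<n. po k l * q k j)"
 shows "brk n po (fconst (sc (1/2) (SUM j<n. SUM k<n. sc (q k j) (ymul k (ymul j pone))))) b m = Lop n A (b m)"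
proof -
 define u where "u = sc (1/2) (SUM j<n. SUM k<n. sc (q k j) (ymul k (ymul j pone)))"
 have d2: "dy p (ymul k (ymul j pone)) = (if p = k then ymul j pone else 0) + (if p = j then ymul k pone else 0)" for p k j
  by (auto simp: dy_ymul dy_pone ymul_zero ymul_add)
 have du: "dy p u = (SUM j<n. sc (q p j) (ymul j pone))" if p: "p<n" for p
 proof -
  have "dy p u = sc (1/2) ((SUM j<n. SUM k<n. sc (q k j) (if p = k then ymul j pone else 0))
    + (SUM j<n. SUM k<n. sc (q k j) (if p = j then ymul k pone else 0)))"
   by (simp add: u_def dy_sc dy_sum d2 sc_add sum.distrib)
  also have "(SUM j<n. SUM k<n. sc (q k j) (if p = k then ymul j pone else 0)) = (SUM j<n. SUM k<n. if p = k then sc (q k j) (ymul j pone) else 0)"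
   by (intro sum.cong refl) (auto simp: sc_zero)
  also have "... = (SUM j<n. sc (q p j) (ymul j pone))" using p by simp
  also have "(SUM j<n. SUM k<n. sc (q k j) (if p = j then ymul k pone else 0)) = (SUM j<n. if p = j then SUM k<n. sc (q k j) (ymul k pone) else 0)"
   by (intro sum.cong refl) (auto simp: sc_zero)
  also have "... = (SUM k<n. sc (q k p) (ymul k pone))" using p by simp
  also have "... = (SUM j<n. sc (q p j) (ymul j pone))" using p by (intro sum.cong refl) (simp add: sym[of p])
  finally have "dy p u = sc (1/2) ((SUM j<n. sc (q p j) (ymul j pone)) + (SUM j<n. sc (q p j) (ymul j pone)))" .
  moreover have "sc (1/2) (v + v) = v" for v :: pol by (simp add: fun_eq_iff sc_apply)
  ultimately show ?thesis by (simp only:)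
 qed
 have ddu: "dy p (dy q' (dy r u)) = 0" if "r<n" for p q' r
 proof -
  have "dy p (dy q' (ymul j pone)) = 0" for j by (simp add: dy_ymul dy_pone ymul_zero dy_zero)
  thus ?thesis unfolding du[OF that] by (simp add: dy_sum dy_sc sc_zero)
 qed
 have "brk n po (fconst u) b m = - bidiff n po 1 u (b m)" by (rule brk_fconst[OF anti ddu])
 also have "bidiff n po 1 u (b m) = (SUM p<n. SUM l<n. SUM j<n. sc (po p l * q p j) (ymul j (dy l (b m))))"
  by (simp add: du pprod_sum_left pprod_sc_left pprod_ymul_left pprod_pone sc_sum sc_sc)
 also have "... = (SUM j<n. SUM l<n. SUM p<n. sc (po p l * q p j) (ymul j (dy l (b m))))"
  by (subst sum.swap, subst (2) sum.swap) (subst sum.swap, rule refl)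
 also have "... = (SUM j<n. SUM l<n. sc (- A l j) (ymul j (dy l (b m))))"
  by (intro sum.cong refl) (simp add: A sc_sum_left)
 also have "- ... = Lop n A (b m)" by (simp add: Lop_def sc_minus_left sum_negf)
 finally show ?thesis unfolding u_def .
qed

text \<open>Linear fibre functions act as constant vector fields. They are the test elements that
  detect the centre when \<open>po\<close> is nondegenerate.\<close>

lemma brk_linear:
 assumes anti: "!!p q. p<n ==> q<n ==> po q p = - po p q" and l: "l<n"
 shows "brk n po (fconst (ymul l pone)) b m = - (SUM q<n. sc (po l q) (dy q (b m)))"
proof -
 have d: "dy p (ymul l pone) = (if p = l then pone else 0)" for p by (simp add: dy_ymul dy_pone ymul_zero)
 have "brk n po (fconst (ymul l pone)) b m = - bidiff n po 1 (ymul l pone) (b m)"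
  by (rule brk_fconst[OF anti]) (auto simp: d dy_pone dy_zero)
 also have "bidiff n po 1 (ymul l pone) (b m) = (SUM p<n. if p = l then (SUM q<n. sc (po p q) (dy q (b m))) else 0)"
  unfolding One_nat_def bidiff.simps d by (intro sum.cong refl) (auto simp: pprod_pone pprod_zero sc_zero)
 also have "... = (SUM q<n. sc (po l q) (dy q (b m)))" using l by simp
 finally show ?thesis .
qed

section \<open>Fedosov's construction, abstractly\<close>

text \<open>The elements of \<open>S\<close> play the role of sections of the Weyl bundle, \<open>d i\<close> and \<open>y i\<close> of
  \<open>\<partial>/\<partial>y\<^sub>i\<close> and multiplication by \<open>y\<^sub>i\<close>, \<open>N i\<close> of a symplectic torsion-free covariant derivative with
  curvature \<open>brk (R i j)\<close>, \<open>dinv s\<close> of the inverse of \<open>\<Sum>y\<^sub>i \<partial>/\<partial>y\<^sub>i + s\<close>, \<open>ct\<close> of the projection to the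
  part not involving \<open>y\<close>, and \<open>Fl\<close> is the filtration by total degree.\<close>

locale fedosov =
 fixes n :: nat and S :: "'w::ab_group_add set" and Fl :: "nat => 'w set"
  and d y N :: "nat => 'w => 'w" and dinv :: "nat => 'w => 'w" and ct :: "'w => 'w"
  and brk :: "'w => 'w => 'w" and R :: "nat => nat => 'w"
 assumes S_zero: "0 : S" and S_add: "a : S ==> b : S ==> a + b : S" and S_diff: "a : S ==> b : S ==> a - b : S"
  and d_S: "a : S ==> i<n ==> d i a : S" and y_S: "a : S ==> i<n ==> y i a : S"
  and N_S: "a : S ==> i<n ==> N i a : S" and dinv_S: "a : S ==> dinv s a : S"
  and brk_S: "a : S ==> b : S ==> brk a b : S" and R_S: "i<n ==> j<n ==> R i j : S"
  and d_add: "d i (a + b) = d i a + d i b" and y_add: "y i (a + b) = y i a + y i b"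
  and dinv_add: "dinv s (a + b) = dinv s a + dinv s b" and ct_add: "ct (a + b) = ct a + ct b"
  and brk_add: "brk a (b + c) = brk a b + brk a c" and brk_anti: "brk b a = - brk a b"
  and N_add: "a : S ==> b : S ==> i<n ==> N i (a + b) = N i a + N i b"
  and d_commute: "d i (d j a) = d j (d i a)" and d_y: "d i (y j a) = (if i = j then a else 0) + y j (d i a)"
  and y_commute: "y i (y j a) = y j (y i a)"
  and dinv1: "a : S ==> (SUM i<n. y i (d i (dinv 1 a))) + dinv 1 a = a"
  and dinv0: "a : S ==> (SUM i<n. y i (d i (dinv 0 a))) = a - ct a"
  and dinv1': "a : S ==> dinv 1 ((SUM i<n. y i (d i a)) + a) = a"
  and dinv2': "a : S ==> dinv 2 ((SUM i<n. y i (d i a)) + a + a) = a"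
  and dinv0': "a : S ==> dinv 0 (SUM i<n. y i (d i a)) = a - ct a"
  and y_dinv: "y i (dinv 1 a) = dinv 0 (y i a)" and ct_y: "ct (y i a) = 0" and ct_dinv0: "ct (dinv 0 a) = 0"
  and Fl_0: "a : Fl 0" and Fl_zero: "0 : Fl k" and Fl_add: "a : Fl k ==> b : Fl k ==> a + b : Fl k"
  and Fl_diff: "a : Fl k ==> b : Fl k ==> a - b : Fl k" and Fl_Suc: "a : Fl (Suc k) ==> a : Fl k"
  and Fl_sep: "(!!k. a : Fl k) ==> a = 0"
  and Fl_d: "a : Fl (Suc k) ==> d i a : Fl k" and Fl_y: "a : Fl k ==> y i a : Fl (Suc k)"
  and Fl_N: "a : S ==> i<n ==> a : Fl k ==> N i a : Fl k" and Fl_dinv: "a : Fl k ==> dinv s a : Fl k"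
  and Fl_brk: "a : Fl p ==> b : Fl q ==> brk a b : Fl (p + q - 2)" and Fl_R: "R i j : Fl 2"
  and complete: "(!!k. x k : S) ==> (!!k. x (Suc k) - x k : Fl k) ==> EX z:S. ALL k. z - x k : Fl k"
  and no_2_torsion: "a + a = (0::'w) ==> a = 0"
  and d_brk: "d i (brk a b) = brk (d i a) b + brk a (d i b)"
  and N_brk: "a : S ==> b : S ==> i<n ==> N i (brk a b) = brk (N i a) b + brk a (N i b)"
  and jacobi: "brk a (brk b c) = brk (brk a b) c + brk b (brk a c)"
  and torsion: "a : S ==> i<n ==> j<n ==> d i (N j a) - N j (d i a) = d j (N i a) - N i (d j a)"
  and curvature: "a : S ==> i<n ==> j<n ==> N i (N j a) - N j (N i a) = brk (R i j) a"
  and R_anti: "i<n ==> j<n ==> R j i = - R i j"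
  and center: "z : S ==> ct z = 0 ==> (!!a. a : S ==> brk z a = 0) ==> z = 0"
  and ct_d_R: "i<n ==> j<n ==> k<n ==> ct (d i (R j k)) = 0"
  and ct_N_R: "i<n ==> j<n ==> k<n ==> ct (N i (R j k)) = 0"
begin

lemma d_zero: "d i 0 = 0" and y_zero: "y i 0 = 0" and dinv_zero: "dinv s 0 = 0" and ct_zero: "ct 0 = 0"
 using d_add[of i 0 0] y_add[of i 0 0] dinv_add[of s 0 0] ct_add[of 0 0] by simp_all

lemma d_uminus: "d i (- a) = - d i a" and y_uminus: "y i (- a) = - y i a" and dinv_uminus: "dinv s (- a) = - dinv s a"
 using d_add[of i a "- a"] y_add[of i a "- a"] dinv_add[of s a "- a"]
 by (simp_all add: d_zero y_zero dinv_zero eq_neg_iff_add_eq_0 add.commute)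

lemma d_diff: "d i (a - b) = d i a - d i b" and y_diff: "y i (a - b) = y i a - y i b"
 and dinv_diff: "dinv s (a - b) = dinv s a - dinv s b"
 using d_add[of i a "- b"] y_add[of i a "- b"] dinv_add[of s a "- b"] by (simp_all add: d_uminus y_uminus dinv_uminus)

lemma d_sum: "d i (SUM j:J. f j) = (SUM j:J. d i (f j))"
 by (induction J rule: infinite_finite_induct) (auto simp: d_zero d_add)

lemma y_sum: "y i (SUM j:J. f j) = (SUM j:J. y i (f j))"
 by (induction J rule: infinite_finite_induct) (auto simp: y_zero y_add)

lemma dinv_sum: "dinv s (SUM j:J. f j) = (SUM j:J. dinv s (f j))"
 by (induction J rule: infinite_finite_induct) (auto simp: dinv_zero dinv_add)

lemma ct_sum: "ct (SUM j:J. f j) = (SUM j:J. ct (f j))"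
 by (induction J rule: infinite_finite_induct) (auto simp: ct_zero ct_add)

lemma S_sum: "(!!j. j : J ==> f j : S) ==> (SUM j:J. f j) : S"
 by (induction J rule: infinite_finite_induct) (auto simp: S_zero S_add)

lemma Fl_sum: "(!!j. j : J ==> f j : Fl k) ==> (SUM j:J. f j) : Fl k"
 by (induction J rule: infinite_finite_induct) (auto simp: Fl_zero Fl_add)

lemma S_uminus: "a : S ==> - a : S" using S_diff[OF S_zero] by fastforce

lemma Fl_uminus: "a : Fl k ==> - a : Fl k" using Fl_diff[OF Fl_zero] by fastforce

lemma Fl_le: "k <= l ==> a : Fl l ==> a : Fl k"
 by (induction l) (auto simp: le_Suc_eq intro: Fl_Suc)

lemma brk_zero: "brk a 0 = 0" using brk_add[of a 0 0] by simp

lemma brk_zero_left: "brk 0 a = 0" using brk_anti[of 0 a] brk_zero by simp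

lemma brk_add_left: "brk (a + b) c = brk a c + brk b c"
 using brk_anti[of "a + b" c] brk_add[of c a b] brk_anti[of a c] brk_anti[of b c] by simp

lemma brk_uminus: "brk a (- b) = - brk a b"
 using brk_add[of a b "- b"] brk_zero by (simp add: eq_neg_iff_add_eq_0 add.commute)

lemma brk_uminus_left: "brk (- a) b = - brk a b"
 using brk_add_left[of a "- a" b] brk_zero_left by (simp add: eq_neg_iff_add_eq_0 add.commute)

lemma brk_diff: "brk a (b - c) = brk a b - brk a c" using brk_add[of a b "- c"] brk_uminus by simp

lemma brk_diff_left: "brk (a - b) c = brk a c - brk b c" using brk_add_left[of a "- b" c] brk_uminus_left by simp

lemma N_zero: "i<n ==> N i 0 = 0" using N_add[OF S_zero S_zero] by simp

lemma N_uminus: "a : S ==> i<n ==> N i (- a) = - N i a"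
 using N_add[of a "- a" i] S_uminus N_zero[of i] by (simp add: eq_neg_iff_add_eq_0 add.commute)

lemma N_diff: "a : S ==> b : S ==> i<n ==> N i (a - b) = N i a - N i b"
 using N_add[of a "- b" i] S_uminus N_uminus by simp

text \<open>Operator identities replace index calculations: the bracket with the sum is the cyclic
  sum of \<open>[d\<^sub>i, [N\<^sub>j, N\<^sub>k]]\<close>, which cancels because
  \<open>[d\<^sub>i, N\<^sub>j]\<close> is symmetric in its indices. An element that brackets to
  zero and has no term free of \<open>y\<close> vanishes by \<open>center\<close>.\<close>

lemma bianchi1:
 assumes ijk: "i<n" "j<n" "k<n"
 shows "d i (R j k) + d j (R k i) + d k (R i j) = 0"
proof (rule center)
 show "d i (R j k) + d j (R k i) + d k (R i j) : S" using ijk by (simp add: S_add d_S R_S)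
 show "ct (d i (R j k) + d j (R k i) + d k (R i j)) = 0" using ijk by (simp add: ct_add ct_d_R)
 fix a assume a: "a : S"
 define \<sigma> where "\<sigma> i j b = d i (N j b) - N j (d i b)" for i j b
 have \<sigma>: "\<sigma> i j b = \<sigma> j i b" "\<sigma> i j b : S" if "i<n" "j<n" "b : S" for i j b
  using torsion[of b i j] that by (simp_all add: \<sigma>_def S_diff d_S N_S)
 have e: "brk (d i (R j k)) a = \<sigma> i j (N k a) + N j (\<sigma> i k a) - \<sigma> i k (N j a) - N k (\<sigma> i j a)"
  if "i<n" "j<n" "k<n" for i j k
 proof -
  have "brk (d i (R j k)) a = d i (N j (N k a) - N k (N j a)) - (N j (N k (d i a)) - N k (N j (d i a)))"
   using that a by (simp add: curvature d_S d_brk)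
  also have "... = \<sigma> i j (N k a) + N j (d i (N k a)) - (\<sigma> i k (N j a) + N k (d i (N j a))) 
    - (N j (N k (d i a)) - N k (N j (d i a)))" by (simp add: \<sigma>_def d_diff)
  also have "N j (d i (N k a)) = N j (\<sigma> i k a) + N j (N k (d i a))"
   using that a by (simp add: N_add[symmetric] \<sigma>(2) d_S N_S) (simp add: \<sigma>_def)
  also have "N k (d i (N j a)) = N k (\<sigma> i j a) + N k (N j (d i a))"
   using that a by (simp add: N_add[symmetric] \<sigma>(2) d_S N_S) (simp add: \<sigma>_def)
  finally show ?thesis by (simp add: algebra_simps)
 qed
 have "brk (d i (R j k) + d j (R k i) + d k (R i j)) a = 
   (\<sigma> i j (N k a) - \<sigma> j i (N k a)) + (\<sigma> j k (N i a) - \<sigma> k j (N i a)) + (\<sigma> k i (N j a) - \<sigma> i k (N j a))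
   + (N i (\<sigma> k j a) - N i (\<sigma> j k a)) + (N j (\<sigma> i k a) - N j (\<sigma> k i a)) + (N k (\<sigma> j i a) - N k (\<sigma> i j a))"
  unfolding brk_add_left e[OF ijk] e[OF ijk(2,3,1)] e[OF ijk(3,1,2)] by (simp add: algebra_simps)
 also have "... = 0"
  using \<sigma>(1)[OF ijk(1,2) N_S[OF a ijk(3)]] \<sigma>(1)[OF ijk(2,3) N_S[OF a ijk(1)]] \<sigma>(1)[OF ijk(3,1) N_S[OF a ijk(2)]]
   \<sigma>(1)[OF ijk(1,2) a] \<sigma>(1)[OF ijk(2,3) a] \<sigma>(1)[OF ijk(3,1) a] by simp
 finally show "brk (d i (R j k) + d j (R k i) + d k (R i j)) a = 0" .
qed

text \<open>Here the Jacobi identity of the operators \<open>N\<close> shows that the sum brackets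
  to zero.\<close>

lemma bianchi2:
 assumes ijk: "i<n" "j<n" "k<n"
 shows "N i (R j k) + N j (R k i) + N k (R i j) = 0"
proof (rule center)
 show "N i (R j k) + N j (R k i) + N k (R i j) : S" using ijk by (simp add: S_add N_S R_S)
 show "ct (N i (R j k) + N j (R k i) + N k (R i j)) = 0" using ijk by (simp add: ct_add ct_N_R)
 fix a assume a: "a : S"
 have e: "brk (N i (R j k)) a = N i (N j (N k a)) - N i (N k (N j a)) - (N j (N k (N i a)) - N k (N j (N i a)))"
  if "i<n" "j<n" "k<n" for i j k
 proof -
  have "brk (N i (R j k)) a = N i (brk (R j k) a) - brk (R j k) (N i a)"
   using that a by (simp add: N_brk R_S)
  thus ?thesis using that a by (simp add: curvature[symmetric] N_S N_diff)
 qed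
 show "brk (N i (R j k) + N j (R k i) + N k (R i j)) a = 0"
  unfolding brk_add_left e[OF ijk] e[OF ijk(2,3,1)] e[OF ijk(3,1,2)] by (simp add: algebra_simps)
qed

text \<open>The covariant derivative minus Fedosov's \<delta>, whose components are the
  \<open>d i\<close>; the flat derivation will be \<open>E\<close> corrected by a bracket.\<close>

definition E :: "nat => 'w => 'w" where "E i a = N i a - d i a"

lemma E_S: "a : S ==> i<n ==> E i a : S"
 by (simp add: E_def S_diff N_S d_S)

lemma E_add: "a : S ==> b : S ==> i<n ==> E i (a + b) = E i a + E i b"
 and E_diff: "a : S ==> b : S ==> i<n ==> E i (a - b) = E i a - E i b"
 by (simp_all add: E_def N_add N_diff d_add d_diff)

lemma E_brk: "a : S ==> b : S ==> i<n ==> E i (brk a b) = brk (E i a) b + brk a (E i b)"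
 by (simp add: E_def N_brk d_brk brk_diff brk_diff_left)

text \<open>The mixed commutators cancel by \<open>torsion\<close> and the \<open>d i\<close>
  commute, so passing from \<open>N\<close> to \<open>E\<close> leaves the curvature
  unchanged.\<close>

lemma E_commutator: "a : S ==> i<n ==> j<n ==> E i (E j a) - E j (E i a) = brk (R i j) a"
 using curvature[of a i j] torsion[of a i j]
 by (simp add: E_def N_diff N_S d_S d_diff d_commute[of i j]) (simp add: algebra_simps)

lemma E_bianchi: "i<n ==> j<n ==> k<n ==> E i (R j k) + E j (R k i) + E k (R i j) = 0"
proof -
 assume ijk: "i<n" "j<n" "k<n"
 have "E i (R j k) + E j (R k i) + E k (R i j) =
   (N i (R j k) + N j (R k i) + N k (R i j)) - (d i (R j k) + d j (R k i) + d k (R i j))"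
  by (simp add: E_def algebra_simps)
 thus ?thesis using bianchi1[OF ijk] bianchi2[OF ijk] by simp
qed

definition curv :: "(nat => 'w) => nat => nat => 'w" where
 "curv r i j = R i j + E i (r j) - E j (r i) + brk (r i) (r j)"

definition D :: "(nat => 'w) => nat => 'w => 'w" where
 "D r i a = E i a + brk (r i) a"

lemma curv_anti: "i<n ==> j<n ==> curv r j i = - curv r i j"
 by (simp add: curv_def R_anti[of i j] brk_anti[of "r i" "r j"])

lemma D_S: "a : S ==> i<n ==> r i : S ==> D r i a : S"
 by (simp add: D_def S_add E_S brk_S)

lemma D_commutator:
 assumes r: "!!i. i<n ==> r i : S" and a: "a : S" and ij: "i<n" "j<n"
 shows "D r i (D r j a) - D r j (D r i a) = brk (curv r i j) a"
proof -
 have s: "brk (r i) a : S" "brk (r j) a : S" "E i a : S" "E j a : S" "r i : S" "r j : S"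
  using r a ij by (simp_all add: brk_S E_S)
 show ?thesis unfolding D_def curv_def using E_commutator[OF a ij] jacobi[of "r i" "r j" a]
  by (simp add: E_add E_brk s a ij brk_add brk_add_left brk_diff_left algebra_simps)
qed

text \<open>Suitably grouped, every part vanishes on its own: the Bianchi identity of
  \<open>R\<close>, the commutators of \<open>E\<close> on the components of \<open>r\<close>, and
  the Jacobi identity for three such components.\<close>

lemma D_bianchi:
 assumes r: "!!i. i<n ==> r i : S" and ijk: "i<n" "j<n" "k<n"
 shows "D r i (curv r j k) + D r j (curv r k i) + D r k (curv r i j) = 0"
proof -
 note s = r[OF ijk(1)] r[OF ijk(2)] r[OF ijk(3)]
 have e: "E i (E j (r k)) - E j (E i (r k)) = brk (R i j) (r k)" if "i<n" "j<n" "k<n" for i j k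
  using E_commutator[OF r[OF that(3)] that(1,2)] .
 have step: "D r i (curv r j k) = E i (R j k) + (E i (E j (r k)) - E i (E k (r j))) 
   + (brk (E i (r j)) (r k) + brk (r j) (E i (r k)))
   + (brk (r i) (R j k) + brk (r i) (E j (r k)) - brk (r i) (E k (r j)) + brk (r i) (brk (r j) (r k)))"
  if "i<n" "j<n" "k<n" for i j k
  by (simp add: D_def curv_def E_add E_diff E_brk E_S brk_S S_add S_diff R_S r that brk_add brk_diff algebra_simps)
 have anti: "brk (r j) (E i (r k)) = - brk (E i (r k)) (r j)" "brk (r i) (R j k) = - brk (R j k) (r i)" for i j k
  by (rule brk_anti)+
 have jac: "brk (r i) (brk (r j) (r k)) + brk (r j) (brk (r k) (r i)) + brk (r k) (brk (r i) (r j)) = 0"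
 proof -
  have 1: "brk (r k) (r i) = - brk (r i) (r k)" by (rule brk_anti)
  have 2: "brk (r k) (brk (r i) (r j)) = - brk (brk (r i) (r j)) (r k)" by (rule brk_anti)
  show ?thesis unfolding 1 2 brk_uminus by (simp only: jacobi[of "r i" "r j" "r k"]) simp
 qed
 have "D r i (curv r j k) + D r j (curv r k i) + D r k (curv r i j) =
   (E i (R j k) + E j (R k i) + E k (R i j))
   + (E i (E j (r k)) - E j (E i (r k)) - brk (R i j) (r k))
   + (E j (E k (r i)) - E k (E j (r i)) - brk (R j k) (r i))
   + (E k (E i (r j)) - E i (E k (r j)) - brk (R k i) (r j))
   + (brk (r i) (brk (r j) (r k)) + brk (r j) (brk (r k) (r i)) + brk (r k) (brk (r i) (r j)))"
  unfolding step[OF ijk] step[OF ijk(2,3,1)] step[OF ijk(3,1,2)] anti by (simp add: algebra_simps)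
 thus ?thesis using e[OF ijk] e[OF ijk(2,3,1)] e[OF ijk(3,1,2)] jac E_bianchi[OF ijk] by simp
qed

text \<open>Both lemmas come from the Euler identity, applied after contraction with \<open>y\<close>.\<close>

lemma one_form_vanishes:
 assumes A: "!!i. i<n ==> A i : S" "!!i. i<n ==> A i : Fl k"
  and closed: "!!i j. i<n ==> j<n ==> d i (A j) - d j (A i) : Fl k"
  and y: "(SUM i<n. y i (A i)) = 0" and j: "j<n"
 shows "A j : Fl (Suc k)"
proof -
 have "(SUM i<n. y i (d i (A j) - d j (A i))) = (SUM i<n. y i (d i (A j))) - (SUM i<n. y i (d j (A i)))"
  by (simp add: y_diff sum_subtractf)
 moreover have "d j (SUM i<n. y i (A i)) = A j + (SUM i<n. y i (d j (A i)))"
  using j by (simp add: d_sum d_y sum.distrib)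
 hence "(SUM i<n. y i (d j (A i))) = - A j" using y by (simp add: d_zero eq_neg_iff_add_eq_0 add.commute)
 ultimately have "(SUM i<n. y i (d i (A j) - d j (A i))) = (SUM i<n. y i (d i (A j))) + A j" by simp
 moreover have "(SUM i<n. y i (d i (A j) - d j (A i))) : Fl (Suc k)"
  by (rule Fl_sum, rule Fl_y, rule closed) (use j in auto)
 ultimately show ?thesis using Fl_dinv[of _ "Suc k" 1] dinv1'[OF A(1)[OF j]] by metis
qed

lemma two_form_vanishes:
 assumes F: "!!i j. i<n ==> j<n ==> F i j : S" "!!i j. i<n ==> j<n ==> F j i = - F i j"
  and closed: "!!i j l. i<n ==> j<n ==> l<n ==> d i (F j l) + d j (F l i) + d l (F i j) : Fl k"
  and y: "!!j. j<n ==> (SUM i<n. y i (F i j)) = 0" and jl: "j<n" "l<n"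
 shows "F j l : Fl (Suc k)"
proof -
 have dy: "(SUM i<n. y i (d j (F i l))) = - F j l" if "j<n" "l<n" for j l
 proof -
  have "d j (SUM i<n. y i (F i l)) = F j l + (SUM i<n. y i (d j (F i l)))"
   using that by (simp add: d_sum d_y sum.distrib)
  thus ?thesis using y[OF that(2)] by (simp add: d_zero eq_neg_iff_add_eq_0 add.commute)
 qed
 have "(SUM i<n. y i (d i (F j l) + d j (F l i) + d l (F i j))) =
   (SUM i<n. y i (d i (F j l))) + (SUM i<n. y i (d j (F l i))) + (SUM i<n. y i (d l (F i j)))"
  by (simp add: y_add sum.distrib)
 also have "(SUM i<n. y i (d j (F l i))) = - (SUM i<n. y i (d j (F i l)))" unfolding sum_negf[symmetric]
  by (rule sum.cong[OF refl]) (simp add: F(2)[OF _ jl(2)] d_uminus y_uminus)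
 also have "(SUM i<n. y i (d l (F i j))) = F j l" using dy[OF jl(2,1)] F(2)[OF jl] by simp
 also have "- (SUM i<n. y i (d j (F i l))) = F j l" using dy[OF jl] by simp
 finally have "(SUM i<n. y i (d i (F j l) + d j (F l i) + d l (F i j))) = (SUM i<n. y i (d i (F j l))) + F j l + F j l" .
 moreover have "(SUM i<n. y i (d i (F j l) + d j (F l i) + d l (F i j))) : Fl (Suc k)"
  by (rule Fl_sum, rule Fl_y, rule closed) (use jl in auto)
 ultimately show ?thesis using Fl_dinv[of _ "Suc k" 2] dinv2'[OF F(1)[OF jl]] by metis
qed

text \<open>Contraction principle for the ultrametric of the filtration: \<open>Ps\<close> improves
  agreement by one degree, so its iterates from 0 converge by \<open>complete\<close>. All
  \<open>m\<close> unknowns are treated at once, and membership in \<open>Fl c\<close> survives in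
  the limit.\<close>

lemma fixed_point:
 fixes Ps :: "(nat => 'w) => nat => 'w"
 assumes S: "!!r i. (!!i. i<m ==> r i : S Int Fl c) ==> i<m ==> Ps r i : S Int Fl c"
  and con: "!!r r' i k. (!!i. i<m ==> r i : S Int Fl c) ==> (!!i. i<m ==> r' i : S Int Fl c) ==>
    (!!i. i<m ==> r' i - r i : Fl k) ==> i<m ==> Ps r' i - Ps r i : Fl (Suc k)"
 shows "EX r. (ALL i<m. r i : S Int Fl c) & (ALL i<m. Ps r i = r i)"
proof -
 define x where "x k = (Ps ^^ k) (%i. 0)" for k
 have xS: "x k i : S Int Fl c" if "i<m" for k i using that
 proof (induction k arbitrary: i)
  case 0 thus ?case by (simp add: x_def S_zero Fl_zero)
 next
  case (Suc k)
  thus ?case using S[of "x k" i] by (simp add: x_def)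
 qed
 have diff: "x (Suc k) i - x k i : Fl k" if "i<m" for k i using that
 proof (induction k arbitrary: i)
  case 0 show ?case by (rule Fl_0)
 next
  case (Suc k)
  have "Ps (x (Suc k)) i - Ps (x k) i : Fl (Suc k)" using xS Suc by (intro con) auto
  thus ?case by (simp add: x_def)
 qed
 have "EX z:S. ALL k. z - x k i : Fl k" if "i<m" for i
  using complete[of "%k. x k i"] xS diff that by auto
 then obtain r where r: "!!i. i<m ==> r i : S" "!!i k. i<m ==> r i - x k i : Fl k" by metis
 have rc: "r i : S Int Fl c" if "i<m" for i
 proof -
  have "(r i - x c i) + x c i : Fl c" by (rule Fl_add) (use r(2)[OF that] xS[OF that] in auto)
  thus ?thesis using r(1)[OF that] by simp
 qed
 have "Ps r i - r i = 0" if i: "i<m" for i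
 proof (rule Fl_sep)
  fix k
  have "Ps r i - Ps (x k) i : Fl (Suc k)" by (rule con) (use rc xS r(2) i in auto)
  moreover have "Ps (x k) i = x (Suc k) i" by (simp add: x_def)
  moreover have "r i - x (Suc k) i : Fl (Suc k)" using r(2)[OF i] .
  ultimately have "(Ps r i - x (Suc k) i) - (r i - x (Suc k) i) : Fl (Suc k)" using Fl_diff by metis
  thus "Ps r i - r i : Fl k" using Fl_Suc by simp
 qed
 hence "Ps r i = r i" if "i<m" for i using that by simp
 thus ?thesis using rc by (intro exI[of _ r]) simp
qed

text \<open>The contraction with \<open>y\<close> is Fedosov's gauge
  \<open>\<delta>\<^sup>-\<^sup>1 r = 0\<close>, which makes the solution unique. Degree 3 ensures
  that a bracket with \<open>r i\<close> raises degrees by one.\<close>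

definition fedosov_form :: "(nat => 'w) => bool" where
 "fedosov_form r <-> (ALL i<n. r i : S & r i : Fl 3) & (SUM i<n. y i (r i)) = 0 & (ALL i<n. ALL j<n. curv r i j = 0)"

lemma Fl_brk3: "a : Fl 3 ==> b : Fl k ==> brk a b : Fl (Suc k)"
 using Fl_brk[of a 3 b k] by simp

lemma Fl_brk3': "a : Fl k ==> b : Fl 3 ==> brk a b : Fl (Suc k)"
 using Fl_uminus[OF Fl_brk3[of b a k]] by (simp add: brk_anti[where a=b and b=a])

text \<open>The part of the curvature without \<open>d\<close>. Flatness then reads
  \<open>d i (r j) - d j (r i) = gcurv r i j\<close>, an equation that can be solved for
  \<open>r\<close> by recursion on the degree.\<close>

definition gcurv :: "(nat => 'w) => nat => nat => 'w" where
 "gcurv r i j = R i j + N i (r j) - N j (r i) + brk (r i) (r j)"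

lemma curv_gcurv: "curv r i j = gcurv r i j - d i (r j) + d j (r i)" by (simp add: curv_def gcurv_def E_def)

lemma gcurv_anti: "i<n ==> j<n ==> gcurv r j i = - gcurv r i j"
 by (simp add: gcurv_def R_anti[of i j] brk_anti[of "r i" "r j"])

lemma gcurv_S: "(!!i. i<n ==> r i : S) ==> i<n ==> j<n ==> gcurv r i j : S"
 by (simp add: gcurv_def S_add S_diff R_S N_S brk_S)

lemma curv_S: "(!!i. i<n ==> r i : S) ==> i<n ==> j<n ==> curv r i j : S"
 by (simp add: curv_gcurv gcurv_S S_add S_diff d_S)

lemma Fl_gcurv: 
 assumes r: "!!i. i<n ==> r i : S" "!!i. i<n ==> r i : Fl 3" and ij: "i<n" "j<n"
 shows "gcurv r i j : Fl 2"
proof -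
 have "N i (r j) : Fl 3" "N j (r i) : Fl 3" "brk (r i) (r j) : Fl 4"
  using Fl_N[OF r(1) _ r(2)] Fl_brk[OF r(2) r(2)] ij by simp_all
 hence "N i (r j) : Fl 2" "N j (r i) : Fl 2" "brk (r i) (r j) : Fl 2"
  using Fl_le[of 2 3] Fl_le[of 2 4] by simp_all
 thus ?thesis unfolding gcurv_def using Fl_R[of i j] by (simp add: Fl_add Fl_diff)
qed

lemma gcurv_difference:
 assumes r: "!!i. i<n ==> r i : S Int Fl 3" and r': "!!i. i<n ==> r' i : S Int Fl 3"
   and diff: "!!i. i<n ==> r' i - r i : Fl k" and i: "i<n" and l: "l<n"
 shows "gcurv r' l i - gcurv r l i : Fl k"
proof -
 have "gcurv r' l i - gcurv r l i = N l (r' i - r i) - N i (r' l - r l)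
   + (brk (r' l) (r' i - r i) + brk (r' l - r l) (r i))"
  using r r' i l by (simp add: gcurv_def N_diff brk_diff brk_diff_left)
 moreover have "N l (r' i - r i) : Fl k" "N i (r' l - r l) : Fl k"
  using r r' i l diff by (auto intro!: Fl_N S_diff)
 moreover have "brk (r' l) (r' i - r i) : Fl k" "brk (r' l - r l) (r i) : Fl k"
  using r[OF i] r'[OF l] diff[OF i] diff[OF l] by (simp_all add: Fl_Suc[OF Fl_brk3] Fl_Suc[OF Fl_brk3'])
 ultimately show ?thesis by (simp add: Fl_add Fl_diff)
qed

lemma fedosov_form_exists: "EX r. fedosov_form r"
proof -
 \<comment> \<open>Contracting the flatness equation with \<open>y\<close> and inserting the gauge
   gives \<open>(\<Sum> y\<^sub>i d\<^sub>i + 1) r\<^sub>j = \<Sum> y\<^sub>i gcurv r i j\<close>;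
   \<open>dinv 1\<close> inverts the operator on the left.\<close>
 define Ps where "Ps r j = dinv 1 (SUM i<n. y i (gcurv r i j))" for r j
 have "EX r. (ALL i<n. r i : S Int Fl 3) & (ALL i<n. Ps r i = r i)"
 proof (rule fixed_point)
  fix r i assume r: "!!i. i<n ==> r i : S Int Fl 3" and i: "i<n"
  have "(SUM l<n. y l (gcurv r l i)) : S"
   by (rule S_sum) (use r i in \<open>auto intro!: y_S gcurv_S\<close>)
  moreover have "(SUM l<n. y l (gcurv r l i)) : Fl 3"
   by (rule Fl_sum) (use r i Fl_y[of _ 2] Fl_gcurv[of r] in auto)
  ultimately show "Ps r i : S Int Fl 3" by (simp add: Ps_def dinv_S Fl_dinv)
 next
  fix r r' i k assume r: "!!i. i<n ==> r i : S Int Fl 3" and r': "!!i. i<n ==> r' i : S Int Fl 3"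
   and diff: "!!i. i<n ==> r' i - r i : Fl k" and i: "i<n"
  have g: "gcurv r' l i - gcurv r l i : Fl k" if l: "l<n" for l
   using gcurv_difference[OF r r' diff i l] .
  have "Ps r' i - Ps r i = dinv 1 (SUM l<n. y l (gcurv r' l i - gcurv r l i))"
   by (simp add: Ps_def dinv_diff[symmetric] y_diff sum_subtractf)
  moreover have "(SUM l<n. y l (gcurv r' l i - gcurv r l i)) : Fl (Suc k)"
   by (rule Fl_sum) (use g in \<open>auto intro: Fl_y\<close>)
  ultimately show "Ps r' i - Ps r i : Fl (Suc k)" by (simp add: Fl_dinv)
 qed
 then obtain r where rS: "!!i. i<n ==> r i : S" and rF: "!!i. i<n ==> r i : Fl 3"
  and fixr: "!!i. i<n ==> dinv 1 (SUM l<n. y l (gcurv r l i)) = r i"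
  by (auto simp: Ps_def)
 have gS: "gcurv r l i : S" if "l<n" "i<n" for l i by (rule gcurv_S) (use rS that in auto)
 \<comment> \<open>An antisymmetric expression contracted with the symmetric
   \<open>y j (y i _)\<close>. The gauge condition for the fixed point follows from it, since
   \<open>dinv 1\<close> passes to \<open>dinv 0\<close> under multiplication by
   \<open>y\<close>.\<close>
 have yyg: "(SUM j<n. SUM i<n. y j (y i (gcurv r i j))) = 0"
 proof -
  let ?s = "SUM j<n. SUM i<n. y j (y i (gcurv r i j))"
  have "?s = (SUM j<n. SUM i<n. y i (y j (gcurv r j i)))" by (rule sum.swap)
  also have "... = - ?s" unfolding sum_negf[symmetric]
  proof (intro sum.cong refl)
   fix i j assume ij: "i : {..<n}" "j : {..<n}"
   have "gcurv r i j = - gcurv r j i" by (rule gcurv_anti) (use ij in auto)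
   thus "y j (y i (gcurv r i j)) = - y i (y j (gcurv r j i))" by (simp add: y_uminus y_commute[of j i])
  qed
  finally have s: "?s = - ?s" .
  hence "?s + ?s = 0" unfolding eq_neg_iff_add_eq_0 .
  thus ?thesis by (rule no_2_torsion)
 qed
 have yr: "(SUM j<n. y j (r j)) = 0"
 proof -
  have "(SUM j<n. y j (r j)) = (SUM j<n. dinv 0 (y j (SUM l<n. y l (gcurv r l j))))"
   by (rule sum.cong[OF refl]) (simp only: y_dinv[symmetric] fixr lessThan_iff)
  also have "... = dinv 0 (SUM j<n. SUM l<n. y j (y l (gcurv r l j)))" by (simp add: dinv_sum y_sum)
  finally show ?thesis unfolding yyg dinv_zero .
 qed
 have yF: "(SUM i<n. y i (curv r i j)) = 0" if j: "j<n" for j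
 proof -
  have "(SUM i<n. y i (curv r i j)) = (SUM i<n. y i (gcurv r i j)) - (SUM i<n. y i (d i (r j))) + (SUM i<n. y i (d j (r i)))"
   by (simp add: curv_gcurv y_add y_diff sum.distrib sum_subtractf)
  moreover have "(SUM i<n. y i (gcurv r i j)) = (SUM i<n. y i (d i (r j))) + r j"
  proof -
   have "(SUM i<n. y i (gcurv r i j)) : S" by (intro S_sum y_S gS) (use j in auto)
   from dinv1[OF this] show ?thesis unfolding fixr[OF j] by simp
  qed
  moreover have "d j (SUM i<n. y i (r i)) = r j + (SUM i<n. y i (d j (r i)))"
   using j by (simp add: d_sum d_y sum.distrib)
  ultimately show ?thesis using yr by (simp add: d_zero)
 qed
 have cS: "curv r i j : S" if "i<n" "j<n" for i j by (rule curv_S) (use rS that in auto)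
 \<comment> \<open>By the Bianchi identity the curvature is closed up to terms of higher degree, and
   it contracts to zero with \<open>y\<close>; so its degree can be raised indefinitely.\<close>
 have "ALL i<n. ALL j<n. curv r i j : Fl k" for k
 proof (induction k)
  case 0 show ?case by (simp add: Fl_0)
 next
  case (Suc k)
  show ?case
  proof (intro allI impI)
   fix j l assume jl: "j<n" "l<n"
   show "curv r j l : Fl (Suc k)"
   proof (rule two_form_vanishes[of "curv r"])
    show "curv r i j : S" if "i<n" "j<n" for i j using cS that .
    show "curv r j i = - curv r i j" if "i<n" "j<n" for i j using curv_anti that .
    show "(SUM i<n. y i (curv r i j)) = 0" if "j<n" for j using yF that .
    show "j<n" "l<n" using jl .
    fix i j l assume ijl: "i<n" "j<n" "l<n"
    have "D r i (curv r j l) + D r j (curv r l i) + D r l (curv r i j) = 0" by (rule D_bianchi[OF rS ijl])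
    hence "d i (curv r j l) + d j (curv r l i) + d l (curv r i j) =
      (N i (curv r j l) + N j (curv r l i) + N l (curv r i j))
      + (brk (r i) (curv r j l) + brk (r j) (curv r l i) + brk (r l) (curv r i j))"
     by (simp add: D_def E_def algebra_simps eq_neg_iff_add_eq_0)
    moreover have "... : Fl k" using Suc ijl by (intro Fl_add Fl_N cS Fl_Suc[OF Fl_brk3] rF) auto
    ultimately show "d i (curv r j l) + d j (curv r l i) + d l (curv r i j) : Fl k" by simp
   qed
  qed
 qed
 hence "curv r i j = 0" if "i<n" "j<n" for i j using that by (intro Fl_sep) auto
 thus ?thesis using rS rF yr by (intro exI[of _ r]) (simp add: fedosov_form_def)
qed

text \<open>If two solutions agree up to degree \<open>k\<close>, the flatness equations make their
  difference closed modulo that degree, and the gauge makes its contraction with \<open>y\<close>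
  zero; \<open>one_form_vanishes\<close> gains one degree.\<close>

lemma fedosov_form_unique:
 assumes r: "fedosov_form r" and r': "fedosov_form r'" and i: "i<n"
 shows "r' i = r i"
proof -
 have s: "!!i. i<n ==> r i : S Int Fl 3" "!!i. i<n ==> r' i : S Int Fl 3" 
  using r r' by (simp_all add: fedosov_form_def)
 have "ALL i<n. r' i - r i : Fl k" for k
 proof (induction k)
  case 0 show ?case by (simp add: Fl_0)
 next
  case (Suc k)
  show ?case
  proof (intro allI impI, rule one_form_vanishes[of "%i. r' i - r i"])
   show "r' i - r i : S" if "i<n" for i using s[OF that] by (simp add: S_diff)
   show "r' i - r i : Fl k" if "i<n" for i using Suc that by simp
   show "(SUM i<n. y i (r' i - r i)) = 0" using r r' by (simp add: fedosov_form_def y_diff sum_subtractf)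
   fix i j assume ij: "i<n" "j<n"
   have "curv r i j = 0" "curv r' i j = 0" using r r' ij by (simp_all add: fedosov_form_def)
   hence "d i (r' j - r j) - d j (r' i - r i) = gcurv r' i j - gcurv r i j"
    by (simp add: curv_gcurv d_diff algebra_simps)
   thus "d i (r' j - r j) - d j (r' i - r i) : Fl k"
    using gcurv_difference[OF s(1) s(2) _ ij(2) ij(1)] Suc by simp
  qed
 qed
 hence "r' i - r i = 0" using i by (intro Fl_sep) auto
 thus ?thesis by simp
qed

text \<open>Flatness, read as \<open>\<delta> a = N a + [r, a]\<close>, is integrated by
  \<open>dinv 0\<close> from the initial value \<open>f\<close>. For the solution the contraction of
  \<open>D r a\<close> with \<open>y\<close> vanishes, and since the curvature is zero,
  \<open>one_form_vanishes\<close> raises the degree of \<open>D r a\<close> without end.\<close>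

lemma flat_exists:
 assumes r: "fedosov_form r" and f: "f : S" "!!i. i<n ==> d i f = 0" "ct f = f"
 shows "EX a:S. (ALL i<n. D r i a = 0) & ct a = f"
proof -
 have rS: "r i : S" "r i : Fl 3" if "i<n" for i using r that by (simp_all add: fedosov_form_def)
 define B where "B a i = N i a + brk (r i) a" for a i
 have BS: "B a i : S" if "a : S" "i<n" for a i using that rS by (simp add: B_def S_add N_S brk_S)
 \<comment> \<open>The index \<open>l\<close> is a dummy: \<open>fixed_point\<close> is used with
   the single component 0.\<close>
 define Ps where "Ps a l = f + dinv 0 (SUM i<n. y i (B (a l) i))" for a :: "nat => 'w" and l
 have "EX a. (ALL i<1. a i : S Int Fl 0) & (ALL i<1. Ps a i = a i)"
 proof (rule fixed_point)
  fix a :: "nat => 'w" and i :: nat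
  assume a: "!!i::nat. i<1 ==> a i : S Int Fl 0" and i: "i<1"
  have "(SUM l<n. y l (B (a i) l)) : S" using a[OF i] by (intro S_sum y_S BS) auto
  thus "Ps a i : S Int Fl 0" using f(1) by (simp add: Ps_def S_add dinv_S Fl_0)
 next
  fix a a' :: "nat => 'w" and i k :: nat
  assume a: "!!i::nat. i<1 ==> a i : S Int Fl 0" and a': "!!i::nat. i<1 ==> a' i : S Int Fl 0"
   and diff: "!!i::nat. i<1 ==> a' i - a i : Fl k" and i: "i<1"
  have g: "B (a' i) l - B (a i) l : Fl k" if l: "l<n" for l
  proof -
   have "B (a' i) l - B (a i) l = N l (a' i - a i) + brk (r l) (a' i - a i)"
    using a[OF i] a'[OF i] l by (simp add: B_def N_diff brk_diff)
   moreover have "... : Fl k"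
    using a[OF i] a'[OF i] l diff[OF i] rS by (intro Fl_add Fl_N S_diff Fl_Suc[OF Fl_brk3]) auto
   ultimately show ?thesis by simp
  qed
  have "Ps a' i - Ps a i = dinv 0 (SUM l<n. y l (B (a' i) l - B (a i) l))"
   by (simp add: Ps_def dinv_diff[symmetric] y_diff sum_subtractf)
  moreover have "(SUM l<n. y l (B (a' i) l - B (a i) l)) : Fl (Suc k)"
   by (rule Fl_sum) (use g in \<open>auto intro: Fl_y\<close>)
  ultimately show "Ps a' i - Ps a i : Fl (Suc k)" by (simp add: Fl_dinv)
 qed
 then obtain a where aS: "a : S" and fixr: "a = f + dinv 0 (SUM i<n. y i (B a i))"
  by (auto simp: Ps_def)
 define A where "A i = D r i a" for i
 have AB: "A i = B a i - d i a" for i by (simp add: A_def D_def E_def B_def)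
 have AS: "A i : S" if "i<n" for i using aS rS(1) that by (simp add: A_def D_S)
 have yA: "(SUM i<n. y i (A i)) = 0"
 proof -
  let ?Z = "SUM i<n. y i (B a i)"
  have Z: "?Z : S" using aS by (intro S_sum y_S BS) auto
  have "(SUM i<n. y i (d i a)) = (SUM i<n. y i (d i f)) + (SUM i<n. y i (d i (dinv 0 ?Z)))"
   by (subst fixr) (simp add: d_add y_add sum.distrib)
  also have "... = ?Z" using f(2) dinv0[OF Z] by (simp add: y_zero ct_sum ct_y)
  finally show ?thesis by (simp add: AB y_diff sum_subtractf)
 qed
 have "ALL i<n. A i : Fl k" for k
 proof (induction k)
  case 0 show ?case by (simp add: Fl_0)
 next
  case (Suc k)
  show ?case
  proof (intro allI impI, rule one_form_vanishes[of A])
   show "A i : S" if "i<n" for i using AS that .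
   show "A i : Fl k" if "i<n" for i using Suc that by simp
   show "(SUM i<n. y i (A i)) = 0" by (rule yA)
   fix i j assume ij: "i<n" "j<n"
   have "D r i (A j) - D r j (A i) = brk (curv r i j) a"
    unfolding A_def by (rule D_commutator[OF rS(1) aS ij])
   also have "... = 0" using r ij by (simp add: fedosov_form_def brk_zero_left)
   finally have "d i (A j) - d j (A i) = (N i (A j) + brk (r i) (A j)) - (N j (A i) + brk (r j) (A i))"
    by (simp add: D_def E_def algebra_simps)
   moreover have "... : Fl k"
    using Suc ij AS rS by (intro Fl_diff Fl_add Fl_N Fl_Suc[OF Fl_brk3]) auto
   ultimately show "d i (A j) - d j (A i) : Fl k" by simp
  qed
 qed
 hence "A i = 0" if "i<n" for i using that by (intro Fl_sep) auto
 moreover have "ct a = f" by (subst fixr) (simp add: ct_add ct_dinv0 f(3))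
 ultimately show ?thesis using aS by (auto simp: A_def)
qed

text \<open>The fibre derivatives of a flat \<open>a\<close> have at least the degree of
  \<open>a\<close>. Without a term free of \<open>y\<close>, \<open>a\<close> is recovered from them
  by multiplication with \<open>y\<close> and \<open>dinv 0\<close>, which gains one degree.\<close>

lemma flat_zero:
 assumes r: "fedosov_form r" and a: "a : S" "!!i. i<n ==> D r i a = 0" "ct a = 0"
 shows "a = 0"
proof (rule Fl_sep)
 have rS: "r i : S" "r i : Fl 3" if "i<n" for i using r that by (simp_all add: fedosov_form_def)
 fix k show "a : Fl k"
 proof (induction k)
  case 0 show ?case by (rule Fl_0)
 next
  case (Suc k)
  have "d i a : Fl k" if "i<n" for i
  proof -
   have "d i a = N i a + brk (r i) a" using a(2)[OF that] by (simp add: D_def E_def algebra_simps)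
   moreover have "... : Fl k" using Suc that a(1) rS by (intro Fl_add Fl_N Fl_Suc[OF Fl_brk3]) auto
   ultimately show ?thesis by simp
  qed
  hence "(SUM i<n. y i (d i a)) : Fl (Suc k)" by (intro Fl_sum Fl_y) auto
  from Fl_dinv[OF this, of 0] show ?case using dinv0'[OF a(1)] a(3) by simp
 qed
qed

lemma D_diff: "a : S ==> b : S ==> i<n ==> D r i (a - b) = D r i a - D r i b"
 by (simp add: D_def E_diff brk_diff)

lemma flat_unique:
 assumes r: "fedosov_form r" and a: "a : S" "!!i. i<n ==> D r i a = 0" 
  and b: "b : S" "!!i. i<n ==> D r i b = 0" and "ct a = ct b"
 shows "a = b"
proof -
 have "ct (a - b) = 0" using ct_add[of "a - b" b] assms(6) by simp
 hence "a - b = 0" using a b by - (rule flat_zero[OF r], simp_all add: S_diff D_diff)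
 thus ?thesis by simp
qed

end

section \<open>The Weyl bundle of a symplectic coordinate domain\<close>

lemma size_sum_count:
 fixes M :: "nat multiset"
 shows "(!!i. i \<in># M ==> i<n) ==> (SUM i<n. count M i) = size M"
proof -
 assume "!!i. i \<in># M ==> i<n"
 hence "(SUM i:set_mset M. count M i) = (SUM i<n. count M i)"
  by (intro sum.mono_neutral_left) (auto simp: not_in_iff)
 thus ?thesis by (simp add: size_multiset_overloaded_eq)
qed

lemma euler_ymul_dy:
 assumes "!!i. i >= n ==> dy i a = 0"
 shows "(SUM i<n. ymul i (dy i a)) M = of_nat (size M) * a M"
proof -
 have "ymul i (dy i a) M = of_nat (count M i) * a M" for i
  by (cases "i \<in># M") (simp_all add: ymul_def dy_def not_in_iff)
 hence "(SUM i<n. ymul i (dy i a)) M = of_nat (SUM i<n. count M i) * a M"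
  by (simp add: sum_fun_apply sum_distrib_right)
 also have "... = of_nat (size M) * a M"
 proof (cases "\<forall>i\<in>#M. i<n")
  case True thus ?thesis by (simp add: size_sum_count)
 next
  case False
  then obtain i where i: "i \<in># M" "i >= n" by (meson not_less)
  hence "a M = dy i a (M - {#i#})" by (simp add: dy_def)
  thus ?thesis using assms[OF i(2)] by simp
 qed
 finally show ?thesis .
qed

definition pol_smooth :: "nat => pt set => (pt => pol) => bool" where
 "pol_smooth n V a <-> (ALL M. smooth_on n V (%x. a x M))"

definition pdx :: "nat => (pt => pol) => pt => pol" where
 "pdx i a x M = jc a i M x"

text \<open>The sign is that of the action on functions of the tangent vector \<open>y\<close>, dual
  to the action on \<open>y\<close> itself.\<close>

definition nab :: "nat => (nat => nat => pt => complex) => nat => (pt => pol) => pt => pol" where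
 "nab n A i a x = pdx i a x - Lop n (%k j. A k j x) (a x)"

lemma pdx_dy: "pdx i (%x. dy p (a x)) x = dy p (pdx i a x)" by (simp add: pdx_def dy_def fun_eq_iff)

context
 fixes n V assumes V: "oES n V"
begin

lemma pol_smooth_dy: "pol_smooth n V a ==> pol_smooth n V (%x. dy p (a x))"
 by (simp add: pol_smooth_def dy_def)

lemma pol_smooth_ymul: "pol_smooth n V a ==> pol_smooth n V (%x. ymul p (a x))"
 by (simp add: pol_smooth_def ymul_def smooth_on_mult[OF V] smooth_on_const[OF V])

lemma pol_smooth_sc: "smooth_on n V f ==> pol_smooth n V a ==> pol_smooth n V (%x. sc (f x) (a x))"
 by (simp add: pol_smooth_def sc_apply smooth_on_mult[OF V])

lemma pol_smooth_diff: "pol_smooth n V a ==> pol_smooth n V b ==> pol_smooth n V (%x. a x - b x)"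
 by (simp add: pol_smooth_def smooth_on_diff[OF V])

lemma pol_smooth_const: "pol_smooth n V (%x. c)" by (simp add: pol_smooth_def smooth_on_const[OF V])

lemma pol_smooth_sum: "(!!i. i : I ==> pol_smooth n V (%x. a i x)) ==> pol_smooth n V (%x. SUM i:I. a i x)"
 by (simp add: pol_smooth_def sum_fun_apply smooth_on_sum[OF V])

lemma pol_smooth_pprod:
 assumes "pol_smooth n V a" "pol_smooth n V b"
 shows "pol_smooth n V (%x. pprod (a x) (b x))"
proof -
 have "smooth_on n V (%x. pprod (a x) (b x) M)" for M using assms
 proof (induction M arbitrary: a b)
  case empty thus ?case by (simp add: pprod_empty pol_smooth_def smooth_on_mult[OF V])
 next
  case (add i M) thus ?case by (simp add: pprod_add_mset smooth_on_add[OF V] pol_smooth_dy)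
 qed
 thus ?thesis by (simp add: pol_smooth_def)
qed

lemma pol_smooth_bidiff:
 assumes po: "!!p q. p<n ==> q<n ==> smooth_on n V (po p q)"
 shows "pol_smooth n V a ==> pol_smooth n V b ==> pol_smooth n V (%x. bidiff n (%p q. po p q x) k (a x) (b x))"
proof (induction k arbitrary: a b)
 case 0 thus ?case by (simp add: pol_smooth_pprod)
next
 case (Suc k)
 thus ?case unfolding bidiff.simps by (intro pol_smooth_sum pol_smooth_sc) (auto intro: po pol_smooth_dy)
qed

lemma pol_smooth_Lop:
 assumes A: "!!k j. k<n ==> j<n ==> smooth_on n V (A k j)"
 shows "pol_smooth n V a ==> pol_smooth n V (%x. Lop n (%k j. A k j x) (a x))"
 unfolding Lop_def by (intro pol_smooth_sum pol_smooth_sc pol_smooth_ymul pol_smooth_dy) (auto intro: A)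

lemma pol_smooth_pdx: "pol_smooth n V a ==> i<n ==> pol_smooth n V (pdx i a)"
proof -
 assume "pol_smooth n V a" "i<n"
 moreover have "(%x. pdx i a x M) = pd i (%x. a x M)" for M by (simp add: pdx_def fun_eq_iff)
 ultimately show ?thesis by (simp add: pol_smooth_def smooth_on_partial_deriv)
qed

context
 fixes x i assumes x: "x : V" and i: "i<n"
begin

lemma pdx_add: "pol_smooth n V a ==> pol_smooth n V b ==> pdx i (%x. a x + b x) x = pdx i a x + pdx i b x"
 by (simp add: pdx_def fun_eq_iff pol_smooth_def partial_deriv_add[OF V x i])

lemma pdx_diff: "pol_smooth n V a ==> pol_smooth n V b ==> pdx i (%x. a x - b x) x = pdx i a x - pdx i b x"
 by (simp add: pdx_def fun_eq_iff pol_smooth_def partial_deriv_diff[OF V x i])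

lemma pdx_sum: "(!!j. j : J ==> pol_smooth n V (a j)) ==> pdx i (%x. SUM j:J. a j x) x = (SUM j:J. pdx i (a j) x)"
 by (simp add: pdx_def fun_eq_iff pol_smooth_def sum_fun_apply partial_deriv_sum[OF V x i])

lemma pdx_sc: "smooth_on n V f ==> pol_smooth n V a ==>
  pdx i (%x. sc (f x) (a x)) x = sc (pd i f x) (a x) + sc (f x) (pdx i a x)"
 by (simp add: pdx_def fun_eq_iff pol_smooth_def sc_apply partial_deriv_mult[OF V x i])

lemma pdx_ymul: "pol_smooth n V a ==> pdx i (%x. ymul p (a x)) x = ymul p (pdx i a x)"
 by (simp add: pdx_def fun_eq_iff pol_smooth_def ymul_def partial_deriv_mult[OF V x i] smooth_on_const[OF V])

lemma pdx_pprod: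
 assumes "pol_smooth n V a" "pol_smooth n V b"
 shows "pdx i (%x. pprod (a x) (b x)) x = pprod (pdx i a x) (b x) + pprod (a x) (pdx i b x)"
proof
 fix M
 show "pdx i (%x. pprod (a x) (b x)) x M = (pprod (pdx i a x) (b x) + pprod (a x) (pdx i b x)) M"
  using assms
 proof (induction M arbitrary: a b)
  case empty thus ?case by (simp add: pdx_def pprod_empty pol_smooth_def partial_deriv_mult[OF V x i])
 next
  case (add p M)
  have "pdx i (%x. pprod (a x) (b x)) x (add_mset p M) = 
    pd i (%x. pprod (dy p (a x)) (b x) M + pprod (a x) (dy p (b x)) M) x"
   by (simp add: pdx_def pprod_add_mset)
  also have "... = pdx i (%x. pprod (dy p (a x)) (b x)) x M + pdx i (%x. pprod (a x) (dy p (b x))) x M"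
   unfolding pdx_def
   by (rule partial_deriv_add[OF V x i]) (use add.prems pol_smooth_pprod pol_smooth_dy pol_smooth_def in auto)
  also have "... = (pprod (pdx i a x) (b x) + pprod (a x) (pdx i b x)) (add_mset p M)"
   using add by (simp add: pol_smooth_dy pprod_add_mset pdx_dy)
  finally show ?case .
 qed
qed

end

text \<open>For each factor of the operator, the derivative of \<open>po\<close> and the two
  connection terms produced by moving \<open>nab\<close> past \<open>dy\<close> add up to zero by
  \<open>parallel\<close>.\<close>

lemma nab_bidiff:
 assumes po: "!!p q. p<n ==> q<n ==> smooth_on n V (po p q)"
  and x: "x : V" and i: "i<n"
  and parallel: "!!p q. p<n ==> q<n ==>
   pd i (po p q) x + (SUM k<n. A p k x * po k q x) + (SUM k<n. A q k x * po p k x) = 0"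
 shows "pol_smooth n V a ==> pol_smooth n V b ==>
  nab n A i (%x. bidiff n (%p q. po p q x) r (a x) (b x)) x =
   bidiff n (%p q. po p q x) r (nab n A i a x) (b x) + bidiff n (%p q. po p q x) r (a x) (nab n A i b x)"
proof (induction r arbitrary: a b)
 case 0
 have d: "pprod (u - v) c = pprod u c - pprod v c" "pprod c (u - v) = pprod c u - pprod c v" for u v c
  using pprod_add_left[of "u - v" v c] pprod_add_right[of c "u - v" v] by simp_all
 show ?case unfolding nab_def bidiff.simps pdx_pprod[OF x i 0] Lop_pprod d by (simp add: algebra_simps)
next
 case (Suc r)
 let ?B = "%a b. bidiff n (%p q. po p q x) r a b"
 have nd: "nab n A i (%x. dy p (a x)) x = dy p (nab n A i a x) + (SUM k<n. sc (A k p x) (dy k (a x)))" if "p<n" for p a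
  using that by (simp add: nab_def pdx_dy dy_diff dy_Lop)
 have sm: "pol_smooth n V (%x. bidiff n (%p q. po p q x) r (dy p (a x)) (dy q (b x)))" for p q
  by (intro pol_smooth_bidiff po pol_smooth_dy Suc.prems)
 have Lsum: "Lop n A (SUM i:I. f i) = (SUM i:I. Lop n A (f i))" for A f and I :: "nat set"
  using sum_comp_morphism[of "Lop n A" f I] by (simp add: Lop_zero Lop_add comp_def)
 have "nab n A i (%x. bidiff n (%p q. po p q x) (Suc r) (a x) (b x)) x = 
   (SUM p<n. SUM q<n. sc (pd i (po p q) x) (?B (dy p (a x)) (dy q (b x)))
    + sc (po p q x) (nab n A i (%x. bidiff n (%p q. po p q x) r (dy p (a x)) (dy q (b x))) x))"
 proof -
  have "pdx i (%x. SUM p<n. SUM q<n. sc (po p q x) (bidiff n (%p q. po p q x) r (dy p (a x)) (dy q (b x)))) x =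
   (SUM p<n. pdx i (%x. SUM q<n. sc (po p q x) (bidiff n (%p q. po p q x) r (dy p (a x)) (dy q (b x)))) x)"
   by (rule pdx_sum[OF x i]) (intro pol_smooth_sum pol_smooth_sc sm; simp add: po)
  also have "... = (SUM p<n. SUM q<n. pdx i (%x. sc (po p q x) (bidiff n (%p q. po p q x) r (dy p (a x)) (dy q (b x)))) x)"
   by (intro sum.cong refl pdx_sum[OF x i] pol_smooth_sc sm) (simp add: po)
  also have "... = (SUM p<n. SUM q<n. sc (pd i (po p q) x) (?B (dy p (a x)) (dy q (b x)))
     + sc (po p q x) (pdx i (%x. bidiff n (%p q. po p q x) r (dy p (a x)) (dy q (b x))) x))"
   by (intro sum.cong refl pdx_sc[OF x i] sm) (simp add: po)
  finally show ?thesis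
   by (simp add: nab_def Lsum Lop_sc sc_diff sum_subtractf sum.distrib del: plus_fun_apply)
 qed
 also have "... = (SUM p<n. SUM q<n. sc (pd i (po p q) x) (?B (dy p (a x)) (dy q (b x)))
    + sc (po p q x) ((?B (dy p (nab n A i a x)) (dy q (b x)) + (SUM k<n. sc (A k p x) (?B (dy k (a x)) (dy q (b x)))))
    + (?B (dy p (a x)) (dy q (nab n A i b x)) + (SUM k<n. sc (A k q x) (?B (dy p (a x)) (dy k (b x)))))))"
  by (intro sum.cong refl arg_cong2[where f="(+)"] arg_cong2[where f=sc])
    (simp add: Suc pol_smooth_dy nd bidiff_add_left bidiff_add_right bidiff_sum_left bidiff_sum_right bidiff_sc_left bidiff_sc_right del: plus_fun_apply)
 also have "... = (SUM p<n. SUM q<n. sc (po p q x) (?B (dy p (nab n A i a x)) (dy q (b x))))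
   + (SUM p<n. SUM q<n. sc (po p q x) (?B (dy p (a x)) (dy q (nab n A i b x))))
   + ((SUM p<n. SUM q<n. sc (pd i (po p q) x) (?B (dy p (a x)) (dy q (b x))))
    + (SUM p<n. SUM q<n. SUM k<n. sc (po p q x * A k p x) (?B (dy k (a x)) (dy q (b x))))
    + (SUM p<n. SUM q<n. SUM k<n. sc (po p q x * A k q x) (?B (dy p (a x)) (dy k (b x)))))"
  by (simp add: sc_add sc_sum sc_sc sum.distrib algebra_simps del: plus_fun_apply)
 also have "(SUM p<n. SUM q<n. SUM k<n. sc (po p q x * A k p x) (?B (dy k (a x)) (dy q (b x)))) =
   (SUM k<n. SUM q<n. SUM p<n. sc (po p q x * A k p x) (?B (dy k (a x)) (dy q (b x))))"
  by (subst sum3_swap) (rule sum.swap)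
 also have "... = (SUM p<n. SUM q<n. sc (SUM k<n. A p k x * po k q x) (?B (dy p (a x)) (dy q (b x))))"
  by (simp add: sc_sum_left mult.commute)
 also have "(SUM p<n. SUM q<n. SUM k<n. sc (po p q x * A k q x) (?B (dy p (a x)) (dy k (b x)))) =
   (SUM p<n. SUM k<n. SUM q<n. sc (po p q x * A k q x) (?B (dy p (a x)) (dy k (b x))))"
  by (rule sum.cong[OF refl]) (rule sum.swap)
 also have "... = (SUM p<n. SUM q<n. sc (SUM k<n. A q k x * po p k x) (?B (dy p (a x)) (dy q (b x))))"
  by (simp add: sc_sum_left mult.commute)
 also have "((SUM p<n. SUM q<n. sc (pd i (po p q) x) (?B (dy p (a x)) (dy q (b x))))
   + (SUM p<n. SUM q<n. sc (SUM k<n. A p k x * po k q x) (?B (dy p (a x)) (dy q (b x))))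
   + (SUM p<n. SUM q<n. sc (SUM k<n. A q k x * po p k x) (?B (dy p (a x)) (dy q (b x))))) =
   (SUM p<n. SUM q<n. sc (pd i (po p q) x + (SUM k<n. A p k x * po k q x) + (SUM k<n. A q k x * po p k x)) 
    (?B (dy p (a x)) (dy q (b x))))" by (simp only: sum.distrib[symmetric] sc_add_left[symmetric])
 also have "... = 0" by (simp add: parallel sc_zero_left)
 finally show ?case by simp
qed

end

text \<open>Chosen pointwise, so it has a value even where no inverse exists. Smoothness is
  transferred from Cramer's formula by uniqueness of the inverse.\<close>

definition minv :: "nat => (nat => pt) => nat => pt" where
 "minv n A = (SOME B. ALL i<n. ALL k<n. (SUM j<n. B i j * A j k) = dl i k &
   (SUM j<n. A i j * B j k) = dl i k)"

lemma sum_delta_mult: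
 fixes f :: "nat => 'a::semiring_1"
 assumes "k<n"
 shows "(SUM j<n. dl j k * f j) = f k" "(SUM j<n. dl k j * f j) = f k"
  "(SUM j<n. f j * dl j k) = f k" "(SUM j<n. f j * dl k j) = f k"
 using assms by (simp_all add: if_distrib[of "%z. z * _"] if_distrib[of "%z. _ * z"] cong: if_cong)

lemma inverse_matrix_unique:
 fixes A B C :: "nat => nat => 'a::comm_semiring_1"
 assumes B: "!!i k. i<n ==> k<n ==> (SUM j<n. B i j * A j k) = dl i k"
  and C: "!!i k. i<n ==> k<n ==> (SUM j<n. A i j * C j k) = dl i k"
  and ik: "i<n" "k<n"
 shows "B i k = C i k"
proof -
 have "B i k = (SUM j<n. B i j * dl j k)" using ik by (simp add: sum_delta_mult)
 also have "... = (SUM j<n. B i j * (SUM l<n. A j l * C l k))"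
  by (rule sum.cong) (simp_all add: C ik)
 also have "... = (SUM l<n. (SUM j<n. B i j * A j l) * C l k)"
  by (simp only: sum_distrib_left sum_distrib_right mult.assoc) (rule sum.swap)
 also have "... = (SUM l<n. dl i l * C l k)" by (rule sum.cong) (simp_all add: B ik)
 also have "... = C i k" using ik by (simp add: sum_delta_mult)
 finally show ?thesis .
qed

lemma minv:
 assumes B: "!!i k. i<n ==> k<n ==> (SUM j<n. B i j * A j k) = dl i k"
  "!!i k. i<n ==> k<n ==> (SUM j<n. A i j * B j k) = dl i k" and ik: "i<n" "k<n"
 shows "minv n A i k = B i k" "(SUM j<n. minv n A i j * A j k) = dl i k"
  "(SUM j<n. A i j * minv n A j k) = dl i k"
proof -
 have *: "ALL i<n. ALL k<n. (SUM j<n. minv n A i j * A j k) = dl i k &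
   (SUM j<n. A i j * minv n A j k) = dl i k" unfolding minv_def by (rule someI[where x=B]) (use B in simp)
 show "(SUM j<n. minv n A i j * A j k) = dl i k"
  "(SUM j<n. A i j * minv n A j k) = dl i k" using * ik by simp_all
 show "minv n A i k = B i k" by (rule inverse_matrix_unique[where A=A and n=n]) (use * B ik in simp_all)
qed

text \<open>The connection is given by \<open>T k i j = \<Sum>\<^sub>l \<omega>\<^sub>k\<^sub>l \<Gamma>\<^sup>l\<^sub>i\<^sub>j\<close>: with the index lowered, its transformation
  law involves no inverse matrices.\<close>

definition sympl_conn :: "nat => pt set => (nat => nat => pt => real) =>
  (nat => nat => nat => pt => real) => bool" where
 "sympl_conn n V w T <->
  (ALL k<n. ALL i<n. ALL j<n. smooth_on n V (T k i j)) &
  (ALL x:V. ALL k<n. ALL i<n. ALL j<n. T k i j x = T k j i x & pd i (w j k) x = T j i k x - T k i j x)"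

text \<open>Closedness is not listed here; it enters through \<open>sympl_conn\<close>, where the
  symmetry of \<open>T\<close> forces the cyclic sum of the derivatives of \<open>w\<close> to
  vanish.\<close>

definition sympl_form :: "nat => pt set => (nat => nat => pt => real) => bool" where
 "sympl_form n V w <-> oES n V & 
  (ALL i<n. ALL j<n. smooth_on n V (w i j)) & (ALL x:V. ALL i<n. ALL j<n. w i j x = - w j i x) &
  (ALL x:V. ALL v. (ALL j<n. (SUM i<n. v i * w i j x) = 0) --> (ALL i<n. v i = 0))"

lemma smooth_inverse_matrix_ex:
 fixes a :: "nat => nat => pt => real"
 assumes V: "oES n V" and s: "!!i j. i<m ==> j<m ==> smooth_on n V (a i j)"
  and inj: "!!x v. x : V ==> (!!i. i<m ==> (SUM j<m. a i j x * v j) = 0) ==> ALL j<m. v j = 0"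
 shows "EX K. (ALL i<m. ALL j<m. smooth_on n V (K i j)) &
  (ALL x:V. ALL i<m. ALL k<m. (SUM j<m. K i j x * a j k x) = dl i k &
   (SUM j<m. a i j x * K j k x) = dl i k)"
proof (rule smooth_inverse_matrix[OF V s inj])
 fix K assume "!!i j. i<m ==> j<m ==> smooth_on n V (K i j)"
  "!!x i k. x : V ==> i<m ==> k<m ==> (SUM j<m. K i j x * a j k x) = dl i k"
  "!!x i k. x : V ==> i<m ==> k<m ==> (SUM j<m. a i j x * K j k x) = dl i k"
 thus ?thesis by (intro exI[of _ K]) simp
qed

definition winv :: "nat => (nat => nat => pt => real) => nat => nat => pt => real" where
 "winv n w i j x = minv n (%i j. w i j x) i j"

lemma winv:
 assumes "sympl_form n V w"
 shows winv_smooth: "i<n ==> j<n ==> smooth_on n V (winv n w i j)"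
  and winv_left: "x : V ==> i<n ==> k<n ==> (SUM j<n. winv n w i j x * w j k x) = dl i k"
  and winv_right: "x : V ==> i<n ==> k<n ==> (SUM j<n. w i j x * winv n w j k x) = dl i k"
  and winv_anti: "x : V ==> i<n ==> j<n ==> winv n w j i x = - winv n w i j x"
proof -
 have V: "oES n V" and ws: "!!i j. i<n ==> j<n ==> smooth_on n V (w i j)"
  and wa: "!!x i j. x : V ==> i<n ==> j<n ==> w i j x = - w j i x"
  and wn: "!!x v. x : V ==> (ALL j<n. (SUM i<n. v i * w i j x) = 0) ==> (ALL i<n. v i = 0)"
  using assms unfolding sympl_form_def by blast+
 have inj: "ALL j<n. v j = 0" if x: "x : V" and z: "!!i. i<n ==> (SUM j<n. w i j x * v j) = 0" for x v
 proof (rule wn[OF x], intro allI impI)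
  fix j assume j: "j<n"
  have "(SUM i<n. v i * w i j x) = (SUM i<n. - (w j i x * v i))"
  proof (rule sum.cong[OF refl])
   fix i assume "i : {..<n}"
   hence "w i j x = - w j i x" using wa[OF x _ j] by simp
   thus "v i * w i j x = - (w j i x * v i)" by simp
  qed
  thus "(SUM i<n. v i * w i j x) = 0" using z[OF j] by (simp add: sum_negf)
 qed
 from smooth_inverse_matrix_ex[OF V ws inj] obtain K where K': "(ALL i<n. ALL j<n. smooth_on n V (K i j)) &
  (ALL x:V. ALL i<n. ALL k<n. (SUM j<n. K i j x * w j k x) = dl i k &
   (SUM j<n. w i j x * K j k x) = dl i k)" ..
 have K: "!!i j. i<n ==> j<n ==> smooth_on n V (K i j)"
  "!!x i k. x : V ==> i<n ==> k<n ==> (SUM j<n. K i j x * w j k x) = dl i k"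
  "!!x i k. x : V ==> i<n ==> k<n ==> (SUM j<n. w i j x * K j k x) = dl i k"
  using K' by simp_all
 have e: "winv n w i j x = K i j x" if "x : V" "i<n" "j<n" for i j x
  unfolding winv_def by (rule minv(1)) (use K(2,3)[OF that(1)] that in simp_all)
 show "i<n ==> j<n ==> smooth_on n V (winv n w i j)" for i j
  using smooth_on_cong[OF V, of "winv n w i j" "K i j"] e K(1) by simp
 show l: "(SUM j<n. winv n w i j x * w j k x) = dl i k" if "x : V" "i<n" "k<n" for x i k
  using K(2)[OF that] e[OF that(1,2)] by simp
 show r: "(SUM j<n. w i j x * winv n w j k x) = dl i k" if "x : V" "i<n" "k<n" for x i k
  using K(3)[OF that] e[OF that(1) _ that(3)] by simp
 show "winv n w j i x = - winv n w i j x" if "x : V" "i<n" "j<n" for x i j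
 proof (rule inverse_matrix_unique[where A="%i j. w i j x" and B="%i j. winv n w i j x" and C="%i j. - winv n w j i x" and n=n])
  show "(SUM j<n. winv n w i j x * w j k x) = dl i k" if "i<n" "k<n" for i k
   using l \<open>x : V\<close> that by simp
  show "(SUM j<n. w i j x * - winv n w k j x) = dl i k" if "i<n" "k<n" for i k
  proof -
   have "(SUM j<n. w i j x * - winv n w k j x) = (SUM j<n. winv n w k j x * w j i x)"
   proof (rule sum.cong[OF refl])
    fix j assume "j : {..<n}"
    hence "w i j x = - w j i x" using wa[OF \<open>x : V\<close> \<open>i<n\<close>] by simp
    thus "w i j x * - winv n w k j x = winv n w k j x * w j i x" by simp
   qed
   thus ?thesis using l[OF \<open>x : V\<close> that(2,1)] by auto
  qed
 qed (use that in simp_all)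
qed

definition Gam :: "nat => (nat => nat => pt => real) => (nat => nat => nat => pt => real) =>
  nat => nat => nat => pt => real" where
 "Gam n w T i l j x = (SUM k<n. winv n w l k x * T k i j x)"

locale sympl_chart =
 fixes n :: nat and V :: "pt set" and w :: "nat => nat => pt => real"
  and T :: "nat => nat => nat => pt => real"
 assumes form: "sympl_form n V w" and conn: "sympl_conn n V w T"
begin

lemma V: "oES n V" and w_smooth: "i<n ==> j<n ==> smooth_on n V (w i j)"
 and w_anti: "x : V ==> i<n ==> j<n ==> w i j x = - w j i x"
 and T_smooth: "i<n ==> j<n ==> k<n ==> smooth_on n V (T k i j)"
 and T_sym: "x : V ==> i<n ==> j<n ==> k<n ==> T k i j x = T k j i x"
 and T_w: "x : V ==> i<n ==> j<n ==> k<n ==> pd i (w j k) x = T j i k x - T k i j x"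
 by (rule form[unfolded sympl_form_def, THEN conjunct1]
   form[unfolded sympl_form_def, THEN conjunct2, THEN conjunct1, rule_format]
   form[unfolded sympl_form_def, THEN conjunct2, THEN conjunct2, THEN conjunct1, rule_format]
   conn[unfolded sympl_conn_def, THEN conjunct1, rule_format]
   conn[unfolded sympl_conn_def, THEN conjunct2, rule_format, THEN conjunct1]
   conn[unfolded sympl_conn_def, THEN conjunct2, rule_format, THEN conjunct2]; assumption)+

abbreviation "P \<equiv> winv n w"

lemmas P_smooth = winv_smooth[OF form] and P_left = winv_left[OF form] and P_right = winv_right[OF form]
 and P_anti = winv_anti[OF form]

lemma Gam_smooth: "i<n ==> j<n ==> l<n ==> smooth_on n V (Gam n w T i l j)"
 unfolding Gam_def[abs_def] by (intro smooth_on_sum[OF V] smooth_on_mult[OF V]) (simp_all add: P_smooth T_smooth)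

lemma Gam_sym: "x : V ==> i<n ==> j<n ==> l<n ==> Gam n w T i l j x = Gam n w T j l i x"
 unfolding Gam_def by (intro sum.cong refl arg_cong2[where f="(*)"] T_sym) auto

lemma P_deriv:
 assumes x: "x : V" and i: "i<n" and ac: "a<n" "c<n"
 shows "pd i (P a c) x = - (SUM j<n. SUM b<n. P a j x * pd i (w j b) x * P b c x)"
proof -
 have e: "(SUM j<n. P a j x * pd i (w j b) x) + (SUM j<n. pd i (P a j) x * w j b x) = 0" if b: "b<n" for b
 proof -
  have "pd i (%x. SUM j<n. P a j x * w j b x) x = pd i (%x. if a = b then 1 else 0) x"
   by (rule partial_deriv_cong[OF V x i]) (simp add: P_left ac(1) b)
  moreover have "pd i (%x. SUM j<n. P a j x * w j b x) x = 
    (SUM j<n. P a j x * pd i (w j b) x + pd i (P a j) x * w j b x)"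
   by (subst partial_deriv_sum[OF V x i])
     (auto intro!: sum.cong partial_deriv_mult[OF V x i] smooth_on_mult[OF V] simp: P_smooth w_smooth ac b)
  ultimately show ?thesis by (simp add: sum.distrib)
 qed
 have "pd i (P a c) x = (SUM j<n. pd i (P a j) x * dl j c)" using ac by (simp add: sum_delta_mult)
 also have "... = (SUM j<n. pd i (P a j) x * (SUM b<n. w j b x * P b c x))"
  by (rule sum.cong) (simp_all add: P_right x ac)
 also have "... = (SUM b<n. (SUM j<n. pd i (P a j) x * w j b x) * P b c x)"
  by (simp only: sum_distrib_left sum_distrib_right mult.assoc) (rule sum.swap)
 also have "... = (SUM b<n. - (SUM j<n. P a j x * pd i (w j b) x) * P b c x)"
  by (intro sum.cong refl arg_cong2[where f="(*)"]) (use e in \<open>simp add: eq_neg_iff_add_eq_0 add.commute\<close>)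
 also have "... = - (SUM b<n. SUM j<n. P a j x * pd i (w j b) x * P b c x)"
  by (simp add: sum_negf sum_distrib_right)
 also have "... = - (SUM j<n. SUM b<n. P a j x * pd i (w j b) x * P b c x)" by (subst sum.swap) simp
 finally show ?thesis .
qed

text \<open>The formula for the derivative of an inverse matrix turns the condition on
  \<open>w\<close> into one on \<open>P\<close>; the connection terms are those of two raised
  indices.\<close>

lemma P_parallel:
 assumes x: "x : V" and i: "i<n" and pq: "p<n" "q<n"
 shows "pd i (P q p) x + (SUM k<n. Gam n w T i p k x * P q k x) + (SUM k<n. Gam n w T i q k x * P k p x) = 0"
proof -
 have "pd i (P q p) x = - (SUM m<n. SUM r<n. P q m x * (T m i r x - T r i m x) * P r p x)"
  unfolding P_deriv[OF x i pq(2,1)] by (intro arg_cong[where f=uminus] sum.cong refl) (simp add: T_w x i)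
 also have "... = (SUM m<n. SUM r<n. P q m x * T r i m x * P r p x) - (SUM m<n. SUM r<n. P q m x * T m i r x * P r p x)"
  by (simp add: algebra_simps sum_subtractf)
 also have "(SUM m<n. SUM r<n. P q m x * T m i r x * P r p x) = (SUM k<n. Gam n w T i q k x * P k p x)"
  unfolding Gam_def sum_distrib_right by (rule sum.swap)
 also have "(SUM m<n. SUM r<n. P q m x * T r i m x * P r p x) = - (SUM k<n. Gam n w T i p k x * P q k x)"
 proof -
  have "P q m x * T r i m x * P r p x = - (P p r x * T r i m x * P q m x)" if "r<n" for m r
   using P_anti[OF x pq(1) that] by simp
  thus ?thesis unfolding Gam_def sum_distrib_right sum_negf[symmetric] by (intro sum.cong refl) simp
 qed
 finally show ?thesis by simp
qed

text \<open>The transposition makes this the tensor of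
  \<open>{f, g} = \<omega>(X\<^sub>f, X\<^sub>g)\<close> with
  \<open>\<omega>(X\<^sub>f, \<cdot>) = df\<close>, so that \<open>{q, p} = 1\<close> for
  \<open>dq \<and> dp\<close>.\<close>

definition pois :: "nat => nat => pt => complex" where "pois p q x = of_real (P q p x)"

definition A :: "nat => nat => nat => pt => complex" where "A i l j x = of_real (Gam n w T i l j x)"

lemma pois_smooth: "p<n ==> q<n ==> smooth_on n V (pois p q)"
 unfolding pois_def[abs_def] by (intro smooth_on_of_real[OF V]) (simp add: P_smooth)

lemma pois_anti: "x : V ==> p<n ==> q<n ==> pois q p x = - pois p q x"
 using P_anti[of x q p] by (simp add: pois_def)

lemma A_smooth: "i<n ==> j<n ==> l<n ==> smooth_on n V (A i l j)"
 unfolding A_def[abs_def] by (intro smooth_on_of_real[OF V]) (simp add: Gam_smooth)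

lemma A_sym: "x : V ==> i<n ==> j<n ==> l<n ==> A i l j x = A j l i x"
 by (simp add: A_def Gam_sym)

lemma parallel:
 assumes x: "x : V" and i: "i<n" and pq: "p<n" "q<n"
 shows "pd i (pois p q) x + (SUM k<n. A i p k x * pois k q x) + (SUM k<n. A i q k x * pois p k x) = 0"
proof -
 have "pd i (pois p q) x = of_real (pd i (P q p) x)"
  unfolding pois_def[abs_def] by (rule partial_deriv_of_real[OF V x i]) (simp add: P_smooth pq)
 hence "pd i (pois p q) x + (SUM k<n. A i p k x * pois k q x) + (SUM k<n. A i q k x * pois p k x) =
   of_real (pd i (P q p) x + (SUM k<n. Gam n w T i p k x * P q k x) + (SUM k<n. Gam n w T i q k x * P k p x))"
  by (simp add: A_def pois_def)
 thus ?thesis using P_parallel[OF assms] by simp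
qed

text \<open>Sections are extended by zero outside of \<open>V\<close>.\<close>

definition secs :: "(pt => fib) set" where
 "secs = {a. (ALL m. pol_smooth n V (%x. a x m)) & (ALL x m i. i >= n --> dy i (a x m) = 0) & (ALL x. x ~: V --> a x = 0)}"

definition sdy :: "nat => (pt => fib) => pt => fib" where "sdy i a x m = dy i (a x m)"

definition sym :: "nat => (pt => fib) => pt => fib" where "sym i a x m = ymul i (a x m)"

definition snab :: "nat => (pt => fib) => pt => fib" where
 "snab i a x m = (if x : V then nab n (A i) i (%x. a x m) x else 0)"

text \<open>For \<open>s = 0\<close> the coefficient free of \<open>y\<close> is divided by zero,
  which gives zero: \<open>sinv 0\<close> thereby also removes that coefficient, as
  \<open>sct (sinv 0 a) = 0\<close> demands.\<close>

definition sinv :: "nat => (pt => fib) => pt => fib" where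
 "sinv s a x m M = a x m M / of_nat (size M + s)"

definition sct :: "(pt => fib) => pt => fib" where
 "sct a x m M = (if M = {#} then a x m M else 0)"

definition sbrk :: "(pt => fib) => (pt => fib) => pt => fib" where
 "sbrk a b x = brk n (%p q. pois p q x) (a x) (b x)"

definition smul :: "(pt => fib) => (pt => fib) => pt => fib" where
 "smul a b x = moy n (%p q. pois p q x) (a x) (b x)"

definition sFil :: "nat => (pt => fib) set" where "sFil k = {a. ALL x. a x : Fil k}"

definition K :: "nat => nat => nat => nat => pt => complex" where
 "K i j m l x = pd j (A i m l) x - pd i (A j m l) x
   + (SUM k<n. A j m k x * A i k l x - A i m k x * A j k l x)"

definition Q :: "nat => nat => nat => nat => pt => complex" where
 "Q i j k l x = - (SUM m<n. of_real (w k m x) * K i j m l x)"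

text \<open>The quadratic fibre function that generates the curvature operator \<open>Lop\<close> of
  \<open>K\<close>. Its coefficients \<open>Q\<close> are the curvature with an index lowered by the
  form, up to sign.\<close>

definition sR :: "nat => nat => pt => fib" where
 "sR i j x = (if x : V & i<n & j<n
   then fconst (sc (1/2) (SUM l<n. SUM k<n. sc (Q i j k l x) (ymul k (ymul l pone)))) else 0)"

lemma secsD:
 assumes "a : secs"
 shows "pol_smooth n V (%x. a x m)" "i >= n ==> dy i (a x m) = 0" "x ~: V ==> a x = 0"
 using assms by (simp_all add: secs_def)

lemma secs_fconst:
 assumes "pol_smooth n V u" "!!x i. x : V ==> i >= n ==> dy i (u x) = 0"
 shows "(%x. if x : V then fconst (u x) else 0) : secs"
proof -
 have "pol_smooth n V (%x. (if x : V then fconst (u x) else 0) m)" for m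
 proof -
  have "smooth_on n V (%x. (if x : V then fconst (u x) else 0) m M) <-> smooth_on n V (%x. if m = 0 then u x M else 0)" for M
   by (rule smooth_on_cong[OF V]) (simp add: fconst_def)
  thus ?thesis using assms(1) smooth_on_const[OF V, of 0] by (cases "m = 0") (simp_all add: pol_smooth_def)
 qed
 thus ?thesis using assms(2) by (auto simp: secs_def fconst_def dy_zero)
qed

lemma secs_mask:
 assumes "!!m. pol_smooth n V (%x. a x m)" "!!x m i. x : V ==> i >= n ==> dy i (a x m) = 0"
 shows "(%x m. if x : V then a x m else 0) : secs"
proof -
 have "smooth_on n V (%x. (if x : V then a x m else 0) M) <-> smooth_on n V (%x. a x m M)" for m M
  by (rule smooth_on_cong[OF V]) simp
 thus ?thesis using assms by (auto simp: secs_def pol_smooth_def dy_zero fun_eq_iff)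
qed

lemma secs_add: "a : secs ==> b : secs ==> a + b : secs" and secs_diff: "a : secs ==> b : secs ==> a - b : secs"
 and secs_zero: "0 : secs"
 by (auto simp: secs_def dy_add dy_diff dy_zero pol_smooth_def smooth_on_add[OF V] smooth_on_diff[OF V] smooth_on_const[OF V])

lemma secs_dy: "a : secs ==> sdy i a : secs"
 by (auto simp: secs_def sdy_def fun_eq_iff pol_smooth_def dy_def add_mset_commute)

lemma secs_ymul: "a : secs ==> i<n ==> sym i a : secs"
 by (auto simp: secs_def sym_def pol_smooth_ymul[OF V] dy_ymul ymul_zero fun_eq_iff[of _ "0::fib"])

lemma secs_snab:
 assumes a: "a : secs" and i: "i<n"
 shows "snab i a : secs"
proof -
 have "(%x m. if x : V then nab n (A i) i (%x. a x m) x else 0) : secs"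
 proof (rule secs_mask)
  show "pol_smooth n V (nab n (A i) i (%x. a x m))" for m unfolding nab_def[abs_def]
   by (intro pol_smooth_diff[OF V] pol_smooth_pdx[OF V] pol_smooth_Lop[OF V] secsD(1)[OF a] i) (simp add: A_smooth i)
  fix x m p assume x: "x : V" and p: "n <= p"
  have z: "dy p (a x m) = 0" for x using secsD(2)[OF a p] .
  have "dy p (Lop n (%k j. A i k j x) (a x m)) = 0"
   using p by (simp add: Lop_def dy_sum dy_sc dy_ymul dy_commute[of p] z dy_zero ymul_zero sc_zero)
  moreover have "dy p (pdx i (%x. a x m) x) = 0"
   unfolding pdx_dy[symmetric] z by (simp add: pdx_def fun_eq_iff)
  ultimately show "dy p (nab n (A i) i (%x. a x m) x) = 0" by (simp add: nab_def dy_diff)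
 qed
 moreover have "snab i a = (%x m. if x : V then nab n (A i) i (%x. a x m) x else 0)"
  by (simp add: fun_eq_iff snab_def)
 ultimately show ?thesis by simp
qed

lemma secs_sinv: "a : secs ==> sinv s a : secs"
proof -
 assume a: "a : secs"
 have "smooth_on n V (%x. a x m M / c)" for m M c
  using smooth_on_mult[OF V smooth_on_const[OF V, of "inverse c"], of "%x. a x m M"] secsD(1)[OF a]
  by (simp add: pol_smooth_def divide_inverse mult.commute)
 moreover have "a x m (add_mset i M) = 0" if "i >= n" for x m i M
  using secsD(2)[OF a that, of x m] by (simp add: dy_def fun_eq_iff)
 ultimately show ?thesis using secsD(3)[OF a] by (auto simp: secs_def sinv_def pol_smooth_def dy_def fun_eq_iff)
qed

lemma pol_smooth_moy:
 assumes "a : secs" "b : secs"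
 shows "pol_smooth n V (%x. moy n (%p q. pois p q x) (a x) (b x) m)"
 unfolding moy_def split_beta
 by (intro pol_smooth_sum[OF V] pol_smooth_sc[OF V] smooth_on_const[OF V] pol_smooth_bidiff[OF V] secsD(1)[OF assms(1)] secsD(1)[OF assms(2)])
   (simp add: pois_smooth)

lemma dy_moy: "dy i (moy n po a b m) = (SUM (k, p, q):triples m. sc (moy_coeff k) (bidiff n po k (dy i (a p)) (b q) + bidiff n po k (a p) (dy i (b q))))"
 by (simp add: moy_def split_beta dy_sum dy_sc dy_bidiff)

lemma secs_smul: "a : secs ==> b : secs ==> smul a b : secs"
 unfolding secs_def[of] mem_Collect_eq
 by (intro conjI allI impI) (auto simp: smul_def pol_smooth_moy secs_def dy_moy bidiff_zero sc_zero split_beta moy_zero simp del: plus_fun_apply)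

lemma secs_sbrk: 
 assumes a: "a : secs" and b: "b : secs"
 shows "sbrk a b : secs"
proof -
 have "pol_smooth n V (%x. sbrk a b x m)" for m unfolding sbrk_def brk_def
  by (intro pol_smooth_sc[OF V] smooth_on_const[OF V] pol_smooth_diff[OF V] pol_smooth_moy a b)
 moreover have "dy i (sbrk a b x m) = 0" if "i >= n" for i x m
  using secsD(2)[OF a that] secsD(2)[OF b that]
  by (simp add: sbrk_def brk_def dy_sc dy_diff dy_moy bidiff_zero sc_zero split_beta del: plus_fun_apply)
 moreover have "sbrk a b x = 0" if "x ~: V" for x
  by (rule ext) (simp add: sbrk_def brk_def secsD(3)[OF a that] secsD(3)[OF b that] moy_zero sc_zero)
 ultimately show ?thesis by (simp add: secs_def)
qed

end

lemma pdx_cong: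
 assumes "oES n V" "x : V" "i<n" "!!y. y : V ==> a y = b y"
 shows "pdx i a x = pdx i b x"
 unfolding pdx_def by (rule ext, rule partial_deriv_cong[OF assms(1-3)]) (simp add: assms(4))

lemma Lop_diff: "Lop n A (a - b) = Lop n A a - Lop n A b" using Lop_add[of n A "a - b" b] by simp

lemma Lop_sum: "Lop n A (SUM i:I. f i) = (SUM i:I. Lop n A (f i))"
 using sum_comp_morphism[of "Lop n A" f I] by (simp add: Lop_zero Lop_add comp_def)

lemma Lop_matrix_add: "Lop n (%k j. A k j + B k j) a = Lop n A a + Lop n B a"
 and Lop_matrix_diff: "Lop n (%k j. A k j - B k j) a = Lop n A a - Lop n B a"
 by (simp_all add: Lop_def sum.distrib[symmetric] sum_subtractf[symmetric], 
   simp_all add: fun_eq_iff sum_fun_apply sc_apply algebra_simps sum.distrib sum_subtractf)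

lemma Lop_empty: "Lop n A a {#} = 0" by (simp add: Lop_def sum_fun_apply sc_apply ymul_empty)

lemma ymul_zero_below:
 assumes "!!M. size M<d ==> a M = 0" "size M<Suc d"
 shows "ymul i a M = 0"
proof (cases "i \<in># M")
 case True
 hence "size M > 0" by (auto simp: nonempty_has_size[symmetric])
 hence "size (M - {#i#})<d" using True assms(2) by (simp add: size_Diff_singleton)
 thus ?thesis using assms(1) by (simp add: ymul_def)
qed (simp add: ymul_def not_in_iff)

lemma dy_zero_below: "(!!M. size M<Suc d ==> a M = 0) ==> size M<d ==> dy i a M = 0"
 by (simp add: dy_def)

lemma pdx_commute:
 assumes "oES n V" "x : V" "i<n" "j<n" "pol_smooth n V a"
 shows "pdx i (pdx j a) x = pdx j (pdx i a) x"
proof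
 fix M
 have "pdx i (pdx j a) x M = hs a i j M x" for i j
  by (simp add: pdx_def[of _ "pdx _ _"], simp add: pdx_def[abs_def])
 thus "pdx i (pdx j a) x M = pdx j (pdx i a) x M"
  using partial_deriv_commute[OF assms(1-4), of "%x. a x M"] assms(5) by (simp add: pol_smooth_def)
qed

lemma pdx_Lop:
 assumes V: "oES n V" "x : V" "i<n" 
  and A: "!!k j. k<n ==> j<n ==> smooth_on n V (A k j)" and a: "pol_smooth n V a"
 shows "pdx i (%x. Lop n (%k j. A k j x) (a x)) x =
   Lop n (%k j. pd i (A k j) x) (a x) + Lop n (%k j. A k j x) (pdx i a x)"
proof -
 have s: "pol_smooth n V (%x. sc (A k j x) (ymul j (dy k (a x))))" if "k<n" "j<n" for k j
  by (intro pol_smooth_sc[OF V(1)] pol_smooth_ymul[OF V(1)] pol_smooth_dy[OF V(1)] A that a)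
 have "pdx i (%x. Lop n (%k j. A k j x) (a x)) x = (SUM j<n. pdx i (%x. SUM k<n. sc (A k j x) (ymul j (dy k (a x)))) x)"
  unfolding Lop_def by (rule pdx_sum[OF V]) (auto intro!: pol_smooth_sum[OF V(1)] s)
 also have "... = (SUM j<n. SUM k<n. pdx i (%x. sc (A k j x) (ymul j (dy k (a x)))) x)"
  by (intro sum.cong refl pdx_sum[OF V]) (simp add: s)
 also have "... = (SUM j<n. SUM k<n. sc (pd i (A k j) x) (ymul j (dy k (a x))) + sc (A k j x) (ymul j (dy k (pdx i a x))))"
 proof (intro sum.cong refl)
  fix j k assume "j : {..<n}" "k : {..<n}"
  thus "pdx i (%x. sc (A k j x) (ymul j (dy k (a x)))) x =
    sc (pd i (A k j) x) (ymul j (dy k (a x))) + sc (A k j x) (ymul j (dy k (pdx i a x)))"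
   by (subst pdx_sc[OF V]) 
     (auto intro!: A pol_smooth_ymul[OF V(1)] pol_smooth_dy[OF V(1)] a simp: pdx_ymul[OF V pol_smooth_dy[OF V(1) a]] pdx_dy)
 qed
 finally show ?thesis by (simp add: Lop_def sum.distrib)
qed

lemma nab_sum:
 assumes V: "oES n V" "x : V" "i<n" and "!!j. j : J ==> pol_smooth n V (f j)"
 shows "nab n A i (%x. SUM j:J. f j x) x = (SUM j:J. nab n A i (f j) x)"
proof -
 have "pdx i (%x. SUM j:J. f j x) x = (SUM j:J. pdx i (f j) x)" by (rule pdx_sum[OF V assms(4)])
 thus ?thesis by (simp add: nab_def Lop_sum sum_subtractf del: minus_apply)
qed

lemma nab_sc:
 assumes V: "oES n V" "x : V" "i<n" and "pol_smooth n V a"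
 shows "nab n A i (%x. sc c (a x)) x = sc c (nab n A i a x)"
 unfolding nab_def Lop_sc pdx_sc[OF V smooth_on_const[OF V(1)] assms(4)] partial_deriv_const sc_zero_left by (simp add: sc_diff)

lemma nab_diff:
 assumes V: "oES n V" "x : V" "i<n" and "pol_smooth n V a" "pol_smooth n V b"
 shows "nab n A i (%x. a x - b x) x = nab n A i a x - nab n A i b x"
 unfolding nab_def Lop_diff pdx_diff[OF V assms(4,5)] by simp

lemma nab_cong:
 assumes "oES n V" "x : V" "i<n" "!!y. y : V ==> a y = b y"
 shows "nab n A i a x = nab n A i b x"
proof -
 have "pdx i a x = pdx i b x" by (rule pdx_cong[OF assms(1-3)]) (rule assms(4))
 thus ?thesis unfolding nab_def assms(4)[OF assms(2)] by simp
qed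

context sympl_chart begin

lemma snab_add: 
 assumes "a : secs" "b : secs" "i<n"
 shows "snab i (a + b) = snab i a + snab i b"
proof (intro ext)
 fix x m M
 have "pdx i (%x. a x m + b x m) x = pdx i (%x. a x m) x + pdx i (%x. b x m) x" if "x : V"
  by (rule pdx_add[OF V that assms(3)]) (use assms secsD(1) in auto)
 thus "snab i (a + b) x m M = (snab i a + snab i b) x m M" by (simp add: snab_def nab_def Lop_add)
qed

text \<open>The commutator of fibre and covariant derivative is minus the connection matrix applied
  to \<open>dy\<close>, which is symmetric in \<open>i\<close> and \<open>j\<close>.\<close>

lemma snab_torsion:
 assumes a: "a : secs" and ij: "i<n" "j<n"
 shows "sdy i (snab j a) - snab j (sdy i a) = sdy j (snab i a) - snab i (sdy j a)"
proof (intro ext)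
 fix x m M
 have e: "sdy i (snab j a) x m - snab j (sdy i a) x m = (if x : V then - (SUM k<n. sc (A j k i x) (dy k (a x m))) else 0)"
  if "i<n" "j<n" for i j
  using that by (simp add: sdy_def snab_def nab_def dy_diff dy_Lop pdx_dy dy_zero del: plus_fun_apply)
 have "sdy i (snab j a) x m - snab j (sdy i a) x m = sdy j (snab i a) x m - snab i (sdy j a) x m"
  unfolding e[OF ij] e[OF ij(2,1)] using A_sym[of x i j] ij by (auto intro!: sum.cong)
 from fun_cong[OF this, of M] show "(sdy i (snab j a) - snab j (sdy i a)) x m M = (sdy j (snab i a) - snab i (sdy j a)) x m M"
  by simp
qed

text \<open>Second derivatives commute and the mixed terms occur in both orders; the quadratic part
  of \<open>K\<close> is the matrix commutator from \<open>Lop_compose\<close>.\<close>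

lemma snab_curvature:
 assumes a: "a : secs" and ij: "i<n" "j<n" and x: "x : V"
 shows "snab i (snab j a) x m - snab j (snab i a) x m = Lop n (%p l. K i j p l x) (a x m)"
proof -
 let ?u = "%x. a x m"
 have u: "pol_smooth n V ?u" using secsD(1)[OF a] .
 have e: "snab i (snab j a) x m = pdx i (pdx j ?u) x - Lop n (%k l. pd i (A j k l) x) (?u x)
   - Lop n (%k l. A j k l x) (pdx i ?u x) - Lop n (%k l. A i k l x) (pdx j ?u x)
   + Lop n (%k l. A i k l x) (Lop n (%k l. A j k l x) (?u x))" if ij: "i<n" "j<n" for i j
 proof -
  have "snab i (snab j a) x m = nab n (A i) i (%x. nab n (A j) j ?u x) x"
   using x by (simp add: snab_def[of i]) (rule nab_cong[OF V x ij(1)], simp add: snab_def)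
  also have "... = pdx i (%x. pdx j ?u x - Lop n (%k l. A j k l x) (?u x)) x
    - Lop n (%k l. A i k l x) (pdx j ?u x - Lop n (%k l. A j k l x) (?u x))"
   by (simp only: nab_def)
  also have "pdx i (%x. pdx j ?u x - Lop n (%k l. A j k l x) (?u x)) x =
    pdx i (pdx j ?u) x - pdx i (%x. Lop n (%k l. A j k l x) (?u x)) x"
   by (rule pdx_diff[OF V x ij(1)]) (auto intro!: pol_smooth_pdx[OF V] pol_smooth_Lop[OF V] u ij A_smooth)
  also have "pdx i (%x. Lop n (%k l. A j k l x) (?u x)) x = 
    Lop n (%k l. pd i (A j k l) x) (?u x) + Lop n (%k l. A j k l x) (pdx i ?u x)"
   by (rule pdx_Lop[OF V x ij(1) _ u]) (simp add: A_smooth ij)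
  finally have q: "snab i (snab j a) x m = pdx i (pdx j ?u) x - (Lop n (%k l. pd i (A j k l) x) (?u x)
    + Lop n (%k l. A j k l x) (pdx i ?u x)) - Lop n (%k l. A i k l x) (pdx j ?u x - Lop n (%k l. A j k l x) (?u x))" .
  show ?thesis unfolding q Lop_diff by (rule ext) simp
 qed
 have "snab i (snab j a) x m - snab j (snab i a) x m = 
   Lop n (%k l. pd j (A i k l) x) (?u x) - Lop n (%k l. pd i (A j k l) x) (?u x)
   + (Lop n (%k l. A i k l x) (Lop n (%k l. A j k l x) (?u x)) - Lop n (%k l. A j k l x) (Lop n (%k l. A i k l x) (?u x)))"
  unfolding e[OF ij] e[OF ij(2,1)] using pdx_commute[OF V x ij u] by (simp add: algebra_simps)
 also have "... = Lop n (%p l. K i j p l x) (?u x)"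
  unfolding Lop_compose K_def Lop_matrix_add Lop_matrix_diff ..
 finally show ?thesis .
qed

lemma snab_smul:
 assumes a: "a : secs" and b: "b : secs" and i: "i<n"
 shows "snab i (smul a b) = smul (snab i a) b + smul a (snab i b)"
proof (intro ext)
 fix x m M
 show "snab i (smul a b) x m M = (smul (snab i a) b + smul a (snab i b)) x m M"
 proof (cases "x : V")
  case False
  thus ?thesis using secsD(3)[OF a] secsD(3)[OF b] by (simp add: smul_def snab_def moy_zero)
 next
  case True
  let ?B = "%k a b x. bidiff n (%p q. pois p q x) k (a x) (b x)"
  have sm: "pol_smooth n V (?B k (%x. a x p) (%x. b x q))" for k p q
   by (rule pol_smooth_bidiff[OF V]) (simp_all add: pois_smooth secsD(1)[OF a] secsD(1)[OF b])
  have "snab i (smul a b) x m = nab n (A i) i (%x. SUM z:triples m. sc (moy_coeff (fst z)) (?B (fst z) (%x. a x (fst (snd z))) (%x. b x (snd (snd z))) x)) x"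
   using True by (simp add: snab_def smul_def moy_def split_beta)
  also have "... = (SUM z:triples m. nab n (A i) i (%x. sc (moy_coeff (fst z)) (?B (fst z) (%x. a x (fst (snd z))) (%x. b x (snd (snd z))) x)) x)"
   by (rule nab_sum[OF V True i]) (rule pol_smooth_sc[OF V smooth_on_const[OF V] sm])
  also have "... = (SUM z:triples m. sc (moy_coeff (fst z)) (bidiff n (%p q. pois p q x) (fst z) (snab i a x (fst (snd z))) (b x (snd (snd z)))
    + bidiff n (%p q. pois p q x) (fst z) (a x (fst (snd z))) (snab i b x (snd (snd z)))))"
  proof (rule sum.cong[OF refl])
   fix z
   show "nab n (A i) i (%x. sc (moy_coeff (fst z)) (?B (fst z) (%x. a x (fst (snd z))) (%x. b x (snd (snd z))) x)) x =
    sc (moy_coeff (fst z)) (bidiff n (%p q. pois p q x) (fst z) (snab i a x (fst (snd z))) (b x (snd (snd z)))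
    + bidiff n (%p q. pois p q x) (fst z) (a x (fst (snd z))) (snab i b x (snd (snd z))))"
    unfolding nab_sc[OF V True i sm] snab_def if_P[OF True]
    by (rule arg_cong[where f="sc _"], rule nab_bidiff[OF V _ True i])
      (simp_all add: pois_smooth parallel[OF True i] secsD(1)[OF a] secsD(1)[OF b])
  qed
  also have "... = smul (snab i a) b x m + smul a (snab i b) x m"
   by (simp add: smul_def moy_def split_beta sc_add sum.distrib del: plus_fun_apply)
  finally show ?thesis by simp
 qed
qed

lemma sbrk_smul: "sbrk a b x m = sc \<i> (smul a b x (Suc m) - smul b a x (Suc m))"
 by (simp add: sbrk_def brk_def smul_def)

lemma snab_sbrk:
 assumes a: "a : secs" and b: "b : secs" and i: "i<n"
 shows "snab i (sbrk a b) = sbrk (snab i a) b + sbrk a (snab i b)"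
proof (intro ext)
 fix x m M
 show "snab i (sbrk a b) x m M = (sbrk (snab i a) b + sbrk a (snab i b)) x m M"
 proof (cases "x : V")
  case False
  thus ?thesis using secsD(3)[OF a] secsD(3)[OF b] by (simp add: sbrk_smul smul_def snab_def moy_zero sc_zero)
 next
  case True
  have s: "pol_smooth n V (%x. smul a b x m)" "pol_smooth n V (%x. smul b a x m)" for m
   using secsD(1)[OF secs_smul[OF a b]] secsD(1)[OF secs_smul[OF b a]] by simp_all
  have "snab i (sbrk a b) x m = nab n (A i) i (%x. sc \<i> (smul a b x (Suc m) - smul b a x (Suc m))) x"
   using True by (simp add: snab_def sbrk_smul)
  also have "... = sc \<i> (nab n (A i) i (%x. smul a b x (Suc m)) x - nab n (A i) i (%x. smul b a x (Suc m)) x)"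
   by (subst nab_sc[OF V True i pol_smooth_diff[OF V s]], subst nab_diff[OF V True i s], rule refl)
  also have "... = sc \<i> (snab i (smul a b) x (Suc m) - snab i (smul b a) x (Suc m))"
   using True by (simp add: snab_def)
  also have "... = sbrk (snab i a) b x m + sbrk a (snab i b) x m"
   unfolding snab_smul[OF a b i] snab_smul[OF b a i] sbrk_smul by (simp add: fun_eq_iff sc_apply algebra_simps)
  finally show ?thesis by simp
 qed
qed

definition lin :: "nat => pt => fib" where
 "lin p x = (if x : V then fconst (ymul p pone) else 0)"

lemma lin_secs: "p<n ==> lin p : secs"
proof -
 assume p: "p<n"
 have "dy i (ymul p pone) = 0" if "i >= n" for i using p that by (simp add: dy_ymul dy_pone ymul_zero)
 hence "(%x. if x : V then fconst ((%x. ymul p pone) x) else 0) : secs"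
  by (intro secs_fconst pol_smooth_const[OF V])
 thus ?thesis by (simp add: lin_def[abs_def])
qed

lemma sbrk_lin:
 assumes "x : V" "p<n"
 shows "sbrk (lin p) b x m = - (SUM q<n. sc (pois p q x) (dy q (b x m)))"
proof -
 have "brk n (%p q. pois p q x) (fconst (ymul p pone)) (b x) m = - (SUM q<n. sc (pois p q x) (dy q (b x m)))"
  by (rule brk_linear[OF pois_anti[OF assms(1)] assms(2)])
 thus ?thesis using assms(1) by (simp add: sbrk_def lin_def)
qed

lemma sbrk_anti: "sbrk b a = - sbrk a b"
proof
 fix x show "sbrk b a x = (- sbrk a b) x" by (subst uminus_apply, simp only: sbrk_def, rule brk_anti)
qed

text \<open>No Christoffel symbols are expanded: the commutator of covariant derivatives is a
  derivation of the bracket. Applied to two linear fibre functions, whose bracket at order zero is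
  free of \<open>y\<close> and hence annihilated by \<open>Lop\<close>, it says that
  \<open>K\<close> is infinitesimally symplectic.\<close>

lemma K_symplectic:
 assumes ij: "i<n" "j<n" and x: "x : V" and pq: "p<n" "q<n"
 shows "(SUM l<n. K i j p l x * pois l q x) + (SUM l<n. K i j q l x * pois p l x) = 0"
proof -
 define C where "C a = snab i (snab j a) - snab j (snab i a)" for a
 have Cs: "C a : secs" if "a : secs" for a unfolding C_def by (intro secs_diff secs_snab that ij)
 have Cx: "C a x m = Lop n (%p l. K i j p l x) (a x m)" if "a : secs" for a m
  using snab_curvature[OF that ij x, of m] by (simp add: C_def)
 have S: "lin p : secs" "lin q : secs" using lin_secs pq by simp_all
 have der: "C (sbrk a b) = sbrk (C a) b + sbrk a (C b)" if a: "a : secs" and b: "b : secs" for a b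
 proof -
  have s: "snab i (snab j (sbrk a b)) = sbrk (snab i (snab j a)) b + sbrk (snab j a) (snab i b)
    + (sbrk (snab i a) (snab j b) + sbrk a (snab i (snab j b)))" if "i<n" "j<n" for i j
   using that a b by (simp add: snab_sbrk snab_add secs_snab secs_sbrk)
  have l: "sbrk (u - v) c = sbrk u c - sbrk v c" "sbrk c (u - v) = sbrk c u - sbrk c v" for u v c
  proof -
   show r: "sbrk c (u - v) = sbrk c u - sbrk c v" for u v c by (rule ext) (simp add: sbrk_def brk_diff)
   show "sbrk (u - v) c = sbrk u c - sbrk v c" unfolding sbrk_anti[of _ c] r by simp
  qed
  show ?thesis unfolding C_def s[OF ij] s[OF ij(2,1)] l by (simp add: algebra_simps)
 qed
 have Clin: "C (lin p) x m = (if m = 0 then (SUM l<n. sc (K i j p l x) (ymul l pone)) else 0)" if "p<n" for p m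
  unfolding Cx[OF lin_secs[OF that]] using that x
  by (simp add: lin_def fconst_def Lop_ymul Lop_pone ymul_zero Lop_zero)
 have pp: "dy q (ymul l pone) = (if q = l then pone else 0)" for q l by (simp add: dy_ymul dy_pone ymul_zero)
 have b: "sbrk (lin p) (C (lin q)) x 0 = - sc (SUM l<n. pois p l x * K i j q l x) pone" if "p<n" "q<n" for p q
 proof -
  have "sbrk (lin p) (C (lin q)) x 0 = - (SUM r<n. SUM l<n. if r = l then sc (pois p r x * K i j q l x) pone else 0)"
   unfolding sbrk_lin[OF x that(1)] Clin[OF that(2)] 
   by (simp add: dy_sum dy_sc pp sc_sum sc_sc if_distrib[of "sc _"] sc_zero cong: if_cong)
  also have "... = - (SUM r<n. sc (pois p r x * K i j q r x) pone)" by simp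
  finally show ?thesis by (simp add: sc_sum_left)
 qed
 have "C (sbrk (lin p) (lin q)) x 0 = 0"
 proof -
  have "sbrk (lin p) (lin q) x 0 = - (SUM r<n. sc (pois p r x) (if r = q then pone else 0))"
   unfolding sbrk_lin[OF x pq(1)] using x by (simp add: lin_def fconst_def pp)
  hence "Lop n (%p l. K i j p l x) (sbrk (lin p) (lin q) x 0) = 0"
  proof -
   have "Lop n M (- (SUM r<n. sc (pois p r x) (if r = q then pone else 0))) = 0" for M
    using Lop_sc[of n M "-1" "SUM r<n. sc (pois p r x) (if r = q then pone else 0)"]
    by (simp add: sc_minus_one Lop_sum Lop_sc if_distrib[of "Lop n M"] Lop_pone Lop_zero sc_zero cong: if_cong)
   thus ?thesis using \<open>sbrk (lin p) (lin q) x 0 = _\<close> by simp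
  qed
  thus ?thesis using Cx[OF secs_sbrk[OF S], of 0] by simp
 qed
 moreover have "C (sbrk (lin p) (lin q)) x 0 = - sbrk (lin q) (C (lin p)) x 0 + sbrk (lin p) (C (lin q)) x 0"
  unfolding der[OF S] using sbrk_anti[of "C (lin p)" "lin q"] by simp
 ultimately have "0 = sc (SUM l<n. pois q l x * K i j p l x) pone - sc (SUM l<n. pois p l x * K i j q l x) pone"
  unfolding b[OF pq] b[OF pq(2,1)] by simp
 from fun_cong[OF this, of "{#}"]
 have "0 = (SUM l<n. pois q l x * K i j p l x) - (SUM l<n. pois p l x * K i j q l x)"
  by (simp add: sc_apply pone_def)
 moreover have "(SUM l<n. pois q l x * K i j p l x) = - (SUM l<n. K i j p l x * pois l q x)"
  unfolding sum_negf[symmetric]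
 proof (rule sum.cong[OF refl])
  fix l assume "l : {..<n}"
  hence "pois q l x = - pois l q x" using pois_anti[OF x _ pq(2)] by simp
  thus "pois q l x * K i j p l x = - (K i j p l x * pois l q x)" by simp
 qed
 ultimately have "(SUM l<n. pois p l x * K i j q l x) = - (SUM l<n. K i j p l x * pois l q x)" by simp
 thus ?thesis by (simp add: mult.commute[of "K _ _ q _ _"])
qed

end

context sympl_chart begin

lemma w_pois: "x : V ==> j<n ==> l<n ==> (SUM q<n. of_real (w j q x) * pois l q x) = dl j l"
proof -
 assume a: "x : V" "j<n" "l<n"
 have "(SUM q<n. of_real (w j q x) * pois l q x) = (of_real (SUM q<n. w j q x * P q l x) :: complex)"
  by (simp add: pois_def)
 thus ?thesis using P_right[OF a] by simp
qed

lemma pois_w: "x : V ==> l<n ==> m<n ==> (SUM k<n. pois k l x * of_real (w k m x)) = dl l m"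
proof -
 assume a: "x : V" "l<n" "m<n"
 have "(SUM k<n. pois k l x * of_real (w k m x)) = (of_real (SUM k<n. P l k x * w k m x) :: complex)"
  by (simp add: pois_def)
 thus ?thesis using P_left[OF a] by simp
qed

lemma w_pois': "x : V ==> k<n ==> l<n ==> (SUM p<n. of_real (w k p x) * pois p l x) = (if k = l then - 1 else 0)"
proof -
 assume a: "x : V" "k<n" "l<n"
 have "(SUM p<n. of_real (w k p x) * pois p l x) = (SUM p<n. - (of_real (w k p x) * pois l p x))"
 proof (rule sum.cong[OF refl])
  fix p assume "p : {..<n}"
  hence "pois p l x = - pois l p x" using pois_anti[OF a(1) a(3)] by simp
  thus "of_real (w k p x) * pois p l x = - (of_real (w k p x) * pois l p x)" by simp
 qed
 also have "... = - dl k l" unfolding sum_negf w_pois[OF a] ..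
 finally show ?thesis by simp
qed

text \<open>Both free indices of \<open>K_symplectic\<close> are lowered with the form. The two
  contractions of form and Poisson tensor differ in sign, which turns the sum into a
  difference.\<close>

lemma Q_sym:
 assumes x: "x : V" and ij: "i<n" "j<n" and kl: "k<n" "l<n"
 shows "Q i j k l x = Q i j l k x"
proof -
 let ?w = "%i j. of_real (w i j x) :: complex"
 have "(SUM p<n. SUM q<n. ?w k p * ?w l q * ((SUM r<n. K i j p r x * pois r q x) + (SUM r<n. K i j q r x * pois p r x))) = 0"
  by (simp add: K_symplectic[OF ij x])
 hence "(SUM p<n. SUM q<n. SUM r<n. ?w k p * K i j p r x * (?w l q * pois r q x))
   + (SUM p<n. SUM q<n. SUM r<n. ?w l q * K i j q r x * (?w k p * pois p r x)) = 0"
  by (simp add: distrib_left sum.distrib sum_distrib_left mult_ac)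
 moreover have "(SUM p<n. SUM q<n. SUM r<n. ?w k p * K i j p r x * (?w l q * pois r q x)) = - Q i j k l x"
 proof -
  have "(SUM p<n. SUM q<n. SUM r<n. ?w k p * K i j p r x * (?w l q * pois r q x)) =
    (SUM p<n. SUM r<n. ?w k p * K i j p r x * (SUM q<n. ?w l q * pois r q x))"
   unfolding sum_distrib_left by (rule sum.cong[OF refl], rule sum.swap)
  also have "... = (SUM p<n. SUM r<n. ?w k p * K i j p r x * dl l r)"
   by (intro sum.cong refl arg_cong2[where f="(*)"] w_pois[OF x kl(2)]) simp
  also have "... = - Q i j k l x" using kl by (simp add: sum_delta_mult Q_def)
  finally show ?thesis .
 qed
 moreover have "(SUM p<n. SUM q<n. SUM r<n. ?w l q * K i j q r x * (?w k p * pois p r x)) = Q i j l k x"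
 proof -
  have "(SUM p<n. SUM q<n. SUM r<n. ?w l q * K i j q r x * (?w k p * pois p r x)) =
    (SUM q<n. SUM r<n. ?w l q * K i j q r x * (SUM p<n. ?w k p * pois p r x))"
   unfolding sum_distrib_left by (rule sum3_swap)
  also have "... = (SUM q<n. SUM r<n. ?w l q * K i j q r x * (if k = r then - 1 else 0))"
   by (intro sum.cong refl arg_cong2[where f="(*)"] w_pois'[OF x kl(1)]) simp
  also have "... = (SUM q<n. SUM r<n. - (?w l q * K i j q r x) * dl k r)"
   by (intro sum.cong refl) simp
  also have "... = Q i j l k x" unfolding sum_delta_mult(4)[OF kl(1)] Q_def sum_negf ..
  finally show ?thesis .
 qed
 ultimately show ?thesis by simp
qed

lemma K_from_Q:
 assumes x: "x : V" and lr: "l<n"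
 shows "K i j l r x = - (SUM k<n. pois k l x * Q i j k r x)"
proof -
 let ?w = "%i j. of_real (w i j x) :: complex"
 have "- (SUM k<n. pois k l x * Q i j k r x) = (SUM k<n. SUM m<n. pois k l x * ?w k m * K i j m r x)"
  by (simp add: Q_def sum_negf sum_distrib_left mult.assoc)
 also have "... = (SUM m<n. (SUM k<n. pois k l x * ?w k m) * K i j m r x)"
  unfolding sum_distrib_right by (rule sum.swap)
 also have "... = (SUM m<n. dl l m * K i j m r x)"
  by (intro sum.cong refl arg_cong2[where f="(*)"] pois_w[OF x lr]) simp
 also have "... = K i j l r x" using lr by (simp add: sum_delta_mult)
 finally show ?thesis ..
qed

lemma sbrk_sR:
 assumes "x : V" "i<n" "j<n"
 shows "sbrk (sR i j) a x m = Lop n (%k l. K i j k l x) (a x m)"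
proof -
 have "brk n (%p q. pois p q x) (fconst (sc (1/2) (SUM l<n. SUM k<n. sc (Q i j k l x) (ymul k (ymul l pone))))) (a x) m
   = Lop n (%k l. K i j k l x) (a x m)"
  by (rule brk_quadratic) (rule pois_anti[OF assms(1)] Q_sym[OF assms] K_from_Q[OF assms(1)]; assumption)+
 thus ?thesis using assms by (simp add: sbrk_def sR_def)
qed

lemma K_anti: "K j i k l x = - K i j k l x" by (simp add: K_def sum_subtractf)

lemma Q_smooth:
 assumes ij: "i<n" "j<n" and kl: "k<n" "l<n"
 shows "smooth_on n V (Q i j k l)"
proof -
 have "smooth_on n V (K i j m l)" if "m<n" for m unfolding K_def[abs_def] using ij that kl
  by (intro smooth_on_add[OF V] smooth_on_diff[OF V] smooth_on_sum[OF V] smooth_on_mult[OF V] smooth_on_partial_deriv A_smooth) auto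
 thus ?thesis unfolding Q_def[abs_def] using ij kl
  by (intro smooth_on_uminus[OF V] smooth_on_sum[OF V] smooth_on_mult[OF V] smooth_on_of_real[OF V] w_smooth) auto
qed

lemma sR_secs: "i<n ==> j<n ==> sR i j : secs"
proof -
 assume ij: "i<n" "j<n"
 let ?u = "%x. sc (1/2) (SUM l<n. SUM k<n. sc (Q i j k l x) (ymul k (ymul l pone)))"
 have "pol_smooth n V ?u"
  by (intro pol_smooth_sc[OF V] pol_smooth_sum[OF V] smooth_on_const[OF V] pol_smooth_const[OF V] Q_smooth ij) auto
 moreover have "dy p (?u x) = 0" if "p >= n" for p x
  using that by (simp add: dy_sc dy_sum dy_ymul dy_pone ymul_zero sc_zero)
 ultimately have "(%x. if x : V then fconst (?u x) else 0) : secs" by (rule secs_fconst)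
 thus ?thesis using ij by (simp add: sR_def[abs_def])
qed

lemma sR_small: "size M<2 ==> sR i j x m M = 0"
proof -
 assume M: "size M<2"
 have "ymul k (ymul l pone) M = 0" for k l
  by (rule ymul_zero_below[where d=1], rule ymul_zero_below[where d=0]) (use M in auto)
 thus ?thesis by (simp add: sR_def fconst_def sc_apply sum_fun_apply)
qed

lemma sFil_alt: "a : sFil k <-> (ALL x m M. 2 * m + size M<k --> a x m M = 0)"
 by (auto simp: sFil_def Fil_def)

text \<open>The coefficient of degree \<open>2 * m + size M\<close> no longer changes from the next
  index on, whence the \<open>Suc\<close> in the definition of \<open>z\<close>.\<close>

lemma secs_complete:
 assumes X: "!!k. X k : secs" and d: "!!k. X (Suc k) - X k : sFil k"
 shows "EX z:secs. ALL k. z - X k : sFil k"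
proof -
 define z where "z x m M = X (Suc (2 * m + size M)) x m M" for x :: "pt" and m :: nat and M :: "nat multiset"
 have step: "X (k + l) x m M = X k x m M" if "2 * m + size M<k" for k l :: nat and x :: "pt" and m :: nat and M :: "nat multiset"
 proof (induction l)
  case (Suc l)
  have "X (Suc (k + l)) x m M - X (k + l) x m M = 0" using d[of "k + l"] that by (auto simp: sFil_alt)
  thus ?case using Suc by simp
 qed simp
 have "z : secs"
 proof -
  have "X k x m (add_mset i M) = 0" if "i >= n" for k x m i M
   using secsD(2)[OF X[of k] that, of x m] by (simp add: dy_def fun_eq_iff)
  thus ?thesis
   using secsD(1)[OF X] secsD(3)[OF X] by (auto simp: secs_def z_def pol_smooth_def dy_def fun_eq_iff)
 qed
 moreover have "z - X k : sFil k" for k unfolding sFil_alt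
 proof (intro allI impI)
  fix x :: "pt" and m :: nat and M :: "nat multiset" assume l: "2 * m + size M<k"
  have "X (Suc (2 * m + size M) + (k - Suc (2 * m + size M))) x m M = X (Suc (2 * m + size M)) x m M"
   by (rule step) simp
  thus "(z - X k) x m M = 0" using l by (simp add: z_def)
 qed
 ultimately show ?thesis by blast
qed

lemma secs_support: "a : secs ==> (SUM i<n. sym i (sdy i a)) x m M = of_nat (size M) * a x m M"
 using euler_ymul_dy[of n "a x m" M] secsD(2)[of a] by (simp add: sum_fun_apply sym_def sdy_def)

text \<open>By nondegeneracy of the form, brackets with the linear functions recover all fibre
  derivatives; a section with zero brackets does not depend on \<open>y\<close>, and its term free
  of \<open>y\<close> is zero by assumption.\<close>

lemma secs_center:
 assumes z: "z : secs" and ct: "sct z = 0" and b: "!!p. p<n ==> sbrk (lin p) z = 0"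
 shows "z = 0"
proof (intro ext)
 fix x m M
 have e: "dy r (z x m) = 0" for r
 proof (cases "r<n & x : V")
  case False
  thus ?thesis using secsD(2,3)[OF z] by (auto simp: dy_zero not_less)
 next
  case True
  hence r: "r<n" and x: "x : V" by auto
  have s: "(SUM q<n. sc (pois p q x) (dy q (z x m))) = 0" if "p<n" for p
   using b[OF that] sbrk_lin[OF x that, of z m] by simp
  have "0 = (SUM p<n. sc (of_real (w r p x)) (SUM q<n. sc (pois p q x) (dy q (z x m))))"
   using s by (simp add: sc_zero)
  also have "... = (SUM q<n. sc (SUM p<n. of_real (w r p x) * pois p q x) (dy q (z x m)))"
   by (simp add: sc_sum sc_sc sc_sum_left) (rule sum.swap)
  also have "... = (SUM q<n. sc (if r = q then - 1 else 0) (dy q (z x m)))"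
   by (intro sum.cong refl arg_cong2[where f=sc] w_pois'[OF x r]) simp
  also have "... = (SUM q<n. if r = q then - dy q (z x m) else 0)"
   by (intro sum.cong refl) (auto simp: sc_minus_one sc_zero_left)
  also have "... = - dy r (z x m)" using r by simp
  finally show ?thesis by simp
 qed
 show "z x m M = 0 x m M"
 proof (cases M)
  case empty
  thus ?thesis using fun_cong[OF fun_cong[OF fun_cong[OF ct, of x], of m], of M] by (simp add: sct_def)
 next
  case (add r N)
  thus ?thesis using fun_cong[OF e[of r], of N] by (simp add: dy_def)
 qed
qed

lemma snab_Fil: "a : sFil k ==> snab i a : sFil k" unfolding sFil_alt
proof (intro allI impI)
 fix x :: "pt" and m :: nat and M :: "nat multiset" assume a: "ALL x m M. 2 * m + size M<k --> a x m M = 0" and l: "2 * m + size M<k"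
 have "pdx i (%x. a x m) x M = 0" using a l by (simp add: pdx_def)
 moreover have "Lop n A (a x m) M = 0" for A
 proof -
  define d where "d = k - 2 * m"
  have d: "a x m M = 0" if "size M<d" for M :: "nat multiset" using a that by (simp add: d_def)
  have "ymul j (dy p (a x m)) M = 0" for j p
   by (rule ymul_zero_below[where d="d - 1"], rule dy_zero_below[where d="d - 1"]) (use d l in \<open>auto simp: d_def\<close>)
  thus ?thesis by (simp add: Lop_def sum_fun_apply sc_apply)
 qed
 ultimately show "snab i a x m M = 0" by (simp add: snab_def nab_def)
qed

lemma sdy_smul: "sdy i (smul a b) = smul (sdy i a) b + smul a (sdy i b)"
proof (intro ext)
 fix x m M
 have "sdy i (smul a b) x m = smul (sdy i a) b x m + smul a (sdy i b) x m"
  unfolding sdy_def smul_def dy_moy unfolding moy_def by (simp add: split_beta sc_add sum.distrib sdy_def del: plus_fun_apply)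
 thus "sdy i (smul a b) x m M = (smul (sdy i a) b + smul a (sdy i b)) x m M" by simp
qed

sublocale fed: fedosov n secs sFil sdy sym snab sinv sct sbrk sR
proof unfold_locales
 fix a b c z :: "pt => fib" and i j k p q s :: nat and X :: "nat => pt => fib"
 show "0 : secs" by (rule secs_zero)
 show "a : secs ==> b : secs ==> a + b : secs" by (rule secs_add)
 show "a : secs ==> b : secs ==> a - b : secs" by (rule secs_diff)
 show "a : secs ==> i<n ==> sdy i a : secs" by (rule secs_dy)
 show "a : secs ==> i<n ==> sym i a : secs" by (rule secs_ymul)
 show "a : secs ==> i<n ==> snab i a : secs" by (rule secs_snab)
 show "a : secs ==> sinv s a : secs" by (rule secs_sinv)
 show "a : secs ==> b : secs ==> sbrk a b : secs" by (rule secs_sbrk)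
 show "i<n ==> j<n ==> sR i j : secs" by (rule sR_secs)
 show "sdy i (a + b) = sdy i a + sdy i b" by (simp add: fun_eq_iff sdy_def dy_def)
 show "sym i (a + b) = sym i a + sym i b" by (simp add: fun_eq_iff sym_def ymul_def distrib_left)
 show "sinv s (a + b) = sinv s a + sinv s b" by (simp add: fun_eq_iff sinv_def add_divide_distrib)
 show "sct (a + b) = sct a + sct b" by (simp add: fun_eq_iff sct_def)
 show "sbrk a (b + c) = sbrk a b + sbrk a c" by (rule ext) (simp add: sbrk_def brk_add)
 show "sbrk b a = - sbrk a b" by (rule sbrk_anti)
 show "a : secs ==> b : secs ==> i<n ==> snab i (a + b) = snab i a + snab i b" by (rule snab_add)
 show "sdy i (sdy j a) = sdy j (sdy i a)" by (simp add: fun_eq_iff sdy_def dy_def add_mset_commute)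
 show "sdy i (sym j a) = (if i = j then a else 0) + sym j (sdy i a)"
  by (rule ext, rule ext) (simp add: sdy_def sym_def dy_ymul)
 show "sym i (sym j a) = sym j (sym i a)" by (rule ext, rule ext) (simp only: sym_def ymul_commute)
 show "a : secs ==> (SUM i<n. sym i (sdy i (sinv 1 a))) + sinv 1 a = a"
 proof (intro ext)
  fix x :: "pt" and m :: nat and M :: "nat multiset" assume a: "a : secs"
  have "of_nat (size M) * u / c + u / c = of_nat (size M + 1) * u / c" for u c :: complex by (simp add: algebra_simps add_divide_distrib[symmetric])
  moreover have "(of_nat (size M + 1) :: complex) ~= 0" unfolding of_nat_eq_0_iff by simp
  ultimately show "((SUM i<n. sym i (sdy i (sinv 1 a))) + sinv 1 a) x m M = a x m M"
   by (simp add: secs_support[OF secs_sinv[OF a]] sinv_def del: of_nat_add of_nat_Suc)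
 qed
 show "a : secs ==> (SUM i<n. sym i (sdy i (sinv 0 a))) = a - sct a"
  by (intro ext) (simp add: secs_support[OF secs_sinv], simp add: sinv_def sct_def)
 show "a : secs ==> sinv 1 ((SUM i<n. sym i (sdy i a)) + a) = a"
  by (intro ext) (simp add: sinv_def secs_support field_simps del: of_nat_Suc, simp add: field_simps)
 show "a : secs ==> sinv 2 ((SUM i<n. sym i (sdy i a)) + a + a) = a"
 proof (intro ext)
  fix x :: "pt" and m :: nat and M :: "nat multiset" assume a: "a : secs"
  have "of_nat (size M) * a x m M + a x m M + a x m M = a x m M * of_nat (size M + 2)" by (simp add: algebra_simps)
  moreover have "(of_nat (size M + 2) :: complex) ~= 0" unfolding of_nat_eq_0_iff by simp
  ultimately show "sinv 2 ((SUM i<n. sym i (sdy i a)) + a + a) x m M = a x m M"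
   by (simp add: sinv_def secs_support[OF a] del: of_nat_add)
 qed
 show "a : secs ==> sinv 0 (SUM i<n. sym i (sdy i a)) = a - sct a"
  by (intro ext) (simp add: sinv_def secs_support sct_def)
 show "sym i (sinv 1 a) = sinv 0 (sym i a)"
 proof (intro ext)
  fix x :: "pt" and m :: nat and M :: "nat multiset"
  show "sym i (sinv 1 a) x m M = sinv 0 (sym i a) x m M"
  proof (cases "i \<in># M")
   case True
   hence "Suc (size (M - {#i#})) = size M" by (metis insert_DiffM size_add_mset)
   thus ?thesis by (simp add: sym_def sinv_def ymul_def)
  qed (simp add: sym_def sinv_def ymul_def not_in_iff)
 qed
 show "sct (sym i a) = 0" by (simp add: fun_eq_iff sct_def sym_def ymul_def)
 show "sct (sinv 0 a) = 0" by (simp add: fun_eq_iff sct_def sinv_def)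
 show "a : sFil 0" "0 : sFil k" by (simp_all add: sFil_alt)
 show "a : sFil k ==> b : sFil k ==> a + b : sFil k" "a : sFil k ==> b : sFil k ==> a - b : sFil k"
  "a : sFil (Suc k) ==> a : sFil k" by (simp_all add: sFil_alt)
 show "(!!k. a : sFil k) ==> a = 0"
 proof (intro ext)
  fix x :: "pt" and m :: nat and M :: "nat multiset" assume "!!k. a : sFil k"
  from this[of "Suc (2 * m + size M)"] show "a x m M = 0 x m M" by (simp add: sFil_alt)
 qed
 show "a : sFil (Suc k) ==> sdy i a : sFil k" by (simp add: sFil_alt sdy_def dy_def)
 show "a : sFil k ==> sym i a : sFil (Suc k)" unfolding sFil_alt
 proof (intro allI impI)
  fix x :: "pt" and m :: nat and M :: "nat multiset" assume a: "ALL x m M. 2 * m + size M<k --> a x m M = 0" and l: "2 * m + size M<Suc k"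
  show "sym i a x m M = 0" unfolding sym_def
   by (rule ymul_zero_below[where d="k - 2 * m"]) (use a l in auto)
 qed
 show "a : secs ==> i<n ==> a : sFil k ==> snab i a : sFil k" by (rule snab_Fil)
 show "a : sFil k ==> sinv s a : sFil k" by (simp add: sFil_alt sinv_def)
 show "a : sFil p ==> b : sFil q ==> sbrk a b : sFil (p + q - 2)" by (simp add: sFil_def sbrk_def brk_Fil)
 show "sR i j : sFil 2" by (simp add: sFil_alt sR_small)
 show "(!!k. X k : secs) ==> (!!k. X (Suc k) - X k : sFil k) ==> EX z:secs. ALL k. z - X k : sFil k"
  by (rule secs_complete)
 show "a + a = 0 ==> a = 0" by (simp add: fun_eq_iff)
 show "sdy i (sbrk a b) = sbrk (sdy i a) b + sbrk a (sdy i b)"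
 proof (intro ext)
  fix x :: "pt" and m :: nat and M :: "nat multiset"
  have "sdy i (sbrk a b) x m = sc \<i> (sdy i (smul a b) x (Suc m) - sdy i (smul b a) x (Suc m))"
   by (simp add: sdy_def sbrk_smul dy_sc dy_diff del: minus_apply)
  also have "... = sbrk (sdy i a) b x m + sbrk a (sdy i b) x m"
   unfolding sdy_smul sbrk_smul by (simp add: fun_eq_iff sc_apply algebra_simps)
  finally show "sdy i (sbrk a b) x m M = (sbrk (sdy i a) b + sbrk a (sdy i b)) x m M" by simp
 qed
 show "a : secs ==> b : secs ==> i<n ==> snab i (sbrk a b) = sbrk (snab i a) b + sbrk a (snab i b)" by (rule snab_sbrk)
 show "sbrk a (sbrk b c) = sbrk (sbrk a b) c + sbrk b (sbrk a c)"
  by (rule ext) (simp add: sbrk_def brk_jacobi[of n _ "a _" "b _"])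
 show "a : secs ==> i<n ==> j<n ==> sdy i (snab j a) - snab j (sdy i a) = sdy j (snab i a) - snab i (sdy j a)"
  by (rule snab_torsion)
 show "snab i (snab j a) - snab j (snab i a) = sbrk (sR i j) a" if a: "a : secs" and ij: "i<n" "j<n"
 proof (intro ext)
  fix x :: "pt" and m :: nat and M :: "nat multiset"
  show "(snab i (snab j a) - snab j (snab i a)) x m M = sbrk (sR i j) a x m M"
  proof (cases "x : V")
   case True
   from fun_cong[OF snab_curvature[OF a ij True], of m M] show ?thesis by (simp add: sbrk_sR[OF True ij])
  next
   case False
   thus ?thesis using secsD(3)[OF secs_sbrk[OF sR_secs[OF ij] a] False] by (simp add: snab_def)
  qed
 qed
 show "i<n ==> j<n ==> sR j i = - sR i j"
 proof (intro ext)
  fix x :: "pt" and m :: nat and M :: "nat multiset"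
  have "Q j i k l x = - Q i j k l x" for k l by (simp add: Q_def K_anti[of j i] sum_negf)
  thus "sR j i x m M = (- sR i j) x m M" by (simp add: sR_def fconst_def sc_apply sum_fun_apply sum_negf)
 qed
 show "z : secs ==> sct z = 0 ==> (!!a. a : secs ==> sbrk z a = 0) ==> z = 0"
  by (rule secs_center) (simp_all add: lin_secs sbrk_anti[of z])
 show "sct (sdy i (sR j k)) = 0" by (simp add: fun_eq_iff sct_def sdy_def dy_def sR_small)
 show "sct (snab i (sR j k)) = 0" by (simp add: fun_eq_iff sct_def snab_def nab_def pdx_def Lop_empty sR_small)
qed

end

lemma moy_fps_const_left: "moy n po (%m. sc (c m) pone) b m = (SUM k<=m. sc (c k) (b (m - k)))"
proof -
 let ?j = "%k::nat. (0::nat, k, m - k)"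
 have "moy n po (%m. sc (c m) pone) b m = (SUM (k, p, q):triples m. if k = 0 then sc (c p) (b q) else 0)"
  unfolding moy_def by (intro sum.cong refl) (auto simp: bidiff_sc_left bidiff_pone sc_zero moy_coeff_def sc_one)
 also have "... = (SUM (k, p, q):?j ` {..m}. if k = 0 then sc (c p) (b q) else 0)"
  by (intro sum.mono_neutral_right finite_triples) (auto simp: triples_def image_iff intro: le_add1)
 also have "... = (SUM k<=m. sc (c k) (b (m - k)))" by (subst sum.reindex) (auto intro!: inj_onI)
 finally show ?thesis .
qed

lemma moy_fps_const: "moy n po (%m. sc (c m) pone) b m = (SUM k<=m. sc (c k) (b (m - k)))"
 "moy n po b (%m. sc (c m) pone) m = (SUM k<=m. sc (c k) (b (m - k)))"
 using moy_fps_const_left[of n "%p q. po q p" c b m] by (simp_all only: moy_fps_const_left moy_flip[of n po])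

lemma triples_1: "triples (Suc 0) = {(1, 0, 0), (0, 1, 0), (0, 0, 1)}" by (auto simp: triples_def)

text \<open>At first order the terms with \<open>pprod\<close> cancel by commutativity, while the
  two halves \<open>\<i> / 2\<close> of the antisymmetric part add up.\<close>

lemma moy_commutator_1:
 assumes "!!p q. p<n ==> q<n ==> po q p = - po p q"
 shows "moy n po a b 1 - moy n po b a 1 = sc \<i> (bidiff n po 1 (a 0) (b 0))"
proof -
 have "moy n po a b 1 = sc (\<i> / 2) (bidiff n po 1 (a 0) (b 0)) + (pprod (a 1) (b 0) + pprod (a 0) (b 1))" for a b
  by (simp add: moy_def triples_1 moy_coeff_def sc_one del: bidiff.simps(2))
 hence "moy n po a b 1 - moy n po b a 1 = sc (\<i> / 2) (bidiff n po 1 (a 0) (b 0) - bidiff n po 1 (b 0) (a 0))"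
  by (simp add: pprod_commute[of "b (Suc 0)"] pprod_commute[of "b 0"] sc_diff del: bidiff.simps(2))
 also have "bidiff n po 1 (b 0) (a 0) = - bidiff n po 1 (a 0) (b 0)"
  using bidiff_swap[OF assms, where k=1 and b="b 0" and a="a 0"] by (simp add: sc_minus_one del: bidiff.simps(2))
 also have "sc (\<i> / 2) (bidiff n po 1 (a 0) (b 0) - - bidiff n po 1 (a 0) (b 0)) = sc \<i> (bidiff n po 1 (a 0) (b 0))"
  by (simp add: fun_eq_iff sc_apply del: bidiff.simps(2))
 finally show ?thesis .
qed

section \<open>Flat sections and the star product of a coordinate domain\<close>

context sympl_chart begin

text \<open>Its components below \<open>n\<close> are determined by
  \<open>fedosov_form_unique\<close>, so the choice does not impair naturality.\<close>

definition fform :: "nat => pt => fib" where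
 "fform = (SOME r. fed.fedosov_form r)"

lemma fform: "fed.fedosov_form fform" unfolding fform_def using fed.fedosov_form_exists by (rule someI_ex)

lemma fform_secs: "i<n ==> fform i : secs" "i<n ==> fform i : sFil 3"
 using fform by (simp_all add: fed.fedosov_form_def)

definition flat :: "(pt => fib) => bool" where
 "flat a <-> a : secs & (ALL i<n. fed.D fform i a = 0)"

text \<open>Fedosov's quantization map. For a smooth series the choice is determined by
  \<open>flat_eqI\<close>.\<close>

definition flat_ext :: "(nat => pt => complex) => pt => fib" where
 "flat_ext F = (SOME a. flat a & (ALL x:V. ALL m. a x m {#} = F m x))"

definition smooth_series :: "(nat => pt => complex) => bool" where
 "smooth_series F <-> (ALL m. smooth_on n V (F m))"

lemma flat_ext:
 assumes "smooth_series F"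
 shows flat_flat_ext: "flat (flat_ext F)" and flat_ext_empty: "x : V ==> flat_ext F x m {#} = F m x"
proof -
 define f where "f x m M = (if x : V & M = {#} then F m x else 0)" for x m and M :: "nat multiset"
 have s: "smooth_on n V (%x. f x m M)" for m M
 proof -
  have "smooth_on n V (%x. f x m M) <-> smooth_on n V (if M = {#} then F m else (%x. 0))"
   by (rule smooth_on_cong[OF V]) (simp add: f_def)
  thus ?thesis using assms by (simp add: smooth_series_def smooth_on_const[OF V])
 qed
 have d: "sdy i f = 0" for i by (simp add: fun_eq_iff sdy_def dy_def f_def)
 have "dy i (f x m) = 0" for i x m by (simp add: fun_eq_iff dy_def f_def)
 hence "f : secs" using s by (simp add: secs_def pol_smooth_def) (simp add: f_def fun_eq_iff)
 moreover have "sct f = f" by (simp add: fun_eq_iff sct_def f_def)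
 ultimately obtain a where a: "a : secs" "ALL i<n. fed.D fform i a = 0" "sct a = f"
  using fed.flat_exists[OF fform, of f] d by auto
 have "a x m {#} = F m x" if "x : V" for x m
  using fun_cong[OF fun_cong[OF fun_cong[OF a(3), of x], of m], of "{#}"] that by (simp add: sct_def f_def)
 hence *: "flat a & (ALL x:V. ALL m. a x m {#} = F m x)" using a(1,2) by (simp add: flat_def)
 show "flat (flat_ext F)" "x : V ==> flat_ext F x m {#} = F m x"
  using someI[of "%a. flat a & (ALL x:V. ALL m. a x m {#} = F m x)", OF *] by (simp_all add: flat_ext_def)
qed

lemma flat_eqI:
 assumes "flat a" "flat b" "!!x m. x : V ==> a x m {#} = b x m {#}"
 shows "a = b"
proof (rule fed.flat_unique[OF fform])
 show "sct a = sct b"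
 proof (intro ext)
  fix x m M show "sct a x m M = sct b x m M"
   using assms(3) secsD(3)[of a x] secsD(3)[of b x] assms(1,2) by (cases "x : V") (simp_all add: sct_def flat_def)
 qed
qed (use assms in \<open>simp_all add: flat_def\<close>)

lemma smooth_series_flat: "flat a ==> smooth_series (%m x. a x m {#})"
 using secsD(1)[of a] by (simp add: smooth_series_def flat_def pol_smooth_def)

lemma flat_ext_eqI:
 assumes "flat a" "!!x m. x : V ==> a x m {#} = F m x"
 shows "flat_ext F = a"
proof (rule flat_eqI)
 have "smooth_on n V (F m)" for m
  using smooth_on_cong[OF V, of "%x. a x m {#}" "F m"] assms(2) smooth_series_flat[OF assms(1)]
  by (simp add: smooth_series_def)
 hence "smooth_series F" by (simp add: smooth_series_def)
 from flat_ext[OF this] show "flat (flat_ext F)" "!!x m. x : V ==> flat_ext F x m {#} = a x m {#}" 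
  using assms(2) by simp_all
qed (fact assms(1))

lemma sbrk_smul_right: "sbrk r (smul a b) = smul (sbrk r a) b + smul a (sbrk r b)"
 by (rule ext) (simp add: sbrk_def smul_def brk_moy)

lemma smul_add_left: "smul (a + a') b = smul a b + smul a' b" and smul_add_right: "smul a (b + b') = smul a b + smul a b'"
 by (rule ext, simp add: smul_def moy_add_left moy_add_right)+

lemma smul_zero: "smul 0 b = 0" "smul a 0 = 0" by (rule ext, simp add: smul_def moy_zero)+

lemma smul_diff_left: "smul (a - a') b = smul a b - smul a' b" and smul_diff_right: "smul a (b - b') = smul a b - smul a b'"
 by (rule ext, simp add: smul_def moy_diff_left moy_diff_right)+

lemma smul_assoc: "smul (smul a b) c = smul a (smul b c)" by (rule ext) (simp add: smul_def moy_assoc)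

lemma flat_smul:
 assumes "flat a" "flat b"
 shows "flat (smul a b)"
proof -
 have s: "a : secs" "b : secs" using assms by (simp_all add: flat_def)
 have "fed.D fform i (smul a b) = smul (fed.D fform i a) b + smul a (fed.D fform i b)" if "i<n" for i
  unfolding fed.D_def fed.E_def snab_smul[OF s that] sdy_smul sbrk_smul_right smul_add_left smul_add_right
   smul_diff_left smul_diff_right by simp
 thus ?thesis using assms by (simp add: flat_def secs_smul smul_zero)
qed

lemma flat_add:
 assumes "flat a" "flat b"
 shows "flat (a + b)"
proof -
 have s: "a : secs" "b : secs" using assms by (simp_all add: flat_def)
 have "fed.D fform i (a + b) = fed.D fform i a + fed.D fform i b" if "i<n" for i
  unfolding fed.D_def fed.E_add[OF s that] fed.brk_add by simp
 thus ?thesis using assms by (simp add: flat_def secs_add)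
qed

definition star_loc :: "(nat => pt => complex) => (nat => pt => complex) => nat => pt => complex" where
 "star_loc F G m x = smul (flat_ext F) (flat_ext G) x m {#}"

lemma flat_ext_star:
 assumes "smooth_series F" "smooth_series G"
 shows "flat_ext (star_loc F G) = smul (flat_ext F) (flat_ext G)"
 by (rule flat_ext_eqI) (simp_all add: flat_smul flat_flat_ext assms star_loc_def)

lemma smooth_star:
 assumes "smooth_series F" "smooth_series G"
 shows "smooth_series (star_loc F G)"
 unfolding star_loc_def[abs_def] by (intro smooth_series_flat flat_smul flat_flat_ext assms)

lemma star_loc_assoc:
 assumes "smooth_series F" "smooth_series G" "smooth_series H"
 shows "star_loc (star_loc F G) H m x = star_loc F (star_loc G H) m x"
 by (simp add: star_loc_def[of "star_loc F G" H] star_loc_def[of F "star_loc G H"] flat_ext_star assms smul_assoc)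

lemma flat_ext_cong: "(!!x m. x : V ==> F m x = G m x) ==> flat_ext F = flat_ext G"
 unfolding flat_ext_def by (rule arg_cong[where f=Eps]) (auto simp: fun_eq_iff)

lemma star_loc_cong:
 assumes "!!x m. x : V ==> F m x = F' m x" "!!x m. x : V ==> G m x = G' m x"
 shows "star_loc F G = star_loc F' G'"
proof -
 have "flat_ext F = flat_ext F'" by (rule flat_ext_cong) (rule assms(1))
 moreover have "flat_ext G = flat_ext G'" by (rule flat_ext_cong) (rule assms(2))
 ultimately show ?thesis by (simp add: star_loc_def[abs_def])
qed

lemma flat_ext_add:
 assumes "smooth_series F" "smooth_series G"
 shows "flat_ext (%m x. F m x + G m x) = flat_ext F + flat_ext G"
 by (rule flat_ext_eqI) (simp_all add: flat_add flat_flat_ext assms flat_ext_empty)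

lemma star_loc_add:
 assumes "smooth_series F" "smooth_series G" "smooth_series H"
 shows "star_loc (%m x. F m x + G m x) H m x = star_loc F H m x + star_loc G H m x"
  "star_loc H (%m x. F m x + G m x) m x = star_loc H F m x + star_loc H G m x"
 by (simp_all add: star_loc_def flat_ext_add assms smul_add_left smul_add_right)

text \<open>Formal power series of constants as central flat sections, through which linearity over
  them becomes a case of associativity.\<close>

definition fps_sec :: "(nat => complex) => pt => fib" where
 "fps_sec c x = (if x : V then (%m. sc (c m) pone) else 0)"

lemma smul_fps_sec:
 assumes "b : secs"
 shows "smul (fps_sec c) b x m = (SUM k<=m. sc (c k) (b x (m - k)))" 
  "smul b (fps_sec c) x m = (SUM k<=m. sc (c k) (b x (m - k)))"
 using secsD(3)[OF assms, of x] by (simp_all add: smul_def fps_sec_def moy_fps_const moy_zero sc_zero)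

lemma flat_fps_sec: "flat (fps_sec c)"
proof -
 have s: "fps_sec c : secs"
 proof -
  have "(%x m. if x : V then (%x m. sc (c m) pone) x m else 0) : secs"
   by (rule secs_mask) (simp_all add: pol_smooth_const[OF V] dy_sc dy_pone sc_zero)
  also have "(%x m. if x : V then (%x m. sc (c m) pone) x m else 0) = fps_sec c"
   by (simp add: fun_eq_iff fps_sec_def)
  finally show ?thesis .
 qed
 have 1: "sdy i (fps_sec c) = 0" for i
  by (rule ext, rule ext) (simp add: sdy_def fps_sec_def dy_sc dy_pone sc_zero dy_zero)
 have 2: "snab i (fps_sec c) = 0" if "i<n" for i
 proof (intro ext)
  fix x m M
  have "nab n (A i) i (%x. fps_sec c x m) x M = 0" if "x : V"
  proof -
   have "pdx i (%x. fps_sec c x m) x = pdx i (%x. sc (c m) pone) x"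
    by (rule pdx_cong[OF V that \<open>i<n\<close>]) (simp add: fps_sec_def)
   hence "pdx i (%x. fps_sec c x m) x = 0" by (simp add: fun_eq_iff pdx_def partial_deriv_const)
   thus ?thesis using that by (simp add: nab_def fps_sec_def Lop_sc Lop_pone sc_zero)
  qed
  thus "snab i (fps_sec c) x m M = 0 x m M" by (simp add: snab_def)
 qed
 have 3: "sbrk r (fps_sec c) = 0" if "r : secs" for r
 proof (intro ext)
  fix x m M
  have "smul r (fps_sec c) x m = smul (fps_sec c) r x m" for m by (simp add: smul_fps_sec[OF that])
  thus "sbrk r (fps_sec c) x m M = 0 x m M" by (simp add: sbrk_smul sc_zero)
 qed
 show ?thesis by (simp add: flat_def s fed.D_def fed.E_def 1 2 3 fform_secs)
qed

lemma flat_ext_const: "flat_ext (%m x. c m) = fps_sec c"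
 by (rule flat_ext_eqI) (simp_all add: flat_fps_sec, simp add: fps_sec_def sc_apply pone_def)

lemma star_loc_const:
 assumes "smooth_series F" "x : V"
 shows "star_loc (%m x. c m) F m x = (SUM k<=m. c k * F (m - k) x)"
  "star_loc F (%m x. c m) m x = (SUM k<=m. c k * F (m - k) x)"
proof -
 have "flat_ext F : secs" using flat_flat_ext[OF assms(1)] by (simp add: flat_def)
 from smul_fps_sec[OF this] show "star_loc (%m x. c m) F m x = (SUM k<=m. c k * F (m - k) x)"
  "star_loc F (%m x. c m) m x = (SUM k<=m. c k * F (m - k) x)"
  by (simp_all add: star_loc_def flat_ext_const sum_fun_apply sc_apply flat_ext_empty[OF assms])
qed

lemma smooth_series_const: "smooth_series (%m x. c m)"
 by (simp add: smooth_series_def smooth_on_const[OF V])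

text \<open>Scaling by a series of constants is a star product with constant functions, on either
  side, so both claims are instances of associativity.\<close>

lemma star_loc_scale:
 assumes F: "smooth_series F" and G: "smooth_series G" and x: "x : V"
 shows "star_loc (%m x. SUM k<=m. c k * F (m - k) x) G m x = (SUM k<=m. c k * star_loc F G (m - k) x)"
  "star_loc F (%m x. SUM k<=m. c k * G (m - k) x) m x = (SUM k<=m. c k * star_loc F G (m - k) x)"
proof -
 note s = smooth_series_const[of c]
 have "star_loc (%m x. SUM k<=m. c k * F (m - k) x) G = star_loc (star_loc (%m x. c m) F) G"
  by (rule star_loc_cong) (simp_all add: star_loc_const F)
 thus "star_loc (%m x. SUM k<=m. c k * F (m - k) x) G m x = (SUM k<=m. c k * star_loc F G (m - k) x)"
  by (simp add: star_loc_assoc[OF s F G] star_loc_const smooth_star F G x)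
 have "star_loc F (%m x. SUM k<=m. c k * G (m - k) x) = star_loc F (star_loc G (%m x. c m))"
  by (rule star_loc_cong) (simp_all add: star_loc_const G)
 thus "star_loc F (%m x. SUM k<=m. c k * G (m - k) x) m x = (SUM k<=m. c k * star_loc F G (m - k) x)"
  by (simp add: star_loc_assoc[OF F G s, symmetric] star_loc_const smooth_star F G x)
qed

lemma star_loc_0:
 assumes "smooth_series F" "smooth_series G" "x : V"
 shows "star_loc F G 0 x = F 0 x * G 0 x"
 using assms by (simp add: star_loc_def smul_def moy_0 pprod_empty flat_ext_empty)

text \<open>This is the flatness equation at the coefficient free of \<open>y\<close> and of the
  formal parameter: the bracket with the form of degree 3 has degree at least 1 and drops out, as
  does the connection term.\<close>

lemma flat_ext_single:
 assumes F: "smooth_series F" and x: "x : V" and i: "i<n"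
 shows "flat_ext F x 0 {#i#} = pd i (F 0) x"
proof -
 let ?a = "flat_ext F"
 have f: "?a : secs" "fed.D fform i ?a = 0" using flat_flat_ext[OF F] i by (simp_all add: flat_def)
 have "sbrk (fform i) ?a : sFil 1" using fed.Fl_brk[OF fform_secs(2)[OF i] fed.Fl_0] by simp
 hence "sbrk (fform i) ?a x 0 {#} = 0" by (simp add: sFil_alt)
 moreover have "snab i ?a x 0 {#} = pd i (F 0) x"
 proof -
  have "pd i (%x. ?a x 0 {#}) x = pd i (F 0) x"
   by (rule partial_deriv_cong[OF V x i]) (simp add: flat_ext_empty[OF F])
  thus ?thesis using x by (simp add: snab_def nab_def Lop_empty pdx_def)
 qed
 ultimately show ?thesis using fun_cong[OF fun_cong[OF fun_cong[OF f(2), of x], of 0], of "{#}"]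
  by (simp add: fed.D_def fed.E_def sdy_def dy_def)
qed

lemma star_loc_1:
 assumes F: "smooth_series F" and G: "smooth_series G" and x: "x : V"
 shows "star_loc F G 1 x - star_loc G F 1 x =
  \<i> * (SUM p<n. SUM q<n. of_real (winv n w q p x) * (pd p (F 0) x * pd q (G 0) x))"
proof -
 have anti: "pois q p x = - pois p q x" if "p<n" "q<n" for p q
  using P_anti[OF x that] by (simp add: pois_def)
 have "star_loc F G 1 x - star_loc G F 1 x = (smul (flat_ext F) (flat_ext G) x 1 - smul (flat_ext G) (flat_ext F) x 1) {#}"
  by (simp add: star_loc_def)
 also have "... = \<i> * bidiff n (%p q. pois p q x) 1 (flat_ext F x 0) (flat_ext G x 0) {#}"
  unfolding smul_def by (subst moy_commutator_1) (rule anti, assumption+, simp only: sc_apply)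
 also have "... = \<i> * (SUM p<n. SUM q<n. of_real (winv n w q p x) * (pd p (F 0) x * pd q (G 0) x))"
  by (simp add: sum_fun_apply sc_apply pprod_empty dy_def pois_def)
    (intro sum.cong refl, simp add: flat_ext_single F G x)
 finally show ?thesis .
qed

end

section \<open>Multiplication of sections by functions on the base\<close>

context sympl_chart begin

definition fmul :: "(pt => real) => (pt => fib) => pt => fib" where
 "fmul f a x m = sc (of_real (f x)) (a x m)"

lemma sdy_fmul: "sdy i (fmul f a) = fmul f (sdy i a)" and sym_fmul: "sym i (fmul f a) = fmul f (sym i a)"
 and fmul_zero: "fmul f 0 = 0"
 and fmul_add: "fmul f (a + b) = fmul f a + fmul f b" and fmul_diff: "fmul f (a - b) = fmul f a - fmul f b"
 and fmul_fmul: "fmul f (fmul g a) = fmul (%x. f x * g x) a"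
 by (simp_all add: fun_eq_iff sdy_def sym_def fmul_def dy_def ymul_def sc_apply sct_def algebra_simps)

lemma fmul_sum: "fmul f (SUM i:I. g i) = (SUM i:I. fmul f (g i))"
 using sum_comp_morphism[of "fmul f" g I] by (simp add: fmul_zero fmul_add comp_def)

lemma fmul_cong: "a : secs ==> (!!x. x : V ==> f x = g x) ==> fmul f a = fmul g a"
 by (rule ext, rule ext) (metis fmul_def sc_zero secsD(3) zero_fun_apply)

lemma secs_fmul: "smooth_on n V f ==> a : secs ==> fmul f a : secs"
 by (auto simp: secs_def fmul_def pol_smooth_def sc_apply dy_sc sc_zero fun_eq_iff[of _ "0::fib"]
   intro!: smooth_on_mult[OF V] smooth_on_of_real[OF V])

lemma sFil_fmul: "a : sFil k ==> fmul f a : sFil k"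
 by (simp add: sFil_alt fmul_def sc_apply)

lemma sbrk_fmul: "sbrk b (fmul f a) = fmul f (sbrk b a)"
proof (rule ext)
 fix x
 have e: "fmul f a x = fsc (of_real (f x)) (a x)" for a by (rule ext) (simp add: fmul_def fsc_def)
 show "sbrk b (fmul f a) x = fmul f (sbrk b a) x" by (simp add: e sbrk_def brk_fsc)
qed

lemma sbrk_fmul_left: "sbrk (fmul f b) a = fmul f (sbrk b a)"
proof -
 have "sbrk (fmul f b) a = - fmul f (sbrk a b)" using sbrk_anti[of "fmul f b" a] by (simp only: sbrk_fmul)
 also have "... = fmul f (sbrk b a)"
  unfolding sbrk_anti[of b a] by (simp add: fun_eq_iff fmul_def sc_apply)
 finally show ?thesis .
qed

lemma snab_fmul:
 assumes f: "smooth_on n V f" and a: "a : secs" and i: "i<n"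
 shows "snab i (fmul f a) = fmul (pd i f) a + fmul f (snab i a)"
proof (intro ext)
 fix x m M
 show "snab i (fmul f a) x m M = (fmul (pd i f) a + fmul f (snab i a)) x m M"
 proof (cases "x : V")
  case True
  have "pdx i (%x. sc (of_real (f x)) (a x m)) x = sc (of_real (pd i f x)) (a x m) + sc (of_real (f x)) (pdx i (%x. a x m) x)"
   using pdx_sc[OF V True i smooth_on_of_real[OF V f] secsD(1)[OF a]] by (simp add: partial_deriv_of_real[OF V True i f])
  thus ?thesis using True by (simp add: snab_def fmul_def nab_def Lop_sc sc_diff sc_apply algebra_simps)
 next
  case False
  thus ?thesis using secsD(3)[OF a False] by (simp add: snab_def fmul_def sc_apply)
 qed
qed

end

section \<open>Naturality under symplectic maps that match the connections\<close>

locale sympl_map = A: sympl_chart n V w T + B: sympl_chart n V' w' T'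
 for n V w T V' w' T' +
 fixes ph :: "pt => pt"
 assumes ph: "x : V ==> ph x : V'" and ph_smooth: "k<n ==> smooth_on n V (%x. ph x k)"
  and ph_w: "x : V ==> i<n ==> j<n ==> w i j x =
   fpb n (%k l. w' k l (ph x)) ph i j x"
  and ph_T: "x : V ==> i<n ==> j<n ==> k<n ==> T k i j x =
   (SUM r<n. jc ph k r x * (fpb n (%p q. T' r p q (ph x)) ph i j x +
    (SUM m<n. w' r m (ph x) * hs ph i j m x)))"
begin

definition J :: "nat => nat => pt => real" where
 "J k i x = jc ph i k x"

lemma J_eq: "J k i = pd i (%x. ph x k)" by (simp add: fun_eq_iff J_def)

lemma J_smooth: "k<n ==> i<n ==> smooth_on n V (J k i)"
 unfolding J_eq by (rule smooth_on_partial_deriv) (simp_all add: ph_smooth A.V)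

lemma J_w: "x : V ==> i<n ==> j<n ==> w i j x = (SUM k<n. SUM l<n. w' k l (ph x) * J k i x * J l j x)"
 unfolding J_def by (rule ph_w)

lemma J_T: "x : V ==> i<n ==> j<n ==> k<n ==> T k i j x =
   (SUM r<n. J r k x * ((SUM p<n. SUM q<n. T' r p q (ph x) * J p i x * J q j x) +
    (SUM m<n. w' r m (ph x) * pd i (J m j) x)))" unfolding J_eq by (rule ph_T)

lemma J_deriv_sym: "x : V ==> i<n ==> j<n ==> k<n ==> pd i (J k j) x = pd j (J k i) x"
 unfolding J_eq by (rule partial_deriv_commute[OF A.V]) (simp_all add: ph_smooth)

definition Jinv :: "nat => nat => pt => real" where
 "Jinv i j x = minv n (%i j. J i j x) i j"

text \<open>The form \<open>w\<close> is nondegenerate and is a pull-back along \<open>ph\<close>,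
  which forces the Jacobian to be injective, hence invertible.\<close>

lemma Jinv:
 assumes x: "x : V" and ik: "i<n" "k<n"
 shows Jinv_left: "(SUM j<n. Jinv i j x * J j k x) = dl i k"
  and Jinv_right: "(SUM j<n. J i j x * Jinv j k x) = dl i k"
proof -
 have wn: "(ALL j<n. (SUM i<n. v i * w i j x) = 0) ==> (ALL i<n. v i = 0)" if "x : V" for x v
  using A.form that unfolding sympl_form_def by blast
 have inj: "ALL j<n. v j = 0" if x: "x : V" and z: "!!i. i<n ==> (SUM j<n. J i j x * v j) = 0" for x v
 proof (rule wn[OF x], intro allI impI)
  fix j assume j: "j<n"
  have "(SUM i<n. v i * w i j x) = (SUM i<n. SUM k<n. SUM l<n. v i * (w' k l (ph x) * J k i x * J l j x))"
   by (intro sum.cong refl) (simp add: J_w[OF x _ j] sum_distrib_left)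
  also have "... = (SUM k<n. SUM l<n. SUM i<n. v i * (w' k l (ph x) * J k i x * J l j x))"
   by (rule sum3_swap)
  also have "... = (SUM k<n. SUM l<n. w' k l (ph x) * J l j x * (SUM i<n. J k i x * v i))"
   by (simp add: sum_distrib_left mult_ac)
  also have "... = 0" using z by simp
  finally show "(SUM i<n. v i * w i j x) = 0" .
 qed
 from smooth_inverse_matrix_ex[OF A.V, of n J, OF J_smooth inj] obtain K where K: "(ALL i<n. ALL j<n. smooth_on n V (K i j)) &
  (ALL x:V. ALL i<n. ALL k<n. (SUM j<n. K i j x * J j k x) = dl i k &
   (SUM j<n. J i j x * K j k x) = dl i k)" ..
 show "(SUM j<n. Jinv i j x * J j k x) = dl i k" unfolding Jinv_def
  by (rule minv(2)[where B="%i j. K i j x"]) (use K x ik in simp_all)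
 show "(SUM j<n. J i j x * Jinv j k x) = dl i k" unfolding Jinv_def
  by (rule minv(3)[where B="%i j. K i j x"]) (use K x ik in simp_all)
qed

lemma P_J:
 assumes x: "x : V" and kl: "k<n" "l<n"
 shows "B.P k l (ph x) = (SUM p<n. SUM q<n. J k p x * J l q x * A.P p q x)"
proof (rule inverse_matrix_unique[where A="%i j. w' i j (ph x)" and B="%k l. B.P k l (ph x)"
  and C="%k l. SUM p<n. SUM q<n. J k p x * J l q x * A.P p q x"])
 fix i k assume ik: "i<n" "k<n"
 show "(SUM j<n. B.P i j (ph x) * w' j k (ph x)) = dl i k" by (rule B.P_left) (simp_all add: ph x ik)
 \<comment> \<open>The matrix \<open>w' J P\<close>. As \<open>J\<close> pulls \<open>w'\<close>
   back to \<open>w\<close>, it is the transpose of the inverse Jacobian.\<close>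
 define X where "X i q = (SUM l<n. SUM p<n. w' i l (ph x) * J l p x * A.P p q x)" for i q
 have X: "Jinv q i x = X i q" if q: "q<n" and i: "i<n" for q i
 proof (rule inverse_matrix_unique[where A="%i j. J j i x" and B="%i q. Jinv q i x" and C=X])
  fix j q assume j: "j<n" and q: "q<n"
  show "(SUM i<n. Jinv i j x * J q i x) = dl j q" using Jinv_right[OF x q j] by (simp add: mult.commute)
  have "(SUM i<n. J i j x * X i q) = (SUM i<n. SUM l<n. SUM p<n. J i j x * (w' i l (ph x) * J l p x * A.P p q x))"
   by (simp add: X_def sum_distrib_left)
  also have "... = (SUM p<n. SUM i<n. SUM l<n. J i j x * (w' i l (ph x) * J l p x * A.P p q x))"
   by (rule sum3_swap[symmetric])
  also have "... = (SUM p<n. w j p x * A.P p q x)"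
   by (intro sum.cong refl) (simp add: J_w[OF x j] sum_distrib_right sum_distrib_left mult_ac)
  also have "... = dl j q" by (rule A.P_right) (simp_all add: x j q)
  finally show "(SUM i<n. J i j x * X i q) = dl j q" .
 qed (use that in simp_all)
 have "(SUM l<n. w' i l (ph x) * (SUM p<n. SUM q<n. J l p x * J k q x * A.P p q x)) =
   (SUM l<n. SUM p<n. SUM q<n. w' i l (ph x) * (J l p x * J k q x * A.P p q x))"
  by (simp add: sum_distrib_left)
 also have "... = (SUM q<n. SUM l<n. SUM p<n. w' i l (ph x) * (J l p x * J k q x * A.P p q x))"
  by (rule sum3_swap[symmetric])
 also have "... = (SUM q<n. J k q x * X i q)" by (simp add: X_def sum_distrib_left mult_ac)
 also have "... = (SUM q<n. J k q x * Jinv q i x)" by (intro sum.cong refl) (simp add: X ik)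
 also have "... = dl i k" using Jinv_right[OF x ik(2,1)] by auto
 finally show "(SUM l<n. w' i l (ph x) * (SUM p<n. SUM q<n. J l p x * J k q x * A.P p q x)) = dl i k" .
qed (use kl in simp_all)

text \<open>Raising the index with \<open>P_J\<close> in the law for \<open>T\<close> yields the
  classical transformation law of Christoffel symbols.\<close>

lemma Gam_J:
 assumes x: "x : V" and ija: "i<n" "j<n" "a<n"
 shows "(SUM l<n. J a l x * Gam n w T i l j x) =
  pd i (J a j) x + (SUM p<n. SUM q<n. Gam n w' T' p a q (ph x) * J p i x * J q j x)"
proof -
 define U where "U r = (SUM p<n. SUM q<n. T' r p q (ph x) * J p i x * J q j x) + (SUM m<n. w' r m (ph x) * pd i (J m j) x)" for r
 have "(SUM l<n. J a l x * Gam n w T i l j x) = (SUM l<n. SUM k<n. SUM r<n. J a l x * J r k x * A.P l k x * U r)"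
  unfolding Gam_def U_def
  by (intro sum.cong refl) (simp add: J_T[OF x ija(1,2)] sum_distrib_left sum.distrib distrib_left mult_ac)
 also have "... = (SUM r<n. SUM l<n. SUM k<n. J a l x * J r k x * A.P l k x * U r)"
  by (rule sum3_swap[symmetric])
 also have "... = (SUM r<n. B.P a r (ph x) * U r)"
  by (intro sum.cong refl) (simp add: P_J x ija sum_distrib_right)
 also have "... = (SUM r<n. SUM p<n. SUM q<n. B.P a r (ph x) * (T' r p q (ph x) * J p i x * J q j x))
   + (SUM r<n. SUM m<n. B.P a r (ph x) * (w' r m (ph x) * pd i (J m j) x))"
  by (simp add: U_def distrib_left sum.distrib sum_distrib_left)
 also have "(SUM r<n. SUM m<n. B.P a r (ph x) * (w' r m (ph x) * pd i (J m j) x)) =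
   (SUM m<n. (SUM r<n. B.P a r (ph x) * w' r m (ph x)) * pd i (J m j) x)"
  by (subst sum.swap) (simp add: sum_distrib_right mult.assoc)
 also have "... = (SUM m<n. dl a m * pd i (J m j) x)"
  by (intro sum.cong refl) (simp add: B.P_left ph x ija)
 also have "... = pd i (J a j) x" using ija by (simp add: sum_delta_mult)
 also have "(SUM r<n. SUM p<n. SUM q<n. B.P a r (ph x) * (T' r p q (ph x) * J p i x * J q j x)) =
   (SUM p<n. SUM q<n. SUM r<n. B.P a r (ph x) * (T' r p q (ph x) * J p i x * J q j x))" by (rule sum3_swap)
 also have "... = (SUM p<n. SUM q<n. Gam n w' T' p a q (ph x) * J p i x * J q j x)"
  by (simp add: Gam_def sum_distrib_right mult.assoc)
 finally show ?thesis by simp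
qed

end

context sympl_map begin

definition Jc :: "pt => nat => nat => complex" where
 "Jc x k i = (if i<n then of_real (J k i x) else 0)"

text \<open>Fibre coordinates are components of tangent vectors; so besides moving the base point,
  the Jacobian is substituted into \<open>y\<close>.\<close>

definition pull :: "(pt => fib) => pt => fib" where
 "pull a x m = (if x : V then jst n (Jc x) (a (ph x) m) else 0)"

lemma Jc_smooth: "k<n ==> smooth_on n V (%x. Jc x k i)"
 by (cases "i<n") (simp_all add: Jc_def smooth_on_const[OF A.V] smooth_on_of_real[OF A.V] J_smooth)

lemma pol_smooth_jst:
 assumes "pol_smooth n V' b"
 shows "pol_smooth n V (%x. jst n (Jc x) (b (ph x)))"
proof -
 have "smooth_on n V (%x. jst n (Jc x) (b (ph x)) M)" if "pol_smooth n V' b" for M b using that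
 proof (induction M arbitrary: b)
  case empty
  thus ?case using smooth_on_compose[OF B.V A.V ph _ ph_smooth, of "%x. b x {#}"]
   by (simp add: jst_empty pol_smooth_def)
 next
  case (add i M)
  show ?case unfolding jst_add_mset
   by (intro smooth_on_sum[OF A.V] smooth_on_mult[OF A.V] Jc_smooth add.IH[OF pol_smooth_dy[OF B.V]] add.prems) simp
 qed
 thus ?thesis using assms by (simp add: pol_smooth_def)
qed

lemma secs_pull: "a : B.secs ==> pull a : A.secs"
proof -
 assume a: "a : B.secs"
 have "(%x m. if x : V then (%x m. jst n (Jc x) (a (ph x) m)) x m else 0) : A.secs"
 proof (rule A.secs_mask)
  show "pol_smooth n V (%x. jst n (Jc x) (a (ph x) m))" for m
   by (rule pol_smooth_jst) (rule B.secsD(1)[OF a])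
 qed (simp add: dy_jst Jc_def sc_zero_left)
 also have "(%x m. if x : V then (%x m. jst n (Jc x) (a (ph x) m)) x m else 0) = pull a"
  by (simp add: fun_eq_iff[of _ "pull a"] fun_eq_iff[of _ "pull a _"] pull_def)
 finally show ?thesis .
qed

lemma pull_add: "pull (a + b) = pull a + pull b" and pull_zero: "pull 0 = 0" and pull_diff: "pull (a - b) = pull a - pull b"
 by (rule ext, rule ext, simp add: pull_def jst_add jst_zero jst_diff)+

lemma pull_sum: "pull (SUM i:I. f i) = (SUM i:I. pull (f i))"
 using sum_comp_morphism[of pull f I] by (simp add: pull_zero pull_add comp_def)

lemma pull_empty: "x : V ==> pull a x m {#} = a (ph x) m {#}"
 by (simp add: pull_def jst_empty)

lemma sdy_pull: "i<n ==> A.sdy i (pull a) = (SUM k<n. A.fmul (J k i) (pull (B.sdy k a)))"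
 by (rule ext, rule ext)
   (simp add: A.sdy_def B.sdy_def pull_def dy_jst A.fmul_def sum_fun_apply[of _ _ _ ] Jc_def dy_zero sc_zero)

lemma pull_sym: "k<n ==> pull (B.sym k a) = (SUM i<n. A.fmul (J k i) (A.sym i (pull a)))"
 by (rule ext, rule ext)
   (simp add: A.sym_def B.sym_def pull_def jst_ymul A.fmul_def sum_fun_apply Jc_def ymul_zero sc_zero)

lemma pull_sFil:
 assumes a: "a : B.sFil k"
 shows "pull a : A.sFil k" unfolding A.sFil_alt
proof (intro allI impI)
 fix x :: "pt" and m :: nat and M :: "nat multiset" assume l: "2 * m + size M<k"
 have "jst n (Jc x) (a (ph x) m) M = 0"
  by (rule jst_size_zero[where d="k - 2 * m"]) (use a l in \<open>auto simp: B.sFil_alt\<close>)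
 thus "pull a x m M = 0" by (simp add: pull_def)
qed

lemma pois_J:
 assumes "x : V" "k<n" "l<n"
 shows "B.pois k l (ph x) = (SUM p<n. SUM q<n. Jc x k p * Jc x l q * A.pois p q x)"
proof -
 have "B.pois k l (ph x) = of_real (SUM q<n. SUM p<n. J l q x * J k p x * A.P q p x)"
  by (simp only: B.pois_def P_J[OF assms(1,3,2)])
 also have "... = of_real (SUM p<n. SUM q<n. J l q x * J k p x * A.P q p x)" by (subst sum.swap) simp
 also have "... = (SUM p<n. SUM q<n. Jc x k p * Jc x l q * A.pois p q x)"
  by (simp add: Jc_def A.pois_def mult_ac)
 finally show ?thesis .
qed

lemma pull_fmap: "x : V ==> pull a x = fmap (jst n (Jc x)) (a (ph x))"
 by (rule ext) (simp add: pull_def fmap_def)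

lemma pull_out: "x ~: V ==> pull a x = 0" by (rule ext) (simp add: pull_def)

lemma pull_smul: "pull (B.smul a b) = A.smul (pull a) (pull b)"
proof
 fix x show "pull (B.smul a b) x = A.smul (pull a) (pull b) x"
 proof (cases "x : V")
  case True
  thus ?thesis by (simp add: pull_fmap A.smul_def B.smul_def jst_moy[where po="%p q. A.pois p q x"] pois_J)
 qed (simp add: pull_out A.smul_def moy_zero)
qed

lemma pull_sbrk: "pull (B.sbrk a b) = A.sbrk (pull a) (pull b)"
proof
 fix x show "pull (B.sbrk a b) x = A.sbrk (pull a) (pull b) x"
 proof (cases "x : V")
  case True
  thus ?thesis by (simp add: pull_fmap A.sbrk_def B.sbrk_def jst_brk[where po="%p q. A.pois p q x"] pois_J)
 next
  case False
  have "brk n po 0 0 = 0" for po by (rule ext) (simp add: brk_def moy_zero sc_zero)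
  thus ?thesis using False by (simp add: pull_out A.sbrk_def)
 qed
qed

text \<open>The second sum stems from differentiating the substituted Jacobian; in
  \<open>snab_pull\<close> it cancels the inhomogeneous term of \<open>Gam_J\<close>.\<close>

lemma pdx_jst:
 assumes x: "x : V" and i: "i<n" and a: "pol_smooth n V' a"
 shows "pdx i (%x. jst n (Jc x) (a (ph x))) x = (SUM k<n. sc (Jc x k i) (jst n (Jc x) (pdx k a (ph x))))
  + (SUM j<n. SUM m<n. sc (of_real (pd i (J m j) x)) (ymul j (jst n (Jc x) (dy m (a (ph x))))))"
proof
 fix M
 show "pdx i (%x. jst n (Jc x) (a (ph x))) x M = ((SUM k<n. sc (Jc x k i) (jst n (Jc x) (pdx k a (ph x))))
  + (SUM j<n. SUM m<n. sc (of_real (pd i (J m j) x)) (ymul j (jst n (Jc x) (dy m (a (ph x))))))) M"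
  using a
 proof (induction M arbitrary: a)
  case empty
  hence s: "smooth_on n V' (%x. a x {#})" by (simp add: pol_smooth_def)
  have "pd i (%x. a (ph x) {#}) x = (SUM k<n. J k i x *\<^sub>R pd k (%x. a x {#}) (ph x))"
   unfolding J_def by (rule partial_deriv_compose[OF B.V A.V ph x i s ph_smooth])
  thus ?case using i by (simp add: pdx_def jst_empty sum_fun_apply sc_apply ymul_empty Jc_def scaleR_conv_of_real)
 next
  case (add p M)
  have s: "pol_smooth n V (%x. jst n (Jc x) (dy m (a (ph x))))" for m
   using pol_smooth_jst[OF pol_smooth_dy[OF B.V add.prems]] .
  have dJ: "pd i (%x. Jc x m p) x = (if p<n then of_real (pd i (J m p) x) else 0)" if "m<n" for m
   by (cases "p<n") (simp_all add: Jc_def partial_deriv_const partial_deriv_of_real[OF A.V x i] J_smooth that)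
  have "pdx i (%x. jst n (Jc x) (a (ph x))) x (add_mset p M) =
    pd i (%x. SUM m<n. Jc x m p * jst n (Jc x) (dy m (a (ph x))) M) x"
   by (simp add: pdx_def jst_add_mset)
  also have "... = (SUM m<n. pd i (%x. Jc x m p * jst n (Jc x) (dy m (a (ph x))) M) x)"
   by (rule partial_deriv_sum[OF A.V x i]) (use s in \<open>simp add: pol_smooth_def smooth_on_mult[OF A.V] Jc_smooth\<close>)
  also have "... = (SUM m<n. Jc x m p * pdx i (%x. jst n (Jc x) (dy m (a (ph x)))) x M +
    (if p<n then of_real (pd i (J m p) x) else 0) * jst n (Jc x) (dy m (a (ph x))) M)"
  proof (rule sum.cong[OF refl])
   fix m assume "m : {..<n}"
   hence m: "m<n" by simp
   show "pd i (%x. Jc x m p * jst n (Jc x) (dy m (a (ph x))) M) x = Jc x m p * pdx i (%x. jst n (Jc x) (dy m (a (ph x)))) x M +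
    (if p<n then of_real (pd i (J m p) x) else 0) * jst n (Jc x) (dy m (a (ph x))) M"
    unfolding pdx_def dJ[OF m, symmetric]
    by (rule partial_deriv_mult[OF A.V x i]) (use s in \<open>simp_all add: pol_smooth_def Jc_smooth m\<close>)
  qed
  also have "... = (SUM m<n. Jc x m p * ((SUM k<n. Jc x k i * jst n (Jc x) (pdx k (%x. dy m (a x)) (ph x)) M)
    + (SUM j<n. SUM r<n. of_real (pd i (J r j) x) * ymul j (jst n (Jc x) (dy r (dy m (a (ph x))))) M))
    + (if p<n then of_real (pd i (J m p) x) else 0) * jst n (Jc x) (dy m (a (ph x))) M)"
   unfolding add.IH[OF pol_smooth_dy[OF B.V add.prems]] by (simp add: sum_fun_apply sc_apply)
  also have "... = (SUM m<n. SUM k<n. Jc x m p * (Jc x k i * jst n (Jc x) (dy m (pdx k a (ph x))) M))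
    + (SUM m<n. SUM j<n. SUM r<n. Jc x m p * (of_real (pd i (J r j) x) * ymul j (jst n (Jc x) (dy r (dy m (a (ph x))))) M))
    + (SUM m<n. (if p<n then of_real (pd i (J m p) x) else 0) * jst n (Jc x) (dy m (a (ph x))) M)"
   by (simp add: distrib_left sum.distrib sum_distrib_left pdx_dy)
  also have "(SUM m<n. SUM k<n. Jc x m p * (Jc x k i * jst n (Jc x) (dy m (pdx k a (ph x))) M))
    = (SUM k<n. SUM m<n. Jc x k i * (Jc x m p * jst n (Jc x) (dy m (pdx k a (ph x))) M))"
   by (subst sum.swap) (simp add: mult.left_commute)
  also have "(SUM m<n. SUM j<n. SUM r<n. Jc x m p * (of_real (pd i (J r j) x) * ymul j (jst n (Jc x) (dy r (dy m (a (ph x))))) M))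
   = (SUM j<n. SUM r<n. SUM m<n. of_real (pd i (J r j) x) * (Jc x m p * ymul j (jst n (Jc x) (dy m (dy r (a (ph x))))) M))"
   by (subst sum3_swap) (simp add: mult.left_commute dy_commute)
  also have "(SUM m<n. (if p<n then of_real (pd i (J m p) x) else 0) * jst n (Jc x) (dy m (a (ph x))) M)
   = (SUM j<n. SUM m<n. of_real (pd i (J m j) x) * (if p = j then jst n (Jc x) (dy m (a (ph x))) M else 0))"
   by (subst sum.swap, rule sum.cong[OF refl]) (simp add: if_distrib[of "%z. _ * z"] cong: if_cong)
  finally have e: "pdx i (%x. jst n (Jc x) (a (ph x))) x (add_mset p M) =
   (SUM k<n. SUM m<n. Jc x k i * (Jc x m p * jst n (Jc x) (dy m (pdx k a (ph x))) M)) +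
   (SUM j<n. SUM r<n. SUM m<n. of_real (pd i (J r j) x) * (Jc x m p * ymul j (jst n (Jc x) (dy m (dy r (a (ph x))))) M)) +
   (SUM j<n. SUM m<n. of_real (pd i (J m j) x) * (if p = j then jst n (Jc x) (dy m (a (ph x))) M else 0))" .
  have y: "ymul j (jst n (Jc x) b) (add_mset p M) = (if p = j then jst n (Jc x) b M else 0) +
    (SUM m<n. Jc x m p * ymul j (jst n (Jc x) (dy m b)) M)" for j b
  proof -
   have "ymul j (jst n (Jc x) b) (add_mset p M) = dy p (ymul j (jst n (Jc x) b)) M" by (simp add: dy_def)
   also have "... = (if p = j then jst n (Jc x) b M else 0) + (SUM m<n. Jc x m p * ymul j (jst n (Jc x) (dy m b)) M)"
    by (simp add: dy_ymul dy_jst ymul_sum ymul_sc sum_fun_apply sc_apply)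
   finally show ?thesis .
  qed
  show ?case unfolding e
   by (simp add: sum_fun_apply sc_apply jst_add_mset y distrib_left sum.distrib sum_distrib_left)
 qed
qed

lemma snab_pull:
 assumes a: "a : B.secs" and i: "i<n"
 shows "A.snab i (pull a) = (SUM k<n. A.fmul (J k i) (pull (B.snab k a)))"
proof (intro ext)
 fix x m M
 show "A.snab i (pull a) x m M = (SUM k<n. A.fmul (J k i) (pull (B.snab k a))) x m M"
 proof (cases "x : V")
  case False
  thus ?thesis by (simp add: A.snab_def sum_fun_apply A.fmul_def pull_out sc_zero)
 next
  case x: True
  let ?j = "jst n (Jc x)" and ?a = "a (ph x) m"
  have p: "pdx i (%x. pull a x m) x = pdx i (%x. jst n (Jc x) (a (ph x) m)) x"
   by (rule pdx_cong[OF A.V x i]) (simp add: pull_def)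
  have "Lop n (%l j. A.A i l j x) (?j ?a) = (SUM j<n. SUM l<n. SUM m<n. sc (Jc x m l * A.A i l j x) (ymul j (?j (dy m ?a))))"
   by (simp add: Lop_def dy_jst ymul_sum ymul_sc sc_sum sc_sc mult.commute)
  also have "... = (SUM j<n. SUM m<n. SUM l<n. sc (Jc x m l * A.A i l j x) (ymul j (?j (dy m ?a))))"
   by (rule sum.cong[OF refl], rule sum.swap)
  also have "... = (SUM j<n. SUM m<n. sc (SUM l<n. Jc x m l * A.A i l j x) (ymul j (?j (dy m ?a))))"
   by (simp add: sc_sum_left)
  also have "... = (SUM j<n. SUM m<n. sc (of_real (pd i (J m j) x) + (SUM p<n. SUM q<n. B.A p m q (ph x) * Jc x p i * Jc x q j)) (ymul j (?j (dy m ?a))))"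
  proof (intro sum.cong refl arg_cong2[where f=sc])
   fix j m assume "j : {..<n}" "m : {..<n}"
   hence j: "j<n" and m: "m<n" by auto
   have "(SUM l<n. Jc x m l * A.A i l j x) = of_real (SUM l<n. J m l x * Gam n w T i l j x)"
    by (simp add: Jc_def A.A_def)
   also have "... = of_real (pd i (J m j) x) + (SUM p<n. SUM q<n. B.A p m q (ph x) * Jc x p i * Jc x q j)"
    unfolding Gam_J[OF x i j m] by (simp add: Jc_def B.A_def i j)
   finally show "(SUM l<n. Jc x m l * A.A i l j x) = of_real (pd i (J m j) x) + (SUM p<n. SUM q<n. B.A p m q (ph x) * Jc x p i * Jc x q j)" .
  qed
  finally have L: "Lop n (%l j. A.A i l j x) (?j ?a) = (SUM j<n. SUM m<n. sc (of_real (pd i (J m j) x)) (ymul j (?j (dy m ?a))))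
    + (SUM j<n. SUM m<n. sc (SUM p<n. SUM q<n. B.A p m q (ph x) * Jc x p i * Jc x q j) (ymul j (?j (dy m ?a))))"
   by (simp add: sc_add_left sum.distrib)
  have "(SUM p<n. sc (Jc x p i) (?j (Lop n (%m q. B.A p m q (ph x)) ?a))) =
    (SUM p<n. SUM q<n. SUM m<n. SUM j<n. sc (B.A p m q (ph x) * Jc x p i * Jc x q j) (ymul j (?j (dy m ?a))))"
   by (simp add: Lop_def jst_sum jst_sc jst_ymul Jc_def sc_sum sc_sc mult_ac)
  also have "... = (SUM m<n. SUM j<n. SUM p<n. SUM q<n. sc (B.A p m q (ph x) * Jc x p i * Jc x q j) (ymul j (?j (dy m ?a))))"
   by (rule sum4_swap)
  also have "... = (SUM j<n. SUM m<n. sc (SUM p<n. SUM q<n. B.A p m q (ph x) * Jc x p i * Jc x q j) (ymul j (?j (dy m ?a))))"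
   by (subst sum.swap) (simp add: sc_sum_left)
  finally have L': "(SUM j<n. SUM m<n. sc (SUM p<n. SUM q<n. B.A p m q (ph x) * Jc x p i * Jc x q j) (ymul j (?j (dy m ?a))))
    = (SUM p<n. sc (Jc x p i) (?j (Lop n (%m q. B.A p m q (ph x)) ?a)))" by simp
  have "nab n (A.A i) i (%x. pull a x m) x = pdx i (%x. jst n (Jc x) (a (ph x) m)) x - Lop n (%l j. A.A i l j x) (?j ?a)"
   unfolding nab_def p using x by (simp add: pull_def)
  also have "... = (SUM k<n. sc (Jc x k i) (?j (pdx k (%x. a x m) (ph x)))) - (SUM p<n. sc (Jc x p i) (?j (Lop n (%m q. B.A p m q (ph x)) ?a)))"
   unfolding pdx_jst[OF x i B.secsD(1)[OF a]] L L' by simp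
  also have "... = (SUM k<n. sc (Jc x k i) (?j (nab n (B.A k) k (%x. a x m) (ph x))))"
   by (simp add: nab_def jst_diff sc_diff sum_subtractf)
  finally show ?thesis using x i ph[OF x]
   by (simp add: A.snab_def sum_fun_apply A.fmul_def pull_def B.snab_def Jc_def sc_apply)
 qed
qed

end

lemma (in fedosov) N_sum: "(!!l. l : I ==> f l : S) ==> i<n ==> N i (SUM l:I. f l) = (SUM l:I. N i (f l))"
 by (induction I rule: infinite_finite_induct) (auto simp: N_zero N_add S_sum)

context sympl_map begin

text \<open>Pull-back of one-forms with values in the Weyl bundle; \<open>pull2\<close> is its
  analogue for two indices.\<close>

definition pull1 :: "(nat => pt => fib) => nat => pt => fib" where
 "pull1 b i = (SUM l<n. A.fmul (J l i) (pull (b l)))"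

definition pull2 :: "(nat => nat => pt => fib) => nat => nat => pt => fib" where
 "pull2 c i j = (SUM k<n. SUM l<n. A.fmul (%x. J k i x * J l j x) (pull (c k l)))"

lemma pull2_add: "pull2 (%k l. b k l + c k l) i j = pull2 b i j + pull2 c i j"
 and pull2_diff: "pull2 (%k l. b k l - c k l) i j = pull2 b i j - pull2 c i j"
 by (simp_all add: pull2_def pull_add pull_diff A.fmul_add A.fmul_diff sum.distrib sum_subtractf)

lemma pull2_swap: "pull2 c j i = pull2 (%k l. c l k) i j"
 unfolding pull2_def by (subst sum.swap) (simp add: mult.commute)

lemma pull2_cong: "(!!k l. k<n ==> l<n ==> b k l = c k l) ==> pull2 b i j = pull2 c i j"
 by (simp add: pull2_def)

lemma pull1_secs: "(!!l. l<n ==> b l : B.secs) ==> i<n ==> pull1 b i : A.secs"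
 unfolding pull1_def by (rule A.fed.S_sum) (simp add: A.secs_fmul J_smooth secs_pull)

lemma pull2_secs: "(!!k l. k<n ==> l<n ==> c k l : B.secs) ==> i<n ==> j<n ==> pull2 c i j : A.secs"
 unfolding pull2_def by (intro A.fed.S_sum) (simp add: A.secs_fmul J_smooth secs_pull smooth_on_mult[OF A.V])

text \<open>The derivatives of the Jacobian drop out of the antisymmetrized expression by
  \<open>J_deriv_sym\<close>.\<close>

lemma snab_pull1:
 assumes b: "!!l. l<n ==> b l : B.secs" and ij: "i<n" "j<n"
 shows "A.snab i (pull1 b j) - A.snab j (pull1 b i) = pull2 (%k l. B.snab k (b l) - B.snab l (b k)) i j"
proof -
 have e: "A.snab i (pull1 b j) = (SUM l<n. A.fmul (pd i (J l j)) (pull (b l))) + pull2 (%k l. B.snab k (b l)) i j"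
  if ij: "i<n" "j<n" for i j
 proof -
  have "A.snab i (pull1 b j) = (SUM l<n. A.fmul (pd i (J l j)) (pull (b l)) + A.fmul (J l j) (SUM k<n. A.fmul (J k i) (pull (B.snab k (b l)))))"
   unfolding pull1_def by (subst A.fed.N_sum) (simp_all add: ij A.secs_fmul J_smooth secs_pull b A.snab_fmul snab_pull)
  also have "... = (SUM l<n. A.fmul (pd i (J l j)) (pull (b l))) + (SUM l<n. SUM k<n. A.fmul (%x. J k i x * J l j x) (pull (B.snab k (b l))))"
   by (simp add: sum.distrib A.fmul_sum A.fmul_fmul mult.commute)
  finally show ?thesis unfolding pull2_def by (subst sum.swap) simp
 qed
 have "(SUM l<n. A.fmul (pd i (J l j)) (pull (b l))) = (SUM l<n. A.fmul (pd j (J l i)) (pull (b l)))"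
  by (intro sum.cong refl A.fmul_cong) (simp_all add: secs_pull b J_deriv_sym ij)
 thus ?thesis unfolding e[OF ij] e[OF ij(2,1)] pull2_diff by (simp add: pull2_swap[of _ j i])
qed

lemma sdy_pull1: "i<n ==> A.sdy i (pull1 b j) = pull2 (%k l. B.sdy k (b l)) i j"
proof -
 assume i: "i<n"
 have "A.sdy i (pull1 b j) = (SUM l<n. A.fmul (J l j) (SUM k<n. A.fmul (J k i) (pull (B.sdy k (b l)))))"
  by (simp add: pull1_def A.fed.d_sum A.sdy_fmul sdy_pull i)
 thus ?thesis unfolding pull2_def by (subst sum.swap) (simp add: A.fmul_sum A.fmul_fmul mult.commute)
qed

lemma sbrk_sum: "A.sbrk a (SUM l:I. b l) = (SUM l:I. A.sbrk a (b l))" and sbrk_sum_left: "A.sbrk (SUM l:I. b l) a = (SUM l:I. A.sbrk (b l) a)"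
proof -
 have z: "A.sbrk a 0 = 0" "A.sbrk 0 a = 0" using A.fed.brk_add[of a 0 0] A.sbrk_anti[of 0 a] by simp_all
 show 1: "A.sbrk a (SUM l:I. b l) = (SUM l:I. A.sbrk a (b l))"
  using sum_comp_morphism[of "A.sbrk a" b I] by (simp add: z A.fed.brk_add comp_def)
 show "A.sbrk (SUM l:I. b l) a = (SUM l:I. A.sbrk (b l) a)"
  using 1 by (simp add: A.sbrk_anti[of _ a] sum_negf)
qed

lemma sbrk_pull1: "A.sbrk (pull1 b i) (pull1 b j) = pull2 (%k l. B.sbrk (b k) (b l)) i j"
 by (simp add: pull1_def pull2_def sbrk_sum sbrk_sum_left A.sbrk_fmul A.sbrk_fmul_left A.fmul_sum A.fmul_fmul pull_sbrk)
   (subst sum.swap, simp add: mult.commute)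

lemma sbrk_pull2: "A.sbrk (pull2 c i j) (pull a) = pull2 (%k l. B.sbrk (c k l) a) i j"
 by (simp add: pull2_def sbrk_sum_left A.sbrk_fmul_left pull_sbrk)

lemma pull_lin: "p<n ==> pull (B.lin p) = (SUM i<n. A.fmul (J p i) (A.lin i))"
proof (rule ext, rule ext)
 fix x m assume p: "p<n"
 show "pull (B.lin p) x m = (SUM i<n. A.fmul (J p i) (A.lin i)) x m" using ph[of x] p
  by (cases "m = 0") (simp_all add: pull_def B.lin_def A.lin_def fconst_def A.fmul_def sum_fun_apply jst_ymul jst_pone jst_zero Jc_def sc_zero)
qed

text \<open>By the curvature identities of source and target, both sides have equal brackets with
  all pulled-back sections, and neither has a term free of \<open>y\<close>. Since the Jacobian is
  invertible, the pulled-back linear functions span all linear ones, and \<open>secs_center\<close>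
  applies to the difference.\<close>

lemma sR_pull:
 assumes ij: "i<n" "j<n"
 shows "A.sR i j = pull2 B.sR i j"
proof -
 define z where "z = A.sR i j - pull2 B.sR i j"
 have zs: "z : A.secs" unfolding z_def by (intro A.secs_diff A.sR_secs pull2_secs B.sR_secs ij)
 have z1: "A.sbrk z (pull a) = 0" if a: "a : B.secs" for a
 proof -
  have p1: "A.snab j (pull a) = pull1 (%k. B.snab k a) j" if "j<n" for j
   unfolding pull1_def by (rule snab_pull[OF a that])
  have "A.sbrk (A.sR i j) (pull a) = A.snab i (A.snab j (pull a)) - A.snab j (A.snab i (pull a))"
   by (rule A.fed.curvature[OF secs_pull[OF a] ij, symmetric])
  also have "... = pull2 (%k l. B.snab k (B.snab l a) - B.snab l (B.snab k a)) i j"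
   unfolding p1[OF ij(1)] p1[OF ij(2)] by (rule snab_pull1[OF _ ij]) (rule B.secs_snab[OF a])
  also have "... = pull2 (%k l. B.sbrk (B.sR k l) a) i j"
   by (rule pull2_cong) (rule B.fed.curvature[OF a])
  also have "... = A.sbrk (pull2 B.sR i j) (pull a)" by (rule sbrk_pull2[symmetric])
  finally have "A.sbrk (A.sR i j) (pull a) - A.sbrk (pull2 B.sR i j) (pull a) = 0" by simp
  moreover have "A.sbrk z (pull a) = - A.sbrk (pull a) z" by (rule A.sbrk_anti)
  ultimately show ?thesis by (simp add: z_def A.fed.brk_diff A.sbrk_anti[of "pull a"])
 qed
 have "z = 0"
 proof (rule A.secs_center[OF zs])
  show "A.sct z = 0"
  proof (intro ext)
   fix x m M
   have "pull (B.sR k l) x m {#} = 0" for k l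
    by (cases "x : V") (simp_all add: pull_empty pull_out B.sR_small)
   thus "A.sct z x m M = 0 x m M"
    by (simp add: A.sct_def z_def A.sR_small pull2_def sum_fun_apply A.fmul_def sc_apply)
  qed
  fix q assume q: "q<n"
  show "A.sbrk (A.lin q) z = 0"
  proof (intro ext)
   fix x m M
   show "A.sbrk (A.lin q) z x m M = 0 x m M"
   proof (cases "x : V")
    case False
    thus ?thesis using A.secsD(3)[OF A.secs_sbrk[OF A.lin_secs[OF q] zs], of x] by simp
   next
    case x: True
    have z: "(SUM i<n. of_real (J p i x) * A.sbrk z (A.lin i) x m M) = 0" if p: "p<n" for p
    proof -
     have "A.sbrk z (pull (B.lin p)) = (SUM i<n. A.fmul (J p i) (A.sbrk z (A.lin i)))"
      by (simp add: pull_lin[OF p] sbrk_sum A.sbrk_fmul)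
     hence "(SUM i<n. A.fmul (J p i) (A.sbrk z (A.lin i))) x m M = 0"
      using z1[OF B.lin_secs[OF p]] by simp
     thus ?thesis by (simp add: sum_fun_apply A.fmul_def sc_apply)
    qed
    have "0 = (SUM p<n. of_real (Jinv q p x) * (SUM i<n. of_real (J p i x) * A.sbrk z (A.lin i) x m M))"
     using z by simp
    also have "... = (SUM i<n. of_real (SUM p<n. Jinv q p x * J p i x) * A.sbrk z (A.lin i) x m M)"
     by (simp add: sum_distrib_left sum_distrib_right mult.assoc) (rule sum.swap)
    also have "... = (SUM i<n. dl q i * A.sbrk z (A.lin i) x m M)"
     by (intro sum.cong refl) (simp add: Jinv_left x q)
    also have "... = A.sbrk z (A.lin q) x m M" using q by (simp add: sum_delta_mult)
    finally show ?thesis using A.sbrk_anti[of "A.lin q" z] by simp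
   qed
  qed
 qed
 thus ?thesis by (simp add: z_def)
qed

text \<open>The pull-back inherits degree, gauge and flatness, and these determine the form.\<close>

lemma fform_pull:
 assumes "i<n"
 shows "A.fform i = pull1 B.fform i"
proof (rule A.fed.fedosov_form_unique[OF _ A.fform assms])
 have B: "B.fform i : B.secs" "B.fform i : B.sFil 3" if "i<n" for i
  using B.fform_secs that by simp_all
 have B0: "(SUM i<n. B.sym i (B.fform i)) = 0" and Bc: "!!i j. i<n ==> j<n ==> B.fed.curv B.fform i j = 0"
  using B.fform by (simp_all add: B.fed.fedosov_form_def)
 have "pull1 B.fform i : A.sFil 3" for i
  unfolding pull1_def by (rule A.fed.Fl_sum) (simp add: A.sFil_fmul pull_sFil B)
 moreover have "(SUM i<n. A.sym i (pull1 B.fform i)) = 0"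
 proof -
  have "(SUM i<n. A.sym i (pull1 B.fform i)) = (SUM i<n. SUM l<n. A.fmul (J l i) (A.sym i (pull (B.fform l))))"
   by (simp add: pull1_def A.fed.y_sum A.sym_fmul)
  also have "... = (SUM l<n. pull (B.sym l (B.fform l)))" by (subst sum.swap) (simp add: pull_sym)
  also have "... = 0" using B0 by (simp add: pull_sum[symmetric] pull_zero)
  finally show ?thesis .
 qed
 moreover have "A.fed.curv (pull1 B.fform) i j = 0" if ij: "i<n" "j<n" for i j
 proof -
  have s: "A.snab i (pull1 B.fform j) - A.snab j (pull1 B.fform i) = pull2 (%k l. B.snab k (B.fform l) - B.snab l (B.fform k)) i j"
   by (rule snab_pull1[OF _ ij]) (rule B(1))
  have t: "A.sdy i (pull1 B.fform j) - A.sdy j (pull1 B.fform i) = pull2 (%k l. B.sdy k (B.fform l) - B.sdy l (B.fform k)) i j"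
   unfolding sdy_pull1[OF ij(1)] sdy_pull1[OF ij(2)] pull2_swap[of _ j i] pull2_diff ..
  have "A.fed.curv (pull1 B.fform) i j = A.sR i j + (A.snab i (pull1 B.fform j) - A.snab j (pull1 B.fform i))
    - (A.sdy i (pull1 B.fform j) - A.sdy j (pull1 B.fform i)) + A.sbrk (pull1 B.fform i) (pull1 B.fform j)"
   by (simp add: A.fed.curv_def A.fed.E_def)
  also have "... = pull2 B.sR i j + pull2 (%k l. B.snab k (B.fform l) - B.snab l (B.fform k)) i j
    - pull2 (%k l. B.sdy k (B.fform l) - B.sdy l (B.fform k)) i j + pull2 (%k l. B.sbrk (B.fform k) (B.fform l)) i j"
   by (simp only: sR_pull[OF ij] s t sbrk_pull1)
  also have "... = pull2 (%k l. B.fed.curv B.fform k l) i j"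
   unfolding pull2_add[symmetric] pull2_diff[symmetric]
   by (simp add: B.fed.curv_def B.fed.E_def algebra_simps)
  also have "... = pull2 (%k l. 0) i j" by (rule pull2_cong) (rule Bc)
  also have "... = 0" by (simp add: pull2_def pull_zero A.fmul_zero)
  finally show ?thesis .
 qed
 ultimately show "A.fed.fedosov_form (pull1 B.fform)" by (simp add: A.fed.fedosov_form_def pull1_secs B)
qed

lemma flat_pull:
 assumes "B.flat a"
 shows "A.flat (pull a)"
proof -
 have a: "a : B.secs" "!!k. k<n ==> B.fed.D B.fform k a = 0" using assms by (simp_all add: B.flat_def)
 have "A.fed.D A.fform i (pull a) = (SUM k<n. A.fmul (J k i) (pull (B.fed.D B.fform k a)))" if i: "i<n" for i
 proof -
  have "A.sbrk (pull1 B.fform i) (pull a) = (SUM k<n. A.fmul (J k i) (pull (B.sbrk (B.fform k) a)))"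
   by (simp add: pull1_def sbrk_sum_left A.sbrk_fmul_left pull_sbrk)
  thus ?thesis
   by (simp add: A.fed.D_def A.fed.E_def B.fed.D_def B.fed.E_def fform_pull[OF i] snab_pull[OF a(1) i] sdy_pull[OF i]
     pull_add pull_diff A.fmul_add A.fmul_diff sum.distrib sum_subtractf)
 qed
 thus ?thesis by (simp add: A.flat_def secs_pull a pull_zero A.fmul_zero)
qed

theorem star_loc_natural:
 assumes F: "B.smooth_series F" and G: "B.smooth_series G" and x: "x : V"
 shows "A.star_loc (%m x. F m (ph x)) (%m x. G m (ph x)) m x = B.star_loc F G m (ph x)"
proof -
 have e: "A.flat_ext (%m x. F m (ph x)) = pull (B.flat_ext F)" if F: "B.smooth_series F" for F
  by (rule A.flat_ext_eqI) (simp_all add: flat_pull B.flat_flat_ext F pull_empty B.flat_ext_empty ph)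
 show ?thesis by (simp add: A.star_loc_def B.star_loc_def e F G pull_smul[symmetric] pull_empty x)
qed

end

section \<open>Invariance of dimension and local continuity\<close>

lemma Euclidean_space_inj_dim:
 assumes U: "oES n U" "U ~= {}" and f: "continuous_map (sES n U) (ES m) f"
  and inj: "inj_on f U"
 shows "n <= m"
proof (rule ccontr)
 assume "~ n <= m"
 hence mn: "m<n" by simp
 have fm: "ALL i>=m. f x i = 0" if "x : U" for x
  using continuous_map_image_subset_topspace[OF f] openin_subset[OF U(1)] that
  by (auto simp: topspace_Euclidean_space)
 have "continuous_map (sES n U) (ES n) f" using f mn fm unfolding Euclidean_space_eq_top_of_set
  by (simp add: continuous_map_in_subtopology image_subset_iff Pi_iff)
 hence o: "oES n (f ` U)" by (rule invariance_of_domain_Euclidean_space[OF U(1) _ inj])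
 obtain u where u: "u : U" using U(2) by auto
 have fu: "f u : f ` U" using u by simp
 from openin_ES_box[OF o fu]
 obtain e where e: "e > 0" "!!y. (!!i. i >= n ==> y i = 0) ==> (!!i. i<n ==> \<bar>y i - f u i\<bar> <= e) ==> y : f ` U"
  by metis
 \<comment> \<open>By invariance of domain the image is open in dimension \<open>n\<close>, although
   all its points have \<open>m\<close>-th coordinate zero.\<close>
 have "(f u)(m := e) : f ` U" by (rule e(2)) (use fm[OF u] mn e(1) in auto)
 then obtain z where "z : U" "f z = (f u)(m := e)" by auto
 hence "e = f z m" by simp
 thus False using fm[OF \<open>z : U\<close>] e(1) by simp
qed

lemma continuous_map_locally:
 assumes "!!x. x : topspace X ==> EX W. openin X W & x : W & continuous_map (subtopology X W) Y f"
 shows "continuous_map X Y f" unfolding continuous_map_def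
proof (intro conjI allI impI)
 show "f : topspace X \<rightarrow> topspace Y"
 proof
  fix x assume "x : topspace X"
  then obtain W where W: "openin X W" "x : W" "continuous_map (subtopology X W) Y f" using assms by blast
  thus "f x : topspace Y" using continuous_map_image_subset_topspace[OF W(3)] openin_subset[OF W(1)] by auto
 qed
 fix V assume V: "openin Y V"
 show "openin X {x : topspace X. f x : V}"
 proof (subst openin_subopen, intro ballI)
  fix x assume "x : {x : topspace X. f x : V}"
  hence x: "x : topspace X" "f x : V" by auto
  then obtain W where W: "openin X W" "x : W" "continuous_map (subtopology X W) Y f" using assms by blast
  have "openin (subtopology X W) {x : topspace (subtopology X W). f x : V}"
   by (rule openin_continuous_map_preimage[OF W(3) V])
  hence "openin X {x : topspace (subtopology X W). f x : V}"
   using openin_open_subtopology[OF W(1)] by blast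
  thus "EX T. openin X T & x : T & T <= {x : topspace X. f x : V}"
   using W x by (intro exI[of _ "{x : topspace (subtopology X W). f x : V}"]) auto
 qed
qed

lemma continuous_map_smooth_ES:
 assumes W: "oES m W" and V: "oES n V"
  and f: "!!x. x : W ==> f x : V" and s: "!!l. l<n ==> smooth_on m W (%x. f x l)"
 shows "continuous_map (sES m W) (sES n V) f"
proof -
 have "continuous_on W f"
  by (rule continuous_on_ES_map[OF f openin_ES_subset[OF V]]) (simp_all add: smooth_on_continuous[OF W s])
 hence "continuous_map (top_of_set W) (top_of_set V) f" using f by (auto simp: continuous_map_in_subtopology)
 thus ?thesis by (simp add: subtopology_ES openin_ES_subset V W)
qed

section \<open>Coordinate systems, smooth parametrizations and pulled-back forms\<close>

abbreviation vdom :: "'m coord => pt set" where "vdom a \<equiv> snd a ` fst a"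

abbreviation civ :: "'m coord => pt => 'm" where "civ a \<equiv> inv_into (fst a) (snd a)"

context
 fixes M :: "'m manifold"
 assumes M: "smooth_manifold M"
begin

lemma co_system: "a : mcoords M ==> coord_system (mtop M) (mdim M) a"
 using M unfolding smooth_manifold_def smooth_atlas_def by blast

lemma co_open: "a : mcoords M ==> openin (mtop M) (fst a)"
 and co_dom: "a : mcoords M ==> oES (mdim M) (vdom a)"
 and co_homeo: "a : mcoords M ==> homeomorphic_map (subtopology (mtop M) (fst a)) (sES (mdim M) (vdom a)) (snd a)"
 using co_system by (auto simp: coord_system_def)

lemma co_inj: "a : mcoords M ==> inj_on (snd a) (fst a)"
 using homeomorphic_imp_injective_map[OF co_homeo] openin_subset[OF co_open] by (simp add: inf.absorb2)

lemma civ_in: "v : vdom a ==> civ a v : fst a" and co_civ: "v : vdom a ==> snd a (civ a v) = v"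
 by (rule inv_into_into f_inv_into_f; assumption)+

lemma civ_co: "a : mcoords M ==> p : fst a ==> civ a (snd a p) = p"
 by (rule inv_into_f_f[OF co_inj])

lemma co_cont: "a : mcoords M ==> continuous_map (subtopology (mtop M) (fst a)) (sES (mdim M) (vdom a)) (snd a)"
 by (rule homeomorphic_imp_continuous_map[OF co_homeo])

lemma civ_cont:
 assumes a: "a : mcoords M"
 shows "continuous_map (sES (mdim M) (vdom a)) (subtopology (mtop M) (fst a)) (civ a)"
proof -
 from homeomorphic_map_maps[THEN iffD1, OF co_homeo[OF a]] obtain g where
  g: "homeomorphic_maps (subtopology (mtop M) (fst a)) (sES (mdim M) (vdom a)) (snd a) g" ..
 have "civ a v = g v" if "v : vdom a" for v
 proof -
  from that obtain p where p: "p : fst a" "v = snd a p" by (rule imageE)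
  have "p : topspace (mtop M)" using openin_subset[OF co_open[OF a]] p by auto
  hence "g v = p" using g p by (auto simp: homeomorphic_maps_def)
  thus ?thesis using civ_co[OF a p(1)] p by simp
 qed
 thus ?thesis using g by (auto simp: homeomorphic_maps_def elim!: continuous_map_eq)
qed

lemma co_ex: "p : topspace (mtop M) ==> EX a:mcoords M. p : fst a"
 using M unfolding smooth_manifold_def smooth_atlas_def by blast

lemma co_trans: "a : mcoords M ==> b : mcoords M ==> j<mdim M ==> smooth_on (mdim M) (coord_rep_dom a id b) (%x. coord_rep a id b x j)"
 using M unfolding smooth_manifold_def smooth_atlas_def by blast

lemma coord_rep_dom_eq: "a : mcoords M ==> coord_rep_dom a ff b = {v : vdom a. ff (civ a v) : fst b}"
 by (auto simp: coord_rep_dom_def civ_co)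

end

text \<open>Maps between manifolds are studied after composition with Euclidean parametrizations,
  which leaves only the coordinates of the target to be handled.\<close>

definition smap :: "nat => pt set => 'm manifold => (pt => 'm) => bool" where
 "smap n D M Ph <-> oES n D &
   continuous_map (sES n D) (mtop M) Ph &
   (ALL a:mcoords M. ALL j<mdim M. smooth_on n (D Int Ph -` fst a) (%x. snd a (Ph x) j))"

lemma smap_open: "smap n D M Ph ==> oES n D"
 and smap_cont: "smap n D M Ph ==> continuous_map (sES n D) (mtop M) Ph"
 and smap_smooth: "smap n D M Ph ==> a : mcoords M ==> j<mdim M ==> smooth_on n (D Int Ph -` fst a) (%x. snd a (Ph x) j)"
 by (simp_all add: smap_def)

lemma cont_ES_preimage:
 assumes "oES n D" "continuous_map (sES n D) Y Ph" "openin Y S"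
 shows "oES n (D Int Ph -` S)"
proof -
 have "openin (sES n D) {x : topspace (sES n D). Ph x : S}"
  by (rule openin_continuous_map_preimage[OF assms(2,3)])
 moreover have "{x : topspace (sES n D). Ph x : S} = D Int Ph -` S"
  using openin_subset[OF assms(1)] by auto
 ultimately show ?thesis using openin_open_subtopology[OF assms(1)] by simp
qed

lemma smap_preimage: "smap n D M Ph ==> openin (mtop M) S ==> oES n (D Int Ph -` S)"
 by (rule cont_ES_preimage[OF smap_open smap_cont])

lemma smap_into: "smap n D M Ph ==> x : D ==> Ph x : topspace (mtop M)"
 using continuous_map_image_subset_topspace[OF smap_cont] openin_subset[OF smap_open] by fastforce

text \<open>One coordinate system of the target near each point suffices; any other is reached by a
  smooth change of coordinates.\<close>

lemma smap_localI:
 assumes M: "smooth_manifold M" and D: "oES n D"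
  and loc: "!!x. x : D ==> EX a:mcoords M. EX W. oES n W & x : W & W <= D & Ph ` W <= fst a &
    (ALL j<mdim M. smooth_on n W (%x. snd a (Ph x) j))"
 shows "smap n D M Ph"
proof -
 have cW: "continuous_map (sES n W) (mtop M) Ph"
  if a: "a : mcoords M" and W: "oES n W" "Ph ` W <= fst a" and s: "ALL j<mdim M. smooth_on n W (%x. snd a (Ph x) j)" for a W
 proof -
  have "continuous_map (sES n W) (sES (mdim M) (vdom a)) (%x. snd a (Ph x))"
   by (rule continuous_map_smooth_ES[OF W(1) co_dom[OF M a]]) (use W s in auto)
  from continuous_map_compose[OF this civ_cont[OF M a]]
  have c: "continuous_map (sES n W) (mtop M) (civ a o (%x. snd a (Ph x)))"
   by (simp add: continuous_map_in_subtopology)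
  show ?thesis by (rule continuous_map_eq[OF c]) (use W civ_co[OF M a] in auto)
 qed
 have c: "continuous_map (sES n D) (mtop M) Ph"
 proof (rule continuous_map_locally)
  fix x assume "x : topspace (sES n D)"
  hence "x : D" by simp
  from loc[OF this] obtain a W where a: "a : mcoords M" and W: "oES n W" "x : W" "W <= D" "Ph ` W <= fst a"
   "ALL j<mdim M. smooth_on n W (%x. snd a (Ph x) j)" by auto
  have "continuous_map (subtopology (sES n D) W) (mtop M) Ph"
   using cW[OF a W(1,4,5)] W(3) by (simp add: subtopology_subtopology inf.absorb2)
  moreover have "openin (sES n D) W" using W D by (simp add: openin_open_subtopology)
  ultimately show "EX W. openin (sES n D) W & x : W &
    continuous_map (subtopology (sES n D) W) (mtop M) Ph" using W(2) by auto
 qed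
 have "smooth_on n (D Int Ph -` fst b) (%x. snd b (Ph x) j)" if b: "b : mcoords M" and j: "j<mdim M" for b j
 proof (rule smooth_on_local)
  show ob: "oES n (D Int Ph -` fst b)" by (rule cont_ES_preimage[OF D c co_open[OF M b]])
  fix x assume x: "x : D Int Ph -` fst b"
  from loc[of x] x obtain a W where a: "a : mcoords M" and W: "oES n W" "x : W" "W <= D" "Ph ` W <= fst a"
   "ALL j<mdim M. smooth_on n W (%x. snd a (Ph x) j)" by auto
  have W': "oES n (W Int (D Int Ph -` fst b))" using W(1) ob by (rule openin_Int)
  have od: "oES (mdim M) (coord_rep_dom a id b)"
  proof -
   have "coord_rep_dom a id b = vdom a Int civ a -` fst b" by (simp add: coord_rep_dom_eq[OF M a] set_eq_iff)
   moreover have "continuous_map (sES (mdim M) (vdom a)) (mtop M) (civ a)"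
    using civ_cont[OF M a] by (rule continuous_map_into_fulltopology)
   ultimately show ?thesis using cont_ES_preimage[OF co_dom[OF M a] _ co_open[OF M b]] by simp
  qed
  have "smooth_on n (W Int (D Int Ph -` fst b)) (%x. coord_rep a id b (snd a (Ph x)) j)"
  proof (rule smooth_on_compose[OF od W' _ co_trans[OF M a b j]])
   show "snd a (Ph x) : coord_rep_dom a id b" if "x : W Int (D Int Ph -` fst b)" for x
    using that W(4) civ_co[OF M a] by (auto simp: coord_rep_dom_eq[OF M a])
   show "smooth_on n (W Int (D Int Ph -` fst b)) (%x. snd a (Ph x) l)" if "l<mdim M" for l
    by (rule smooth_on_subset[OF W(1) W']) (use W(5) that in auto)
  qed
  hence "smooth_on n (W Int (D Int Ph -` fst b)) (%x. snd b (Ph x) j)"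
   by (rule smooth_on_cong[OF W', THEN iffD1, rotated]) (use W(4) civ_co[OF M a] in \<open>auto simp: coord_rep_def\<close>)
  thus "EX W. oES n W & x : W & smooth_on n W (%x. snd b (Ph x) j)"
   using W' W(2) x by (intro exI[of _ "W Int (D Int Ph -` fst b)"]) auto
 qed
 thus ?thesis using D c by (simp add: smap_def)
qed

lemma smap_subset:
 assumes "smap n D M Ph" "oES n D'" "D' <= D" "smooth_manifold M"
 shows "smap n D' M Ph"
proof -
 have c: "continuous_map (sES n D') (mtop M) Ph"
  using continuous_map_from_subtopology_mono[OF smap_cont[OF assms(1)] assms(3)] .
 have "smooth_on n (D' Int Ph -` fst a) (%x. snd a (Ph x) j)" if "a : mcoords M" "j<mdim M" for a j
  by (rule smooth_on_subset[OF smap_preimage[OF assms(1)] cont_ES_preimage[OF assms(2) c] _ smap_smooth[OF assms(1) that]])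
    (use assms(3) co_open[OF assms(4) that(1)] in auto)
 thus ?thesis using assms(2) c by (simp add: smap_def)
qed

lemma smap_civ:
 assumes M: "smooth_manifold M" and a: "a : mcoords M"
 shows "smap (mdim M) (vdom a) M (civ a)"
proof (rule smap_localI[OF M co_dom[OF M a]])
 fix x assume x: "x : vdom a"
 have "smooth_on (mdim M) (vdom a) (%x. snd a (civ a x) j)" for j
  by (rule smooth_on_cong[OF co_dom[OF M a], THEN iffD1, OF _ smooth_on_coord[OF co_dom[OF M a], of j]])
    (simp add: co_civ[OF M])
 thus "EX a':mcoords M. EX W. oES (mdim M) W & x : W & W <= vdom a & civ a ` W <= fst a' &
    (ALL j<mdim M. smooth_on (mdim M) W (%x. snd a' (civ a x) j))"
  using a x co_dom[OF M a] by (intro bexI[of _ a] exI[of _ "vdom a"]) (auto simp: civ_co[OF M a])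
qed

lemma coord_rep_dom_open:
 assumes N: "smooth_manifold N" and M: "smooth_manifold M" and p: "smooth_map N M ff" and a: "a : mcoords N" and b: "b : mcoords M"
 shows "oES (mdim N) (coord_rep_dom a ff b)"
proof -
 have "continuous_map (sES (mdim N) (vdom a)) (mtop N) (civ a)"
  using civ_cont[OF N a] by (simp add: continuous_map_in_subtopology)
 hence "continuous_map (sES (mdim N) (vdom a)) (mtop M) (ff o civ a)"
  using p by (simp add: smooth_map_def continuous_map_compose)
 from cont_ES_preimage[OF co_dom[OF N a] this co_open[OF M b]] show ?thesis
  by (simp add: coord_rep_dom_eq[OF N a] Int_def vimage_def)
qed

lemma smap_map:
 assumes N: "smooth_manifold N" and M: "smooth_manifold M" and s: "smap n D N Ph" and p: "smooth_map N M ff"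
 shows "smap n D M (%x. ff (Ph x))"
proof -
 have D: "oES n D" using smap_open[OF s] .
 have c: "continuous_map (sES n D) (mtop M) (%x. ff (Ph x))"
  using continuous_map_compose[OF smap_cont[OF s], of "mtop M" ff] p by (simp add: smooth_map_def o_def)
 show ?thesis
 proof (rule smap_localI[OF M D])
  fix x assume x: "x : D"
  obtain a where a: "a : mcoords N" "Ph x : fst a" using co_ex[OF N smap_into[OF s x]] by auto
  have "ff (Ph x) : topspace (mtop M)"
   using p smap_into[OF s x] by (auto simp: smooth_map_def continuous_map_def)
  from co_ex[OF M this] obtain b where b: "b : mcoords M" "ff (Ph x) : fst b" by auto
  define W where "W = (D Int Ph -` fst a) Int (D Int (%x. ff (Ph x)) -` fst b)"
  have oa: "oES n (D Int Ph -` fst a)" by (rule smap_preimage[OF s co_open[OF N a(1)]])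
  have W: "oES n W" unfolding W_def by (intro openin_Int oa cont_ES_preimage[OF D c] co_open[OF M b(1)])
  have "smooth_on n W (%x. snd b (ff (Ph x)) j)" if j: "j<mdim M" for j
  proof -
   have "smooth_on n W (%x. coord_rep a ff b (snd a (Ph x)) j)"
   proof (rule smooth_on_compose[where f="%x. coord_rep a ff b x j" and ff="%x. snd a (Ph x)", OF coord_rep_dom_open[OF N M p a(1) b(1)] W])
    show "snd a (Ph x) : coord_rep_dom a ff b" if "x : W" for x
     using that by (auto simp: W_def coord_rep_dom_def)
    show "smooth_on (mdim N) (coord_rep_dom a ff b) (%x. coord_rep a ff b x j)"
     using p a(1) b(1) j by (simp add: smooth_map_def)
    show "smooth_on n W (%x. snd a (Ph x) l)" if "l<mdim N" for l
     by (rule smooth_on_subset[OF oa W _ smap_smooth[OF s a(1) that]]) (auto simp: W_def)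
   qed
   thus ?thesis
    by (rule smooth_on_cong[OF W, THEN iffD1, rotated]) (use civ_co[OF N a(1)] in \<open>auto simp: coord_rep_def W_def\<close>)
  qed
  thus "EX a:mcoords M. EX W. oES n W & x : W & W <= D & (%x. ff (Ph x)) ` W <= fst a &
    (ALL j<mdim M. smooth_on n W (%x. snd a (ff (Ph x)) j))"
   using W x a b by (intro bexI[OF _ b(1)] exI[of _ W]) (auto simp: W_def)
 qed
qed

lemma smap_pre:
 assumes M: "smooth_manifold M" and s: "smap n D M Ph" and D': "oES m D'"
  and F: "!!x. x : D' ==> F x : D" "!!l. l<n ==> smooth_on m D' (%x. F x l)"
 shows "smap m D' M (%x. Ph (F x))"
proof -
 have D: "oES n D" using smap_open[OF s] .
 have "continuous_map (sES m D') (sES n D) F" by (rule continuous_map_smooth_ES[OF D' D F])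
 hence c: "continuous_map (sES m D') (mtop M) (%x. Ph (F x))"
  using continuous_map_compose[OF _ smap_cont[OF s]] by (simp add: o_def)
 have "smooth_on m (D' Int (%x. Ph (F x)) -` fst a) (%x. snd a (Ph (F x)) j)" if "a : mcoords M" "j<mdim M" for a j
 proof -
  have o: "oES m (D' Int (%x. Ph (F x)) -` fst a)" by (rule cont_ES_preimage[OF D' c co_open[OF M that(1)]])
  show ?thesis
   by (rule smooth_on_compose[OF smap_preimage[OF s co_open[OF M that(1)]] o _ smap_smooth[OF s that]])
     (use F in \<open>auto intro: smooth_on_subset[OF D' o]\<close>)
 qed
 thus ?thesis using D' c by (simp add: smap_def)
qed

text \<open>The relation \<open>Ph\<^sup>* \<eta> = v\<close>, with \<open>v\<close> given by
  Euclidean components; it is stated in every coordinate system so that any convenient one can be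
  used.\<close>

definition pform :: "nat => pt set => 'm manifold => 'm two_form => (pt => 'm) =>
  (nat => nat => pt => real) => bool" where
 "pform n D M \<eta> Ph v <-> (ALL b:mcoords M. ALL x:D. Ph x : fst b --> (ALL i<n. ALL j<n. v i j x =
   (SUM k<mdim M. SUM l<mdim M. \<eta> b (Ph x) k l * pd i (%x. snd b (Ph x) k) x * pd j (%x. snd b (Ph x) l) x)))"

lemma pformD:
 "pform n D M \<eta> Ph v ==> b : mcoords M ==> x : D ==> Ph x : fst b ==> i<n ==> j<n ==> v i j x =
   (SUM k<mdim M. SUM l<mdim M. \<eta> b (Ph x) k l * pd i (%x. snd b (Ph x) k) x * pd j (%x. snd b (Ph x) l) x)"
 unfolding pform_def by blast

lemma form_compose:
 fixes e :: "nat => nat => 'a::comm_ring_1"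
 shows "(SUM k<m. SUM l<m. e k l * (SUM p<r. B p i * A k p) * (SUM q<r. B q j * A l q)) =
  (SUM p<r. SUM q<r. (SUM k<m. SUM l<m. e k l * A k p * A l q) * B p i * B q j)"
proof -
 have "(SUM k<m. SUM l<m. e k l * (SUM p<r. B p i * A k p) * (SUM q<r. B q j * A l q)) =
   (SUM k<m. SUM l<m. SUM p<r. SUM q<r. e k l * A k p * A l q * B p i * B q j)"
  by (intro sum.cong refl) (simp add: sum_distrib_left sum_distrib_right mult_ac)
 also have "... = (SUM p<r. SUM q<r. SUM k<m. SUM l<m. e k l * A k p * A l q * B p i * B q j)" by (rule sum4_swap)
 also have "... = (SUM p<r. SUM q<r. (SUM k<m. SUM l<m. e k l * A k p * A l q) * B p i * B q j)"
  by (simp add: sum_distrib_right)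
 finally show ?thesis .
qed

lemma pform_unique:
 assumes M: "smooth_manifold M" and s: "smap n D M Ph" and "pform n D M \<eta> Ph v" "pform n D' M \<eta> Ph' v'"
  and D': "x : D'" "oES n D'" "!!x. x : D' ==> x : D & Ph' x = Ph x" and ij: "i<n" "j<n"
 shows "v i j x = v' i j x"
proof -
 have x: "x : D" "Ph' x = Ph x" using D' by auto
 obtain b where b: "b : mcoords M" "Ph x : fst b" using co_ex[OF M smap_into[OF s x(1)]] by auto
 have pd: "pd i (%x. snd b (Ph' x) k) x = pd i (%x. snd b (Ph x) k) x" if "i<n" for i k
  by (rule partial_deriv_cong[OF D'(2,1) that]) (simp add: D'(3))
 show ?thesis
  using pformD[OF assms(3) b(1) x(1) b(2) ij] pformD[OF assms(4) b(1) D'(1) _ ij] b(2) by (simp add: x(2) pd ij)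
qed

lemma pform_subset: "pform n D M \<eta> Ph v ==> D' <= D ==> pform n D' M \<eta> Ph v"
 unfolding pform_def by blast

lemma pform_civ:
 assumes M: "smooth_manifold M" and a: "a : mcoords M" and \<eta>: "pullback_eq M M id \<eta> \<eta>"
 shows "pform (mdim M) (vdom a) M \<eta> (civ a) (form_rep \<eta> a)" unfolding pform_def
proof (intro ballI impI allI)
 fix b x i j assume b: "b : mcoords M" and x: "x : vdom a" and xb: "civ a x : fst b" and ij: "i<mdim M" "j<mdim M"
 have "\<eta> a (civ a x) i j = (SUM k<mdim M. SUM l<mdim M. \<eta> b (civ a x) k l * jacobian a id b (civ a x) k i * jacobian a id b (civ a x) l j)"
  using \<eta>[unfolded pullback_eq_def, rule_format, OF a b, of "civ a x" i j] civ_in[OF M x] xb ij by simp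
 moreover have "jacobian a id b (civ a x) k i = pd i (%x. snd b (civ a x) k) x" for k i
  by (simp add: jacobian_def coord_rep_def co_civ[OF M x])
 ultimately show "form_rep \<eta> a i j x = (SUM k<mdim M. SUM l<mdim M. \<eta> b (civ a x) k l *
   pd i (%x. snd b (civ a x) k) x * pd j (%x. snd b (civ a x) l) x)"
  by (simp add: form_rep_def)
qed

lemma pform_map:
 assumes N: "smooth_manifold N" and M: "smooth_manifold M" and s: "smap n D N Ph" and p: "smooth_map N M ff"
  and f: "pform n D N \<theta> Ph v" and e: "pullback_eq N M ff \<eta> \<theta>"
 shows "pform n D M \<eta> (%x. ff (Ph x)) v" unfolding pform_def
proof (intro ballI impI allI)
 fix b x i j assume b: "b : mcoords M" and x: "x : D" and xb: "ff (Ph x) : fst b" and ij: "i<n" "j<n"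
 obtain a where a: "a : mcoords N" "Ph x : fst a" using co_ex[OF N smap_into[OF s x]] by auto
 have e': "\<theta> a (Ph x) p q = (SUM k<mdim M. SUM l<mdim M. \<eta> b (ff (Ph x)) k l * jacobian a ff b (Ph x) k p * jacobian a ff b (Ph x) l q)"
  if "p<mdim N" "q<mdim N" for p q
  using e[unfolded pullback_eq_def, rule_format, OF a(1) b, of "Ph x" p q] a(2) xb that by simp
 define W where "W = D Int (%x. ff (Ph x)) -` fst b Int (D Int Ph -` fst a)"
 have oa: "oES n (D Int Ph -` fst a)" by (rule smap_preimage[OF s co_open[OF N a(1)]])
 have W: "oES n W" unfolding W_def
  by (intro openin_Int oa smap_preimage[OF smap_map[OF N M s p]] co_open[OF M b])
 have xW: "x : W" using x xb a(2) by (simp add: W_def)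
 have pd: "pd i (%x. snd b (ff (Ph x)) k) x =
   (SUM p<mdim N. pd i (%x. snd a (Ph x) p) x * jacobian a ff b (Ph x) k p)" if "i<n" "k<mdim M" for i k
 proof -
  have "pd i (%x. snd b (ff (Ph x)) k) x = pd i (%x. coord_rep a ff b (snd a (Ph x)) k) x"
   by (rule partial_deriv_cong[OF W xW that(1)]) (auto simp: coord_rep_def W_def civ_co[OF N a(1)])
  also have "... = (SUM l<mdim N. pd i (%x. snd a (Ph x) l) x *\<^sub>R pd l (%x. coord_rep a ff b x k) (snd a (Ph x)))"
  proof (rule partial_deriv_compose[where f="%x. coord_rep a ff b x k" and ff="%x. snd a (Ph x)", OF coord_rep_dom_open[OF N M p a(1) b] W _ xW that(1)])
   show "snd a (Ph x) : coord_rep_dom a ff b" if "x : W" for x using that by (auto simp: W_def coord_rep_dom_def)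
   show "smooth_on (mdim N) (coord_rep_dom a ff b) (%x. coord_rep a ff b x k)" using p a(1) b that by (simp add: smooth_map_def)
   show "smooth_on n W (%x. snd a (Ph x) l)" if "l<mdim N" for l
    by (rule smooth_on_subset[OF oa W _ smap_smooth[OF s a(1) that]]) (auto simp: W_def)
  qed
  finally show ?thesis by (simp add: jacobian_def)
 qed
 have "v i j x = (SUM p<mdim N. SUM q<mdim N. \<theta> a (Ph x) p q * pd i (%x. snd a (Ph x) p) x * pd j (%x. snd a (Ph x) q) x)"
  by (rule pformD[OF f a(1) x a(2) ij])
 also have "... = (SUM k<mdim M. SUM l<mdim M. \<eta> b (ff (Ph x)) k l * (SUM p<mdim N. pd i (%x. snd a (Ph x) p) x * jacobian a ff b (Ph x) k p) *
   (SUM q<mdim N. pd j (%x. snd a (Ph x) q) x * jacobian a ff b (Ph x) l q))"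
  by (subst form_compose[where A="jacobian a ff b (Ph x)" and B="%p i. pd i (%x. snd a (Ph x) p) x"])
    (simp add: e')
 finally show "v i j x = (SUM k<mdim M. SUM l<mdim M. \<eta> b (ff (Ph x)) k l *
   pd i (%x. snd b (ff (Ph x)) k) x * pd j (%x. snd b (ff (Ph x)) l) x)"
  by (simp add: pd ij)
qed

lemma pform_pre:
 assumes M: "smooth_manifold M" and s: "smap n D M Ph" and D': "oES m D'"
  and F: "!!x. x : D' ==> F x : D" "!!l. l<n ==> smooth_on m D' (%x. F x l)" and f: "pform n D M \<eta> Ph v"
 shows "pform m D' M \<eta> (%x. Ph (F x)) (%i j x. SUM k<n. SUM l<n. v k l (F x) * jc F i k x * jc F j l x)"
 unfolding pform_def
proof (intro ballI impI allI)
 fix b x i j assume b: "b : mcoords M" and x: "x : D'" and xb: "Ph (F x) : fst b" and ij: "i<m" "j<m"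
 define W where "W = D' Int (%x. Ph (F x)) -` fst b"
 have ob: "oES n (D Int Ph -` fst b)" by (rule smap_preimage[OF s co_open[OF M b]])
 have W: "oES m W" unfolding W_def by (rule smap_preimage[OF smap_pre[OF M s D' F] co_open[OF M b]])
 have xW: "x : W" using x xb by (simp add: W_def)
 have FW: "smooth_on m W (%x. F x l)" if "l<n" for l
  by (rule smooth_on_subset[OF D' W _ F(2)[OF that]]) (simp add: W_def)
 have pd: "pd i (%x. snd b (Ph (F x)) k) x =
   (SUM p<n. jc F i p x * pd p (%x. snd b (Ph x) k) (F x))" if "i<m" "k<mdim M" for i k
 proof -
  have "pd i (%x. snd b (Ph (F x)) k) x = (SUM p<n. jc F i p x *\<^sub>R pd p (%x. snd b (Ph x) k) (F x))"
   by (rule partial_deriv_compose[where f="%x. snd b (Ph x) k" and ff=F, OF ob W _ xW that(1) smap_smooth[OF s b that(2)] FW])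
     (use F in \<open>auto simp: W_def\<close>)
  thus ?thesis by simp
 qed
 have "fpb n (%p q. v p q (F x)) F i j x =
   (SUM p<n. SUM q<n. (SUM k<mdim M. SUM l<mdim M. \<eta> b (Ph (F x)) k l * pd p (%x. snd b (Ph x) k) (F x) * pd q (%x. snd b (Ph x) l) (F x))
    * jc F i p x * jc F j q x)"
  by (intro sum.cong refl arg_cong2[where f="(*)"] pformD[OF f b F(1)[OF x] xb]) auto
 also have "... = (SUM k<mdim M. SUM l<mdim M. \<eta> b (Ph (F x)) k l * (SUM p<n. jc F i p x * pd p (%x. snd b (Ph x) k) (F x)) *
   (SUM q<n. jc F j q x * pd q (%x. snd b (Ph x) l) (F x)))"
  by (rule form_compose[where A="%k p. pd p (%x. snd b (Ph x) k) (F x)" and B="%p i. jc F i p x", symmetric])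
 finally show "fpb n (%k l. v k l (F x)) F i j x =
   (SUM k<mdim M. SUM l<mdim M. \<eta> b (Ph (F x)) k l * pd i (%x. snd b (Ph (F x)) k) x * pd j (%x. snd b (Ph (F x)) l) x)"
  by (simp add: pd ij)
qed

text \<open>Inverse function theorem for an injective map: invariance of domain gives the open image
  and the continuous inverse, and \<open>smooth_on_inverse_map\<close> its smoothness.\<close>

lemma smap_local_inverse:
 assumes M: "smooth_manifold M" and s: "smap n D M Ps" and n: "mdim M = n" and inj: "inj_on Ps D"
  and a: "a : mcoords M" and z: "z : D" "Ps z : fst a"
  and imm: "!!x v. x : D ==> Ps x : fst a ==> (!!j. j<n ==> (SUM i<n. pd i (%x. snd a (Ps x) j) x * v i) = 0) ==> ALL i<n. v i = 0"
 shows "EX W ps. oES n W & snd a (Ps z) : W & W <= vdom a & (ALL y:W. ps y : D & Ps (ps y) = civ a y) &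
   (ALL i<n. smooth_on n W (%y. ps y i)) & ps (snd a (Ps z)) = z"
proof -
 define E where "E = D Int Ps -` fst a"
 define f where "f x = snd a (Ps x)" for x
 have E: "oES n E" unfolding E_def by (rule smap_preimage[OF s co_open[OF M a]])
 have fs: "smooth_on n E (%x. f x j)" if "j<n" for j
  using smap_smooth[OF s a, of j] that n by (simp add: E_def f_def)
 have fi: "inj_on f E" using inj co_inj[OF M a] by (auto simp: inj_on_def E_def f_def)
 have fv: "f x : vdom a" if "x : E" for x using that by (simp add: E_def f_def)
 have ov: "oES n (vdom a)" using co_dom[OF M a] n by simp
 have fc: "continuous_map (sES n E) (ES n) f"
  using continuous_map_smooth_ES[OF E ov fv fs] by (rule continuous_map_into_fulltopology)
 have fo: "oES n (f ` S)" if "oES n S" "S <= E" for S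
  by (rule invariance_of_domain_Euclidean_space[OF that(1) continuous_map_from_subtopology_mono[OF fc that(2)] inj_on_subset[OF fi that(2)]])
 define W where "W = f ` E"
 define ps where "ps = inv_into E f"
 have W: "oES n W" unfolding W_def by (rule fo[OF E]) simp
 have ps: "ps y : E" "f (ps y) = y" if "y : W" for y
  using that by (auto simp: W_def ps_def inv_into_into f_inv_into_f)
 have pc: "continuous_on W ps"
 proof -
  have "continuous_map (sES n W) (ES n) ps" unfolding continuous_map_def
  proof (intro conjI allI impI)
   show "ps : topspace (sES n W) \<rightarrow> topspace (ES n)" using ps(1) openin_subset[OF E] by auto
   fix S assume S: "oES n S"
   have "{x : topspace (sES n W). ps x : S} = f ` (E Int S)"
    using openin_subset[OF W] ps by (auto simp: W_def ps_def inv_into_f_f[OF fi])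
   thus "openin (sES n W) {x : topspace (sES n W). ps x : S}"
    using fo[OF openin_Int[OF E S]] unfolding openin_open_subtopology[OF W] by (auto simp: W_def)
  qed
  hence "continuous_map (sES n W) (top_of_set {x. ALL i>=n. x i = 0}) ps"
   by (simp only: Euclidean_space_eq_top_of_set)
  thus ?thesis
   by (rule continuous_map_ES_iff[OF openin_ES_subset[OF W], THEN iffD1, OF continuous_map_into_fulltopology])
 qed
 have "EX K. (ALL i<n. ALL j<n. smooth_on n E (K i j)) &
  (ALL x:E. ALL i<n. ALL k<n. (SUM j<n. K i j x * jc f k j x) = dl i k &
   (SUM j<n. jc f j i x * K j k x) = dl i k)"
 proof (rule smooth_inverse_matrix_ex[OF E])
  show "smooth_on n E (pd j (%x. f x i))" if "i<n" "j<n" for i j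
   by (rule smooth_on_partial_deriv[OF fs]) (use that in simp_all)
  show "ALL j<n. v j = 0" if "x : E" "!!i. i<n ==> (SUM j<n. jc f j i x * v j) = 0" for x v
   by (rule imm[of x]) (use that in \<open>simp_all add: E_def f_def\<close>)
 qed
 then obtain K where K': "(ALL i<n. ALL j<n. smooth_on n E (K i j)) &
  (ALL x:E. ALL i<n. ALL k<n. (SUM j<n. K i j x * jc f k j x) = dl i k &
   (SUM j<n. jc f j i x * K j k x) = dl i k)" ..
 have K: "!!i j. i<n ==> j<n ==> smooth_on n E (K i j)"
  "!!x i k. x : E ==> i<n ==> k<n ==> (SUM j<n. K i j x * jc f k j x) = dl i k" using K' by simp_all
 have "smooth_on n W (%y. ps y i)" if "i<n" for i
  by (rule smooth_on_inverse_map[where ff=f, OF E W fs K ps pc that])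
 moreover have "ps (f z) = z" unfolding ps_def by (rule inv_into_f_f[OF fi]) (use z in \<open>simp add: E_def\<close>)
 moreover have "Ps (ps y) = civ a y" if "y : W" for y
  using ps[OF that] civ_co[OF M a, of "Ps (ps y)"] by (simp add: f_def E_def)
 ultimately show ?thesis using W ps z fv by (intro exI[of _ W] exI[of _ ps]) (auto simp: f_def W_def E_def)
qed

text \<open>The closed sets are removed one at a time: either the open set lies in the current one,
  or the rest of it is open, nonempty and covered by fewer. This handles maps that agree up to a
  group element varying from point to point.\<close>

lemma finite_baire:
 assumes "finite I" "!!i. i : I ==> closedin X (S i)" "openin X N" "N ~= {}" "N <= (UN i:I. S i)"
 shows "EX i:I. EX W. openin X W & W ~= {} & W <= N & W <= S i"
 using assms
proof (induction I arbitrary: N rule: finite_induct)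
 case (insert i I)
 show ?case
 proof (cases "N <= S i")
  case True
  thus ?thesis using insert.prems by blast
 next
  case False
  have "openin X (N - S i)" using insert.prems by (simp add: openin_diff)
  moreover have "N - S i ~= {}" "N - S i <= (UN i:I. S i)" using False insert.prems(4) by auto
  ultimately obtain j W where "j : I" "openin X W" "W ~= {}" "W <= N - S i" "W <= S j"
   using insert.IH[of "N - S i"] insert.prems(1) by (metis insertCI)
  thus ?thesis by blast
 qed
qed auto

lemma compactin_ES_box: "compactin (ES n) {y. (ALL i>=n. y i = 0) & (ALL i<n. \<bar>y i - v i\<bar> <= e)}"
proof -
 have "compactin (powertop_real UNIV) (Pi\<^sub>E UNIV (%i. if i<n then {v i - e..v i + e} else {0}))"
  by (subst compactin_PiE) auto
 moreover have "Pi\<^sub>E UNIV (%i. if i<n then {v i - e..v i + e} else {0}) = {y. (ALL i>=n. y i = 0) & (ALL i<n. \<bar>y i - v i\<bar> <= e)}"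
  (is "?A = ?B")
 proof (intro Set.set_eqI iffI)
  fix y assume "y : ?A"
  hence y: "y i : (if i<n then {v i - e..v i + e} else {0})" for i by (auto simp: PiE_iff)
  have "y i = 0" if "i >= n" for i using y[of i] that by simp
  moreover have "\<bar>y i - v i\<bar> <= e" if "i<n" for i using y[of i] that by auto
  ultimately show "y : ?B" by simp
 next
  fix y assume "y : ?B"
  thus "y : ?A" by (auto simp: PiE_iff abs_le_iff)
 qed
 ultimately show ?thesis by (simp add: Euclidean_space_def compactin_subtopology) blast
qed

lemma openin_ES_open_box: "oES n {y. (ALL i>=n. y i = 0) & (ALL i<n. \<bar>y i - v i\<bar><e)}"
proof -
 have "open (INT i:{..<n}. {y :: pt. \<bar>y i - v i\<bar><e})"
 proof (rule open_INT)
  show "ALL i:{..<n}. open {y :: pt. \<bar>y i - v i\<bar><e}"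
   by (intro ballI open_Collect_less continuous_intros continuous_on_product_coordinates)
 qed simp
 thus ?thesis unfolding Euclidean_space_eq_top_of_set
  by (auto simp: openin_open intro!: exI[of _ "INT i:{..<n}. {y :: pt. \<bar>y i - v i\<bar><e}"])
qed

section \<open>Finite group actions and orbifold charts\<close>

context
 fixes c :: "('m, 'g, 'z) gmanifold_scheme"
 assumes c: "finite_gmanifold c"
begin

lemma gm_manifold: "smooth_manifold (gspace c)"
 and gm_action: "group_action (ggroup c) (gpoints c) (gact c)"
 and gm_finite: "finite (gcar c)"
 and gm_group: "Group.group (ggroup c)"
 and gm_smooth: "g : gcar c ==> smooth_map (gspace c) (gspace c) (gact c g)"
 using c by (simp_all add: finite_gmanifold_def)

lemma gm_closed: "g : gcar c ==> p : gpoints c ==> gact c g p : gpoints c"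
 by (rule group_action.element_image[OF gm_action _ _ refl])

lemma gm_inv_closed: "g : gcar c ==> inv\<^bsub>ggroup c\<^esub> g : gcar c"
 by (rule group.inv_closed[OF gm_group])

lemma gm_inv: "g : gcar c ==> p : gpoints c ==> gact c (inv\<^bsub>ggroup c\<^esub> g) (gact c g p) = p"
 by (rule group_action.orbit_sym_aux[OF gm_action _ _ refl])

lemma gm_mult: "g : gcar c ==> h : gcar c ==> p : gpoints c ==>
  gact c (g \<otimes>\<^bsub>ggroup c\<^esub> h) p = gact c g (gact c h p)"
 by (rule group_action.composition_rule[OF gm_action])

lemma gm_mult_closed: "g : gcar c ==> h : gcar c ==> g \<otimes>\<^bsub>ggroup c\<^esub> h : gcar c"
 by (rule monoid.m_closed[OF group.is_monoid[OF gm_group]])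

lemma gm_one: "p : gpoints c ==> gact c \<one>\<^bsub>ggroup c\<^esub> p = p"
 using group_action.id_eq_one[OF gm_action] by (metis restrict_apply')

lemma gm_cont: "g : gcar c ==> continuous_map (gtop c) (gtop c) (gact c g)"
 using gm_smooth by (simp add: smooth_map_def)

lemma gm_orbit_refl: "p : gpoints c ==> p : gorbit c p"
 by (rule group_action.orbit_refl[OF gm_action])

lemma gm_orbit: "q : gorbit c p <-> (EX g:gcar c. q = gact c g p)"
 by (auto simp: orbit_def)

text \<open>The saturation of an open set is the union of its preimages under the group elements,
  hence open.\<close>

lemma gm_orbit_open:
 assumes N: "openin (gtop c) N"
 shows "openin (orbit_space c) (gorbit c ` N)"
proof -
 have Ns: "N <= gpoints c" using openin_subset[OF N] .
 have "{x : gpoints c. gorbit c x : gorbit c ` N} = (UN g:gcar c. {x : gpoints c. gact c g x : N})"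
 proof (intro Set.set_eqI iffI)
  fix x assume "x : {x : gpoints c. gorbit c x : gorbit c ` N}"
  then obtain u where x: "x : gpoints c" and u: "u : N" "gorbit c x = gorbit c u" by auto
  hence "u : gorbit c x" using gm_orbit_refl[of u] Ns by auto
  then obtain g where "g : gcar c" "u = gact c g x" by (auto simp only: gm_orbit)
  thus "x : (UN g:gcar c. {x : gpoints c. gact c g x : N})" using x u(1) by auto
 next
  fix x assume "x : (UN g:gcar c. {x : gpoints c. gact c g x : N})"
  then obtain g where g: "g : gcar c" "x : gpoints c" "gact c g x : N" by auto
  have "gorbit c x = gorbit c (gact c g x)"
  proof (intro Set.set_eqI iffI)
   fix y assume "y : gorbit c x"
   then obtain h where h: "h : gcar c" "y = gact c h x" by (auto simp: gm_orbit)
   have "gact c (h \<otimes>\<^bsub>ggroup c\<^esub> inv\<^bsub>ggroup c\<^esub> g) (gact c g x) = y"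
    using h g by (simp add: gm_mult gm_inv gm_inv_closed gm_closed)
   thus "y : gorbit c (gact c g x)" unfolding gm_orbit
    by (intro bexI[of _ "h \<otimes>\<^bsub>ggroup c\<^esub> inv\<^bsub>ggroup c\<^esub> g"]) (simp_all add: gm_mult_closed gm_inv_closed h g)
  next
   fix y assume "y : gorbit c (gact c g x)"
   then obtain h where h: "h : gcar c" "y = gact c h (gact c g x)" by (auto simp: gm_orbit)
   thus "y : gorbit c x" unfolding gm_orbit
    by (intro bexI[of _ "h \<otimes>\<^bsub>ggroup c\<^esub> g"]) (simp_all add: gm_mult_closed gm_mult h g)
  qed
  thus "x : {x : gpoints c. gorbit c x : gorbit c ` N}" using g by auto
 qed
 moreover have "openin (gtop c) (UN g:gcar c. {x : gpoints c. gact c g x : N})"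
  by (intro openin_Union ballI) (auto intro!: openin_continuous_map_preimage[OF gm_cont N])
 ultimately show ?thesis using Ns by (auto simp: orbit_space_def openin_quotient_topology)
qed

end

lemma chart_orbit_image:
 assumes c: "orbifold_chart X c" and p: "p : gpoints c"
 shows "the_elem (pj c ` gorbit c p) = pj c p"
proof -
 have cf: "finite_gmanifold c" using c by (simp add: orbifold_chart_def)
 have "pj c q = pj c p" if "q : gorbit c p" for q
  using that c p by (auto simp: gm_orbit[OF cf] orbifold_chart_def)
 hence "pj c ` gorbit c p = {pj c p}" using imageI[OF gm_orbit_refl[OF cf p], of "pj c"] by blast
 thus ?thesis by simp
qed

text \<open>The induced map is injective on the orbit space, so points over the same point of
  \<open>X\<close> have equal orbits.\<close>

lemma chart_fibre:
 assumes c: "orbifold_chart X c" and p: "p : gpoints c" "p' : gpoints c" "pj c p = pj c p'"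
 shows "EX g:gcar c. gact c g p = p'"
proof -
 have cf: "finite_gmanifold c" using c by (simp add: orbifold_chart_def)
 note o = chart_orbit_image[OF c]
 have "inj_on (%O'. the_elem (pj c ` O')) (gorbit c ` gpoints c)"
  using c homeomorphic_imp_injective_map by (fastforce simp: orbifold_chart_def orbit_space_def topspace_quotient_topology)
 hence "gorbit c p = gorbit c p'" by (rule inj_onD) (use p o in auto)
 hence "p' : gorbit c p" using gm_orbit_refl[OF cf p(2)] by simp
 thus ?thesis by (auto simp: gm_orbit[OF cf])
qed

lemma chart_manifold: "orbifold_chart X c ==> smooth_manifold (gspace c)" and chart_gm: "orbifold_chart X c ==> finite_gmanifold c"
 and chart_inv: "orbifold_chart X c ==> g : gcar c ==> p : gpoints c ==> pj c (gact c g p) = pj c p"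
 and chart_open: "orbifold_chart X c ==> openin X (oimage c)" and chart_cont: "orbifold_chart X c ==> continuous_map (gtop c) X (pj c)"
 by (auto simp: orbifold_chart_def finite_gmanifold_def)

lemma chart_quotient_map:
 assumes "orbifold_chart X c"
 shows "quotient_map (gtop c) (subtopology X (oimage c)) (pj c)"
proof -
 have cf: "finite_gmanifold c" using assms by (simp add: orbifold_chart_def)
 have "quotient_map (gtop c) (subtopology X (oimage c)) ((%O'. the_elem (pj c ` O')) o gorbit c)"
 proof (rule quotient_map_compose)
  show "quotient_map (gtop c) (orbit_space c) (gorbit c)"
   unfolding orbit_space_def by (rule quotient_map_quotient_topology)
  show "quotient_map (orbit_space c) (subtopology X (oimage c)) (%O'. the_elem (pj c ` O'))"
   using assms by (simp add: orbifold_chart_def homeomorphic_map_def)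
 qed
 moreover have "((%O'. the_elem (pj c ` O')) o gorbit c) p = pj c p" if "p : gpoints c" for p
  using chart_orbit_image[OF assms that] by simp
 ultimately show ?thesis by (rule quotient_map_eq)
qed

lemma co_preimage_open:
 assumes M: "smooth_manifold M" and a: "a : mcoords M" and B: "oES (mdim M) B"
 shows "openin (mtop M) (fst a Int snd a -` B)"
proof -
 have "openin (subtopology (mtop M) (fst a)) {p : topspace (subtopology (mtop M) (fst a)). snd a p : B}"
  by (rule openin_continuous_map_preimage[OF continuous_map_into_fulltopology[OF co_cont[OF M a]] B])
 moreover have "{p : topspace (subtopology (mtop M) (fst a)). snd a p : B} = fst a Int snd a -` B"
  using openin_subset[OF co_open[OF M a]] by auto
 ultimately show ?thesis using openin_open_subtopology[OF co_open[OF M a]] by simp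
qed

text \<open>Equality of dimensions is not part of the notion of embedding. One inequality is
  invariance of domain in coordinates. For the other, openness on orbit spaces provides an open set
  covered by finitely many translates of a compact image, and \<open>finite_baire\<close> an open
  set of the target on which a translate of the embedding can be inverted continuously.\<close>

lemma gembedding_dim:
 fixes d :: "('n, 'h, 'y) gmanifold_scheme" and c :: "('m, 'g, 'z) gmanifold_scheme"
 assumes d: "finite_gmanifold d" and c: "finite_gmanifold c" and F: "gembedding d c F" and y: "y : gpoints d"
 shows "cdim d = cdim c"
proof (rule antisym)
 define ff where "ff = fst F"
 note md = gm_manifold[OF d] and mc = gm_manifold[OF c]
 have emb: "embedding_map (gtop d) (gtop c) ff" and sm: "smooth_map (gspace d) (gspace c) ff"
  using F by (simp_all add: gembedding_def smooth_embedding_def immersion_def ff_def)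
 have inj: "inj_on ff (gpoints d)"
  using emb homeomorphic_imp_injective_map by (fastforce simp: embedding_map_def)
 have into: "ff p : gpoints c" if "p : gpoints d" for p
  using sm that by (auto simp: smooth_map_def continuous_map_def)
 obtain a where a: "a : mcoords (gspace d)" "y : fst a" using co_ex[OF md y] by auto
 obtain b where b: "b : mcoords (gspace c)" "ff y : fst b" using co_ex[OF mc into[OF y]] by auto
 let ?n = "cdim d" and ?m = "cdim c"
 have sa: "smap ?n (vdom a) (gspace d) (civ a)" by (rule smap_civ[OF md a(1)])
 show "?n <= ?m"
 proof (rule Euclidean_space_inj_dim)
  let ?W = "vdom a Int (%v. ff (civ a v)) -` fst b"
  show W: "oES ?n ?W" by (rule smap_preimage[OF smap_map[OF md mc sa sm] co_open[OF mc b(1)]])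
  show "?W ~= {}" using a(2) b(2) civ_co[OF md a] by auto
  show "continuous_map (sES ?n ?W) (ES ?m) (%v. snd b (ff (civ a v)))"
   by (rule continuous_map_into_fulltopology[OF continuous_map_smooth_ES[OF W co_dom[OF mc b(1)]]])
     (auto intro: smap_smooth[OF smap_map[OF md mc sa sm] b(1)])
  show "inj_on (%v. snd b (ff (civ a v))) ?W"
  proof (rule inj_onI)
   fix v v' assume v: "v : ?W" "v' : ?W" and e: "snd b (ff (civ a v)) = snd b (ff (civ a v'))"
   have "ff (civ a v) = ff (civ a v')" using inj_onD[OF co_inj[OF mc b(1)] e] v by auto
   moreover have "civ a v : gpoints d" "civ a v' : gpoints d" using smap_into[OF sa] v by auto
   ultimately have "civ a v = civ a v'" using inj_onD[OF inj] by blast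
   thus "v = v'" using co_civ[OF md] v by (metis IntD1)
  qed
 qed
 show "?m <= ?n"
 proof -
  have "snd a y : vdom a" using a(2) by simp
  from openin_ES_box[OF co_dom[OF md a(1)] this] obtain e where e: "e > 0"
   "!!u. (!!i. i >= ?n ==> u i = 0) ==> (!!i. i<?n ==> \<bar>u i - snd a y i\<bar> <= e) ==> u : vdom a" by metis
  \<comment> \<open>The closed box is compact, so its images stay closed in a Hausdorff space; the
    open box below provides an open set \<open>N\<close> of points.\<close>
  define B where "B = {u. (ALL i>=?n. u i = 0) & (ALL i<?n. \<bar>u i - snd a y i\<bar> <= e)}"
  define B' where "B' = {u. (ALL i>=?n. u i = 0) & (ALL i<?n. \<bar>u i - snd a y i\<bar><e)}"
  have BV: "B <= vdom a" using e(2) by (auto simp: B_def)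
  have B'B: "B' <= B" by (auto simp: B_def B'_def less_imp_le)
  have yB: "snd a y : B'" using openin_ES_subset[OF co_dom[OF md a(1)]] a(2) e(1) by (auto simp: B'_def)
  have ca: "continuous_map (sES ?n (vdom a)) (gtop d) (civ a)" by (rule smap_cont[OF sa])
  have K: "compactin (gtop d) (civ a ` B)"
   by (rule image_compactin[OF _ ca]) (use compactin_ES_box[of ?n "snd a y" e] BV in \<open>simp add: compactin_subtopology B_def\<close>)
  define N where "N = fst a Int snd a -` B'"
  have N: "openin (gtop d) N"
   unfolding N_def by (rule co_preimage_open[OF md a(1)]) (simp add: B'_def openin_ES_open_box)
  have NK: "N <= civ a ` B"
  proof
   fix p assume "p : N"
   hence "p : fst a" "snd a p : B" using B'B by (auto simp: N_def)
   thus "p : civ a ` B" using civ_co[OF md a(1)] by (metis imageI)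
  qed
  have yN: "y : N" using a(2) yB by (simp add: N_def)
  let ?I = "induced_map c ff"
  have Iemb: "embedding_map (orbit_space d) (orbit_space c) ?I"
   and Iop: "openin (orbit_space c) (?I ` topspace (orbit_space d))"
   using F by (simp_all add: gembedding_def ff_def)
  have oN: "openin (orbit_space d) (gorbit d ` N)" by (rule gm_orbit_open[OF d N])
  have "openin (subtopology (orbit_space c) (?I ` topspace (orbit_space d))) (?I ` (gorbit d ` N))"
   using homeomorphic_imp_open_map[OF Iemb[unfolded embedding_map_def]] oN by (simp add: open_map_def)
  hence "openin (orbit_space c) (?I ` (gorbit d ` N))" using openin_open_subtopology[OF Iop] by blast
  hence oZ: "openin (gtop c) {z : gpoints c. gorbit c z : ?I ` (gorbit d ` N)}" (is "openin _ ?Z")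
   by (simp add: orbit_space_def openin_quotient_topology)
  have Z: "EX g:gcar c. EX p:N. z = gact c g (ff p)" if "z : ?Z" for z
  proof -
   from that obtain p where z: "z : gpoints c" and p: "p : N" "gorbit c z = ?I (gorbit d p)" by auto
   have pd: "p : gpoints d" using p(1) openin_subset[OF N] by auto
   have "ff p : ?I (gorbit d p)"
    using gm_orbit_refl[OF d pd] gm_orbit_refl[OF c into[OF pd]] by (auto simp: induced_map_def)
   hence "ff p : gorbit c z" using p(2) by simp
   then obtain g where g: "g : gcar c" "ff p = gact c g z" by (auto simp: gm_orbit[OF c])
   hence "z = gact c (inv\<^bsub>ggroup c\<^esub> g) (ff p)" using gm_inv[OF c g(1) z] by simp
   thus ?thesis using p(1) gm_inv_closed[OF c g(1)] by blast
  qed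
  have Zne: "?Z ~= {}"
  proof -
   have "?I (gorbit d y) = gorbit c (ff y)"
   proof -
    have e: "ff (gact d h y) = gact c (snd F h) (ff y) & snd F h : gcar c" if "h : gcar d" for h
     using F that y by (auto simp: gembedding_def gmorphism_def ff_def hom_def)
    hence 1: "?I (gorbit d y) <= gorbit c (ff y)"
    proof (intro subsetI)
     fix z assume "z : ?I (gorbit d y)"
     then obtain h k where h: "h : gcar d" and k: "k : gcar c" "z = gact c k (ff (gact d h y))"
      by (auto simp: induced_map_def gm_orbit[OF d] gm_orbit[OF c])
     hence "z = gact c (k \<otimes>\<^bsub>ggroup c\<^esub> snd F h) (ff y)" "k \<otimes>\<^bsub>ggroup c\<^esub> snd F h : gcar c"
      using e[OF h] by (simp_all add: gm_mult[OF c] gm_mult_closed[OF c] into[OF y])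
     thus "z : gorbit c (ff y)" unfolding gm_orbit[OF c] by (rule bexI)
    qed
    thus ?thesis using gm_orbit_refl[OF d y] by (auto simp: induced_map_def)
   qed
   hence "ff y : ?Z" using into[OF y] yN by (metis (mono_tags, lifting) imageI mem_Collect_eq)
   thus ?thesis by blast
  qed
  have cg: "continuous_map (gtop d) (gtop c) (%p. gact c g (ff p))" if "g : gcar c" for g
   using continuous_map_compose[of "gtop d" "gtop c" ff "gtop c" "gact c g"] sm gm_cont[OF c that] by (simp add: smooth_map_def o_def)
  \<comment> \<open>The set of points whose orbits come from \<open>N\<close> is open, nonempty and
    covered by the translates, so one translate of the compact image contains an open set.\<close>
  have "EX g:gcar c. EX W. openin (gtop c) W & W ~= {} & W <= ?Z & W <= (%p. gact c g (ff p)) ` (civ a ` B)"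
  proof (rule finite_baire[OF gm_finite[OF c] _ oZ Zne])
   fix g assume "g : gcar c"
   thus "closedin (gtop c) ((%p. gact c g (ff p)) ` (civ a ` B))"
    using image_compactin[OF K cg] mc by (auto simp: smooth_manifold_def intro: compactin_imp_closedin)
  next
   show "?Z <= (UN g:gcar c. (%p. gact c g (ff p)) ` (civ a ` B))"
    using Z NK by fastforce
  qed
  then obtain g W where g: "g : gcar c" and W: "openin (gtop c) W" "W ~= {}" "W <= (%p. gact c g (ff p)) ` (civ a ` B)"
   by blast
  obtain w where w: "w : W" using W(2) by blast
  hence "w : gpoints c" using openin_subset[OF W(1)] by auto
  from co_ex[OF mc this] obtain b' where b': "b' : mcoords (gspace c)" "w : fst b'" by auto
  let ?U = "vdom b' Int civ b' -` W"
  have sb: "smap ?m (vdom b') (gspace c) (civ b')" by (rule smap_civ[OF mc b'(1)])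
  let ?gi = "inv\<^bsub>ggroup c\<^esub> g"
  have gi: "?gi : gcar c" by (rule gm_inv_closed[OF c g])
  obtain pz where pz: "homeomorphic_maps (gtop d) (subtopology (gtop c) (ff ` gpoints d)) ff pz"
   using emb unfolding embedding_map_def homeomorphic_map_maps by blast
  have pzff: "pz (ff p) = p" if "p : gpoints d" for p using pz that by (simp add: homeomorphic_maps_def)
  have pzc: "continuous_map (subtopology (gtop c) (ff ` gpoints d)) (gtop d) pz" using pz by (simp add: homeomorphic_maps_def)
  have Kd: "civ a ` B <= fst a"
  proof (intro image_subsetI)
   fix u assume "u : B"
   thus "civ a u : fst a" by (rule civ_in[OF md subsetD[OF BV]])
  qed
  have ad: "fst a <= gpoints d" by (rule openin_subset[OF co_open[OF md a(1)]])
  have U: "oES ?m ?U" by (rule smap_preimage[OF sb W(1)])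
  have UW: "EX u:B. civ b' v = gact c g (ff (civ a u)) & gact c ?gi (civ b' v) = ff (civ a u)" if "v : ?U" for v
  proof -
   from that W(3) obtain u where u: "u : B" "civ b' v = gact c g (ff (civ a u))" by blast
   have "civ a u : gpoints d" using u(1) Kd ad by blast
   hence "gact c ?gi (civ b' v) = ff (civ a u)" unfolding u(2) by (rule gm_inv[OF c g into])
   thus ?thesis using u by blast
  qed
  have pzin: "pz (gact c ?gi (civ b' v)) : fst a" if "v : ?U" for v
   using UW[OF that] pzff Kd ad by fastforce
  show ?thesis
  proof (rule Euclidean_space_inj_dim[OF U])
   show "?U ~= {}" using w b' civ_co[OF mc b'] by auto
   have c1: "continuous_map (sES ?m ?U) (gtop c) (%v. gact c ?gi (civ b' v))"
    using continuous_map_compose[OF continuous_map_from_subtopology_mono[OF smap_cont[OF sb]] gm_cont[OF c gi], of ?U] by (simp add: o_def)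
   have "continuous_map (sES ?m ?U) (subtopology (gtop c) (ff ` gpoints d)) (%v. gact c ?gi (civ b' v))"
    unfolding continuous_map_in_subtopology using c1 UW Kd ad by fastforce
   from continuous_map_compose[OF this pzc]
   have "continuous_map (sES ?m ?U) (gtop d) (%v. pz (gact c ?gi (civ b' v)))" by (simp add: o_def)
   hence "continuous_map (sES ?m ?U) (subtopology (gtop d) (fst a)) (%v. pz (gact c ?gi (civ b' v)))"
    unfolding continuous_map_in_subtopology using pzin by auto
   from continuous_map_compose[OF this continuous_map_into_fulltopology[OF co_cont[OF md a(1)]]]
   show "continuous_map (sES ?m ?U) (ES ?n) (%v. snd a (pz (gact c ?gi (civ b' v))))" by (simp add: o_def)
   show "inj_on (%v. snd a (pz (gact c ?gi (civ b' v)))) ?U"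
   proof (rule inj_onI)
    fix v v' assume v: "v : ?U" "v' : ?U" and e: "snd a (pz (gact c ?gi (civ b' v))) = snd a (pz (gact c ?gi (civ b' v')))"
    obtain u where u: "u : B" "civ b' v = gact c g (ff (civ a u))" "gact c ?gi (civ b' v) = ff (civ a u)" using UW[OF v(1)] by blast
    obtain u' where u': "u' : B" "civ b' v' = gact c g (ff (civ a u'))" "gact c ?gi (civ b' v') = ff (civ a u')" using UW[OF v(2)] by blast
    have "civ a u : gpoints d" "civ a u' : gpoints d" using u u' Kd ad by blast+
    hence "snd a (civ a u) = snd a (civ a u')" using e u u' pzff by simp
    hence "u = u'" using co_civ[OF md] BV u(1) u'(1) by (metis subsetD)
    hence "civ b' v = civ b' v'" using u u' by simp
    thus "v = v'" using co_civ[OF mc] v by (metis IntD1)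
   qed
  qed
 qed
qed

text \<open>A map from part of a coordinate domain of \<open>c\<close> to \<open>c'\<close> over the
  identity of \<open>X\<close> that respects the forms. The Euclidean source lets lifts be
  restricted and composed freely.\<close>

definition lift where
 "lift c a \<eta> c' \<eta>' D Ph <-> D <= vdom a & cdim c = mdim (gspace c') &
   smap (cdim c) D (gspace c') Ph & (ALL z:D. pj c' (Ph z) = pj c (civ a z)) &
   pform (cdim c) D (gspace c') \<eta>' Ph (form_rep \<eta> a)"

text \<open>The map passes through the common chart \<open>d\<close>: a group element of
  \<open>c\<close> moves the point into the image of the first embedding, which is inverted locally;
  the second embedding follows, and a group element of \<open>c'\<close> moves the result to
  \<open>p'\<close>.\<close>

lemma lift_exists:
 fixes c c' d :: "('m, 'g, 'x) ochart"
 assumes ch: "orbifold_chart X c" "orbifold_chart X c'" "orbifold_chart X d"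
  and F: "gembedding d c F" "over_space d c F" and F': "gembedding d c' F'" "over_space d c' F'"
  and a: "a : mcoords (gspace c)" "v : vdom a" and p': "p' : gpoints c'" "pj c' p' = pj c (civ a v)"
  and xd: "pj c (civ a v) : oimage d"
  and \<eta>: "pullback_eq (gspace d) (gspace c) (fst F) \<eta> \<theta>" "pullback_eq (gspace d) (gspace c') (fst F') \<eta>' \<theta>"
   "pullback_eq (gspace c) (gspace c) id \<eta> \<eta>" "pullback_eq (gspace d) (gspace d) id \<theta> \<theta>"
   "!!g. g : gcar c ==> pullback_eq (gspace c) (gspace c) (gact c g) \<eta> \<eta>"
   "!!g. g : carrier (ggroup c') ==> pullback_eq (gspace c') (gspace c') (gact c' g) \<eta>' \<eta>'"
 shows "EX D Ph. lift c a \<eta> c' \<eta>' D Ph & v : D & Ph v = p'"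
proof -
 define ff where "ff = fst F"
 define ff' where "ff' = fst F'"
 note m = chart_manifold[OF ch(1)] and m' = chart_manifold[OF ch(2)] and md = chart_manifold[OF ch(3)]
 note gc = chart_gm[OF ch(1)] and gc' = chart_gm[OF ch(2)] and gd = chart_gm[OF ch(3)]
 have s: "smooth_map (gspace d) (gspace c) ff" "smooth_map (gspace d) (gspace c') ff'"
  and imm: "immersion (gspace d) (gspace c) ff" and emb: "embedding_map (gtop d) (gtop c) ff"
  using F(1) F'(1) by (simp_all add: gembedding_def smooth_embedding_def immersion_def ff_def ff'_def)
 have ov: "pj c (ff y) = pj d y" "pj c' (ff' y) = pj d y" if "y : gpoints d" for y
  using F(2) F'(2) that by (simp_all add: over_space_def ff_def ff'_def)
 have into: "ff y : gpoints c" "ff' y : gpoints c'" if "y : gpoints d" for y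
  using s that by (auto simp: smooth_map_def continuous_map_def)
 obtain y where y: "y : gpoints d" "pj d y = pj c (civ a v)" using xd by (auto simp: oimage_def)
 let ?n = "cdim d"
 have n: "cdim c = ?n" "mdim (gspace c') = ?n"
  using gembedding_dim[OF gd gc F(1) y(1)] gembedding_dim[OF gd gc' F'(1) y(1)] by simp_all
 have sa: "smap ?n (vdom a) (gspace c) (civ a)" using smap_civ[OF m a(1)] n by simp
 have pc: "civ a v : gpoints c" by (rule smap_into[OF sa a(2)])
 obtain g where g: "g : gcar c" "gact c g (civ a v) = ff y"
  using chart_fibre[OF ch(1) pc into(1)[OF y(1)]] ov(1)[OF y(1)] y(2) by auto
 obtain g' where g': "g' : carrier (ggroup c')" "gact c' g' (ff' y) = p'"
  using chart_fibre[OF ch(2) into(2)[OF y(1)] p'(1)] ov(2)[OF y(1)] y(2) p'(2) by auto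
 obtain a0 where a0: "a0 : mcoords (gspace d)" "y : fst a0" using co_ex[OF md y(1)] by auto
 obtain b where b: "b : mcoords (gspace c)" "ff y : fst b" using co_ex[OF m into(1)[OF y(1)]] by auto
 have s0: "smap ?n (vdom a0) (gspace d) (civ a0)" by (rule smap_civ[OF md a0(1)])
 define Ps where "Ps u = ff (civ a0 u)" for u
 have sPs: "smap ?n (vdom a0) (gspace c) Ps" unfolding Ps_def by (rule smap_map[OF md m s0 s(1)])
 have Psy: "Ps (snd a0 y) = ff y" by (simp add: Ps_def civ_co[OF md a0])
 have "EX W ps. oES ?n W & snd b (Ps (snd a0 y)) : W & W <= vdom b &
   (ALL u:W. ps u : vdom a0 & Ps (ps u) = civ b u) & (ALL i<?n. smooth_on ?n W (%u. ps u i)) & ps (snd b (Ps (snd a0 y))) = snd a0 y"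
 proof (rule smap_local_inverse[OF m sPs n(1) _ b(1)])
  show "inj_on Ps (vdom a0)"
  proof (rule inj_onI)
   fix u u' assume u: "u : vdom a0" "u' : vdom a0" "Ps u = Ps u'"
   have "inj_on ff (gpoints d)" using homeomorphic_imp_injective_map[OF emb[unfolded embedding_map_def]] .
   from inj_onD[OF this u(3)[unfolded Ps_def] smap_into[OF s0 u(1)] smap_into[OF s0 u(2)]]
   have "snd a0 (civ a0 u) = snd a0 (civ a0 u')" by simp
   thus "u = u'" unfolding co_civ[OF md u(1)] co_civ[OF md u(2)] .
  qed
  show "ALL i<?n. w i = 0" if h: "x : vdom a0" "Ps x : fst b" "!!j. j<?n ==> (SUM i<?n. pd i (%x. snd b (Ps x) j) x * w i) = 0" for x w
  proof -
   have "ALL j<cdim c. (SUM i<?n. Defs.jacobian a0 ff b (civ a0 x) j i * w i) = 0"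
    using h(3) n(1) by (simp add: Defs.jacobian_def coord_rep_def co_civ[OF md h(1)] Ps_def)
   moreover have "civ a0 x : fst a0 Int ff -` fst b" using h(2) civ_in[OF md h(1)] by (simp add: Ps_def)
   ultimately show ?thesis using imm a0(1) b(1) unfolding immersion_def by blast
  qed
 qed (use a0 b Psy in auto)
 then obtain W ps where W: "oES ?n W" "snd b (ff y) : W" "W <= vdom b"
  "ALL u:W. ps u : vdom a0 & Ps (ps u) = civ b u" "ALL i<?n. smooth_on ?n W (%u. ps u i)"
  "ps (snd b (ff y)) = snd a0 y" unfolding Psy by (elim exE conjE) (rule that)
 \<comment> \<open>Translation by \<open>g\<close> takes the point \<open>civ a v\<close> to the
   point \<open>ff y\<close> of the image of \<open>d\<close>.\<close>
 define \<Gamma> where "\<Gamma> z = gact c g (civ a z)" for z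
 have s\<Gamma>: "smap ?n (vdom a) (gspace c) \<Gamma>" unfolding \<Gamma>_def by (rule smap_map[OF m m sa gm_smooth[OF gc g(1)]])
 define E where "E = vdom a Int \<Gamma> -` fst b"
 define D where "D = E Int (%z. snd b (\<Gamma> z)) -` W"
 have E: "oES ?n E" unfolding E_def by (rule smap_preimage[OF s\<Gamma> co_open[OF m b(1)]])
 have sE: "smooth_on ?n E (%z. snd b (\<Gamma> z) j)" if "j<?n" for j
  using smap_smooth[OF s\<Gamma> b(1)] that n by (simp add: E_def)
 have "continuous_map (sES ?n E) (sES (cdim c) (vdom b)) (%z. snd b (\<Gamma> z))"
  by (rule continuous_map_smooth_ES[OF E co_dom[OF m b(1)]]) (use sE n in \<open>auto simp: E_def\<close>)
 from cont_ES_preimage[OF E continuous_map_into_fulltopology[OF this]] have D: "oES ?n D"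
  using W(1) n(1) by (simp add: D_def)
 \<comment> \<open>The translated domain, read in the coordinates \<open>a0\<close> of
   \<open>d\<close> by the local inverse of the embedding.\<close>
 define H where "H z = ps (snd b (\<Gamma> z))" for z
 have DW: "snd b (\<Gamma> z) : W" "z : vdom a" "\<Gamma> z : fst b" if "z : D" for z using that by (auto simp: D_def E_def)
 have H: "H z : vdom a0" "Ps (H z) = \<Gamma> z" if "z : D" for z
  using W(4)[rule_format, OF DW(1)[OF that]] civ_co[OF m b(1) DW(3)[OF that]] by (simp_all add: H_def)
 have sD: "smooth_on ?n D (%z. snd b (\<Gamma> z) j)" if "j<?n" for j
  by (rule smooth_on_subset[OF E D _ sE[OF that]]) (simp add: D_def)
 have Hs: "smooth_on ?n D (%z. H z i)" if "i<?n" for i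
  unfolding H_def by (rule smooth_on_compose[where f="%u. ps u i" and ff="%z. snd b (\<Gamma> z)", OF W(1) D DW(1) W(5)[rule_format, OF that] sD])
 have vD: "v : D" using a(2) b(2) W(2) by (simp add: D_def E_def \<Gamma>_def g(2))
 have Hv: "H v = snd a0 y" by (simp add: H_def \<Gamma>_def g(2) W(6))
 define Ps' where "Ps' u = gact c' g' (ff' (civ a0 u))" for u
 have s': "smap ?n (vdom a0) (gspace c') (%u. ff' (civ a0 u))" by (rule smap_map[OF md m' s0 s(2)])
 have sPs': "smap ?n (vdom a0) (gspace c') Ps'" unfolding Ps'_def
  by (rule smap_map[OF m' m' s' gm_smooth[OF gc' g'(1)]])
 have p0: "pform ?n (vdom a0) (gspace d) \<theta> (civ a0) (form_rep \<theta> a0)" by (rule pform_civ[OF md a0(1) \<eta>(4)])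
 have p1: "pform ?n (vdom a0) (gspace c) \<eta> Ps (form_rep \<theta> a0)" unfolding Ps_def
  by (rule pform_map[OF md m s0 s(1) p0]) (use \<eta>(1) in \<open>simp add: ff_def\<close>)
 have p2: "pform ?n (vdom a0) (gspace c') \<eta>' Ps' (form_rep \<theta> a0)" unfolding Ps'_def
  by (rule pform_map[OF m' m' s' gm_smooth[OF gc' g'(1)] pform_map[OF md m' s0 s(2) p0] \<eta>(6)[OF g'(1)]]) (use \<eta>(2) in \<open>simp add: ff'_def\<close>)
 have p3: "pform ?n (vdom a) (gspace c) \<eta> \<Gamma> (form_rep \<eta> a)" unfolding \<Gamma>_def
  by (rule pform_map[OF m m sa gm_smooth[OF gc g(1)] _ \<eta>(5)[OF g(1)]]) (use pform_civ[OF m a(1) \<eta>(3)] n in simp)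
 have q1: "pform ?n D (gspace c) \<eta> (%z. Ps (H z)) (%i j x. SUM k<?n. SUM l<?n. form_rep \<theta> a0 k l (H x) * jc H i k x * jc H j l x)"
  by (rule pform_pre[OF m sPs D H(1) Hs p1])
 \<comment> \<open>Both sides are components of the pull-back of \<open>\<eta>\<close> along the
   same map: directly along \<open>\<Gamma>\<close>, and along its factorization through
   \<open>d\<close>.\<close>
 have e: "form_rep \<eta> a i j x = fpb ?n (%k l. form_rep \<theta> a0 k l (H x)) H i j x"
  if "x : D" "i<?n" "j<?n" for x i j
  by (rule pform_unique[OF m s\<Gamma> p3 q1 that(1) D _ that(2,3)]) (simp add: H DW)
 have "pform ?n D (gspace c') \<eta>' (%z. Ps' (H z)) (form_rep \<eta> a)"
  using pform_pre[OF m' sPs' D H(1) Hs p2] unfolding pform_def by (simp add: e)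
 moreover have "pj c' (Ps' (H z)) = pj c (civ a z)" if z: "z : D" for z
 proof -
  have u: "civ a0 (H z) : gpoints d" by (rule smap_into[OF s0 H(1)[OF z]])
  have "pj c' (Ps' (H z)) = pj d (civ a0 (H z))"
   unfolding Ps'_def chart_inv[OF ch(2) g'(1) into(2)[OF u]] by (rule ov(2)[OF u])
  also have "... = pj c (\<Gamma> z)" using ov(1)[OF u] H(2)[OF z] by (simp add: Ps_def)
  also have "... = pj c (civ a z)" unfolding \<Gamma>_def
   by (rule chart_inv[OF ch(1) g(1) smap_into[OF sa DW(2)[OF z]]])
  finally show ?thesis .
 qed
 moreover have "smap ?n D (gspace c') (%z. Ps' (H z))" by (rule smap_pre[OF m' sPs' D H(1) Hs])
 moreover have "Ps' (H v) = p'" by (simp add: Hv Ps'_def civ_co[OF md a0] g'(2))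
 ultimately have "lift c a \<eta> c' \<eta>' D (%z. Ps' (H z)) & v : D & Ps' (H v) = p'"
  using n vD DW(2) by (auto simp: lift_def)
 thus ?thesis by (intro exI)
qed

text \<open>The union of the two finite families is again finite, and a component of its
  intersection is connected, hence contained in each of the given components that it meets.\<close>

lemma cover_objects_Int:
 assumes U: "U : cover_objects X \<U>" and U': "U' : cover_objects X \<U>" and x: "x : U" "x : U'"
 shows "EX W:cover_objects X \<U>. x : W & W <= U & W <= U'"
proof -
 from U obtain F where F: "finite F" "F ~= {}" "F <= \<U>" "U : connected_components_of (subtopology X (\<Inter>F))"
  by (auto simp: cover_objects_def)
 from U' obtain F' where F': "finite F'" "F' ~= {}" "F' <= \<U>" "U' : connected_components_of (subtopology X (\<Inter>F'))"
  by (auto simp: cover_objects_def)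
 have "x : topspace (subtopology X (\<Inter>F))" "x : topspace (subtopology X (\<Inter>F'))"
  using connected_components_of_subset[OF F(4)] connected_components_of_subset[OF F'(4)] x by auto
 hence "x : topspace (subtopology X (\<Inter>(F Un F')))" by auto
 hence "x : \<Union>(connected_components_of (subtopology X (\<Inter>(F Un F'))))" by (simp add: Union_connected_components_of)
 then obtain W where W: "W : connected_components_of (subtopology X (\<Inter>(F Un F')))" "x : W" by auto
 have c: "connectedin X W" "W <= \<Inter>(F Un F')"
  using connectedin_connected_components_of[OF W(1)] by (auto simp: connectedin_subtopology)
 have "W <= U" by (rule connected_components_of_maximal[OF F(4)]) (use c W(2) x in \<open>auto simp: connectedin_subtopology disjnt_def\<close>)
 moreover have "W <= U'" by (rule connected_components_of_maximal[OF F'(4)]) (use c W(2) x in \<open>auto simp: connectedin_subtopology disjnt_def\<close>)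
 moreover have "W : cover_objects X \<U>" unfolding cover_objects_def
  by (rule CollectI, rule exI[of _ "F Un F'"]) (use W(1) F F' in auto)
 ultimately show ?thesis using W(2) by blast
qed

section \<open>Patches of a symplectic orbifold and the maps between them\<close>

locale symplectic_orbifold =
 fixes X :: "'x topology" and A :: "('m, 'g, 'x) ochart set" and \<U> :: "'x set set"
  and Ob :: "'x set => ('m, 'g, 'x) ochart" and Mor :: "'x set => 'x set => ('m => 'm) \<times> ('g => 'g)"
  and \<omega> :: "'x set => 'm two_form"
 assumes orb: "orbifold X A" and covering: "open_covering X \<U>" and func: "orbispace_functor X A \<U> Ob Mor"
  and sform: "orbifold_symplectic_form X \<U> Ob Mor \<omega>"
begin

abbreviation "CO \<equiv> cover_objects X \<U>"
abbreviation "pr U \<equiv> pj (Ob U)"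
abbreviation "mf U \<equiv> gspace (Ob U)"

text \<open>A patch is an object of the cover together with a coordinate system of its chart; all
  local statements on \<open>X\<close> are made on patches.\<close>

definition "pat e <-> fst e : CO & snd e : mcoords (mf (fst e))"

abbreviation "dm e \<equiv> mdim (mf (fst e))"
abbreviation "Vd e \<equiv> vdom (snd e)"

definition "qq e v = pr (fst e) (civ (snd e) v)"
definition "ww e = form_rep (\<omega> (fst e)) (snd e)"

lemma chartA: "c : A ==> orbifold_chart X c"
 using orb by (simp add: orbifold_def orbifold_atlas_def)

lemma Ob: "U : CO ==> Ob U : A" "U : CO ==> oimage (Ob U) = U"
 using func by (simp_all add: orbispace_functor_def)

lemmas Ob_chart = chartA[OF Ob(1)]
lemmas Ob_mf = chart_manifold[OF Ob_chart] and Ob_gm = chart_gm[OF Ob_chart]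

lemma pr_into: "U : CO ==> p : gpoints (Ob U) ==> pr U p : U"
 using Ob(2) by (auto simp: oimage_def)

lemma pr_surj: "U : CO ==> x : U ==> EX p:gpoints (Ob U). pr U p = x"
 using Ob(2)[of U] by (force simp: oimage_def set_eq_iff image_iff)

lemma CO_open: "U : CO ==> openin X U" using chart_open[OF Ob_chart] Ob(2) by metis

lemma CO_ex: "x : topspace X ==> EX U:CO. x : U"
proof -
 assume x: "x : topspace X"
 then obtain V where V: "V : \<U>" "x : V" using covering by (auto simp: open_covering_def)
 have "x : topspace (subtopology X (\<Inter>{V}))" using x V by simp
 hence "x : \<Union>(connected_components_of (subtopology X (\<Inter>{V})))" by (simp only: Union_connected_components_of)
 then obtain W where W: "W : connected_components_of (subtopology X (\<Inter>{V}))" "x : W" by auto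
 hence "W : CO" unfolding cover_objects_def by (intro CollectI exI[of _ "{V}"]) (use V in auto)
 thus ?thesis using W(2) by blast
qed

lemma pat:
 assumes "pat e"
 shows pat_CO: "fst e : CO" and pat_co: "snd e : mcoords (mf (fst e))" and pat_dom: "oES (dm e) (Vd e)"
  and pat_smap: "smap (dm e) (Vd e) (mf (fst e)) (civ (snd e))" and pat_into: "v : Vd e ==> civ (snd e) v : gpoints (Ob (fst e))"
  and qq_into: "v : Vd e ==> qq e v : fst e"
proof -
 show 1: "fst e : CO" "snd e : mcoords (mf (fst e))" using assms by (simp_all add: pat_def)
 show "oES (dm e) (Vd e)" by (rule co_dom[OF Ob_mf[OF 1(1)] 1(2)])
 show 2: "smap (dm e) (Vd e) (mf (fst e)) (civ (snd e))" by (rule smap_civ[OF Ob_mf[OF 1(1)] 1(2)])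
 show "civ (snd e) v : gpoints (Ob (fst e))" if "v : Vd e" by (rule smap_into[OF 2 that])
 thus "qq e v : fst e" if "v : Vd e" using that pr_into[OF 1(1)] by (simp add: qq_def)
qed

lemma pat_ex: "U : CO ==> p : gpoints (Ob U) ==> EX a. pat (U, a) & p : fst a"
 using co_ex[OF Ob_mf] by (fastforce simp: pat_def)

lemma patch_ex:
 assumes "x : topspace X"
 shows "EX e v. pat e & v : Vd e & qq e v = x"
proof -
 obtain U where U: "U : CO" "x : U" using CO_ex[OF assms] by auto
 obtain p where p: "p : gpoints (Ob U)" "pr U p = x" using pr_surj[OF U] by auto
 obtain a where a: "pat (U, a)" "p : fst a" using pat_ex[OF U(1) p(1)] by auto
 hence "qq (U, a) (snd a p) = x" using p(2) civ_co[OF Ob_mf[OF U(1)] pat_co[OF a(1), simplified] a(2)] by (simp add: qq_def)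
 thus ?thesis using a by (intro exI[of _ "(U, a)"] exI[of _ "snd a p"]) simp
qed

lemma sympl: "U : CO ==> symplectic_form (mf U) (\<omega> U)"
 and sympl_id: "U : CO ==> pullback_eq (mf U) (mf U) id (\<omega> U) (\<omega> U)"
 and sympl_g: "U : CO ==> g : gcar (Ob U) ==> pullback_eq (mf U) (mf U) (gact (Ob U) g) (\<omega> U) (\<omega> U)"
 and sympl_Mor: "V : CO ==> U : CO ==> V <= U ==> pullback_eq (mf V) (mf U) (fst (Mor V U)) (\<omega> U) (\<omega> V)"
 using sform unfolding orbifold_symplectic_form_def symplectic_form_def smooth_two_form_def by blast+

lemma pat_form: "pat e ==> sympl_form (dm e) (Vd e) (ww e)"
proof -
 assume e: "pat e"
 note m = Ob_mf[OF pat_CO[OF e]] and a = pat_co[OF e] and s = sympl[OF pat_CO[OF e]]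
 have "ALL i<dm e. v i = 0" if "x : Vd e" "ALL j<dm e. (SUM i<dm e. v i * ww e i j x) = 0" for x v
  using s a civ_in[OF m that(1)] that(2) unfolding symplectic_form_def nondegenerate_two_form_def ww_def form_rep_def by blast
 moreover have "ww e i j x = - ww e j i x" if "x : Vd e" "i<dm e" "j<dm e" for x i j
  using s a civ_in[OF m that(1)] that(2,3) unfolding symplectic_form_def smooth_two_form_def ww_def form_rep_def by blast
 moreover have "smooth_on (dm e) (Vd e) (ww e i j)" if "i<dm e" "j<dm e" for i j
  using s a that unfolding symplectic_form_def smooth_two_form_def ww_def by blast
 ultimately show ?thesis using pat_dom[OF e] unfolding sympl_form_def by blast
qed

lemma pat_closed: "pat e ==> x : Vd e ==> i<dm e ==> j<dm e ==> k<dm e ==>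
  pd i (ww e j k) x + pd j (ww e k i) x + pd k (ww e i j) x = 0"
 using sympl[OF pat_CO] pat_co unfolding symplectic_form_def closed_two_form_def ww_def by blast

definition "lft e U D Ph <-> pat e & U : CO & lift (Ob (fst e)) (snd e) (\<omega> (fst e)) (Ob U) (\<omega> U) D Ph"

text \<open>The common chart is that of a smaller object around the point; the functor embeds it
  into both charts compatibly with the forms, so \<open>lift_exists\<close> applies.\<close>

lemma lft_ex:
 assumes e: "pat e" and v: "v : Vd e" and U: "U : CO" and p: "p : gpoints (Ob U)" "pr U p = qq e v"
 shows "EX D Ph. lft e U D Ph & v : D & Ph v = p"
proof -
 note E = pat_CO[OF e]
 from cover_objects_Int[OF E U qq_into[OF e v]] pr_into[OF U p(1)] p(2)
 obtain W where W: "W : CO" "qq e v : W" "W <= fst e" "W <= U" by auto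
 have M: "gembedding (Ob W) (Ob V) (Mor W V)" "over_space (Ob W) (Ob V) (Mor W V)" if "V : CO" "W <= V" for V
  using func W(1) that by (auto simp: orbispace_functor_def open_gembedding_def)
 have "EX D Ph. lift (Ob (fst e)) (snd e) (\<omega> (fst e)) (Ob U) (\<omega> U) D Ph & v : D & Ph v = p"
  by (rule lift_exists[OF Ob_chart[OF E] Ob_chart[OF U] Ob_chart[OF W(1)] M[OF E W(3)] M[OF U W(4)] pat_co[OF e] v p(1)
    _ _ sympl_Mor[OF W(1) E W(3)] sympl_Mor[OF W(1) U W(4)] sympl_id[OF E] sympl_id[OF W(1)] sympl_g[OF E] sympl_g[OF U]])
   (use p(2) W(2) Ob(2)[OF W(1)] in \<open>simp_all add: qq_def\<close>)
 thus ?thesis using e U by (simp add: lft_def)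
qed

lemma lftD:
 assumes "lft e U D Ph"
 shows lft_pat: "pat e" and lft_CO: "U : CO" and lft_sub: "D <= Vd e" and lft_dim: "mdim (mf U) = dm e"
  and lft_smap: "smap (dm e) D (mf U) Ph" and lft_pr: "z : D ==> pr U (Ph z) = qq e z"
  and lft_form: "pform (dm e) D (mf U) (\<omega> U) Ph (ww e)" and lft_open: "oES (dm e) D"
  and lft_into: "z : D ==> Ph z : gpoints (Ob U)"
 using assms smap_open[of _ D "mf U" Ph] smap_into[of _ D "mf U" Ph] by (auto simp: lft_def lift_def qq_def ww_def)

lemma lft_g:
 assumes l: "lft e U D Ph" and g: "g : gcar (Ob U)"
 shows "lft e U D (%z. gact (Ob U) g (Ph z))"
proof -
 note U = lft_CO[OF l]
 note m = Ob_mf[OF U] and s = gm_smooth[OF Ob_gm[OF U] g]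
 show ?thesis using lft_pat[OF l] U lft_sub[OF l] lft_dim[OF l] smap_map[OF m m lft_smap[OF l] s]
   pform_map[OF m m lft_smap[OF l] s lft_form[OF l] sympl_g[OF U g]] lft_pr[OF l] chart_inv[OF Ob_chart[OF U] g lft_into[OF l]]
  by (simp add: lft_def lift_def qq_def ww_def)
qed

lemma lft_subset:
 assumes l: "lft e U D Ph" and D': "oES (dm e) D'" "D' <= D"
 shows "lft e U D' Ph"
 using l smap_subset[OF lft_smap[OF l] D' Ob_mf[OF lft_CO[OF l]]] pform_subset[OF lft_form[OF l] D'(2)] D'(2) 
 by (auto simp: lft_def lift_def ww_def)

text \<open>An arrow is a map between open subsets of two patches over the identity of \<open>X\<close>.\<close>

definition "arrow e e' D F <-> pat e & pat e' & dm e' = dm e & oES (dm e) D & D <= Vd e &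
 (ALL z:D. F z : Vd e' & qq e' (F z) = qq e z) & (ALL j<dm e. smooth_on (dm e) D (%z. F z j)) &
 (ALL z:D. ALL i<dm e. ALL j<dm e. ww e i j z = fpb (dm e) (%k l. ww e' k l (F z)) F i j z)"

lemma lft_arrow:
 assumes l: "lft e U D Ph" and a: "pat (U, a)"
 shows "arrow e (U, a) (D Int Ph -` fst a) (%z. snd a (Ph z))"
proof -
 have m: "smooth_manifold (mf U)" and co: "a : mcoords (mf U)" using Ob_mf[OF lft_CO[OF l]] pat_co[OF a] by simp_all
 have "qq (U, a) (snd a (Ph z)) = qq e z" if "z : D" "Ph z : fst a" for z
  using lft_pr[OF l that(1)] civ_co[OF m co that(2)] by (simp add: qq_def)
 moreover have "ww e i j z = (SUM k<dm e. SUM l<dm e. ww (U, a) k l (snd a (Ph z)) * pd i (%z. snd a (Ph z) k) z * pd j (%z. snd a (Ph z) l) z)"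
  if "z : D" "Ph z : fst a" "i<dm e" "j<dm e" for z i j
  using pformD[OF lft_form[OF l] co that] lft_dim[OF l] civ_co[OF m co that(2)] by (simp add: ww_def form_rep_def)
 moreover have "smooth_on (dm e) (D Int Ph -` fst a) (%z. snd a (Ph z) j)" if "j<dm e" for j
  using smap_smooth[OF lft_smap[OF l] co] that lft_dim[OF l] by simp
 ultimately show ?thesis
  using lft_pat[OF l] a lft_dim[OF l] smap_preimage[OF lft_smap[OF l] co_open[OF m co]] lft_sub[OF l] by (auto simp: arrow_def)
qed

lemma arrow_ex:
 assumes "pat e" "v : Vd e" "pat e'" "v' : Vd e'" "qq e' v' = qq e v"
 shows "EX D F. arrow e e' D F & v : D & F v = v'"
proof -
 note e' = pat_CO[OF assms(3)]
 obtain D Ph where l: "lft e (fst e') D Ph" "v : D" "Ph v = civ (snd e') v'"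
  using lft_ex[OF assms(1,2) e' pat_into[OF assms(3,4)]] assms(5) by (auto simp: qq_def)
 have "arrow e e' (D Int Ph -` fst (snd e')) (%z. snd (snd e') (Ph z))" using lft_arrow[OF l(1), of "snd e'"] assms(3) by simp
 moreover have "v : D Int Ph -` fst (snd e')" "snd (snd e') (Ph v) = v'"
  using l civ_in[OF Ob_mf[OF e'] assms(4)] co_civ[OF Ob_mf[OF e'] assms(4)] by auto
 ultimately show ?thesis by blast
qed

lemma lft_pre:
 assumes F: "arrow e e' D F" and l: "lft e' U D' Ph"
 shows "lft e U (D Int F -` D') (%z. Ph (F z))"
proof -
 have A: "pat e" "pat e'" "dm e' = dm e" "oES (dm e) D" "D <= Vd e"
  "!!z. z : D ==> F z : Vd e'" "!!z. z : D ==> qq e' (F z) = qq e z" "!!j. j<dm e ==> smooth_on (dm e) D (%z. F z j)"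
  "!!z i j. z : D ==> i<dm e ==> j<dm e ==> ww e i j z = fpb (dm e) (%k l. ww e' k l (F z)) F i j z"
  using F unfolding arrow_def by simp_all
 note m = Ob_mf[OF lft_CO[OF l]]
 have "continuous_map (sES (dm e) D) (sES (dm e) (Vd e')) F"
  by (rule continuous_map_smooth_ES[OF A(4) _ A(6,8)]) (use pat_dom[OF A(2)] A(3) in simp)
 from cont_ES_preimage[OF A(4) continuous_map_into_fulltopology[OF this], of D'] lft_open[OF l] A(3)
 have o: "oES (dm e) (D Int F -` D')" by simp
 have s: "smooth_on (dm e) (D Int F -` D') (%z. F z j)" if "j<dm e" for j
  by (rule smooth_on_subset[OF A(4) o _ A(8)[OF that]]) simp
 have 1: "smap (dm e) (D Int F -` D') (mf U) (%z. Ph (F z))"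
  by (rule smap_pre[OF m lft_smap[OF l] o]) (use s A(3) in auto)
 have "pform (dm e) (D Int F -` D') (mf U) (\<omega> U) (%z. Ph (F z)) (%i j x. SUM k<dm e'. SUM l<dm e'. ww e' k l (F x) * jc F i k x * jc F j l x)"
  by (rule pform_pre[OF m lft_smap[OF l] o _ _ lft_form[OF l]]) (use s A(3) in auto)
 hence "pform (dm e) (D Int F -` D') (mf U) (\<omega> U) (%z. Ph (F z)) (ww e)"
  unfolding pform_def by (simp add: A(3,9))
 thus ?thesis using 1 A(1,3,5,7) lft_CO[OF l] lft_dim[OF l] lft_pr[OF l] by (auto simp: lft_def lift_def ww_def qq_def)
qed

lemma qq_cont: "pat e ==> continuous_map (sES (dm e) (Vd e)) X (qq e)"
 using continuous_map_compose[OF smap_cont[OF pat_smap] chart_cont[OF Ob_chart[OF pat_CO]], of e]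
 by (simp add: o_def qq_def[abs_def])

lemma functions_patch:
 assumes "f : orbifold_functions X A" "pat e"
 shows "smooth_on (dm e) (Vd e) (%v. f (qq e v))"
proof -
 have "smooth_function (mf (fst e)) (f o pr (fst e))" using assms Ob(1)[OF pat_CO[OF assms(2)]] by (simp add: orbifold_functions_def)
 thus ?thesis using pat_co[OF assms(2)] by (simp add: smooth_function_def o_def qq_def)
qed

text \<open>Smoothness has to hold on every chart of the maximal atlas, while the assumption
  concerns the charts of the functor; germ equivalence supplies local lifts from the former to the
  latter.\<close>

lemma functionsI:
 fixes f :: "'x => complex"
 assumes s: "!!e. pat e ==> smooth_on (dm e) (Vd e) (%v. f (qq e v))" and z: "!!x. x ~: topspace X ==> f x = 0"
 shows "f : orbifold_functions X A"
proof -
 have "smooth_function (gspace c) (f o pj c)" if c: "c : A" for c unfolding smooth_function_def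
 proof (intro ballI, rule smooth_on_local)
  note ch = chartA[OF c]
  note m = chart_manifold[OF ch]
  fix a assume a: "a : mcoords (gspace c)"
  show "oES (cdim c) (vdom a)" by (rule co_dom[OF m a])
  fix v assume v: "v : vdom a"
  let ?x = "pj c (civ a v)"
  have p: "civ a v : gpoints c" by (rule smap_into[OF smap_civ[OF m a] v])
  have xc: "?x : oimage c" using p by (simp add: oimage_def)
  hence "?x : topspace X" using openin_subset[OF chart_open[OF ch]] by auto
  then obtain U where U: "U : CO" "?x : U" using CO_ex by auto
  have "germ_equivalent X ?x c (Ob U)" using orb c Ob[OF U(1)] xc U(2) by (auto simp: orbifold_def orbifold_atlas_def)
  then obtain d F F' where d: "orbifold_chart X d" "?x : oimage d" "gembedding d c F" "over_space d c F" "gembedding d (Ob U) F'" "over_space d (Ob U) F'"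
   unfolding germ_equivalent_def by blast
  obtain q where q: "q : gpoints (Ob U)" "pr U q = ?x" using pr_surj[OF U] by auto
  \<comment> \<open>An arbitrary chart of the atlas carries no symplectic form; zero forms make that
    part of a lift trivial.\<close>
  have "EX D Ph. lift c a (%_ _ _ _. 0) (Ob U) (%_ _ _ _. 0) D Ph & v : D & Ph v = q"
   by (rule lift_exists[OF ch Ob_chart[OF U(1)] d(1,3-6) a v q d(2), where \<theta>="%_ _ _ _. 0"]) (simp_all add: pullback_eq_def)
  then obtain D Ph where l: "lift c a (%_ _ _ _. 0) (Ob U) (%_ _ _ _. 0) D Ph" "v : D" "Ph v = q" by blast
  obtain b where b: "pat (U, b)" "q : fst b" using pat_ex[OF U(1) q(1)] by auto
  note mU = Ob_mf[OF U(1)]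
  have bc: "b : mcoords (mf U)" using pat_co[OF b(1)] by simp
  let ?n = "cdim c"
  have sl: "smap ?n D (mf U) Ph" and n: "mdim (mf U) = ?n" 
   by (rule l(1)[unfolded lift_def, THEN conjunct2, THEN conjunct2, THEN conjunct1] l(1)[unfolded lift_def, THEN conjunct2, THEN conjunct1, symmetric])+
  define W where "W = D Int Ph -` fst b"
  have W: "oES ?n W" unfolding W_def by (rule smap_preimage[OF sl co_open[OF mU bc]])
  have "smooth_on ?n W (%z. f (qq (U, b) (snd b (Ph z))))"
   by (rule smooth_on_compose[where f="%v. f (qq (U, b) v)" and ff="%z. snd b (Ph z)", OF co_dom[OF mU bc] W])
     (use s[OF b(1)] smap_smooth[OF sl bc] in \<open>auto simp: W_def\<close>)
  hence "smooth_on ?n W (f o pj c o civ a)"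
  proof (rule smooth_on_cong[OF W, THEN iffD1, rotated])
   show "f (qq (U, b) (snd b (Ph z))) = (f o pj c o civ a) z" if "z : W" for z
   using that l(1) civ_co[OF mU bc] by (auto simp: lift_def qq_def W_def)
  qed
  thus "EX W. oES ?n W & v : W & smooth_on ?n W (f o pj c o civ a)"
   using W l(2,3) b(2) by (auto simp: W_def)
 qed
 moreover have "continuous_map X euclidean f"
 proof (rule continuous_map_locally)
  fix x assume "x : topspace X"
  then obtain U where U: "U : CO" "x : U" using CO_ex by auto
  \<comment> \<open>Continuity is checked on the chart domain and descends, the projection being a
    quotient map onto \<open>U\<close>.\<close>
  have "continuous_map (gtop (Ob U)) euclidean (f o pr U)"
  proof (rule continuous_map_locally)
   fix p assume "p : gpoints (Ob U)"
   from pat_ex[OF U(1) this] obtain a where a: "pat (U, a)" "p : fst a" by blast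
   have ac: "a : mcoords (mf U)" using pat_co[OF a(1)] by simp
   note m = Ob_mf[OF U(1)]
   have "continuous_map (sES (mdim (mf U)) (vdom a)) euclidean (%v. f (qq (U, a) v))"
    using s[OF a(1)] unfolding smooth_on_def by (metis Ck_on.simps(1) fst_conv snd_conv)
   from continuous_map_compose[OF co_cont[OF m ac] this]
   have "continuous_map (subtopology (gtop (Ob U)) (fst a)) euclidean (f o pr U)"
    by (rule continuous_map_eq) (auto simp: qq_def civ_co[OF m ac])
   thus "EX W. openin (gtop (Ob U)) W & p : W & continuous_map (subtopology (gtop (Ob U)) W) euclidean (f o pr U)"
    using co_open[OF m ac] a(2) by blast
  qed
  hence "continuous_map (subtopology X U) euclidean f"
   using continuous_compose_quotient_map[OF chart_quotient_map[OF Ob_chart[OF U(1)]], of euclidean f] unfolding Ob(2)[OF U(1)] by blast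
  thus "EX W. openin X W & x : W & continuous_map (subtopology X W) euclidean f" using U CO_open by blast
 qed
 ultimately show ?thesis using z by (simp add: orbifold_functions_def)
qed

end

section \<open>Pull-back of symplectic connections\<close>

definition PT :: "nat => (nat => nat => nat => pt => real) => (nat => nat => pt => real) =>
  (pt => pt) => nat => nat => nat => pt => real" where
 "PT n T w H k i j z = (SUM r<n. jc H k r z * (fpb n (%p q. T r p q (H z)) H i j z +
   (SUM m<n. w r m (H z) * hs H i j m z)))"

text \<open>The algebra behind functoriality of \<open>PT\<close>: \<open>a\<close> and
  \<open>b\<close> are the Jacobians of the inner and the outer map, \<open>c\<close> and
  \<open>h\<close> the corresponding second derivatives.\<close>

lemma connection_compose:
 fixes a b :: "nat => pt"
 shows "(SUM s<n. (SUM r<n. a r k * b s r) * ((SUM u<n. SUM v<n. T s u v * (SUM p<n. a p i * b u p) * (SUM q<n. a q j * b v q)) +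
   (SUM m<n. w s m * (SUM l<n. a l j * (SUM q<n. a q i * h m l q) + c l * b m l)))) =
  (SUM r<n. a r k * ((SUM p<n. SUM q<n. (SUM s<n. b s r * ((SUM u<n. SUM v<n. T s u v * b u p * b v q) + (SUM m<n. w s m * h m q p))) * a p i * a q j) +
   (SUM l<n. (SUM s<n. SUM m<n. w s m * b s r * b m l) * c l)))"
proof -
 define G where "G s p q = (SUM u<n. SUM v<n. T s u v * b u p * b v q) + (SUM m<n. w s m * h m q p)" for s p q
 have B: "(SUM u<n. SUM v<n. T s u v * (SUM p<n. a p i * b u p) * (SUM q<n. a q j * b v q)) + (SUM m<n. w s m * (SUM l<n. a l j * (SUM q<n. a q i * h m l q) + c l * b m l))
   = (SUM p<n. SUM q<n. G s p q * a p i * a q j) + (SUM l<n. (SUM m<n. w s m * b m l) * c l)" for s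
 proof -
  have "(SUM m<n. w s m * (SUM l<n. a l j * (SUM q<n. a q i * h m l q) + c l * b m l)) =
    (SUM m<n. SUM l<n. SUM q<n. w s m * h m l q * a q i * a l j) + (SUM m<n. SUM l<n. w s m * b m l * c l)"
   by (simp add: sum_distrib_left sum.distrib algebra_simps)
  also have "(SUM m<n. SUM l<n. w s m * b m l * c l) = (SUM l<n. (SUM m<n. w s m * b m l) * c l)"
   by (subst sum.swap) (simp add: sum_distrib_right)
  also have "(SUM m<n. SUM l<n. SUM q<n. w s m * h m l q * a q i * a l j) = (SUM l<n. SUM q<n. SUM m<n. w s m * h m l q * a q i * a l j)"
   by (rule sum3_swap)
  also have "... = (SUM q<n. SUM l<n. (SUM m<n. w s m * h m l q) * a q i * a l j)"
   by (subst sum.swap) (simp add: sum_distrib_right)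
  finally show ?thesis unfolding form_compose G_def by (simp add: sum.distrib algebra_simps)
 qed
 have S: "(SUM s<n. b s r * ((SUM p<n. SUM q<n. G s p q * a p i * a q j) + (SUM l<n. (SUM m<n. w s m * b m l) * c l))) =
   (SUM p<n. SUM q<n. (SUM s<n. b s r * G s p q) * a p i * a q j) + (SUM l<n. (SUM s<n. SUM m<n. w s m * b s r * b m l) * c l)" for r
 proof -
  have "(SUM s<n. b s r * ((SUM p<n. SUM q<n. G s p q * a p i * a q j) + (SUM l<n. (SUM m<n. w s m * b m l) * c l))) =
    (SUM s<n. SUM p<n. SUM q<n. b s r * G s p q * a p i * a q j) + (SUM s<n. SUM l<n. SUM m<n. w s m * b s r * b m l * c l)"
   by (simp add: sum_distrib_left sum_distrib_right sum.distrib distrib_left mult_ac)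
  also have "(SUM s<n. SUM p<n. SUM q<n. b s r * G s p q * a p i * a q j) = (SUM p<n. SUM q<n. SUM s<n. b s r * G s p q * a p i * a q j)"
   by (rule sum3_swap)
  also have "(SUM s<n. SUM l<n. SUM m<n. w s m * b s r * b m l * c l) = (SUM l<n. SUM s<n. SUM m<n. w s m * b s r * b m l * c l)"
   by (rule sum.swap)
  finally show ?thesis by (simp add: sum_distrib_right)
 qed
 have "(SUM s<n. (SUM r<n. a r k * b s r) * ((SUM p<n. SUM q<n. G s p q * a p i * a q j) + (SUM l<n. (SUM m<n. w s m * b m l) * c l))) =
   (SUM r<n. a r k * (SUM s<n. b s r * ((SUM p<n. SUM q<n. G s p q * a p i * a q j) + (SUM l<n. (SUM m<n. w s m * b m l) * c l))))"
  by (simp only: sum_distrib_left sum_distrib_right mult.assoc) (rule sum.swap)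
 thus ?thesis unfolding B S by (simp add: G_def)
qed

context
 fixes n :: nat and D E and F H :: "pt => pt" and z
 assumes D: "oES n D" and E: "oES n E" and FE: "!!z. z : D ==> F z : E" and z: "z : D"
  and Fs: "!!l. l<n ==> smooth_on n D (%z. F z l)" and Hs: "!!l. l<n ==> smooth_on n E (%z. H z l)"
begin

lemma pd_compose: "x : D ==> i<n ==> s<n ==> pd i (%z. H (F z) s) x =
  (SUM l<n. jc F i l x * jc H l s (F x))"
 using partial_deriv_compose[where f="%z. H z s" and ff=F, OF E D FE _ _ Hs Fs] by simp

lemma pd2_compose:
 assumes ij: "i<n" "j<n" and s: "s<n"
 shows "pd i (pd j (%z. H (F z) s)) z = (SUM l<n. jc F j l z *
  (SUM q<n. jc F i q z * hs H q l s (F z)) +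
   hs F i j l z * jc H l s (F z))"
proof -
 have sH: "smooth_on n E (pd l (%z. H z s))" if "l<n" for l using smooth_on_partial_deriv[OF Hs[OF s] that] .
 have sF: "smooth_on n D (pd j (%z. F z l))" if "l<n" for l using smooth_on_partial_deriv[OF Fs[OF that] ij(2)] .
 have sHF: "smooth_on n D (%z. jc H l s (F z))" if "l<n" for l
  by (rule smooth_on_compose[OF E D FE sH[OF that] Fs])
 have "pd i (pd j (%z. H (F z) s)) z =
   pd i (%x. SUM l<n. jc F j l x * jc H l s (F x)) z"
  by (rule partial_deriv_cong[OF D z ij(1)]) (rule pd_compose[OF _ ij(2) s])
 also have "... = (SUM l<n. pd i (%x. jc F j l x * jc H l s (F x)) z)"
  by (rule partial_deriv_sum[OF D z ij(1)]) (simp add: smooth_on_mult[OF D] sF sHF)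
 also have "... = (SUM l<n. jc F j l z * pd i (%x. jc H l s (F x)) z +
   hs F i j l z * jc H l s (F z))"
  by (intro sum.cong refl partial_deriv_mult[OF D z ij(1)]) (simp_all add: sF sHF)
 finally show ?thesis using partial_deriv_compose[OF E D FE z ij(1) sH Fs] by simp
qed

lemma PT_compose:
 assumes ij: "i<n" "j<n" "k<n"
  and w': "!!r l. r<n ==> l<n ==> w' r l (F z) = (SUM s<n. SUM m<n. w s m (H (F z)) * jc H r s (F z) * jc H l m (F z))"
 shows "PT n T w (%z. H (F z)) k i j z = claw n F i j k z (%r p q. PT n T w H r p q (F z)) (%r l. w' r l (F z))"
proof -
 have "PT n T w (%z. H (F z)) k i j z = (SUM s<n. (SUM r<n. jc F k r z * jc H r s (F z)) * ((SUM u<n. SUM v<n. T s u v (H (F z)) *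
   (SUM p<n. jc F i p z * jc H p u (F z)) * (SUM q<n. jc F j q z * jc H q v (F z))) +
   (SUM m<n. w s m (H (F z)) * (SUM l<n. jc F j l z * (SUM q<n. jc F i q z * hs H q l m (F z)) +
     hs F i j l z * jc H l m (F z)))))" unfolding PT_def by (simp add: pd_compose[OF z] pd2_compose ij)
 also note connection_compose[where a="%r k. jc F k r z" and b="%s r. jc H r s (F z)"]
 finally show ?thesis unfolding PT_def by (simp add: w')
qed

end

lemma PT_cong:
 assumes "oES n W" "z : W" "!!x. x : W ==> H x = H' x" "i<n" "j<n" "k<n"
 shows "PT n T w H k i j z = PT n T w H' k i j z"
proof -
 have 1: "jc H i r x = jc H' i r x" if "x : W" "i<n" for i r x
  by (rule partial_deriv_cong[OF assms(1) that]) (simp add: assms(3))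
 have "hs H i j m z = hs H' i j m z" for m
  by (rule partial_deriv_cong[OF assms(1,2,4)]) (rule 1[OF _ assms(5)])
 thus ?thesis using assms by (simp add: PT_def 1)
qed

context
 fixes n :: nat and D V and H :: "pt => pt" and w T
 assumes D: "oES n D" and V: "oES n V" and HV: "!!z. z : D ==> H z : V"
  and Hs: "!!l. l<n ==> smooth_on n D (%z. H z l)" and form: "sympl_form n V w" and conn: "sympl_conn n V w T"
begin

interpretation C: sympl_chart n V w T by (rule sympl_chart.intro[OF form conn])

lemma PT_smooth: "i<n ==> j<n ==> k<n ==> smooth_on n D (PT n T w H k i j)"
 unfolding PT_def[abs_def]
 by (intro smooth_on_sum[OF D] smooth_on_mult[OF D] smooth_on_add[OF D] smooth_on_partial_deriv Hs smooth_on_compose[OF V D HV _ Hs])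
   (simp_all add: C.w_smooth C.T_smooth)

lemma PT_sym: "z : D ==> i<n ==> j<n ==> PT n T w H k i j z = PT n T w H k j i z"
proof -
 assume a: "z : D" "i<n" "j<n"
 have "fpb n (%p q. T r p q (H z)) H i j z =
   fpb n (%p q. T r p q (H z)) H j i z" if "r<n" for r
  by (subst sum.swap, intro sum.cong refl) (use C.T_sym[OF HV[OF a(1)]] that in simp)
 thus ?thesis unfolding PT_def by (intro sum.cong refl) (simp add: partial_deriv_commute[OF D a Hs])
qed

text \<open>By the product rule, the Hessian terms are the inhomogeneous terms of the two
  \<open>PT\<close>, and differentiating \<open>w\<close> yields the remaining ones through
  \<open>T_w\<close>.\<close>

lemma PT_conn:
 assumes z: "z : D" and ij: "i<n" "j<n" "k<n"
  and w': "!!x. x : D ==> w' x = fpb n (%r s. w r s (H x)) H j k x"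
 shows "pd i w' z = PT n T w H j i k z - PT n T w H k i j z"
proof -
 define h where "h i r = jc H i r z" for i r
 define c where "c j r = hs H i j r z" for j r
 have s: "smooth_on n D (%x. w r s (H x))" if "r<n" "s<n" for r s
  by (rule smooth_on_compose[OF V D HV C.w_smooth[OF that] Hs])
 have s': "smooth_on n D (pd j (%x. H x r))" if "r<n" "j<n" for r j
  by (rule smooth_on_partial_deriv[OF Hs[OF that(1)] that(2)])
 have d: "pd i (%x. w r s (H x) * jc H j r x * jc H k s x) z =
   w r s (H z) * h j r * c k s + (w r s (H z) * c j r + (SUM p<n. h i p * (T r p s (H z) - T s p r (H z))) * h j r) * h k s" if rs: "r<n" "s<n" for r s
 proof -
  have "pd i (%x. w r s (H x)) z = (SUM p<n. h i p * (T r p s (H z) - T s p r (H z)))"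
   using partial_deriv_compose[OF V D HV z ij(1) C.w_smooth[OF rs] Hs] C.T_w[OF HV[OF z]] rs by (simp add: h_def)
  thus ?thesis using rs ij
   by (simp add: partial_deriv_mult[OF D z ij(1)] smooth_on_mult[OF D] s s' h_def c_def)
 qed
 define Q where "Q r s x = w r s (H x) * jc H j r x * jc H k s x" for r s x
 have sQ: "smooth_on n D (Q r s)" if "r<n" "s<n" for r s
  unfolding Q_def[abs_def] by (simp add: smooth_on_mult[OF D] s s' ij that)
 have "pd i (%x. SUM r<n. SUM s<n. Q r s x) z = (SUM r<n. pd i (%x. SUM s<n. Q r s x) z)"
  by (rule partial_deriv_sum[OF D z ij(1)], rule smooth_on_sum[OF D], rule sQ) simp_all
 also have "... = (SUM r<n. SUM s<n. pd i (Q r s) z)"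
  by (rule sum.cong[OF refl], rule partial_deriv_sum[OF D z ij(1)], rule sQ) simp_all
 finally have e: "pd i (%x. SUM r<n. SUM s<n. Q r s x) z =
  (SUM r<n. SUM s<n. w r s (H z) * h j r * c k s + (w r s (H z) * c j r + (SUM p<n. h i p * (T r p s (H z) - T s p r (H z))) * h j r) * h k s)"
  by (simp add: Q_def[abs_def] d)
 have "pd i w' z = (SUM r<n. SUM s<n. w r s (H z) * h j r * c k s + (w r s (H z) * c j r + (SUM p<n. h i p * (T r p s (H z) - T s p r (H z))) * h j r) * h k s)"
  unfolding e[symmetric] by (rule partial_deriv_cong[OF D z ij(1)]) (simp add: w' Q_def)
 also have "... = (SUM r<n. SUM s<n. w r s (H z) * h j r * c k s) + (SUM r<n. SUM s<n. w r s (H z) * c j r * h k s)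
   + (SUM r<n. SUM s<n. SUM p<n. T r p s (H z) * h i p * h j r * h k s) - (SUM r<n. SUM s<n. SUM p<n. T s p r (H z) * h i p * h j r * h k s)"
  by (simp add: sum.distrib sum_subtractf sum_distrib_left sum_distrib_right algebra_simps)
 also have "(SUM r<n. SUM s<n. w r s (H z) * c j r * h k s) = - (SUM s<n. SUM r<n. w s r (H z) * c j r * h k s)"
  unfolding sum_negf[symmetric] by (subst sum.swap, intro sum.cong refl, subst C.w_anti[OF HV[OF z]]) simp_all
 also have "(SUM r<n. SUM s<n. SUM p<n. T s p r (H z) * h i p * h j r * h k s) = (SUM s<n. SUM p<n. SUM r<n. T s p r (H z) * h i p * h j r * h k s)"
  by (rule sum3_swap)
 also have "(SUM r<n. SUM s<n. SUM p<n. T r p s (H z) * h i p * h j r * h k s) = (SUM r<n. SUM p<n. SUM s<n. T r p s (H z) * h i p * h j r * h k s)"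
  by (rule sum.cong[OF refl], rule sum.swap)
 finally show ?thesis
  by (simp add: PT_def h_def[symmetric] c_def[symmetric] sum_distrib_left distrib_left sum.distrib mult_ac)
qed

end

section \<open>Averaging local connections over the finite groups\<close>

context symplectic_orbifold begin

text \<open>The flat coordinate connection, corrected so as to preserve the form. Before division by
  3, the difference required by \<open>sympl_conn\<close> is
  \<open>2 \<partial>\<^sub>i \<omega>\<^sub>j\<^sub>k\<close> plus two terms which closedness
  combines into one further \<open>\<partial>\<^sub>i \<omega>\<^sub>j\<^sub>k\<close>.\<close>

definition "Tl e j i k x = (pd i (ww e j k) x + pd k (ww e j i) x) / 3"

lemma Tl_conn: "pat e ==> sympl_conn (dm e) (Vd e) (ww e) (Tl e)"
proof -
 assume e: "pat e"
 note V = pat_dom[OF e] and f = pat_form[OF e]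
 have ws: "!!i j. i<dm e ==> j<dm e ==> smooth_on (dm e) (Vd e) (ww e i j)"
  and wa: "!!x i j. x : Vd e ==> i<dm e ==> j<dm e ==> ww e i j x = - ww e j i x"
  using f unfolding sympl_form_def by blast+
 have 1: "smooth_on (dm e) (Vd e) (Tl e k i j)" if "k<dm e" "i<dm e" "j<dm e" for k i j
  unfolding Tl_def[abs_def] divide_inverse
  by (intro smooth_on_mult[OF V] smooth_on_add[OF V] smooth_on_partial_deriv ws that smooth_on_const[OF V])
 have 2: "Tl e k i j x = Tl e k j i x" for k i j x by (simp add: Tl_def add.commute)
 have 3: "pd i (ww e j k) x = Tl e j i k x - Tl e k i j x" if x: "x : Vd e" and ijk: "i<dm e" "j<dm e" "k<dm e" for x i j k
 proof -
  have a: "pd i (ww e j k) x = - pd i (ww e k j) x" if "i<dm e" "j<dm e" "k<dm e" for i j k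
  proof -
   have "pd i (ww e j k) x = pd i (%x. - ww e k j x) x"
    by (rule partial_deriv_cong[OF V x that(1)]) (rule wa[OF _ that(2,3)])
   thus ?thesis using partial_deriv_uminus[OF V x that(1) ws[OF that(3,2)]] by simp
  qed
  show ?thesis using pat_closed[OF e x ijk] a[OF ijk(1,3,2)] a[OF ijk(3,2,1)] by (simp add: Tl_def field_simps)
 qed
 show ?thesis unfolding sympl_conn_def using 1 2 3 by blast
qed

abbreviation (input) "ed e == fst (snd e)"
abbreviation (input) "ec e == snd (snd e)"

definition "bump_on e0 be K <-> pat e0 & smooth_on (dm e0) (Vd e0) be & compactin (ES (dm e0)) K &
 K <= Vd e0 & (ALL v:Vd e0 - K. be v = (0::real)) & (ALL v. be v >= 0)"

text \<open>\<open>None\<close> yields the cut-off itself and \<open>Some (k, i, j)\<close> the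
  pulled-back connection weighted by it, so that weights and weighted connections share their
  proofs. Zero stands where the lift leaves the coordinate domain.\<close>

definition "trm e0 be Ph \<tau> z = (if Ph z : ed e0 then be (ec e0 (Ph z)) *
  (case \<tau> of None => 1 | Some (k, i, j) => PT (dm e0) (Tl e0) (ww e0) (%x. ec e0 (Ph x)) k i j z) else (0::real))"

definition "okt n \<tau> <-> (case \<tau> of None => True | Some (k, i, j) => k<n & i<n & j<(n::nat))"

abbreviation "GG U \<equiv> gcar (Ob U)"

definition "gsum e0 be Ph \<tau> z = (SUM g:GG (fst e0). trm e0 be (%x. gact (Ob (fst e0)) g (Ph x)) \<tau> z)"

text \<open>The lift is selected by choice; \<open>gsum_indep\<close> makes its selection
  immaterial, and \<open>avg_smooth\<close> justifies the extension by zero.\<close>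

definition "avg e0 be e \<tau> z = (if qq e z : fst e0 then
  gsum e0 be (snd (SOME p. lft e (fst e0) (fst p) (snd p) & z : fst p)) \<tau> z else 0)"

lemma trm_cong:
 assumes W: "oES (dm e0) W" "z : W" "!!x. x : W ==> Ph x = Ph' x" and t: "okt (dm e0) \<tau>"
 shows "trm e0 be Ph \<tau> z = trm e0 be Ph' \<tau> z"
proof -
 have "PT (dm e0) (Tl e0) (ww e0) (%x. ec e0 (Ph x)) k i j z = PT (dm e0) (Tl e0) (ww e0) (%x. ec e0 (Ph' x)) k i j z"
  if "k<dm e0" "i<dm e0" "j<dm e0" for k i j by (rule PT_cong[OF W(1,2)]) (simp_all add: that W(3))
 thus ?thesis using t W(2,3) by (auto simp: trm_def okt_def split: option.splits)
qed

context
 fixes e0 be K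
 assumes b: "bump_on e0 be K"
begin

lemma bump: "pat e0" "smooth_on (dm e0) (Vd e0) be" "compactin (ES (dm e0)) K" "K <= Vd e0"
 "v : Vd e0 ==> v ~: K ==> be v = 0" "be v >= 0"
 using b by (auto simp: bump_on_def)

lemma K_compact: "compactin (gtop (Ob (fst e0))) (civ (snd e0) ` K)"
 by (rule image_compactin[OF _ smap_cont[OF pat_smap[OF bump(1)]]]) (use bump(3,4) in \<open>simp add: compactin_subtopology\<close>)

lemma K_sub: "civ (snd e0) ` K <= ed e0"
proof (rule image_subsetI)
 fix v assume "v : K"
 thus "civ (snd e0) v : ed e0"
  by (rule civ_in[OF Ob_mf[OF pat_CO[OF bump(1)]] subsetD[OF bump(4)]])
qed

lemma trm_nonzero:
 assumes "Ph z : ed e0" "be (ec e0 (Ph z)) ~= 0"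
 shows "Ph z : civ (snd e0) ` K"
proof -
 have "ec e0 (Ph z) : K" using bump(5)[of "ec e0 (Ph z)"] assms by auto
 moreover have "civ (snd e0) (ec e0 (Ph z)) = Ph z"
  by (rule civ_co[OF Ob_mf[OF pat_CO[OF bump(1)]] pat_co[OF bump(1)] assms(1)])
 ultimately show ?thesis by (metis imageI)
qed

text \<open>On the coordinate domain the term is a product of smooth functions. Elsewhere it
  vanishes near the point, because the support is compact and hence closed in the chart
  domain.\<close>

lemma trm_smooth:
 assumes l: "lft e (fst e0) D Ph" and t: "okt (dm e) \<tau>"
 shows "smooth_on (dm e) D (trm e0 be Ph \<tau>)"
proof (rule smooth_on_local[OF lft_open[OF l]])
 fix z assume z: "z : D"
 let ?W = "D Int Ph -` ed e0" and ?H = "%x. ec e0 (Ph x)"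
 note m = Ob_mf[OF lft_CO[OF l]] and a = pat_co[OF bump(1)] and n = lft_dim[OF l]
 have W: "oES (dm e) ?W" by (rule smap_preimage[OF lft_smap[OF l] co_open[OF m a]])
 have H: "smooth_on (dm e) ?W (%x. ?H x j)" if "j<dm e" for j using smap_smooth[OF lft_smap[OF l] a] that n by simp
 have HV: "?H x : Vd e0" if "x : ?W" for x using that by simp
 have V: "oES (dm e) (Vd e0)" using pat_dom[OF bump(1)] n by simp
 show "EX W. oES (dm e) W & z : W & smooth_on (dm e) W (trm e0 be Ph \<tau>)"
 proof (cases "Ph z : ed e0")
  case True
  have sb: "smooth_on (dm e) ?W (%x. be (?H x))"
   by (rule smooth_on_compose[OF V W HV bump(2)[unfolded n] H])
  have "smooth_on (dm e) ?W (%z. case \<tau> of None => 1 | Some (k, i, j) => PT (dm e0) (Tl e0) (ww e0) ?H k i j z)"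
  proof (cases \<tau>)
   case (Some p)
   then obtain k i j where "\<tau> = Some (k, i, j)" by (cases p) auto
   thus ?thesis using t n PT_smooth[OF W V HV H, of "ww e0" "Tl e0" i j k] pat_form[OF bump(1)] Tl_conn[OF bump(1)]
    by (simp add: okt_def)
  qed (simp add: smooth_on_const[OF W])
  from smooth_on_mult[OF W sb this] have "smooth_on (dm e) ?W (trm e0 be Ph \<tau>)"
   by (rule smooth_on_cong[OF W, THEN iffD1, rotated]) (simp add: trm_def)
  thus ?thesis using W z True by (intro exI[of _ ?W]) simp
 next
  case False
  let ?N = "D Int Ph -` (gpoints (Ob (fst e0)) - civ (snd e0) ` K)"
  have "closedin (gtop (Ob (fst e0))) (civ (snd e0) ` K)"
   using K_compact m by (auto simp: smooth_manifold_def intro: compactin_imp_closedin)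
  hence N: "oES (dm e) ?N" by (intro smap_preimage[OF lft_smap[OF l]]) (simp add: openin_diff)
  have "trm e0 be Ph \<tau> x = 0" if "x : ?N" for x
   using trm_nonzero[of Ph x] that by (auto simp: trm_def)
  hence "smooth_on (dm e) ?N (trm e0 be Ph \<tau>)"
   by (intro smooth_on_cong[OF N, THEN iffD1, OF _ smooth_on_const[OF N, of 0]]) simp
  moreover have "Ph z ~: civ (snd e0) ` K" using False subsetD[OF K_sub] by auto
  ultimately show ?thesis using N z lft_into[OF l z] by (intro exI[of _ ?N]) simp
 qed
qed

lemma gsum_smooth: "lft e (fst e0) D Ph ==> okt (dm e) \<tau> ==> smooth_on (dm e) D (gsum e0 be Ph \<tau>)"
 unfolding gsum_def[abs_def] by (rule smooth_on_sum[OF lft_open]) (simp_all add: trm_smooth[OF lft_g])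

text \<open>If the sums differed at a point, they would differ on a nonempty open set. There the
  lifts agree up to a group element depending on the point; \<open>finite_baire\<close> gives an
  open subset with a single element, where the sums agree after relabelling. Ineffective actions are
  harmless, as the element need not be unique.\<close>

lemma gsum_indep:
 assumes l: "lft e (fst e0) D Ph" and l': "lft e (fst e0) D' Ph'" and t: "okt (dm e) \<tau>" and z: "z : D" "z : D'"
 shows "gsum e0 be Ph \<tau> z = gsum e0 be Ph' \<tau> z"
proof (rule ccontr)
 assume ne: "gsum e0 be Ph \<tau> z ~= gsum e0 be Ph' \<tau> z"
 let ?c = "Ob (fst e0)" and ?E = "ES (dm e)"
 note U = lft_CO[OF l]
 note gm = Ob_gm[OF U] and n = lft_dim[OF l]
 define B where "B = D Int D'"
 have B: "openin ?E B" unfolding B_def using lft_open[OF l] lft_open[OF l'] by (rule openin_Int)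
 have lB: "lft e (fst e0) B Ph" "lft e (fst e0) B Ph'" using lft_subset[OF l B] lft_subset[OF l' B] by (auto simp: B_def)
 define f where "f z = gsum e0 be Ph \<tau> z - gsum e0 be Ph' \<tau> z" for z
 have f: "smooth_on (dm e) B f" unfolding f_def by (rule smooth_on_diff[OF B]) (intro gsum_smooth lB t)+
 have "continuous_map (subtopology ?E B) euclidean f" 
  by (rule f[unfolded smooth_on_def, THEN spec, of 0, unfolded Ck_on.simps(1)])
 from cont_ES_preimage[OF B this, of "- {0}"] open_Compl[OF closed_singleton[of "0::real"]]
 have N: "openin ?E (B Int f -` (- {0}))" by simp
 define I where "I g = {x : B. Ph' x = gact ?c g (Ph x)}" for g
 have I: "closedin (subtopology ?E B) (I g)" if g: "g : GG (fst e0)" for g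
 proof -
  have "closedin (subtopology ?E B) {x : topspace (subtopology ?E B). Ph' x = gact ?c g (Ph x)}"
   by (rule closedin_continuous_maps_eq[where Y="gtop ?c"])
     (use Ob_mf[OF U] smap_cont[OF lft_smap[OF lB(2)]] smap_cont[OF lft_smap[OF lft_g[OF lB(1) g]]] in \<open>auto simp: smooth_manifold_def\<close>)
  moreover have "{x : topspace (subtopology ?E B). Ph' x = gact ?c g (Ph x)} = I g" using openin_subset[OF B] by (auto simp: I_def)
  ultimately show ?thesis by simp
 qed
 have "EX g:GG (fst e0). EX W. openin (subtopology ?E B) W & W ~= {} & W <= B Int f -` (- {0}) & W <= I g"
 proof (rule finite_baire[OF gm_finite[OF gm] I])
  show "openin (subtopology ?E B) (B Int f -` (- {0}))" using N by (simp add: openin_open_subtopology[OF B])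
  show "B Int f -` (- {0}) ~= {}" using z ne by (auto simp: B_def f_def)
  have "EX g:GG (fst e0). gact ?c g (Ph x) = Ph' x" if "x : B" for x
   using that by (intro chart_fibre[OF Ob_chart[OF U]]) (simp_all add: lft_into[OF lB(1)] lft_into[OF lB(2)] lft_pr[OF lB(1)] lft_pr[OF lB(2)])
  thus "B Int f -` (- {0}) <= (UN g:GG (fst e0). I g)" by (fastforce simp: I_def)
 qed
 then obtain g W where g: "g : GG (fst e0)" and W: "openin ?E W" "W ~= {}" "W <= B" "W <= f -` (- {0})" "W <= I g"
  by (auto simp: openin_open_subtopology[OF B])
 obtain x where x: "x : W" using W(2) by blast
 \<comment> \<open>On the open set \<open>W\<close> the two lifts differ by the fixed
   \<open>g\<close>, so their derivatives correspond too; right translation by \<open>g\<close> then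
   permutes the group.\<close>
 have "gsum e0 be Ph' \<tau> x = (SUM h:GG (fst e0). trm e0 be (%x. gact ?c (h \<otimes>\<^bsub>ggroup ?c\<^esub> g) (Ph x)) \<tau> x)"
  unfolding gsum_def
 proof (intro sum.cong refl trm_cong[where W=W] x)
  show "oES (dm e0) W" "okt (dm e0) \<tau>" using W(1) t n by simp_all
  fix h y assume "h : GG (fst e0)" "y : W"
  thus "gact ?c h (Ph' y) = gact ?c (h \<otimes>\<^bsub>ggroup ?c\<^esub> g) (Ph y)"
   using gm_mult[OF gm _ g lft_into[OF lB(1)]] W(3,5) by (auto simp: I_def)
 qed
 also have "... = gsum e0 be Ph \<tau> x" unfolding gsum_def
 proof (rule sum.reindex_bij_betw[where h="%h. h \<otimes>\<^bsub>ggroup ?c\<^esub> g" and g="%h. trm e0 be (%x. gact ?c h (Ph x)) \<tau> x"])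
  have i: "inj_on (%h. h \<otimes>\<^bsub>ggroup ?c\<^esub> g) (GG (fst e0))" by (rule group.inj_on_multc[OF gm_group[OF gm] g])
  have "(%h. h \<otimes>\<^bsub>ggroup ?c\<^esub> g) ` GG (fst e0) <= GG (fst e0)" by (auto intro: gm_mult_closed[OF gm] g)
  from endo_inj_surj[OF gm_finite[OF gm] this i] i
  show "bij_betw (%h. h \<otimes>\<^bsub>ggroup ?c\<^esub> g) (GG (fst e0)) (GG (fst e0))" by (simp add: bij_betw_def)
 qed
 finally show False using x W(4) by (auto simp: f_def)
qed

lemma avg_eq:
 assumes l: "lft e (fst e0) D Ph" and z: "z : D" and t: "okt (dm e) \<tau>"
 shows "avg e0 be e \<tau> z = gsum e0 be Ph \<tau> z"
proof -
 let ?p = "SOME p. lft e (fst e0) (fst p) (snd p) & z : fst p"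
 have "EX p. lft e (fst e0) (fst p) (snd p) & z : fst p" using l z by (intro exI[of _ "(D, Ph)"]) simp
 hence p: "lft e (fst e0) (fst ?p) (snd ?p)" "z : fst ?p" using someI_ex[of "%p. lft e (fst e0) (fst p) (snd p) & z : fst p"] by auto
 have "qq e z : fst e0" using pr_into[OF lft_CO[OF l] lft_into[OF l z]] lft_pr[OF l z] by simp
 thus ?thesis using gsum_indep[OF p(1) l t p(2) z] by (simp add: avg_def)
qed

lemma lft_at: "pat e ==> z : Vd e ==> qq e z : fst e0 ==> EX D Ph. lft e (fst e0) D Ph & z : D"
 using pr_surj[OF pat_CO[OF bump(1)]] lft_ex[OF _ _ pat_CO[OF bump(1)]] by metis

lemma avg_smooth:
 assumes e: "pat e" and t: "okt (dm e) \<tau>"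
 shows "smooth_on (dm e) (Vd e) (avg e0 be e \<tau>)"
proof (rule smooth_on_local[OF pat_dom[OF e]])
 let ?E = "ES (dm e)" and ?U = "fst e0"
 fix z assume z: "z : Vd e"
 show "EX W. openin ?E W & z : W & smooth_on (dm e) W (avg e0 be e \<tau>)"
 proof (cases "qq e z : ?U")
  case True
  from lft_at[OF e z True] obtain D Ph where l: "lft e ?U D Ph" "z : D" by blast
  have "smooth_on (dm e) D (avg e0 be e \<tau>)"
   by (rule smooth_on_cong[OF lft_open[OF l(1)], THEN iffD1, OF _ gsum_smooth[OF l(1) t]]) (simp add: avg_eq[OF l(1) _ t])
  thus ?thesis using l lft_open by blast
 next
  case False
  \<comment> \<open>The projected support is compact, hence closed in \<open>X\<close> and contained
    in the object, so the average vanishes near every point outside the object.\<close>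
  define C where "C = pr ?U ` civ (snd e0) ` K"
  note U = pat_CO[OF bump(1)]
  have "compactin X C" unfolding C_def by (rule image_compactin[OF K_compact chart_cont[OF Ob_chart[OF U]]])
  hence "closedin X C" using orb by (auto simp: orbifold_def intro: compactin_imp_closedin)
  hence N: "openin ?E (Vd e Int qq e -` (topspace X - C))" (is "openin _ ?N")
   by (intro cont_ES_preimage[OF pat_dom[OF e] qq_cont[OF e]]) (simp add: openin_diff)
  have CU: "C <= ?U" using pr_into[OF U] subsetD[OF compactin_subset_topspace[OF K_compact]] by (auto simp: C_def)
  have "avg e0 be e \<tau> x = 0" if x: "x : ?N" for x
  proof (cases "qq e x : ?U")
   case True
   from lft_at[OF e _ True] x obtain D Ph where l: "lft e ?U D Ph" "x : D" by blast
   have "trm e0 be (%x. gact (Ob ?U) g (Ph x)) \<tau> x = 0" if g: "g : GG ?U" for g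
   proof (rule ccontr)
    assume "trm e0 be (%x. gact (Ob ?U) g (Ph x)) \<tau> x ~= 0"
    hence "gact (Ob ?U) g (Ph x) : civ (snd e0) ` K"
     using trm_nonzero[of "%x. gact (Ob ?U) g (Ph x)" x] by (auto simp: trm_def split: if_splits)
    hence "pr ?U (gact (Ob ?U) g (Ph x)) : C" by (auto simp: C_def)
    thus False using x lft_pr[OF lft_g[OF l(1) g] l(2)] by simp
   qed
   thus ?thesis by (simp add: avg_eq[OF l t] gsum_def)
  qed (simp add: avg_def)
  hence "smooth_on (dm e) ?N (avg e0 be e \<tau>)"
   by (intro smooth_on_cong[OF N, THEN iffD1, OF _ smooth_on_const[OF N, of 0]]) simp
  moreover have "z : ?N" using z False CU subsetD[OF openin_subset[OF CO_open[OF pat_CO[OF e]]] qq_into[OF e z]] by auto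
  ultimately show ?thesis using N by blast
 qed
qed

text \<open>A lift composed with an arrow is a lift by \<open>lft_pre\<close>, and pull-back of
  connections is functorial by \<open>PT_compose\<close>. The inhomogeneous term carries the weight,
  so the averaged cut-off multiplies the form in it.\<close>

lemma avg_natural:
 assumes F: "arrow e e' D F" and z: "z : D" and t: "okt (dm e) \<tau>"
 shows "avg e0 be e None z = avg e0 be e' None (F z)"
  and "\<tau> = Some (k, i, j) ==> avg e0 be e \<tau> z = claw (dm e) F i j k z (%r p q. avg e0 be e' (Some (r, p, q)) (F z)) (%r m. avg e0 be e' None (F z) * ww e' r m (F z))" (is "_ ==> ?B")
proof -
 have A: "pat e" "pat e'" "dm e' = dm e" "oES (dm e) D" "F z : Vd e'" "qq e' (F z) = qq e z"
  "!!j. j<dm e ==> smooth_on (dm e) D (%z. F z j)"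
  using F z unfolding arrow_def by simp_all
 show "avg e0 be e None z = avg e0 be e' None (F z)" 
  "\<tau> = Some (k, i, j) ==> ?B"
 proof (atomize (full), cases "qq e z : fst e0")
  case False
  thus "avg e0 be e None z = avg e0 be e' None (F z) & (\<tau> = Some (k, i, j) --> ?B)"
   using A(6) by (simp add: avg_def)
 next
  case True
  with lft_at[OF A(2,5)] A(6) obtain D' Ph where l: "lft e' (fst e0) D' Ph" "F z : D'" by auto
  define E where "E = D Int F -` D'"
  have lE: "lft e (fst e0) E (%z. Ph (F z))" unfolding E_def by (rule lft_pre[OF F l(1)])
  have zE: "z : E" using z l(2) by (simp add: E_def)
  let ?Ph = "%g x. gact (Ob (fst e0)) g (Ph x)" and ?a = "ec e0"
  note co = pat_co[OF bump(1)] and U = pat_CO[OF bump(1)]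
  note m = Ob_mf[OF U]
  have n: "dm e0 = dm e" by (rule lft_dim[OF lE])
  have P: "trm e0 be (%x. ?Ph g (F x)) (Some (k, i, j)) z = claw (dm e) F i j k z (%r p q. trm e0 be (?Ph g) (Some (r, p, q)) (F z)) (%r m. trm e0 be (?Ph g) None (F z) * ww e' r m (F z))"
   if g: "g : GG (fst e0)" and ijk: "i<dm e" "j<dm e" "k<dm e" for g
  proof (cases "?Ph g (F z) : ed e0")
   case in_a: True
   have lg: "lft e' (fst e0) D' (?Ph g)" by (rule lft_g[OF l(1) g])
   have lEg: "lft e (fst e0) E (%z. ?Ph g (F z))" by (rule lft_g[OF lE g])
   let ?W = "E Int (%z. ?Ph g (F z)) -` ed e0" and ?W' = "D' Int ?Ph g -` ed e0"
   have W: "oES (dm e) ?W" by (rule smap_preimage[OF lft_smap[OF lEg] co_open[OF m co]])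
   have W': "oES (dm e) ?W'" using smap_preimage[OF lft_smap[OF lg] co_open[OF m co]] A(3) by simp
   have Fs: "smooth_on (dm e) ?W (%z. F z l)" if "l<dm e" for l
    by (rule smooth_on_subset[OF A(4) W _ A(7)[OF that]]) (auto simp: E_def)
   have Hs: "smooth_on (dm e) ?W' (%z. ?a (?Ph g z) l)" if "l<dm e" for l
    using smap_smooth[OF lft_smap[OF lg] co, of l] that n A(3) by simp
   have "PT (dm e) (Tl e0) (ww e0) (%z. ?a (?Ph g (F z))) k i j z = claw (dm e) F i j k z (%r p q. PT (dm e) (Tl e0) (ww e0) (%z. ?a (?Ph g z)) r p q (F z)) (%r l. ww e' r l (F z))"
   proof (rule PT_compose[where H="%z. ?a (?Ph g z)" and F=F, OF W W' _ _ Fs Hs ijk])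
    show "F x : ?W'" if "x : ?W" for x using that by (auto simp: E_def)
    show "z : ?W" using zE in_a by simp
    show "ww e' r l (F z) = (SUM s<dm e. SUM m<dm e. ww e0 s m (?a (?Ph g (F z))) * pd r (%z. ?a (?Ph g z) s) (F z) * pd l (%z. ?a (?Ph g z) m) (F z))"
     if "r<dm e" "l<dm e" for r l
     using lft_arrow[OF lg, of "snd e0"] bump(1) l(2) in_a that A(3) unfolding arrow_def by simp
   qed
   thus ?thesis using in_a n by (simp add: trm_def sum_distrib_left distrib_left mult_ac)
  qed (simp add: trm_def)
  have Q: "trm e0 be (%x. ?Ph g (F x)) None z = trm e0 be (?Ph g) None (F z)" for g by (simp add: trm_def)
  have okN: "okt n None" for n by (simp add: okt_def)
  have 1: "avg e0 be e None z = gsum e0 be (%x. Ph (F x)) None z" "avg e0 be e' None (F z) = gsum e0 be Ph None (F z)"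
   using avg_eq[OF lE zE okN] avg_eq[OF l okN] by simp_all
  have 2: "avg e0 be e' (Some (r, p, q)) (F z) = gsum e0 be Ph (Some (r, p, q)) (F z)" if "r<dm e" "p<dm e" "q<dm e" for r p q
   using avg_eq[OF l] that A(3) by (simp add: okt_def)
  have 3: "?B" if \<tau>: "\<tau> = Some (k, i, j)"
  proof -
   have ijk: "i<dm e" "j<dm e" "k<dm e" using t \<tau> by (auto simp: okt_def)
   have "avg e0 be e \<tau> z = (SUM g:GG (fst e0). SUM r<dm e. jc F k r z *
   (fpb (dm e) (%p q. trm e0 be (?Ph g) (Some (r, p, q)) (F z)) F i j z +
   (SUM m<dm e. trm e0 be (?Ph g) None (F z) * ww e' r m (F z) * hs F i j m z)))"
    unfolding avg_eq[OF lE zE t] gsum_def using P ijk \<tau> by simp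
   also have "... = claw (dm e) F i j k z (%r p q. gsum e0 be Ph (Some (r, p, q)) (F z)) (%r m. gsum e0 be Ph None (F z) * ww e' r m (F z))"
    unfolding gsum_def sum_distrib_right distrib_left sum_distrib_left sum.distrib
    by (simp only: sum.swap[of _ "GG (fst e0)"])
   finally show ?thesis using 1 2 by simp
  qed
  show "avg e0 be e None z = avg e0 be e' None (F z) & (\<tau> = Some (k, i, j) --> ?B)"
   using 1 3 by (simp add: gsum_def Q)
 qed
qed

lemma avg_nonneg: "pat e ==> z : Vd e ==> avg e0 be e None z >= 0"
 using bump(6) by (auto simp: avg_def gsum_def trm_def intro!: sum_nonneg)

text \<open>The lift is chosen through \<open>v\<close>; the summand of the unit element is then
  positive, and the others are nonnegative.\<close>

lemma avg_pos:
 assumes e: "pat e" and z: "z : Vd e" and v: "v : Vd e0" "qq e0 v = qq e z" "be v > 0"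
 shows "avg e0 be e None z > 0"
proof -
 note U = pat_CO[OF bump(1)]
 from lft_ex[OF e z U pat_into[OF bump(1) v(1)]] v(2) obtain D Ph where l: "lft e (fst e0) D Ph" "z : D" "Ph z = civ (snd e0) v"
  by (auto simp: qq_def)
 let ?c = "Ob (fst e0)"
 have 1: "gact ?c \<one>\<^bsub>ggroup ?c\<^esub> (Ph z) = Ph z" "\<one>\<^bsub>ggroup ?c\<^esub> : GG (fst e0)"
  using gm_one[OF Ob_gm[OF U] lft_into[OF l(1,2)]] monoid.one_closed[OF group.is_monoid[OF gm_group[OF Ob_gm[OF U]]]] by auto
 have "trm e0 be (%x. gact ?c \<one>\<^bsub>ggroup ?c\<^esub> (Ph x)) None z > 0"
  unfolding trm_def 1(1) unfolding l(3) using v civ_in[OF Ob_mf[OF U] v(1)] co_civ[OF Ob_mf[OF U] v(1)] by simp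
 hence "gsum e0 be Ph None z > 0" unfolding gsum_def
  by (intro sum_pos2[OF gm_finite[OF Ob_gm[OF U]] 1(2)]) (use bump(6) in \<open>auto simp: trm_def\<close>)
 thus ?thesis using avg_eq[OF l(1,2)] by (simp add: okt_def)
qed

lemma avg_sym:
 assumes e: "pat e" and z: "z : Vd e" and ijk: "i<dm e" "j<dm e" "k<dm e"
 shows "avg e0 be e (Some (k, i, j)) z = avg e0 be e (Some (k, j, i)) z"
  "avg e0 be e (Some (j, i, k)) z - avg e0 be e (Some (k, i, j)) z = avg e0 be e None z * pd i (ww e j k) z"
proof (atomize (full), cases "qq e z : fst e0")
 case False
 thus "avg e0 be e (Some (k, i, j)) z = avg e0 be e (Some (k, j, i)) z &
  avg e0 be e (Some (j, i, k)) z - avg e0 be e (Some (k, i, j)) z = avg e0 be e None z * pd i (ww e j k) z" by (simp add: avg_def)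
next
 case True
 from lft_at[OF e z True] obtain D Ph where l: "lft e (fst e0) D Ph" "z : D" by blast
 note co = pat_co[OF bump(1)] and m = Ob_mf[OF pat_CO[OF bump(1)]]
 have T: "trm e0 be Ph (Some (k, i, j)) z = trm e0 be Ph (Some (k, j, i)) z &
   trm e0 be Ph (Some (j, i, k)) z - trm e0 be Ph (Some (k, i, j)) z = trm e0 be Ph None z * pd i (ww e j k) z"
  if l: "lft e (fst e0) D Ph" for Ph
 proof (cases "Ph z : ed e0")
  case True
  let ?W = "D Int Ph -` ed e0" and ?H = "%x. ec e0 (Ph x)"
  have n: "dm e0 = dm e" by (rule lft_dim[OF l])
  have W: "oES (dm e) ?W" by (rule smap_preimage[OF lft_smap[OF l] co_open[OF m co]])
  have V: "oES (dm e) (Vd e0)" using pat_dom[OF bump(1)] n by simp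
  have HV: "?H x : Vd e0" if "x : ?W" for x using that by simp
  have H: "smooth_on (dm e) ?W (%x. ?H x j)" if "j<dm e" for j using smap_smooth[OF lft_smap[OF l] co] that n by simp
  have f: "sympl_form (dm e) (Vd e0) (ww e0)" "sympl_conn (dm e) (Vd e0) (ww e0) (Tl e0)"
   using pat_form[OF bump(1)] Tl_conn[OF bump(1)] n by simp_all
  have zW: "z : ?W" using True \<open>z : D\<close> by simp
  have A1: "pd i (ww e j k) z = PT (dm e) (Tl e0) (ww e0) ?H j i k z - PT (dm e) (Tl e0) (ww e0) ?H k i j z"
   by (rule PT_conn[OF W V HV H f zW ijk]) (use lft_arrow[OF l, of "snd e0"] bump(1) ijk in \<open>simp_all add: arrow_def\<close>)
  have A2: "PT (dm e) (Tl e0) (ww e0) ?H k i j z = PT (dm e) (Tl e0) (ww e0) ?H k j i z"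
   by (rule PT_sym[OF W V HV H f zW ijk(1,2)])
  show ?thesis using True n by (simp add: trm_def A1 A2 algebra_simps)
 qed (simp add: trm_def)
 have "gsum e0 be Ph (Some (k, i, j)) z = gsum e0 be Ph (Some (k, j, i)) z"
  unfolding gsum_def by (intro sum.cong refl) (simp add: T[OF lft_g[OF l(1)]])
 moreover have "gsum e0 be Ph (Some (j, i, k)) z - gsum e0 be Ph (Some (k, i, j)) z = gsum e0 be Ph None z * pd i (ww e j k) z"
  unfolding gsum_def sum_subtractf[symmetric] sum_distrib_right
  by (intro sum.cong refl T[THEN conjunct2] lft_g[OF l(1)])
 ultimately show "avg e0 be e (Some (k, i, j)) z = avg e0 be e (Some (k, j, i)) z &
  avg e0 be e (Some (j, i, k)) z - avg e0 be e (Some (k, i, j)) z = avg e0 be e None z * pd i (ww e j k) z"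
  using ijk avg_eq[OF l] by (simp add: okt_def)
qed

end

section \<open>Bump functions and the compatible family of connections\<close>

lemma bump_ex:
 assumes "x : topspace X"
 shows "EX P e0 be K. openin X P & x : P & bump_on e0 be K & (ALL y:P. EX v:Vd e0. qq e0 v = y & be v > 0)"
proof -
 from patch_ex[OF assms] obtain e v where e: "pat e" "v : Vd e" "qq e v = x" by blast
 let ?U = "fst e" and ?a = "snd e" and ?n = "dm e" and ?c = "Ob (fst e)"
 note V = pat_dom[OF e(1)] and U = pat_CO[OF e(1)] and a = pat_co[OF e(1)]
 note m = Ob_mf[OF U] and gm = Ob_gm[OF U] and ch = Ob_chart[OF U]
 from openin_ES_box[OF V e(2)] obtain r where r: "r > 0"
  "!!u. (!!i. i >= ?n ==> u i = 0) ==> (!!i. i<?n ==> \<bar>u i - v i\<bar> <= r) ==> u : Vd e" by metis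
 define K where "K = {u. (ALL i>=?n. u i = 0) & (ALL i<?n. \<bar>u i - v i\<bar> <= r)}"
 define B where "B = {u. (ALL i>=?n. u i = 0) & (ALL i<?n. \<bar>u i - v i\<bar><r)}"
 \<comment> \<open>Each factor is positive exactly where the \<open>i\<close>-th coordinate is
   closer than \<open>r\<close> to that of \<open>v\<close>, so on \<open>Vd e\<close> the product
   vanishes off the closed box \<open>K\<close>.\<close>
 define be where "be u = (PROD i<?n. flat_exp 0 (r^2 - (u i - v i)^2))" for u
 have z: "u i = 0" if "u : Vd e" "i >= ?n" for u i using openin_ES_subset[OF V] that by auto
 have B: "oES ?n B" "B <= Vd e" "v : B"
  using openin_ES_open_box[of ?n v r] r z[OF e(2)] by (auto simp: B_def less_imp_le)
 have pos: "flat_exp 0 (r^2 - (u i - v i)^2) > 0 <-> \<bar>u i - v i\<bar><r" for u i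
  using r(1) abs_le_square_iff[of r "u i - v i"] by (auto simp: flat_exp_pos_iff)
 have "smooth_on ?n (Vd e) be" unfolding be_def[abs_def] power2_eq_square
  by (intro smooth_on_prod[OF V] smooth_on_flat_exp[OF V] smooth_on_diff[OF V] smooth_on_mult[OF V] smooth_on_const[OF V] smooth_on_coord[OF V])
 moreover have "be u = 0" if u: "u : Vd e" "u ~: K" for u
 proof -
  obtain i where i: "i<?n" "~ \<bar>u i - v i\<bar> <= r" using u(2) z[OF u(1)] by (auto simp: K_def)
  hence "flat_exp 0 (r^2 - (u i - v i)^2) = 0" using pos[of u i] flat_exp_nonneg[of "r^2 - (u i - v i)^2"] by linarith
  thus ?thesis using i(1) unfolding be_def by (intro prod_zero) auto
 qed
 moreover have "K <= Vd e" using r(2) by (auto simp: K_def)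
 ultimately have b: "bump_on e be K" using e(1) compactin_ES_box[of ?n v r]
  by (auto simp: bump_on_def K_def be_def intro!: prod_nonneg flat_exp_nonneg)
 define N where "N = fst ?a Int snd ?a -` B"
 have N: "openin (gtop ?c) N" unfolding N_def by (rule co_preimage_open[OF m a B(1)])
 have Nq: "EX u:B. qq e u = pr ?U p" if "p : N" for p
  using that civ_co[OF m a, of p] by (intro bexI[of _ "snd ?a p"]) (auto simp: N_def qq_def)
 have Np: "N <= gpoints ?c" by (rule openin_subset[OF N])
 \<comment> \<open>The preimage of the projected set is its saturation, a union of open sets; hence
   the projected set is open for the quotient topology.\<close>
 have "{p : gpoints ?c. pr ?U p : pr ?U ` N} = (UN g:GG ?U. {p : gpoints ?c. gact ?c g p : N})"
 proof (intro equalityI subsetI)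
  fix p assume "p : {p : gpoints ?c. pr ?U p : pr ?U ` N}"
  then obtain q where p: "p : gpoints ?c" "q : N" "pr ?U p = pr ?U q" by auto
  then obtain g where "g : GG ?U" "gact ?c g p = q" using chart_fibre[OF ch p(1) _ p(3)] Np by auto
  thus "p : (UN g:GG ?U. {p : gpoints ?c. gact ?c g p : N})" using p by auto
 next
  fix p assume "p : (UN g:GG ?U. {p : gpoints ?c. gact ?c g p : N})"
  then obtain g where g: "g : GG ?U" "p : gpoints ?c" "gact ?c g p : N" by auto
  thus "p : {p : gpoints ?c. pr ?U p : pr ?U ` N}" using chart_inv[OF ch g(1,2)] by (auto intro: rev_image_eqI)
 qed
 moreover have "openin (gtop ?c) (UN g:GG ?U. {p : gpoints ?c. gact ?c g p : N})"
  by (intro openin_Union ballI) (auto intro!: openin_continuous_map_preimage[OF gm_cont[OF gm] N])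
 moreover have "pr ?U ` N <= ?U" using pr_into[OF U] Np by auto
 ultimately have "openin (subtopology X ?U) (pr ?U ` N)"
  using chart_quotient_map[OF ch, unfolded Ob(2)[OF U] quotient_map_def, THEN conjunct2, THEN spec, of "pr ?U ` N"]
   openin_subset[OF CO_open[OF U]] by simp
 hence "openin X (pr ?U ` N)" using openin_open_subtopology[OF CO_open[OF U]] by blast
 moreover have "x : pr ?U ` N" using e(2,3) B(3) civ_in[OF m e(2)] co_civ[OF m e(2)] by (auto simp: N_def qq_def)
 moreover have "EX u:Vd e. qq e u = y & be u > 0" if y: "y : pr ?U ` N" for y
 proof -
  from y obtain p where p: "p : N" "y = pr ?U p" by auto
  with Nq obtain u where u: "u : B" "qq e u = y" by blast
  hence "be u > 0" unfolding be_def by (intro prod_pos) (simp add: pos B_def)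
  thus ?thesis using u B(2) by blast
 qed
 ultimately show ?thesis using b by blast
qed

text \<open>Second countability makes \<open>X\<close> a Lindelof space, so a sequence of bumps
  suffices; no local finiteness is claimed yet.\<close>

lemma bumps_ex:
 assumes "topspace X ~= {}"
 shows "EX b. (ALL k. bump_on (fst (b k)) (fst (snd (b k))) (snd (snd (b k)))) &
  (ALL x:topspace X. EX k::nat. EX v:Vd (fst (b k)). qq (fst (b k)) v = x & fst (snd (b k)) v > 0)"
proof -
 define Q where "Q = {P. openin X P & (EX e0 be K. bump_on e0 be K & (ALL y:P. EX v:Vd e0. qq e0 v = y & be v > 0))}"
 have "\<Union>Q = topspace X"
 proof (intro equalityI subsetI)
  fix x assume "x : \<Union>Q" thus "x : topspace X" using openin_subset by (fastforce simp: Q_def)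
 next
  fix x assume "x : topspace X"
  from bump_ex[OF this] obtain P e0 be K where P: "openin X P & x : P & bump_on e0 be K & (ALL y:P. EX v:Vd e0. qq e0 v = y & be v > 0)"
   by (elim exE)
  hence "P : Q" unfolding Q_def by (intro CollectI conjI exI[of _ e0] exI[of _ be] exI[of _ K]) simp_all
  thus "x : \<Union>Q" using P by blast
 qed
 moreover have "Lindelof_space X" using orb by (simp add: orbifold_def second_countable_imp_Lindelof_space)
 moreover have "ALL P:Q. openin X P" by (simp add: Q_def)
 ultimately obtain R where R: "countable R" "R <= Q" "\<Union>R = topspace X" unfolding Lindelof_space_def by meson
 have "R ~= {}" using R(3) assms by blast
 have "ALL k. EX b. bump_on (fst b) (fst (snd b)) (snd (snd b)) & (ALL y:from_nat_into R k. EX v:Vd (fst b). qq (fst b) v = y & fst (snd b) v > 0)"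
 proof
  fix k
  have "from_nat_into R k : Q" using from_nat_into[OF \<open>R ~= {}\<close>] R(2) by blast
  then obtain e0 be K where "bump_on e0 be K & (ALL y:from_nat_into R k. EX v:Vd e0. qq e0 v = y & be v > 0)" unfolding Q_def by blast
  thus "EX b. bump_on (fst b) (fst (snd b)) (snd (snd b)) & (ALL y:from_nat_into R k. EX v:Vd (fst b). qq (fst b) v = y & fst (snd b) v > 0)"
   by (intro exI[of _ "(e0, be, K)"]) simp
 qed
 then obtain b where b: "ALL k. bump_on (fst (b k)) (fst (snd (b k))) (snd (snd (b k))) & (ALL y:from_nat_into R k. EX v:Vd (fst (b k)). qq (fst (b k)) v = y & fst (snd (b k)) v > 0)"
  by (rule choice[THEN exE])
 have "EX k. x : from_nat_into R k" if x: "x : topspace X" for x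
 proof -
  from x R(3) obtain P where P: "P : R" "x : P" by auto
  from from_nat_into_surj[OF R(1) P(1)] show ?thesis using P(2) by metis
 qed
 thus ?thesis using b by (intro exI[of _ b]) blast
qed

text \<open>The averaged cut-offs \<open>B k\<close> need not be locally finite. The factors
  \<open>pz k\<close> switch off \<open>B k\<close> wherever an earlier \<open>B j\<close> is at
  least \<open>1 / k\<close>, without losing positivity of the total. Dividing the weighted sum of
  connections by that of the cut-offs restores the affine transformation law.\<close>

theorem connection_ex:
 "EX TT. (ALL e. pat e --> sympl_conn (dm e) (Vd e) (ww e) (TT e)) & (ALL e e' D F z i j k. arrow e e' D F --> z : D --> i<dm e --> j<dm e --> k<dm e -->
   TT e k i j z = claw (dm e) F i j k z (%r p q. TT e' r p q (F z)) (%r m. ww e' r m (F z)))"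
proof (cases "topspace X = {}")
 case True
 have "Vd e = {}" if "pat e" for e
  using True continuous_map_image_subset_topspace[OF qq_cont[OF that]] openin_subset[OF pat_dom[OF that]] by auto
 thus ?thesis by (intro exI[of _ Tl] conjI allI impI) (rule Tl_conn, assumption, unfold arrow_def, blast)
next
 case False
 from bumps_ex[OF False] obtain b where
  b: "!!k. bump_on (fst (b k)) (fst (snd (b k))) (snd (snd (b k)))"
  and cov: "!!x. x : topspace X ==> EX k::nat. EX v:Vd (fst (b k)). qq (fst (b k)) v = x & fst (snd (b k)) v > 0" by blast
 define B where "B k e \<tau> = avg (fst (b k)) (fst (snd (b k))) e \<tau>" for k e \<tau>
 \<comment> \<open>Near a point where some \<open>B j\<close> is positive, all factors with large
   \<open>k\<close> vanish. For \<open>k = 0\<close> the product is empty and equals 1.\<close>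
 define pz where "pz k e z = (PROD j<k. flat_exp 0 (1 / real k - B j e None z))" for k e z
 define tot where "tot e \<tau> z = suminf (%k. pz k e z * B k e \<tau> z)" for e \<tau> z
 have okN: "okt n None" for n by (simp add: okt_def)
 note Bs = avg_smooth[OF b, folded B_def]
 have B0: "B k e None z >= 0" if "pat e" "z : Vd e" for k e z using avg_nonneg[OF b that] by (simp add: B_def)
 have pz0: "pz k e z >= 0" for k e z unfolding pz_def by (intro prod_nonneg) (simp add: flat_exp_nonneg)
 have pzs: "smooth_on (dm e) (Vd e) (pz k e)" if e: "pat e" for k e unfolding pz_def[abs_def]
  by (intro smooth_on_prod[OF pat_dom[OF e]] smooth_on_flat_exp[OF pat_dom[OF e]] smooth_on_diff[OF pat_dom[OF e]]
    smooth_on_const[OF pat_dom[OF e]] Bs[OF e okN])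
 have pos: "EX k. B k e None z > 0" if e: "pat e" "z : Vd e" for e z
 proof -
  have "qq e z : topspace X" using subsetD[OF openin_subset[OF CO_open[OF pat_CO[OF e(1)]]] qq_into[OF e]] .
  from cov[OF this] obtain k v where "v : Vd (fst (b k))" "qq (fst (b k)) v = qq e z" "fst (snd (b k)) v > 0" by blast
  from avg_pos[OF b e this] show ?thesis by (auto simp: B_def)
 qed
 have fin: "EX N W. oES (dm e) W & z : W & W <= Vd e & (ALL k>=N. ALL y:W. pz k e y = 0)" if e: "pat e" "z : Vd e" for e z
 proof -
  obtain j where j: "B j e None z > 0" using pos[OF e] by blast
  define c where "c = B j e None z / 2"
  have V: "oES (dm e) (Vd e)" by (rule pat_dom[OF e(1)])
  have "continuous_map (sES (dm e) (Vd e)) euclidean (B j e None)"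
   by (rule Bs[OF e(1) okN, of j, unfolded smooth_on_def, THEN spec, of 0, unfolded Ck_on.simps(1)])
  from cont_ES_preimage[OF V this, of "{c<..}"] have W: "oES (dm e) (Vd e Int B j e None -` {c<..})" by simp
  obtain N :: nat where N: "real N > 1 / c" using reals_Archimedean2 by blast
  have "pz k e y = 0" if k: "k >= max (Suc j) (Suc N)" and y: "y : Vd e Int B j e None -` {c<..}" for k y
  proof -
   have "1 / c<real k" using k N by simp
   hence "1 / real k<c" using j k by (simp add: c_def field_simps)
   hence "flat_exp 0 (1 / real k - B j e None y) = 0" using y by (simp add: flat_exp_def)
   thus ?thesis using k unfolding pz_def by (intro prod_zero) (auto intro!: bexI[of _ j])
  qed
  thus ?thesis using W e j by (intro exI[of _ "max (Suc j) (Suc N)"] exI[of _ "Vd e Int B j e None -` {c<..}"]) (auto simp: c_def)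
 qed
 have tot: "tot e \<tau> y = (SUM k<N. pz k e y * B k e \<tau> y)" if "ALL k>=N. pz k e y = 0" for e \<tau> y N
  unfolding tot_def by (rule suminf_finite) (use that in auto)
 have tots: "smooth_on (dm e) (Vd e) (tot e \<tau>)" if e: "pat e" and t: "okt (dm e) \<tau>" for e \<tau>
 proof (rule smooth_on_local[OF pat_dom[OF e]])
  fix z assume "z : Vd e"
  from fin[OF e this] obtain N W where W: "oES (dm e) W" "z : W" "W <= Vd e" "ALL k>=N. ALL y:W. pz k e y = 0" by blast
  have "smooth_on (dm e) W (%y. SUM k<N. pz k e y * B k e \<tau> y)"
   by (intro smooth_on_sum[OF W(1)] smooth_on_mult[OF W(1)] smooth_on_subset[OF pat_dom[OF e] W(1,3)] pzs Bs e t)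
  hence "smooth_on (dm e) W (tot e \<tau>)"
   by (rule smooth_on_cong[OF W(1), THEN iffD1, rotated]) (rule tot[symmetric], use W(4) in blast)
  thus "EX W. oES (dm e) W & z : W & smooth_on (dm e) W (tot e \<tau>)" using W by blast
 qed
 have tot_pos: "tot e None z > 0" if e: "pat e" "z : Vd e" for e z
 proof -
  \<comment> \<open>Before the least index with positive value all \<open>B j\<close> are zero at
    \<open>z\<close>, so every factor of \<open>pz k\<close> is positive there.\<close>
  define k where "k = (LEAST k. B k e None z > 0)"
  have k: "B k e None z > 0" using LeastI_ex[OF pos[OF e]] by (simp add: k_def)
  have "B j e None z = 0" if "j<k" for j using not_less_Least[of j "%k. B k e None z > 0"] B0[OF e, of j] that by (auto simp: k_def)
  hence "pz k e z > 0" unfolding pz_def by (intro prod_pos) (auto simp: flat_exp_pos_iff)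
  from fin[OF e] obtain N where N: "ALL k>=N. pz k e z = 0" by blast
  hence "k<N" using \<open>pz k e z > 0\<close> by (metis less_irrefl not_le_imp_less)
  thus ?thesis unfolding tot[OF N] using k \<open>pz k e z > 0\<close>
   by (intro sum_pos2[of _ k]) (auto simp: pz0 B0[OF e])
 qed
 define TT where "TT e k i j z = tot e (Some (k, i, j)) z / tot e None z" for e k i j z
 have conn: "sympl_conn (dm e) (Vd e) (ww e) (TT e)" if e: "pat e" for e unfolding sympl_conn_def
 proof (intro conjI allI impI ballI)
  fix i j k assume ijk: "k<dm e" "i<dm e" "j<dm e"
  note V = pat_dom[OF e]
  have "smooth_on (dm e) (Vd e) (%z. inverse (tot e None z))"
   by (rule smooth_on_inverse[OF V tots[OF e okN]]) (use tot_pos[OF e] in force)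
  thus "smooth_on (dm e) (Vd e) (TT e k i j)" unfolding TT_def[abs_def] divide_inverse
   by (intro smooth_on_mult[OF V] tots[OF e]) (simp add: okt_def ijk)
 next
  fix z i j k assume z: "z : Vd e" and ijk: "k<dm e" "i<dm e" "j<dm e"
  note s = avg_sym[OF b e z ijk(2,3,1), folded B_def]
  from fin[OF e z] obtain N where N: "ALL k>=N. pz k e z = 0" by blast
  show "TT e k i j z = TT e k j i z" by (simp add: TT_def tot[OF N] s(1))
  have "tot e (Some (j, i, k)) z - tot e (Some (k, i, j)) z = tot e None z * pd i (ww e j k) z"
   unfolding tot[OF N] sum_subtractf[symmetric] sum_distrib_right right_diff_distrib[symmetric] s(2) by (simp add: mult.assoc)
  thus "pd i (ww e j k) z = TT e j i k z - TT e k i j z"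
   using tot_pos[OF e z] by (simp add: TT_def diff_divide_distrib[symmetric])
 qed
 have "TT e k i j z = claw (dm e) F i j k z (%r p q. TT e' r p q (F z)) (%r m. ww e' r m (F z))"
  if F: "arrow e e' D F" and z: "z : D" and ijk: "i<dm e" "j<dm e" "k<dm e" for e e' D F z i j k
 proof -
  have A: "pat e" "pat e'" "z : Vd e" "F z : Vd e'" using F z unfolding arrow_def by auto
  have BN: "B l e None z = B l e' None (F z)" for l unfolding B_def by (rule avg_natural(1)[OF b F z okN])
  have P: "pz l e z = pz l e' (F z)" for l by (simp add: pz_def BN)
  from fin[OF A(1,3)] obtain N where N: "ALL k>=N. pz k e z = 0" by blast
  hence N': "ALL k>=N. pz k e' (F z) = 0" by (simp add: P)
  have t: "okt (dm e) (Some (k, i, j))" using ijk by (simp add: okt_def)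
  have "tot e (Some (k, i, j)) z = (SUM l<N. pz l e' (F z) * claw (dm e) F i j k z (%r p q. B l e' (Some (r, p, q)) (F z)) (%r m. B l e' None (F z) * ww e' r m (F z)))"
   unfolding tot[OF N] P unfolding B_def avg_natural(2)[OF b F z t refl] ..
  also have "... = claw (dm e) F i j k z (%r p q. tot e' (Some (r, p, q)) (F z)) (%r m. tot e' None (F z) * ww e' r m (F z))"
   unfolding tot[OF N'] sum_distrib_right distrib_left sum_distrib_left sum.distrib
   by (simp only: sum.swap[of _ "{..<N}"] mult_ac)
  finally have t': "tot e (Some (k, i, j)) z = ..." .
  define d where "d = tot e' None (F z)"
  have d: "d ~= 0" using tot_pos[OF A(2,4)] by (simp add: d_def)
  have TT': "tot e' (Some (r, p, q)) (F z) = d * TT e' r p q (F z)" for r p q using d by (simp add: TT_def d_def)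
  have "tot e None z = d" by (simp add: tot[OF N] tot[OF N'] P BN d_def)
  moreover have "tot e (Some (k, i, j)) z = d * claw (dm e) F i j k z (%r p q. TT e' r p q (F z)) (%r m. ww e' r m (F z))"
   unfolding t' TT' d_def[symmetric] by (simp add: sum_distrib_left distrib_left mult_ac)
  ultimately show ?thesis using d by (simp add: TT_def)
 qed
 thus ?thesis using conn by (intro exI[of _ TT]) blast
qed

end

lemma sympl_chart_subset:
 assumes "sympl_chart n V w T" and D: "oES n D" and sub: "D <= V"
 shows "sympl_chart n D w T"
proof -
 interpret sympl_chart n V w T by fact
 note s = smooth_on_subset[OF V D sub]
 have nd: "ALL v. (ALL j<n. (SUM i<n. v i * w i j x) = 0) --> (ALL i<n. v i = 0)" if "x : V" for x
  using form[unfolded sympl_form_def, THEN conjunct2, THEN conjunct2, THEN conjunct2] that by (rule bspec)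
 have "sympl_form n D w" unfolding sympl_form_def
 proof (intro conjI ballI allI impI)
  show "smooth_on n D (w i j)" if "i<n" "j<n" for i j by (rule s[OF w_smooth[OF that]])
  show "w i j x = - w j i x" if "x : D" "i<n" "j<n" for x i j by (rule w_anti[OF subsetD[OF sub that(1)] that(2,3)])
  show "v i = 0" if "x : D" "ALL j<n. (SUM i<n. v i * w i j x) = 0" "i<n" for x v i
   using nd[OF subsetD[OF sub that(1)]] that(2,3) by blast
 qed (rule D)
 moreover have "sympl_conn n D w T" unfolding sympl_conn_def
 proof (intro conjI ballI allI impI)
  show "smooth_on n D (T k i j)" if "k<n" "i<n" "j<n" for i j k by (rule s[OF T_smooth[OF that(2,3,1)]])
  fix x i j k assume "x : D" "k<n" "i<n" "j<n"
  note h = subsetD[OF sub this(1)] this(3,4,2)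
  show "T k i j x = T k j i x" by (rule T_sym[OF h])
  show "pd i (w j k) x = T j i k x - T k i j x" by (rule T_w[OF h])
 qed
 ultimately show ?thesis by (rule sympl_chart.intro)
qed

section \<open>Gluing the star products of the patches\<close>

context symplectic_orbifold begin

abbreviation (input) at_patch (infixl "@@" 70) where "f @@ e \<equiv> %m v. f m (qq e v)"

definition "TT = (SOME T. (ALL e. pat e --> sympl_conn (dm e) (Vd e) (ww e) (T e)) & (ALL e e' D F z i j k. arrow e e' D F --> z : D --> i<dm e --> j<dm e --> k<dm e -->
   T e k i j z = claw (dm e) F i j k z (%r p q. T e' r p q (F z)) (%r m. ww e' r m (F z))))"

lemma TT: "pat e ==> sympl_conn (dm e) (Vd e) (ww e) (TT e)"
 "arrow e e' D F ==> z : D ==> i<dm e ==> j<dm e ==> k<dm e ==> TT e k i j z = claw (dm e) F i j k z (%r p q. TT e' r p q (F z)) (%r m. ww e' r m (F z))"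
 using someI_ex[OF connection_ex, folded TT_def] by blast+

lemma SC: "pat e ==> sympl_chart (dm e) (Vd e) (ww e) (TT e)"
 by (rule sympl_chart.intro[OF pat_form TT(1)])

abbreviation "sl e \<equiv> sympl_chart.star_loc (dm e) (Vd e) (ww e) (TT e)"

abbreviation "C \<equiv> orbifold_functions X A"
definition "ser f <-> (ALL m::nat. f m : C)"

lemma ser_smooth: "ser f ==> pat e ==> sympl_chart.smooth_series (dm e) (Vd e) (f @@ e)"
 by (simp add: sympl_chart.smooth_series_def[OF SC] ser_def functions_patch)

text \<open>On \<open>D\<close>, with form and connection restricted, the arrow is a map to which
  \<open>star_loc_natural\<close> applies; the connections match by the choice of
  \<open>TT\<close>.\<close>

lemma sl_restrict:
 assumes F: "arrow e e' D F" and z: "z : D" and f: "ser f" and g: "ser g"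
 shows "sympl_chart.star_loc (dm e) D (ww e) (TT e) (f @@ e) (g @@ e) m z =
  sl e' (f @@ e') (g @@ e') m (F z)"
proof -
 have A: "pat e" "pat e'" "dm e' = dm e" "oES (dm e) D" "D <= Vd e"
  "!!z. z : D ==> F z : Vd e'" "!!z. z : D ==> qq e' (F z) = qq e z" "!!j. j<dm e ==> smooth_on (dm e) D (%z. F z j)"
  "!!z i j. z : D ==> i<dm e ==> j<dm e ==> ww e i j z = fpb (dm e) (%k l. ww e' k l (F z)) F i j z"
  using F unfolding arrow_def by simp_all
 have R: "sympl_chart (dm e) D (ww e) (TT e)" by (rule sympl_chart_subset[OF SC[OF A(1)] A(4,5)])
 have M: "sympl_map (dm e) D (ww e) (TT e) (Vd e') (ww e') (TT e') F"
  using R SC[OF A(2)] A(3) TT(2)[OF F] A(6,8,9) by (intro sympl_map.intro sympl_map_axioms.intro) simp_all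
 have "sympl_chart.star_loc (dm e) D (ww e) (TT e) (f @@ e) (g @@ e) =
   sympl_chart.star_loc (dm e) D (ww e) (TT e) (%m v. f m (qq e' (F v))) (%m v. g m (qq e' (F v)))"
  by (rule sympl_chart.star_loc_cong[OF R]) (simp_all add: A(7))
 thus ?thesis
  using sympl_map.star_loc_natural[OF M _ _ z, of "%m v. f m (qq e' v)" "%m v. g m (qq e' v)" m] ser_smooth[OF f A(2)] ser_smooth[OF g A(2)] A(3)
  by simp
qed

lemma arrow_id: "pat e ==> oES (dm e) D ==> D <= Vd e ==> arrow e e D (%z. z)"
 by (auto simp: arrow_def smooth_on_coord partial_deriv_coord if_distrib[of "%z. _ * z"] cong: if_cong)

text \<open>Both products are compared with the one of the domain \<open>D\<close> of an arrow:
  through the identity arrow for \<open>e\<close>, and through \<open>F\<close> for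
  \<open>e'\<close>. Locality and invariance are thus the same statement.\<close>

lemma sl_natural:
 assumes "pat e" "v : Vd e" "pat e'" "v' : Vd e'" "qq e' v' = qq e v" "ser f" "ser g"
 shows "sl e (f @@ e) (g @@ e) m v = sl e' (f @@ e') (g @@ e') m v'"
proof -
 from arrow_ex[OF assms(1-5)] obtain D F where F: "arrow e e' D F" "v : D" "F v = v'" by blast
 have "arrow e e D (%z. z)" using F(1) by (intro arrow_id) (simp_all add: arrow_def)
 from sl_restrict[OF this F(2) assms(6,7)] sl_restrict[OF F(1,2) assms(6,7)] F(3) show ?thesis by simp
qed

text \<open>The patch over \<open>x\<close> is chosen arbitrarily; by \<open>stx_patch\<close> every
  other gives the same value when the arguments are series of orbifold functions.\<close>

definition "stx f g m x = (if x : topspace X then case (SOME p. pat (fst p) & snd p : Vd (fst p) & qq (fst p) (snd p) = x) of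
  (e, v) => sl e (f @@ e) (g @@ e) m v else 0)"

lemma qq_top: "pat e ==> v : Vd e ==> qq e v : topspace X"
 using subsetD[OF openin_subset[OF CO_open[OF pat_CO]] qq_into] .

lemma stx_patch:
 assumes e: "pat e" "v : Vd e" and fg: "ser f" "ser g"
 shows "stx f g m (qq e v) = sl e (f @@ e) (g @@ e) m v"
proof -
 let ?P = "%p. pat (fst p) & snd p : Vd (fst p) & qq (fst p) (snd p) = qq e v"
 obtain e' v' where p0: "(SOME p. ?P p) = (e', v')" by (cases "SOME p. ?P p")
 have "?P (SOME p. ?P p)" by (rule someI[where P="?P" and x="(e, v)"]) (use e in simp)
 hence p: "(SOME p. ?P p) = (e', v')" "pat e'" "v' : Vd e'" "qq e' v' = qq e v" unfolding p0 by simp_all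
 thus ?thesis using sl_natural[OF p(2,3) e p(4)[symmetric] fg] qq_top[OF e] by (simp add: stx_def)
qed

lemma stx_ser:
 assumes fg: "ser f" "ser g"
 shows "ser (stx f g)" unfolding ser_def
proof (intro allI functionsI)
 fix m e assume e: "pat e"
 have "sympl_chart.smooth_series (dm e) (Vd e) (sl e (f @@ e) (g @@ e))"
  by (intro sympl_chart.smooth_star[OF SC[OF e]] ser_smooth fg e)
 hence "smooth_on (dm e) (Vd e) (sl e (f @@ e) (g @@ e) m)"
  unfolding sympl_chart.smooth_series_def[OF SC[OF e]] by (rule spec)
 thus "smooth_on (dm e) (Vd e) (%v. stx f g m (qq e v))"
  by (rule smooth_on_cong[OF pat_dom[OF e], THEN iffD1, rotated]) (rule stx_patch[OF e _ fg, symmetric])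
qed (simp add: stx_def)

lemma fun_patch_eqI:
 assumes "!!e v. pat e ==> v : Vd e ==> f (qq e v) = g (qq e v)" "!!x. x ~: topspace X ==> f x = g x"
 shows "f = g"
proof
 fix x show "f x = g x"
 proof (cases "x : topspace X")
  case True
  from patch_ex[OF this] assms(1) show ?thesis by blast
 qed (rule assms(2))
qed

lemma C_out: "f : C ==> x ~: topspace X ==> f x = 0" and stx_out: "x ~: topspace X ==> stx u v m x = 0"
 by (simp_all add: orbifold_functions_def stx_def)

lemma C_add: "f : C ==> g : C ==> (%x. f x + g x) : C" and C_diff: "f : C ==> g : C ==> (%x. f x - g x) : C"
 and C_scale: "f : C ==> (%x. c * f x) : C"
proof -
 show "f : C ==> g : C ==> (%x. f x + g x) : C" by (rule functionsI) (simp_all add: smooth_on_add pat_dom functions_patch C_out)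
 show "f : C ==> g : C ==> (%x. f x - g x) : C" by (rule functionsI) (simp_all add: smooth_on_diff pat_dom functions_patch C_out)
 show "f : C ==> (%x. c * f x) : C" by (rule functionsI) (simp_all add: smooth_on_mult smooth_on_const pat_dom functions_patch C_out)
qed

lemma C_zero: "(%x. 0) : C" and C_one: "orbifold_one X : C"
proof -
 show "(%x. 0) : C" by (rule functionsI) (simp_all add: smooth_on_const pat_dom)
 show "orbifold_one X : C"
 proof (rule functionsI)
  fix e assume e: "pat e"
  show "smooth_on (dm e) (Vd e) (%v. orbifold_one X (qq e v))"
   by (rule smooth_on_cong[OF pat_dom[OF e], THEN iffD1, OF _ smooth_on_const[OF pat_dom[OF e], of 1]]) (simp add: orbifold_one_def qq_top[OF e])
 qed (simp add: orbifold_one_def)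
qed

lemma C_sum: "(!!i. i : I ==> f i : C) ==> (%x. SUM i:I. f i x) : C"
 by (induction I rule: infinite_finite_induct) (simp_all add: C_zero C_add)

definition cs :: "('x => complex) => nat => 'x => complex" where "cs f m = (if m = 0 then f else (%x. 0))"

lemma ser_cs: "f : C ==> ser (cs f)" and ser_add: "ser u ==> ser v ==> ser (%m x. u m x + v m x)"
 and ser_scale: "ser u ==> ser (%m x. SUM k<=m. c k * u (m - k) x)"
 by (simp_all add: ser_def cs_def C_zero C_add C_sum C_scale)

lemma stx_assoc:
 assumes "ser f" "ser g" "ser h"
 shows "stx (stx f g) h m = stx f (stx g h) m"
proof (rule fun_patch_eqI)
 fix e v assume e: "pat e" "v : Vd e"
 note S = SC[OF e(1)]
 have "sl e (%m v. stx f g m (qq e v)) (h @@ e) = sl e (sl e (f @@ e) (g @@ e)) (h @@ e)"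
  "sl e (f @@ e) (%m v. stx g h m (qq e v)) = sl e (f @@ e) (sl e (g @@ e) (h @@ e))"
  by (rule sympl_chart.star_loc_cong[OF S]; simp add: stx_patch e assms)+
 thus "stx (stx f g) h m (qq e v) = stx f (stx g h) m (qq e v)"
  by (simp add: stx_patch e assms stx_ser sympl_chart.star_loc_assoc[OF S] ser_smooth)
qed (simp add: stx_def)

lemma stx_add:
 assumes "ser f" "ser f'" "ser g"
 shows "stx (%m x. f m x + f' m x) g m = (%x. stx f g m x + stx f' g m x)" "stx g (%m x. f m x + f' m x) m = (%x. stx g f m x + stx g f' m x)"
proof -
 show "stx (%m x. f m x + f' m x) g m = (%x. stx f g m x + stx f' g m x)"
  by (rule fun_patch_eqI) (simp_all add: stx_patch assms ser_add sympl_chart.star_loc_add[OF SC] ser_smooth stx_out)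
 show "stx g (%m x. f m x + f' m x) m = (%x. stx g f m x + stx g f' m x)"
  by (rule fun_patch_eqI) (simp_all add: stx_patch assms ser_add sympl_chart.star_loc_add[OF SC] ser_smooth stx_out)
qed

lemma stx_scale:
 assumes "ser f" "ser g"
 shows "stx (%m x. SUM k<=m. c k * f (m - k) x) g m = (%x. SUM k<=m. c k * stx f g (m - k) x)"
  "stx f (%m x. SUM k<=m. c k * g (m - k) x) m = (%x. SUM k<=m. c k * stx f g (m - k) x)"
proof -
 have *: "sl e (%m v. SUM k<=m. c k * f (m - k) (qq e v)) (g @@ e) m v = (SUM k<=m. c k * sl e (f @@ e) (g @@ e) (m - k) v)"
  "sl e (f @@ e) (%m v. SUM k<=m. c k * g (m - k) (qq e v)) m v = (SUM k<=m. c k * sl e (f @@ e) (g @@ e) (m - k) v)"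
  if e: "pat e" "v : Vd e" for e v
  by (rule sympl_chart.star_loc_scale[OF SC[OF e(1)] ser_smooth[OF assms(1) e(1)] ser_smooth[OF assms(2) e(1)] e(2)])+
 show "stx (%m x. SUM k<=m. c k * f (m - k) x) g m = (%x. SUM k<=m. c k * stx f g (m - k) x)"
  by (rule fun_patch_eqI) (simp_all add: stx_patch assms ser_scale * stx_out)
 show "stx f (%m x. SUM k<=m. c k * g (m - k) x) m = (%x. SUM k<=m. c k * stx f g (m - k) x)"
  by (rule fun_patch_eqI) (simp_all add: stx_patch assms ser_scale * stx_out)
qed

lemma cs_scale: "(%m x. SUM k<=m. (if k = 0 then c else 0) * cs f (m - k) x) = cs (%x. c * f x)"
 by (simp add: fun_eq_iff cs_def if_distrib[of "%z. z * _"] cong: if_cong)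

lemma stx_cs_scale:
 assumes "f : C" "g : C"
 shows "stx (cs (%x. c * f x)) (cs g) m = (%x. c * stx (cs f) (cs g) m x)" "stx (cs f) (cs (%x. c * g x)) m = (%x. c * stx (cs f) (cs g) m x)"
 using stx_scale[OF ser_cs[OF assms(1)] ser_cs[OF assms(2)], of "%k. if k = 0 then c else 0" m, unfolded cs_scale]
 by (simp_all add: if_distrib[of "%z. z * _"] cong: if_cong)

lemma stx_0: "f : C ==> g : C ==> stx (cs f) (cs g) 0 = (%x. f x * g x)"
 by (rule fun_patch_eqI) (simp_all add: stx_patch ser_cs sympl_chart.star_loc_0[OF SC] ser_smooth, simp_all add: cs_def stx_def orbifold_functions_def)

lemma stx_one:
 assumes f: "f : C"
 shows "stx (cs f) (cs (orbifold_one X)) m = cs f m" "stx (cs (orbifold_one X)) (cs f) m = cs f m"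
proof -
 let ?c = "%k::nat. if k = 0 then 1 else 0 :: complex"
 have "stx (cs f) (cs (orbifold_one X)) m = cs f m & stx (cs (orbifold_one X)) (cs f) m = cs f m"
 proof (intro conjI fun_patch_eqI)
  fix e v assume e: "pat e" "v : Vd e"
  note S = SC[OF e(1)]
  have o: "cs (orbifold_one X) m (qq e v) = ?c m" if "v : Vd e" for v m using qq_top[OF e(1) that] by (simp add: cs_def orbifold_one_def)
  have "sl e (%m v. cs f m (qq e v)) (%m v. cs (orbifold_one X) m (qq e v)) = sl e (%m v. cs f m (qq e v)) (%m v. ?c m)"
   "sl e (%m v. cs (orbifold_one X) m (qq e v)) (%m v. cs f m (qq e v)) = sl e (%m v. ?c m) (%m v. cs f m (qq e v))"
   by (rule sympl_chart.star_loc_cong[OF S]; simp add: o)+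
  thus "stx (cs f) (cs (orbifold_one X)) m (qq e v) = cs f m (qq e v)" "stx (cs (orbifold_one X)) (cs f) m (qq e v) = cs f m (qq e v)"
   by (simp_all add: stx_patch e f C_one ser_cs sympl_chart.star_loc_const[OF S] ser_smooth if_distrib[of "%z. z * _"] cong: if_cong)
 qed (use f in \<open>simp_all add: stx_def cs_def orbifold_functions_def\<close>)
 thus "stx (cs f) (cs (orbifold_one X)) m = cs f m" "stx (cs (orbifold_one X)) (cs f) m = cs f m" by simp_all
qed

text \<open>By \<open>star_loc_1\<close> the first-order commutator is \<open>\<i>\<close> times the
  contraction of the differentials with the inverse matrix, and that contraction is the value of the
  form on the Hamiltonian vectors; hence the factor \<open>- \<i>\<close>.\<close>

lemma poisson_patch:
 assumes f: "f : C" and g: "g : C" and U: "U : CO" and y: "y : gpoints (Ob U)"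
 shows "poisson_bracket (mf U) (\<omega> U) (f o pr U) (g o pr U) y = - \<i> * (stx (cs f) (cs g) 1 (pr U y) - stx (cs g) (cs f) 1 (pr U y))" (is "_ = ?z")
proof -
 let ?n = "mdim (mf U)" and ?hv = "%h. hamiltonian_vector (mf U) (\<omega> U) (h o pr U)"
 \<comment> \<open>Solving with the inverse matrix gives existence of Hamiltonian vectors and
   uniqueness of their components, which the definite description in the bracket requires.\<close>
 have H: "?hv h a y v <->
   (ALL k<?n. v k = (SUM j<?n. pd j (%v. h (qq (U, a) v)) (snd a y) * of_real (winv ?n (ww (U, a)) j k (snd a y))))"
  (is "_ <-> (ALL k<?n. v k = (SUM j<?n. ?d j * of_real (?W j k)))") if a: "pat (U, a)" "y : fst a" for a v h
 proof -
  have co: "a : mcoords (mf U)" using pat_co[OF a(1)] by simp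
  have vy: "snd a y : vdom a" using a(2) by simp
  note L = winv_left[OF pat_form[OF a(1)], simplified, OF vy] and R = winv_right[OF pat_form[OF a(1)], simplified, OF vy]
  have w: "\<omega> U a y i j = ww (U, a) i j (snd a y)" for i j using civ_co[OF Ob_mf[OF U] co a(2)] by (simp add: ww_def form_rep_def)
  have ham: "?hv h a y v <-> (ALL j<?n. (SUM i<?n. v i * of_real (ww (U, a) i j (snd a y))) = ?d j)"
   by (simp add: hamiltonian_vector_def w qq_def o_def)
  have 1: "(SUM j<?n. (SUM i<?n. u i * of_real (A i j)) * of_real (B j k)) = (u k :: complex)"
   if AB: "!!i. i<?n ==> (SUM j<?n. A i j * B j k) = dl i k" and k: "k<?n" for u A B k
  proof -
   have "(SUM j<?n. (SUM i<?n. u i * of_real (A i j)) * of_real (B j k)) = (SUM i<?n. u i * of_real (SUM j<?n. A i j * B j k))"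
    by (simp add: sum_distrib_left sum_distrib_right mult.assoc) (rule sum.swap)
   also have "... = (SUM i<?n. u i * dl i k)" by (intro sum.cong refl) (simp add: AB)
   also have "... = u k" using k by (simp add: sum_delta_mult)
   finally show ?thesis .
  qed
  show ?thesis unfolding ham
  proof (intro iffI allI impI)
   fix k assume v: "ALL j<?n. (SUM i<?n. v i * of_real (ww (U, a) i j (snd a y))) = ?d j" and k: "k<?n"
   show "v k = (SUM j<?n. ?d j * of_real (?W j k))"
    using 1[of "%i j. ww (U, a) i j (snd a y)" ?W k v] R k v by simp
  next
   fix j assume v: "ALL k<?n. v k = (SUM j<?n. ?d j * of_real (?W j k))" and j: "j<?n"
   show "(SUM i<?n. v i * of_real (ww (U, a) i j (snd a y))) = ?d j"
    using 1[of ?W "%i j. ww (U, a) i j (snd a y)" j ?d] L j v by simp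
  qed
 qed
 have val: "(SUM i<?n. SUM j<?n. of_real (\<omega> U a y i j) * v i * w j) = ?z"
  if a: "pat (U, a)" "y : fst a" and v: "?hv f a y v" and w: "?hv g a y w" for a v w
 proof -
  have co: "a : mcoords (mf U)" using pat_co[OF a(1)] by simp
  have vy: "snd a y : vdom a" using a(2) by simp
  have q: "qq (U, a) (snd a y) = pr U y" using civ_co[OF Ob_mf[OF U] co a(2)] by (simp add: qq_def)
  have dq: "(f o pr U) o civ a = (%v. f (qq (U, a) v))" for f by (simp add: fun_eq_iff qq_def)
  have "(SUM i<?n. SUM j<?n. of_real (\<omega> U a y i j) * v i * w j) = (SUM j<?n. (SUM i<?n. v i * of_real (\<omega> U a y i j)) * w j)"
   by (subst sum.swap) (simp add: sum_distrib_left sum_distrib_right mult_ac)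
  also have "... = (SUM j<?n. SUM k<?n. of_real (winv ?n (ww (U, a)) k j (snd a y)) *
    (pd j (%v. f (qq (U, a) v)) (snd a y) * pd k (%v. g (qq (U, a) v)) (snd a y)))"
   using v w unfolding H[OF a, of g] by (simp add: hamiltonian_vector_def dq sum_distrib_left mult_ac)
  also have "... = ?z"
   using sympl_chart.star_loc_1[OF SC[OF a(1)] ser_smooth[OF ser_cs[OF f] a(1)] ser_smooth[OF ser_cs[OF g] a(1)], of "snd a y"] vy
    stx_patch[OF a(1), of "snd a y" "cs f" "cs g" 1] stx_patch[OF a(1), of "snd a y" "cs g" "cs f" 1]
   by (simp add: ser_cs f g q cs_def)
  finally show ?thesis .
 qed
 have ex: "EX v w. ?hv f a y v & ?hv g a y w"
  if "pat (U, a)" "y : fst a" for a unfolding H[OF that, of f] H[OF that, of g] by (intro exI conjI) (rule allI, rule impI, rule refl)+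
 obtain a where a: "pat (U, a)" "y : fst a" using pat_ex[OF U y] by auto
 have p: "pat (U, a)" if "a : mcoords (mf U)" for a using that U by (simp add: pat_def)
 show ?thesis unfolding poisson_bracket_def
 proof (rule the_equality)
  show "ALL a:mcoords (mf U). y : fst a --> (EX v w. ?hv f a y v &
    ?hv g a y w & ?z = (SUM i<?n. SUM j<?n. of_real (\<omega> U a y i j) * v i * w j))"
  proof (intro ballI impI)
   fix a assume a: "a : mcoords (mf U)" "y : fst a"
   from ex[OF p[OF a(1)] a(2)] obtain v w where vw: "?hv f a y v" "?hv g a y w" by blast
   show "EX v w. ?hv f a y v &
    ?hv g a y w & ?z = (SUM i<?n. SUM j<?n. of_real (\<omega> U a y i j) * v i * w j)"
    using vw val[OF p[OF a(1)] a(2) vw] by (intro exI[of _ v] exI[of _ w]) simp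
  qed
  fix z assume "ALL a:mcoords (mf U). y : fst a --> (EX v w. ?hv f a y v &
    ?hv g a y w & z = (SUM i<?n. SUM j<?n. of_real (\<omega> U a y i j) * v i * w j))"
  from bspec[OF this pat_co[OF a(1), simplified]] a(2) val[OF a] show "z = ?z" by auto
 qed
qed

lemma bracket_eq:
 assumes "f : C" "g : C"
 shows "orbifold_bracket X \<U> Ob \<omega> f g x = - \<i> * (stx (cs f) (cs g) 1 x - stx (cs g) (cs f) 1 x)"
proof (cases "x : topspace X")
 case True
 then obtain U where U: "U : CO" "x : U" using CO_ex by blast
 obtain y where y: "y : gpoints (Ob U)" "pr U y = x" using pr_surj[OF U] by blast
 have "(THE z. ALL U:CO. ALL y:gpoints (Ob U). pr U y = x --> z = poisson_bracket (mf U) (\<omega> U) (f o pr U) (g o pr U) y) =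
   - \<i> * (stx (cs f) (cs g) 1 x - stx (cs g) (cs f) 1 x)"
  by (rule the_equality) (use U(1) y in \<open>auto simp: poisson_patch[OF assms]\<close>)
 thus ?thesis using True by (simp add: orbifold_bracket_def)
qed (simp add: orbifold_bracket_def stx_def)

theorem star_product_ex: "EX star. star_product X A \<U> Ob \<omega> star"
proof -
 define star where "star F G = Abs_fps (stx (fps_nth F) (fps_nth G))" for F G :: "('x => complex) fps"
 have D: "F : fps_over C <-> ser (fps_nth F)" for F by (simp add: fps_over_def ser_def)
 have nth: "fps_nth (star F G) = stx (fps_nth F) (fps_nth G)" for F G by (simp add: star_def fun_eq_iff)
 have nc: "fps_nth (fps_const f) = cs f" for f :: "'x => complex" by (simp add: fun_eq_iff cs_def)
 have na: "fps_nth (F + G) = (%m x. fps_nth F m x + fps_nth G m x)" for F G :: "('x => complex) fps" by (simp add: fun_eq_iff)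
 have ns: "fps_nth (fps_scale a F) = (%m x. SUM k<=m. fps_nth a k * fps_nth F (m - k) x)" for a F by (simp add: fps_scale_def fun_eq_iff)
 have eqI: "F = G" if "!!m x. fps_nth F m x = fps_nth G m x" for F G :: "('x => complex) fps"
  using that by (simp add: fps_eq_iff fun_eq_iff)
 have 1: "fps_bilinear_on (fps_over C) star" unfolding fps_bilinear_on_def D
  by (intro conjI ballI allI eqI) (simp_all only: nth na ns D stx_ser stx_add stx_scale)
 have 2: "star (star F G) H = star F (star G H)" if "F : fps_over C" "G : fps_over C" "H : fps_over C" for F G H
  using that by (intro eqI) (simp add: nth D stx_assoc)
 define \<mu> where "\<mu> k f g = stx (cs f) (cs g) k" for k f g
 have cs_add: "cs (f + g) = (%m x. cs f m x + cs g m x)" for f g by (simp add: cs_def fun_eq_iff)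
 have 3: "bilinear_on C (\<mu> k)" for k unfolding bilinear_on_def \<mu>_def by (intro conjI ballI allI)
    (use stx_ser in \<open>simp_all add: cs_add stx_add stx_cs_scale ser_cs, simp_all add: ser_def ser_cs[unfolded ser_def] fun_eq_iff\<close>)
 have 4: "\<mu> 0 f g = (%x. f x * g x)" "star (fps_const f) (fps_const g) = Abs_fps (%k. \<mu> k f g)" if "f : C" "g : C" for f g
  using that by (simp_all add: \<mu>_def stx_0 star_def nc)
 have 5: "EX R:fps_over C. star (fps_const f) (fps_const g) - star (fps_const g) (fps_const f)
      - fps_scale (fps_const \<i> * fps_X) (fps_const (orbifold_bracket X \<U> Ob \<omega> f g)) = fps_scale (fps_X ^ 2) R" if fg: "f : C" "g : C" for f g
 proof -
  \<comment> \<open>The commutator from order 2 on, shifted down by 2. Order 0 cancels by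
    commutativity of the pointwise product, order 1 by \<open>bracket_eq\<close>.\<close>
  define R where "R = Abs_fps (%m x. stx (cs f) (cs g) (m + 2) x - stx (cs g) (cs f) (m + 2) x)"
  have "ser (stx (cs f) (cs g))" "ser (stx (cs g) (cs f))" by (intro stx_ser ser_cs fg)+
  hence "R : fps_over C" by (simp add: R_def fps_over_def ser_def C_diff)
  moreover have "fps_nth (star (fps_const f) (fps_const g) - star (fps_const g) (fps_const f)
      - fps_scale (fps_const \<i> * fps_X) (fps_const (orbifold_bracket X \<U> Ob \<omega> f g))) m x = fps_nth (fps_scale (fps_X ^ 2) R) m x" for m x
  proof -
   have X2: "(SUM k<=m. fps_nth (fps_X ^ 2 :: complex fps) k * fps_nth R (m - k) x) = (if m<2 then 0 else fps_nth R (m - 2) x)"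
    by (simp add: fps_X_power_nth if_distrib[of "%z. z * _"] cong: if_cong)
   have X1: "(SUM k<=m. fps_nth (fps_const \<i> * fps_X) k * cs b (m - k) x) = (if m = 1 then \<i> * b x else 0)" for b
   proof -
    have "(SUM k<=m. fps_nth (fps_const \<i> * fps_X) k * cs b (m - k) x) = (SUM k<=m. if k = 1 then \<i> * cs b (m - 1) x else 0)"
     by (intro sum.cong refl) auto
    thus ?thesis by (auto simp: cs_def)
   qed
   consider "m = 0" | "m = 1" | "m >= 2" by linarith
   thus ?thesis
   proof cases
    case 1
    thus ?thesis using stx_0[OF fg] stx_0[OF fg(2,1)] by (simp add: nth nc ns X1 X2)
   next
    case 2
    thus ?thesis using bracket_eq[OF fg, of x] unfolding fps_sub_nth minus_apply nth nc ns X1 X2 by simp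
   next
    case 3
    hence "Suc (Suc (m - 2)) = m" by simp
    thus ?thesis using 3 unfolding fps_sub_nth minus_apply nth nc ns X1 X2 by (simp add: R_def)
   qed
  qed
  ultimately show ?thesis using eqI by blast
 qed
 have 6: "star (fps_const f) (fps_const (orbifold_one X)) = fps_const f" "star (fps_const (orbifold_one X)) (fps_const f) = fps_const f" if "f : C" for f
  by (rule eqI; simp add: nth nc stx_one that del: fps_nth_fps_const)+
 have "star_product X A \<U> Ob \<omega> star" unfolding star_product_def Let_def
  using 1 2 3 4 5 6 by (intro conjI ballI exI[of _ \<mu>] allI) simp_all
 thus ?thesis by blast
qed

end

theorem corollary4p14:
  fixes X :: "'x topology"
    and A :: "('m, 'g, 'x) ochart set"
    and \<U> :: "'x set set"
    and Ob :: "'x set \<Rightarrow> ('m, 'g, 'x) ochart"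
    and Mor :: "'x set \<Rightarrow> 'x set \<Rightarrow> ('m \<Rightarrow> 'm) \<times> ('g \<Rightarrow> 'g)"
    and \<omega> :: "'x set \<Rightarrow> 'm two_form"
  assumes "orbifold X A"
    and "open_covering X \<U>"
    and "orbispace_functor X A \<U> Ob Mor"
    and "orbifold_symplectic_form X \<U> Ob Mor \<omega>"
  shows "\<exists>star. star_product X A \<U> Ob \<omega> star"
  by (rule symplectic_orbifold.star_product_ex[OF symplectic_orbifold.intro[OF assms]])

end
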